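(* Let $\gamma\ge0$. Then the semigroup $\mathcal{T}$ generated by $-\mathcal{A}$ on $\mathcal{H}$ is real, but neither positive nor $L^\infty$-contractive.
   Context: Setting: $\Omega\subseteq\mathbb{R}^d$ is a bounded domain with Lipschitz boundary $\Gamma$; $\Omega$ carries Lebesgue measure $\lambda$ and $\Gamma$ the surface measure $S$. Given are $\alpha\in L^\infty(\Omega;\mathbb{R})$ and $\beta,\gamma\in L^\infty(\Gamma;\mathbb{R})$ such that for some constant $\eta>0$ one has $\alpha\ge\eta$ a.e. on $\Omega$ and $\beta\ge\eta$ a.e. on $\Gamma$. All function spaces are complex valued unless indicated. Notation: $\langle f,g\rangle_\Omega=\int_\Omega f\overline{g}\,dx$, $\langle\nabla u,\nabla v\rangle_\Omega=\int_\Omega\sum_{j=1}^d\partial_ju\,\overline{\partial_jv}\,dx$, $\langle f,g\rangle_{\Gamma,\beta}=\int_\Gamma f\overline g\,\beta^{-1}dS$. $H^1_\Delta(\Omega)=\{u\in H^1(\Omega):\Delta u\in L^2(\Omega)\}$ with $\Delta$ the distributional Laplacian. $\mathrm{tr}$ is the usual trace operator on $H^1(\Omega)$. The Neumann Laplacian has domain $D(\Delta_N)=\{u\in H^1_\Delta(\Omega):\langle\nabla u,\nabla v\rangle_\Omega=-\langle\Delta u,v\rangle_\Omega\ \forall v\in H^1(\Omega)\}$. Hilbert space: $\mathcal{H}=L^2(\Omega)\times L^2(\Gamma,\beta^{-1}dS)$ with inner product $\langle(u_1,u_2),(v_1,v_2)\rangle_{\mathcal{H}}=\langle u_1,v_1\rangle_\Omega+\langle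 u_2,v_2\rangle_{\Gamma,\beta}$. Form: $D(\mathfrak{a})=\{(u_1,u_2)\in\mathcal{H}:u_1\in D(\Delta_N),\ u_2=\mathrm{tr}\,u_1\}$ and $\mathfrak{a}(u,v)=\langle\alpha\Delta u_1,\Delta v_1\rangle_\Omega+\langle\gamma u_2,v_2\rangle_{\Gamma,\beta}$. Associated operator: $u\in D(\mathcal{A})$ and $\mathcal{A}u=f$ if and only if $u\in D(\mathfrak{a})$, $f\in\mathcal{H}$ and $\mathfrak{a}(u,v)=\langle f,v\rangle_{\mathcal{H}}$ for all $v\in D(\mathfrak{a})$. The operator $\mathcal{A}$ is self-adjoint and bounded from below, and $\mathcal{T}=(\mathcal{T}(t))_{t\ge0}$ is the strongly continuous semigroup generated by $-\mathcal{A}$. A semigroup $(T(t))_{t\ge0}$ on $L^2(X;\mathbb{C})$, $(X,\Sigma,\mu)$ a measure space, is called real if $T(t)f\in L^2(X;\mathbb{R})$ for all $t\ge0$ and $f\in L^2(X;\mathbb{R})$; positive if $T(t)f\ge0$ for all $t\ge0$ and all $f\ge0$; $L^\infty$-contractive if $\|T(t)f\|_\infty\le\|f\|_\infty$ for all $t\ge0$ and $f\in L^2(X)\cap L^\infty(X)$. These notions are applied to $\mathcal{T}$ by identifying $\mathcal{H}$ with $L^2(X)$, where $X=\Omega\cup\Gamma$ and $\mu(A)=\lambda(A\cap\Omega)+\int_{A\cap\Gamma}\beta^{-1}dS$. *)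

theory Defs
  imports "HOL-Probability.Probability" "HOL-Library.Function_Algebras"
begin

section \<open>Lebesgue spaces\<close>

text \<open>
  Elements of Lebesgue spaces are represented by measurable functions; equality in these spaces is
  equality almost everywhere.  For a subset of the space, the values of the (total) functions outside
  of the space of the measure are irrelevant.
\<close>

definition L2 :: "'x measure \<Rightarrow> ('x \<Rightarrow> complex) set" where
  "L2 M = {f \<in> borel_measurable M. integrable M (\<lambda>x. (cmod (f x))\<^sup>2)}"

definition L2_norm :: "'x measure \<Rightarrow> ('x \<Rightarrow> complex) \<Rightarrow> real" where
  "L2_norm M f = sqrt (\<integral>x. (cmod (f x))\<^sup>2 \<partial>M)"

definition Linf_norm :: "'x measure \<Rightarrow> ('x \<Rightarrow> 'b::real_normed_vector) \<Rightarrow> ereal" where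
  "Linf_norm M f = esssup M (\<lambda>x. ereal (norm (f x)))"

definition Linf :: "'x measure \<Rightarrow> ('x \<Rightarrow> 'b::real_normed_vector) set" where
  "Linf M = {f \<in> borel_measurable M. Linf_norm M f < \<infinity>}"


section \<open>Real, positive and \<open>L\<^sup>\<infinity>\<close>-contractive semigroups on \<open>L\<^sup>2\<close>\<close>

definition real_semigroup :: "'x measure \<Rightarrow> (real \<Rightarrow> ('x \<Rightarrow> complex) \<Rightarrow> ('x \<Rightarrow> complex)) \<Rightarrow> bool" where
  "real_semigroup M T \<longleftrightarrow>
    (\<forall>t\<ge>0. \<forall>f\<in>L2 M. (AE x in M. f x \<in> \<real>) \<longrightarrow> (AE x in M. T t f x \<in> \<real>))"

definition positive_semigroup :: "'x measure \<Rightarrow> (real \<Rightarrow> ('x \<Rightarrow> complex) \<Rightarrow> ('x \<Rightarrow> complex)) \<Rightarrow> bool" where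
  "positive_semigroup M T \<longleftrightarrow>
    (\<forall>t\<ge>0. \<forall>f\<in>L2 M. (AE x in M. f x \<in> \<real> \<and> 0 \<le> Re (f x)) \<longrightarrow>
       (AE x in M. T t f x \<in> \<real> \<and> 0 \<le> Re (T t f x)))"

definition Linf_contractive_semigroup ::
    "'x measure \<Rightarrow> (real \<Rightarrow> ('x \<Rightarrow> complex) \<Rightarrow> ('x \<Rightarrow> complex)) \<Rightarrow> bool" where
  "Linf_contractive_semigroup M T \<longleftrightarrow>
    (\<forall>t\<ge>0. \<forall>f \<in> L2 M \<inter> Linf M. Linf_norm M (T t f) \<le> Linf_norm M f)"


section \<open>Lipschitz domains and surface measure\<close>

text \<open>
  Near each boundary point, in suitable Cartesian coordinates whose last axis has direction \<open>e\<close>,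
  the set lies strictly above the graph of a Lipschitz function and the boundary is that graph.  (As
  \<open>U\<close> is open, the equation for \<open>\<Omega> \<inter> U\<close> forces \<open>frontier \<Omega> \<inter> U\<close> to be the part of the graph in \<open>U\<close>.)
\<close>

definition lipschitz_boundary :: "'a::euclidean_space set \<Rightarrow> bool" where
  "lipschitz_boundary \<Omega> \<longleftrightarrow>
    (\<forall>z\<in>frontier \<Omega>. \<exists>e U g C. norm e = 1 \<and> open U \<and> z \<in> U \<and>
       C-lipschitz_on {y. y \<bullet> e = 0} g \<and>
       \<Omega> \<inter> U = {x \<in> U. g (x - (x \<bullet> e) *\<^sub>R e) < x \<bullet> e})"

definition lipschitz_domain :: "'a::euclidean_space set \<Rightarrow> bool" where
  "lipschitz_domain \<Omega> \<longleftrightarrow> open \<Omega> \<and> connected \<Omega> \<and> \<Omega> \<noteq> {} \<and> lipschitz_boundary \<Omega>"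

text \<open>
  The \<open>m\<close>-dimensional Hausdorff measure, normalised so that for \<open>m = DIM('a)\<close> it is Lebesgue measure.
  The case distinction makes it the counting measure for \<open>m = 0\<close>.
\<close>

definition hausdorff_gauge :: "nat \<Rightarrow> 'a::metric_space set \<Rightarrow> ennreal" where
  "hausdorff_gauge m U =
    (if U = {} then 0 else ennreal (unit_ball_vol (real m) * (diameter U / 2) ^ m))"

definition hausdorff_pre :: "nat \<Rightarrow> real \<Rightarrow> 'a::metric_space set \<Rightarrow> ennreal" where
  "hausdorff_pre m \<delta> A =
    (INF U \<in> {U :: nat \<Rightarrow> 'a set. A \<subseteq> (\<Union>k. U k) \<and> (\<forall>k. bounded (U k) \<and> diameter (U k) \<le> \<delta>)}.
       \<Sum>k. hausdorff_gauge m (U k))"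

definition hausdorff_outer :: "nat \<Rightarrow> 'a::metric_space set \<Rightarrow> ennreal" where
  "hausdorff_outer m A = (SUP \<delta>\<in>{0<..}. hausdorff_pre m \<delta> A)"

definition hausdorff_measure :: "nat \<Rightarrow> 'a::metric_space measure" where
  "hausdorff_measure m = measure_of UNIV (sets borel) (hausdorff_outer m)"

text \<open>
  The following lemmas show that the outer measure is countably additive on Borel sets, so that
  \<open>hausdorff_measure m\<close> takes the values of \<open>hausdorff_outer m\<close> and \<open>measure_of\<close> does not fall back to
  the zero measure.
\<close>

lemma hausdorff_gauge_mono: "U \<subseteq> V \<Longrightarrow> bounded V \<Longrightarrow> hausdorff_gauge m U \<le> hausdorff_gauge m V"
  by (auto simp: hausdorff_gauge_def intro!: ennreal_leI mult_left_mono power_mono divide_right_mono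
      diameter_subset diameter_ge_0 intro: bounded_subset)

lemma hausdorff_pre_empty: "\<delta> > 0 \<Longrightarrow> hausdorff_pre m \<delta> {} = 0"
  unfolding hausdorff_pre_def
  by (rule antisym, rule INF_lower2[where i = "\<lambda>_. {}"]) (auto simp: hausdorff_gauge_def)

lemma hausdorff_pre_mono: "A \<subseteq> B \<Longrightarrow> hausdorff_pre m \<delta> A \<le> hausdorff_pre m \<delta> B"
  unfolding hausdorff_pre_def by (intro INF_superset_mono) auto

lemma hausdorff_pre_antimono: "\<delta> \<le> \<epsilon> \<Longrightarrow> hausdorff_pre m \<epsilon> A \<le> hausdorff_pre m \<delta> A"
  unfolding hausdorff_pre_def by (intro INF_superset_mono) (auto intro: order_trans)

lemma hausdorff_pre_close:
  "hausdorff_pre m \<delta> A < e \<Longrightarrow>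
    \<exists>U. A \<subseteq> (\<Union>k. U k) \<and> (\<forall>k::nat. bounded (U k) \<and> diameter (U k) \<le> \<delta>) \<and> (\<Sum>k. hausdorff_gauge m (U k)) < e"
  unfolding hausdorff_pre_def INF_less_iff by auto

lemma hausdorff_pre_subadd:
  fixes A :: "nat \<Rightarrow> 'a::metric_space set"
  shows "hausdorff_pre m \<delta> (\<Union>i. A i) \<le> (\<Sum>n. hausdorff_pre m \<delta> (A n))"
proof (rule ennreal_le_epsilon)
  let ?O = "hausdorff_pre m \<delta>" and ?f = "hausdorff_gauge m"
  fix e :: real assume "0 < e" and "(\<Sum>n. ?O (A n)) < top"
  then have *: "\<And>n. ?O (A n) < ?O (A n) + e * (1/2)^Suc n"
    by (auto simp add: less_top dest!: ennreal_suminf_lessD)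
  obtain B :: "nat \<Rightarrow> nat \<Rightarrow> 'a set"
    where B: "\<And>n k. bounded (B n k) \<and> diameter (B n k) \<le> \<delta>"
      and sbB: "\<And>n. A n \<subseteq> (\<Union>i. B n i)"
      and Ble: "\<And>n. (\<Sum>i. ?f (B n i)) \<le> ?O (A n) + e * (1/2)^(Suc n)"
    by (metis less_imp_le hausdorff_pre_close[OF *])
  define C where "C = case_prod B o prod_decode"
  have A_C: "(\<Union>i. A i) \<subseteq> (\<Union>i. C i)"
    using sbB by (auto simp add: C_def subset_eq) (metis prod.case prod_encode_inverse)
  have "?O (\<Union>i. A i) \<le> (\<Sum>i. ?f (C i))"
    unfolding hausdorff_pre_def using A_C B
    by (intro INF_lower) (auto simp: C_def split: prod.split)
  also have "\<dots> = (\<Sum>n. \<Sum>i. ?f (B n i))"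
    unfolding C_def comp_def by (intro suminf_ennreal_2dimen) auto
  also have "\<dots> \<le> (\<Sum>n. ?O (A n) + e * (1/2) ^ Suc n)"
    by (intro suminf_le suminf_nonneg allI Ble) auto
  also have "... = (\<Sum>n. ?O (A n)) + (\<Sum>n. ennreal e * ennreal ((1/2) ^ Suc n))"
    using \<open>0 < e\<close> by (subst suminf_add[symmetric])
                     (auto simp del: ennreal_suminf_cmult simp add: ennreal_mult[symmetric])
  also have "\<dots> = (\<Sum>n. ?O (A n)) + e"
    unfolding ennreal_suminf_cmult
    by (subst suminf_ennreal_eq[OF zero_le_power power_half_series]) auto
  finally show "?O (\<Union>i. A i) \<le> (\<Sum>n. ?O (A n)) + e" .
qed

lemma hausdorff_outer_mono: "A \<subseteq> B \<Longrightarrow> hausdorff_outer m A \<le> hausdorff_outer m B"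
  unfolding hausdorff_outer_def by (intro SUP_mono') (rule hausdorff_pre_mono)

lemma hausdorff_outer_subadd: "hausdorff_outer m (\<Union>i. A i) \<le> (\<Sum>i. hausdorff_outer m (A i :: 'a::metric_space set))"
  unfolding hausdorff_outer_def[of m "\<Union>i. A i"]
  by (intro SUP_least order_trans[OF hausdorff_pre_subadd] suminf_le)
     (auto simp: hausdorff_outer_def intro: SUP_upper)

lemma outer_measure_space_hausdorff: "outer_measure_space UNIV (hausdorff_outer m)"
  unfolding outer_measure_space_def positive_def increasing_def countably_subadditive_def
  using hausdorff_outer_subadd[of m] hausdorff_outer_mono[of _ _ m]
  by (auto simp: hausdorff_outer_def hausdorff_pre_empty)

lemma hausdorff_outer_empty: "hausdorff_outer m {} = 0"
  using outer_measure_space_hausdorff[of m] by (auto simp: outer_measure_space_def positive_def)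

lemma hausdorff_outer_subadd2: "hausdorff_outer m (A \<union> B) \<le> hausdorff_outer m A + hausdorff_outer m B"
proof -
  have "hausdorff_outer m (A \<union> B) \<le> hausdorff_outer m (\<Union>i. binaryset A B i)"
    by (simp add: UN_binaryset_eq)
  also have "\<dots> \<le> (\<Sum>i. hausdorff_outer m (binaryset A B i))"
    by (rule hausdorff_outer_subadd)
  also have "\<dots> = hausdorff_outer m A + hausdorff_outer m B"
    by (rule suminf_binaryset_eq) (simp add: hausdorff_outer_empty)
  finally show ?thesis .
qed

lemma hausdorff_pre_separated:
  fixes A B :: "'a::metric_space set"
  assumes sep: "\<And>x y. x \<in> A \<Longrightarrow> y \<in> B \<Longrightarrow> dist x y > \<delta>"
  shows "hausdorff_pre m \<delta> A + hausdorff_pre m \<delta> B \<le> hausdorff_pre m \<delta> (A \<union> B)"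
  unfolding hausdorff_pre_def[of m \<delta> "A \<union> B"]
proof (rule INF_greatest, safe)
  fix U :: "nat \<Rightarrow> 'a set"
  assume cov: "A \<union> B \<subseteq> (\<Union>k. U k)" and U: "\<forall>k. bounded (U k) \<and> diameter (U k) \<le> \<delta>"
  let ?g = "hausdorff_gauge m"
  have *: "hausdorff_pre m \<delta> C \<le> (\<Sum>k. ?g (U k \<inter> C))" if "C \<subseteq> (\<Union>k. U k)" for C
    unfolding hausdorff_pre_def
  proof (rule INF_lower, safe)
    fix k
    show "bounded (U k \<inter> C)" using U by (meson Int_lower1 bounded_subset)
    show "diameter (U k \<inter> C) \<le> \<delta>" using U by (meson Int_lower1 diameter_subset order_trans)
  qed (use that in auto)
  have "hausdorff_pre m \<delta> A + hausdorff_pre m \<delta> B \<le> (\<Sum>k. ?g (U k \<inter> A)) + (\<Sum>k. ?g (U k \<inter> B))"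
    using cov by (intro add_mono *) auto
  also have "\<dots> = (\<Sum>k. ?g (U k \<inter> A) + ?g (U k \<inter> B))"
    by (rule suminf_add) auto
  also have "\<dots> \<le> (\<Sum>k. ?g (U k))"
  proof (rule suminf_le)
    fix k
    have "U k \<inter> A = {} \<or> U k \<inter> B = {}"
    proof (rule ccontr)
      assume "\<not> ?thesis"
      then obtain x y where "x \<in> U k" "x \<in> A" "y \<in> U k" "y \<in> B" by auto
      with U sep[of x y] diameter_bounded_bound[of "U k" x y] show False
        by (meson leD order_trans)
    qed
    moreover have "?g (U k \<inter> A) \<le> ?g (U k)" "?g (U k \<inter> B) \<le> ?g (U k)"
      using U by (auto intro!: hausdorff_gauge_mono)
    moreover have "?g ({} :: 'a set) = 0" by (simp add: hausdorff_gauge_def)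
    ultimately show "?g (U k \<inter> A) + ?g (U k \<inter> B) \<le> ?g (U k)" by auto
  qed auto
  finally show "hausdorff_pre m \<delta> A + hausdorff_pre m \<delta> B \<le> (\<Sum>k. ?g (U k))" .
qed

lemma hausdorff_outer_separated:
  fixes A B :: "'a::metric_space set"
  assumes "r > 0" and sep: "\<And>x y. x \<in> A \<Longrightarrow> y \<in> B \<Longrightarrow> dist x y \<ge> r"
  shows "hausdorff_outer m A + hausdorff_outer m B \<le> hausdorff_outer m (A \<union> B)"
proof -
  have "(SUP \<delta>\<in>{0<..}. hausdorff_pre m \<delta> A) + (SUP \<delta>\<in>{0<..}. hausdorff_pre m \<delta> B) =
      (SUP \<delta>\<in>{0::real<..}. hausdorff_pre m \<delta> A + hausdorff_pre m \<delta> B)"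
  proof (rule SUP_add_directed_ennreal[symmetric])
    fix \<delta> \<epsilon> :: real assume "\<delta> \<in> {0<..}" "\<epsilon> \<in> {0<..}"
    then show "\<exists>k\<in>{0<..}. hausdorff_pre m \<delta> A + hausdorff_pre m \<epsilon> B \<le> hausdorff_pre m k A + hausdorff_pre m k B"
      by (intro bexI[of _ "min \<delta> \<epsilon>"] add_mono hausdorff_pre_antimono) auto
  qed
  also have "\<dots> \<le> hausdorff_outer m (A \<union> B)"
  proof (rule SUP_least)
    fix \<delta> :: real assume \<delta>: "\<delta> \<in> {0<..}"
    define k where "k = min \<delta> (r / 2)"
    have k: "k > 0" "k \<le> \<delta>" "k < r" using \<delta> \<open>r > 0\<close> by (auto simp: k_def)
    have "hausdorff_pre m \<delta> A + hausdorff_pre m \<delta> B \<le> hausdorff_pre m k A + hausdorff_pre m k B"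
      using k by (intro add_mono hausdorff_pre_antimono) auto
    also have "\<dots> \<le> hausdorff_pre m k (A \<union> B)"
      using sep k by (intro hausdorff_pre_separated) (meson less_le_trans)
    also have "\<dots> \<le> hausdorff_outer m (A \<union> B)"
      unfolding hausdorff_outer_def using k by (intro SUP_upper) auto
    finally show "hausdorff_pre m \<delta> A + hausdorff_pre m \<delta> B \<le> hausdorff_outer m (A \<union> B)" .
  qed
  finally show ?thesis unfolding hausdorff_outer_def[of m A] hausdorff_outer_def[of m B] .
qed

lemma suminf_tail_ennreal:
  fixes f :: "nat \<Rightarrow> ennreal"
  assumes "(\<Sum>i. f i) < \<top>"
  shows "(\<lambda>n. \<Sum>i. f (i + n)) \<longlonglongrightarrow> 0"
proof -
  have f: "f i = ennreal (enn2real (f i))" for i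
    using ennreal_suminf_lessD[OF assms, of i] by (simp add: less_top)
  have s: "summable (\<lambda>i. enn2real (f i))"
    using assms by (intro summable_suminf_not_top) (auto simp: f[symmetric] less_top)
  have "(\<Sum>i. f (i + n)) = ennreal (\<Sum>i. enn2real (f (i + n)))" for n
    by (subst f, rule suminf_ennreal2) (use s in \<open>auto intro: summable_ignore_initial_segment\<close>)
  moreover have "(\<lambda>n. ennreal (\<Sum>i. enn2real (f (i + n)))) \<longlonglongrightarrow> ennreal 0"
    using suminf_exist_split2[OF s] by (intro tendsto_ennrealI) 
  ultimately show ?thesis by simp
qed

lemma hausdorff_outer_shells:
  fixes D :: "nat \<Rightarrow> 'a::metric_space set" and r :: "nat \<Rightarrow> real"
  assumes "\<And>i j x y. i < j \<Longrightarrow> j < n \<Longrightarrow> x \<in> D i \<Longrightarrow> y \<in> D j \<Longrightarrow> dist x y \<ge> r j"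
    and "\<And>j. r j > 0"
  shows "(\<Sum>i<n. hausdorff_outer m (D i)) \<le> hausdorff_outer m (\<Union>i<n. D i)"
  using assms(1)
proof (induction n)
  case (Suc n)
  have "(\<Sum>i<Suc n. hausdorff_outer m (D i)) \<le> hausdorff_outer m (\<Union>i<n. D i) + hausdorff_outer m (D n)"
    using Suc by (simp add: add_right_mono)
  also have "\<dots> \<le> hausdorff_outer m ((\<Union>i<n. D i) \<union> D n)"
    using Suc.prems assms(2) by (intro hausdorff_outer_separated[of "r n"]) auto
  also have "(\<Union>i<n. D i) \<union> D n = (\<Union>i<Suc n. D i)" by (auto simp: lessThan_Suc)
  finally show ?case .
qed (simp add: hausdorff_outer_empty)

lemma hausdorff_outer_caratheodory:
  fixes F A :: "'a::metric_space set"
  assumes F: "closed F" "F \<noteq> {}"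
  shows "hausdorff_outer m (A \<inter> F) + hausdorff_outer m (A - F) \<le> hausdorff_outer m A"
proof (cases "hausdorff_outer m A < \<top>")
  case True
  let ?H = "hausdorff_outer m"
  define a where "a n = 1 / real (Suc n)" for n
  have a_pos: "a n > 0" for n by (simp add: a_def)
  have a_dec: "a (Suc n) < a n" for n by (simp add: a_def field_simps)
  have a_mono: "i \<le> j \<Longrightarrow> a j \<le> a i" for i j by (simp add: a_def field_simps)
  define D where "D n = {x \<in> A. a (Suc n) \<le> infdist x F \<and> infdist x F < a n}" for n
  define S where "S n = {x \<in> A. a n \<le> infdist x F}" for n
  have sepD: "dist x y \<ge> a (Suc i) - a j" if "x \<in> D i" "y \<in> D j" for i j x y
    using that infdist_triangle[of x F y] by (auto simp: D_def)
  have half: "(\<Sum>i. ?H (D (2 * i + k))) \<le> ?H A" for k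
  proof (rule suminf_le_const[OF summableI])
    fix n
    have "(\<Sum>i<n. ?H (D (2 * i + k))) \<le> ?H (\<Union>i<n. D (2 * i + k))"
    proof (rule hausdorff_outer_shells[where r = "\<lambda>j. a (2 * j + k - 1) - a (2 * j + k) + (if 2 * j + k = 0 then 1 else 0)"])
      fix i j x y assume ij: "i < j" "x \<in> D (2 * i + k)" "y \<in> D (2 * j + k)"
      have "a (2 * j + k - 1) \<le> a (Suc (2 * i + k))" using ij by (intro a_mono) auto
      with sepD[OF ij(2,3)] ij(1)
      show "dist x y \<ge> a (2 * j + k - 1) - a (2 * j + k) + (if 2 * j + k = 0 then 1 else 0)" by auto
    next
      fix j show "a (2 * j + k - 1) - a (2 * j + k) + (if 2 * j + k = 0 then 1 else 0) > 0"
        using a_dec[of "2 * j + k - 1"] by (cases "2 * j + k") auto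
    qed
    also have "\<dots> \<le> ?H A" by (rule hausdorff_outer_mono) (auto simp: D_def)
    finally show "(\<Sum>i<n. ?H (D (2 * i + k))) \<le> ?H A" .
  qed
  have "(\<Sum>i. ?H (D i)) \<le> (\<Sum>i. ?H (D (2 * i + 0))) + (\<Sum>i. ?H (D (2 * i + 1)))"
  proof (rule suminf_le_const[OF summableI])
    fix n
    have "(\<Sum>i<n. ?H (D i)) \<le> (\<Sum>i<2 * n. ?H (D i))"
      by (rule sum_mono2) auto
    also have "\<dots> = (\<Sum>i<n. ?H (D (2 * i + 0))) + (\<Sum>i<n. ?H (D (2 * i + 1)))"
      by (induction n) (auto simp: ac_simps)
    also have "\<dots> \<le> (\<Sum>i. ?H (D (2 * i + 0))) + (\<Sum>i. ?H (D (2 * i + 1)))"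
      by (intro add_mono sum_le_suminf) auto
    finally show "(\<Sum>i<n. ?H (D i)) \<le> \<dots>" .
  qed
  also have "\<dots> < \<top>"
    using le_less_trans[OF half True, of 0] le_less_trans[OF half True, of 1] by simp
  finally have tail: "(\<lambda>n. \<Sum>i. ?H (D (i + n))) \<longlonglongrightarrow> 0"
    by (rule suminf_tail_ennreal)
  have "?H (A \<inter> F) + ?H (A - F) \<le> ?H A + (\<Sum>i. ?H (D (i + n)))" for n
  proof -
    have "A - F \<subseteq> S n \<union> (\<Union>i. D (i + n))"
    proof safe
      fix x assume x: "x \<in> A" "x \<notin> F" "x \<notin> (\<Union>i. D (i + n))"
      have pos: "infdist x F > 0"
        using F x in_closed_iff_infdist_zero[of F x] infdist_nonneg[of x F] by force
      obtain N where N: "a N \<le> infdist x F"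
        using nat_approx_posE[OF pos] unfolding a_def by (metis less_imp_le)
      have "a n \<le> infdist x F"
      proof (rule ccontr)
        assume neg: "\<not> a n \<le> infdist x F"
        define M where "M = (LEAST k. a k \<le> infdist x F)"
        have M: "a M \<le> infdist x F" unfolding M_def by (rule LeastI[of _ N]) (rule N)
        have "n < M" using neg M a_mono[of M n] by (meson not_le order_trans)
        then obtain K where K: "M = Suc K" by (cases M) auto
        have "\<not> a K \<le> infdist x F" using not_less_Least[of K "\<lambda>k. a k \<le> infdist x F"] K
          by (auto simp: M_def)
        then have "x \<in> D K" using x M K by (auto simp: D_def)
        moreover have "K = (K - n) + n" using \<open>n < M\<close> K by auto
        ultimately show False using x(3) by (metis UNIV_I UN_iff)
      qed
      then show "x \<in> S n" using x by (auto simp: S_def)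
    qed
    then have "?H (A - F) \<le> ?H (S n \<union> (\<Union>i. D (i + n)))" by (rule hausdorff_outer_mono)
    also have "\<dots> \<le> ?H (S n) + (\<Sum>i. ?H (D (i + n)))"
      by (intro order_trans[OF hausdorff_outer_subadd2] add_left_mono hausdorff_outer_subadd)
    finally have "?H (A \<inter> F) + ?H (A - F) \<le> (?H (A \<inter> F) + ?H (S n)) + (\<Sum>i. ?H (D (i + n)))"
      by (simp add: add.assoc add_left_mono)
    also have "?H (A \<inter> F) + ?H (S n) \<le> ?H ((A \<inter> F) \<union> S n)"
    proof (rule hausdorff_outer_separated[OF a_pos])
      fix x y assume "x \<in> A \<inter> F" "y \<in> S n"
      then show "dist x y \<ge> a n"
        using infdist_le[of x F y] by (auto simp: S_def dist_commute)
    qed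
    also have "\<dots> \<le> ?H A" by (rule hausdorff_outer_mono) (auto simp: S_def)
    finally show ?thesis by (simp add: add_right_mono)
  qed
  then have "\<forall>n. ?H (A \<inter> F) + ?H (A - F) \<le> ?H A + (\<Sum>i. ?H (D (i + n)))" by blast
  moreover have "(\<lambda>n. ?H A + (\<Sum>i. ?H (D (i + n)))) \<longlonglongrightarrow> ?H A + 0"
    by (intro tendsto_add tendsto_const tail)
  ultimately show ?thesis by (intro LIMSEQ_le_const[where X = "\<lambda>n. ?H A + (\<Sum>i. ?H (D (i + n)))"]) auto
qed (auto simp: not_less top_unique)

lemma measure_space_hausdorff:
  "measure_space (UNIV :: 'a::metric_space set) (sets borel) (hausdorff_outer m)"
proof -
  interpret P: sigma_algebra "UNIV :: 'a set" "UNIV" by (metis Pow_UNIV sigma_algebra_Pow)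
  let ?L = "lambda_system UNIV UNIV (hausdorff_outer m) :: 'a set set"
  have L: "measure_space UNIV ?L (hausdorff_outer m)"
    by (rule P.caratheodory_lemma[OF outer_measure_space_hausdorff])
  then interpret L: sigma_algebra UNIV ?L by (simp add: measure_space_def)
  have "F \<in> ?L" if "closed F" for F
  proof (cases "F = {}")
    case False
    show ?thesis unfolding P.lambda_system_eq
    proof safe
      fix A :: "'a set"
      have "hausdorff_outer m A \<le> hausdorff_outer m (A \<inter> F) + hausdorff_outer m (A - F)"
        using hausdorff_outer_subadd2[of m "A \<inter> F" "A - F"] by (simp add: Int_Diff_Un)
      with hausdorff_outer_caratheodory[OF that False]
      show "hausdorff_outer m (A \<inter> F) + hausdorff_outer m (A - F) = hausdorff_outer m A"
        by (meson antisym)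
    qed auto
  qed auto
  then have "sets borel \<subseteq> ?L"
    unfolding borel_eq_closed by (subst sets_measure_of) (auto intro!: L.sigma_sets_subset)
  moreover have "sigma_algebra UNIV (sets (borel :: 'a measure))"
    using sets.sigma_algebra_axioms[of "borel :: 'a measure"] by simp
  ultimately show ?thesis
    using L unfolding measure_space_def positive_def countably_additive_def by blast
qed

lemma sets_hausdorff_measure [simp, measurable_cong]: "sets (hausdorff_measure m) = sets borel"
  by (simp add: hausdorff_measure_def sets.sigma_sets_eq[of borel, simplified])

lemma space_hausdorff_measure [simp]: "space (hausdorff_measure m) = UNIV"
  by (simp add: hausdorff_measure_def)

lemma emeasure_hausdorff_measure:
  "A \<in> sets borel \<Longrightarrow> emeasure (hausdorff_measure m) A = hausdorff_outer m A"
  unfolding hausdorff_measure_def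
  using measure_space_hausdorff[where 'a='a, of m]
  by (subst emeasure_measure_of_sigma) (auto simp: measure_space_def)

definition vol :: "'a::euclidean_space set \<Rightarrow> 'a measure" where
  "vol \<Omega> = restrict_space lborel \<Omega>"

definition surf :: "'a::euclidean_space set \<Rightarrow> 'a measure" where
  "surf \<Omega> = restrict_space (hausdorff_measure (DIM('a) - 1)) (frontier \<Omega>)"


section \<open>Weak derivatives, Sobolev spaces and traces\<close>

text \<open>For \<open>i \<in> Basis\<close> this is the classical partial derivative in the direction of \<open>i\<close>.\<close>

definition partial :: "'a::euclidean_space \<Rightarrow> ('a \<Rightarrow> complex) \<Rightarrow> 'a \<Rightarrow> complex" where
  "partial i f x = frechet_derivative f (at x) i"

fun C_times :: "nat \<Rightarrow> ('a::euclidean_space \<Rightarrow> complex) \<Rightarrow> bool" where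
  "C_times 0 f \<longleftrightarrow> continuous_on UNIV f"
| "C_times (Suc k) f \<longleftrightarrow> (\<forall>x. f differentiable (at x)) \<and> (\<forall>i\<in>Basis. C_times k (partial i f))"

definition smooth :: "('a::euclidean_space \<Rightarrow> complex) \<Rightarrow> bool" where
  "smooth f \<longleftrightarrow> (\<forall>k. C_times k f)"

definition test_functions :: "'a::euclidean_space set \<Rightarrow> ('a \<Rightarrow> complex) set" where
  "test_functions \<Omega> = {\<phi>. smooth \<phi> \<and> (\<exists>K. compact K \<and> K \<subseteq> \<Omega> \<and> (\<forall>x. x \<notin> K \<longrightarrow> \<phi> x = 0))}"

definition has_weak_partial ::
    "'a::euclidean_space set \<Rightarrow> 'a \<Rightarrow> ('a \<Rightarrow> complex) \<Rightarrow> ('a \<Rightarrow> complex) \<Rightarrow> bool" where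
  "has_weak_partial \<Omega> i u g \<longleftrightarrow>
    (\<forall>\<phi>\<in>test_functions \<Omega>. (\<integral>x. u x * partial i \<phi> x \<partial>vol \<Omega>) = - (\<integral>x. g x * \<phi> x \<partial>vol \<Omega>))"

definition has_weak_laplacian ::
    "'a::euclidean_space set \<Rightarrow> ('a \<Rightarrow> complex) \<Rightarrow> ('a \<Rightarrow> complex) \<Rightarrow> bool" where
  "has_weak_laplacian \<Omega> u f \<longleftrightarrow>
    (\<forall>\<phi>\<in>test_functions \<Omega>.
       (\<integral>x. u x * (\<Sum>i\<in>Basis. partial i (partial i \<phi>) x) \<partial>vol \<Omega>) = (\<integral>x. f x * \<phi> x \<partial>vol \<Omega>))"

text \<open>
  The weak derivatives are unique up to equality almost everywhere, so that the choice of a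
  representative is immaterial.
\<close>

definition weak_partial :: "'a::euclidean_space set \<Rightarrow> 'a \<Rightarrow> ('a \<Rightarrow> complex) \<Rightarrow> 'a \<Rightarrow> complex" where
  "weak_partial \<Omega> i u = (SOME g. g \<in> L2 (vol \<Omega>) \<and> has_weak_partial \<Omega> i u g)"

definition weak_laplacian :: "'a::euclidean_space set \<Rightarrow> ('a \<Rightarrow> complex) \<Rightarrow> 'a \<Rightarrow> complex" where
  "weak_laplacian \<Omega> u = (SOME f. f \<in> L2 (vol \<Omega>) \<and> has_weak_laplacian \<Omega> u f)"

definition H1 :: "'a::euclidean_space set \<Rightarrow> ('a \<Rightarrow> complex) set" where
  "H1 \<Omega> = {u \<in> L2 (vol \<Omega>). \<forall>i\<in>Basis. \<exists>g\<in>L2 (vol \<Omega>). has_weak_partial \<Omega> i u g}"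

definition H1_laplace :: "'a::euclidean_space set \<Rightarrow> ('a \<Rightarrow> complex) set" where
  "H1_laplace \<Omega> = {u \<in> H1 \<Omega>. \<exists>f\<in>L2 (vol \<Omega>). has_weak_laplacian \<Omega> u f}"

definition inner_vol ::
    "'a::euclidean_space set \<Rightarrow> ('a \<Rightarrow> complex) \<Rightarrow> ('a \<Rightarrow> complex) \<Rightarrow> complex" where
  "inner_vol \<Omega> f g = (\<integral>x. f x * cnj (g x) \<partial>vol \<Omega>)"

definition inner_grad ::
    "'a::euclidean_space set \<Rightarrow> ('a \<Rightarrow> complex) \<Rightarrow> ('a \<Rightarrow> complex) \<Rightarrow> complex" where
  "inner_grad \<Omega> u v =
    (\<integral>x. (\<Sum>i\<in>Basis. weak_partial \<Omega> i u x * cnj (weak_partial \<Omega> i v x)) \<partial>vol \<Omega>)"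

definition inner_surf ::
    "'a::euclidean_space set \<Rightarrow> ('a \<Rightarrow> real) \<Rightarrow> ('a \<Rightarrow> complex) \<Rightarrow> ('a \<Rightarrow> complex) \<Rightarrow> complex" where
  "inner_surf \<Omega> \<beta> f g = (\<integral>x. f x * cnj (g x) * complex_of_real (inverse (\<beta> x)) \<partial>surf \<Omega>)"

definition neumann_domain :: "'a::euclidean_space set \<Rightarrow> ('a \<Rightarrow> complex) set" where
  "neumann_domain \<Omega> =
    {u \<in> H1_laplace \<Omega>. \<forall>v\<in>H1 \<Omega>. inner_grad \<Omega> u v = - inner_vol \<Omega> (weak_laplacian \<Omega> u) v}"

text \<open>
  \<open>has_trace \<Omega> u g\<close> expresses \<open>tr u = g\<close>.  The trace operator is the bounded extension to \<open>H1 \<Omega>\<close>, with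
  values in \<open>L2 (surf \<Omega>)\<close>, of the restriction to the boundary of functions smooth up to the boundary.
  As these are dense in \<open>H1 \<Omega>\<close> for a bounded Lipschitz domain, its graph is the closure given here.
\<close>

definition has_trace ::
    "'a::euclidean_space set \<Rightarrow> ('a \<Rightarrow> complex) \<Rightarrow> ('a \<Rightarrow> complex) \<Rightarrow> bool" where
  "has_trace \<Omega> u g \<longleftrightarrow> u \<in> H1 \<Omega> \<and> g \<in> L2 (surf \<Omega>) \<and>
    (\<exists>\<phi> :: nat \<Rightarrow> 'a \<Rightarrow> complex. (\<forall>n. smooth (\<phi> n)) \<and>
       (\<lambda>n. L2_norm (vol \<Omega>) (\<lambda>x. \<phi> n x - u x)) \<longlonglongrightarrow> 0 \<and>
       (\<forall>i\<in>Basis. (\<lambda>n. L2_norm (vol \<Omega>) (\<lambda>x. partial i (\<phi> n) x - weak_partial \<Omega> i u x)) \<longlonglongrightarrow> 0) \<and>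
       (\<lambda>n. L2_norm (surf \<Omega>) (\<lambda>x. \<phi> n x - g x)) \<longlonglongrightarrow> 0)"


section \<open>The Hilbert space, the form and its operator\<close>

type_synonym 'a pair = "('a \<Rightarrow> complex) \<times> ('a \<Rightarrow> complex)"

definition Hsp :: "'a::euclidean_space set \<Rightarrow> ('a \<Rightarrow> real) \<Rightarrow> 'a pair set" where
  "Hsp \<Omega> \<beta> = L2 (vol \<Omega>) \<times> L2 (density (surf \<Omega>) (\<lambda>x. ennreal (inverse (\<beta> x))))"

definition H_inner :: "'a::euclidean_space set \<Rightarrow> ('a \<Rightarrow> real) \<Rightarrow> 'a pair \<Rightarrow> 'a pair \<Rightarrow> complex" where
  "H_inner \<Omega> \<beta> u v = inner_vol \<Omega> (fst u) (fst v) + inner_surf \<Omega> \<beta> (snd u) (snd v)"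

definition H_norm :: "'a::euclidean_space set \<Rightarrow> ('a \<Rightarrow> real) \<Rightarrow> 'a pair \<Rightarrow> real" where
  "H_norm \<Omega> \<beta> u = sqrt (Re (H_inner \<Omega> \<beta> u u))"

definition H_eq :: "'a::euclidean_space set \<Rightarrow> 'a pair \<Rightarrow> 'a pair \<Rightarrow> bool" where
  "H_eq \<Omega> u v \<longleftrightarrow> (AE x in vol \<Omega>. fst u x = fst v x) \<and> (AE x in surf \<Omega>. snd u x = snd v x)"

definition scale :: "complex \<Rightarrow> 'a pair \<Rightarrow> 'a pair" where
  "scale c u = (\<lambda>x. c * fst u x, \<lambda>x. c * snd u x)"

definition form_domain :: "'a::euclidean_space set \<Rightarrow> ('a \<Rightarrow> real) \<Rightarrow> 'a pair set" where
  "form_domain \<Omega> \<beta> =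
    {u \<in> Hsp \<Omega> \<beta>. fst u \<in> neumann_domain \<Omega> \<and> has_trace \<Omega> (fst u) (snd u)}"

definition form ::
    "'a::euclidean_space set \<Rightarrow> ('a \<Rightarrow> real) \<Rightarrow> ('a \<Rightarrow> real) \<Rightarrow> ('a \<Rightarrow> real) \<Rightarrow> 'a pair \<Rightarrow> 'a pair \<Rightarrow> complex"
  where
  "form \<Omega> \<alpha> \<beta> \<gamma> u v =
    inner_vol \<Omega> (\<lambda>x. complex_of_real (\<alpha> x) * weak_laplacian \<Omega> (fst u) x) (weak_laplacian \<Omega> (fst v)) +
    inner_surf \<Omega> \<beta> (\<lambda>x. complex_of_real (\<gamma> x) * snd u x) (snd v)"

text \<open>\<open>assoc_op \<Omega> \<alpha> \<beta> \<gamma> u f\<close> means that \<open>u\<close> is in the domain of the operator and is mapped to \<open>f\<close>.\<close>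

definition assoc_op ::
    "'a::euclidean_space set \<Rightarrow> ('a \<Rightarrow> real) \<Rightarrow> ('a \<Rightarrow> real) \<Rightarrow> ('a \<Rightarrow> real) \<Rightarrow> 'a pair \<Rightarrow> 'a pair \<Rightarrow> bool"
  where
  "assoc_op \<Omega> \<alpha> \<beta> \<gamma> u f \<longleftrightarrow> u \<in> form_domain \<Omega> \<beta> \<and> f \<in> Hsp \<Omega> \<beta> \<and>
    (\<forall>v\<in>form_domain \<Omega> \<beta>. form \<Omega> \<alpha> \<beta> \<gamma> u v = H_inner \<Omega> \<beta> f v)"


section \<open>Strongly continuous semigroups\<close>

text \<open>
  An operator on the Hilbert space acts on representatives.  Compatibility with equality almost
  everywhere follows from linearity and boundedness.
\<close>

definition C0_semigroup ::
    "'a::euclidean_space set \<Rightarrow> ('a \<Rightarrow> real) \<Rightarrow> (real \<Rightarrow> 'a pair \<Rightarrow> 'a pair) \<Rightarrow> bool" where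
  "C0_semigroup \<Omega> \<beta> T \<longleftrightarrow>
    (\<forall>t\<ge>0. \<forall>u\<in>Hsp \<Omega> \<beta>. T t u \<in> Hsp \<Omega> \<beta>) \<and>
    (\<forall>t\<ge>0. \<forall>u\<in>Hsp \<Omega> \<beta>. \<forall>v\<in>Hsp \<Omega> \<beta>. H_eq \<Omega> (T t (u + v)) (T t u + T t v)) \<and>
    (\<forall>t\<ge>0. \<forall>c. \<forall>u\<in>Hsp \<Omega> \<beta>. H_eq \<Omega> (T t (scale c u)) (scale c (T t u))) \<and>
    (\<forall>t\<ge>0. \<exists>C. \<forall>u\<in>Hsp \<Omega> \<beta>. H_norm \<Omega> \<beta> (T t u) \<le> C * H_norm \<Omega> \<beta> u) \<and>
    (\<forall>u\<in>Hsp \<Omega> \<beta>. H_eq \<Omega> (T 0 u) u) \<and>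
    (\<forall>s\<ge>0. \<forall>t\<ge>0. \<forall>u\<in>Hsp \<Omega> \<beta>. H_eq \<Omega> (T (s + t) u) (T s (T t u))) \<and>
    (\<forall>u\<in>Hsp \<Omega> \<beta>. ((\<lambda>t. H_norm \<Omega> \<beta> (T t u - u)) \<longlongrightarrow> 0) (at_right 0))"

definition generator ::
    "'a::euclidean_space set \<Rightarrow> ('a \<Rightarrow> real) \<Rightarrow> (real \<Rightarrow> 'a pair \<Rightarrow> 'a pair) \<Rightarrow> 'a pair \<Rightarrow> 'a pair \<Rightarrow> bool"
  where
  "generator \<Omega> \<beta> T u f \<longleftrightarrow> u \<in> Hsp \<Omega> \<beta> \<and> f \<in> Hsp \<Omega> \<beta> \<and>
    ((\<lambda>h. H_norm \<Omega> \<beta> (scale (complex_of_real (inverse h)) (T h u - u) - f)) \<longlongrightarrow> 0) (at_right 0)"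

definition semigroup_generated_by ::
    "'a::euclidean_space set \<Rightarrow> ('a \<Rightarrow> real) \<Rightarrow> ('a pair \<Rightarrow> 'a pair \<Rightarrow> bool) \<Rightarrow>
      (real \<Rightarrow> 'a pair \<Rightarrow> 'a pair) \<Rightarrow> bool" where
  "semigroup_generated_by \<Omega> \<beta> B T \<longleftrightarrow>
    C0_semigroup \<Omega> \<beta> T \<and> (\<forall>u f. generator \<Omega> \<beta> T u f \<longleftrightarrow> B u f)"


section \<open>Identification with an \<open>L\<^sup>2\<close>-space\<close>

definition X_measure :: "'a::euclidean_space set \<Rightarrow> ('a \<Rightarrow> real) \<Rightarrow> 'a measure" where
  "X_measure \<Omega> \<beta> =
    measure_of (\<Omega> \<union> frontier \<Omega>) (sets (restrict_space borel (\<Omega> \<union> frontier \<Omega>)))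
      (\<lambda>A. emeasure lborel (A \<inter> \<Omega>) +
        (\<integral>\<^sup>+x\<in>A \<inter> frontier \<Omega>. ennreal (inverse (\<beta> x)) \<partial>surf \<Omega>))"

lemma sets_X_measure:
  "sets (X_measure \<Omega> \<beta>) = sets (restrict_space borel (\<Omega> \<union> frontier \<Omega>))"
  unfolding X_measure_def
  using sets.sigma_sets_eq[of "restrict_space borel (\<Omega> \<union> frontier \<Omega>)"]
    sets.space_closed[of "restrict_space borel (\<Omega> \<union> frontier \<Omega>)"]
  by (simp add: space_restrict_space)

lemma space_X_measure: "space (X_measure \<Omega> \<beta>) = \<Omega> \<union> frontier \<Omega>"
  unfolding X_measure_def
  using sets.space_closed[of "restrict_space borel (\<Omega> \<union> frontier \<Omega>)"]
  by (simp add: space_restrict_space space_measure_of_conv)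

lemma emeasure_X_measure:
  fixes \<Omega> :: "'a::euclidean_space set"
  assumes \<Omega>: "open \<Omega>" and \<beta>: "\<beta> \<in> borel_measurable (surf \<Omega>)"
    and A: "A \<in> sets borel" "A \<subseteq> \<Omega> \<union> frontier \<Omega>"
  shows "emeasure (X_measure \<Omega> \<beta>) A =
    emeasure lborel (A \<inter> \<Omega>) + (\<integral>\<^sup>+x\<in>A \<inter> frontier \<Omega>. ennreal (inverse (\<beta> x)) \<partial>surf \<Omega>)"
proof -
  let ?X = "\<Omega> \<union> frontier \<Omega>" and ?B = "restrict_space borel (\<Omega> \<union> frontier \<Omega>) :: 'a measure"
  let ?\<mu> = "\<lambda>A. emeasure lborel (A \<inter> \<Omega>) + (\<integral>\<^sup>+x\<in>A \<inter> frontier \<Omega>. ennreal (inverse (\<beta> x)) \<partial>surf \<Omega>)"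
  have fr: "frontier \<Omega> \<in> sets borel" by simp
  have X: "?X \<in> sets borel" using \<Omega> fr by simp
  have sB: "sets ?B = {A \<in> sets borel. A \<subseteq> ?X}"
    using X by (auto simp: sets_restrict_space image_iff intro: bexI[of _ "_"])
  define N where "N = density (surf \<Omega>) (\<lambda>x. ennreal (inverse (\<beta> x)))"
  have sN: "C \<inter> frontier \<Omega> \<in> sets N" if "C \<in> sets borel" for C
    using that by (auto simp: N_def surf_def sets_restrict_space)
  have \<mu>: "?\<mu> C = emeasure lborel (C \<inter> \<Omega>) + emeasure N (C \<inter> frontier \<Omega>)" if "C \<in> sets borel" for C
    using that \<beta> sN[OF that] by (simp add: N_def emeasure_density)
  have "emeasure (X_measure \<Omega> \<beta>) A = ?\<mu> A"
  proof (rule emeasure_measure_of[OF X_measure_def])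
    show "sets ?B \<subseteq> Pow ?X" by (auto simp: sB)
    show "A \<in> sets (X_measure \<Omega> \<beta>)" using A by (simp add: sets_X_measure sB)
    show "positive (sets (X_measure \<Omega> \<beta>)) ?\<mu>" by (simp add: positive_def)
    show "countably_additive (sets (X_measure \<Omega> \<beta>)) ?\<mu>"
    proof (rule countably_additiveI)
      fix C :: "nat \<Rightarrow> 'a set"
      assume C: "range C \<subseteq> sets (X_measure \<Omega> \<beta>)" "disjoint_family C" 
      then have Cb: "C i \<in> sets borel" for i by (auto simp: sets_X_measure sB)
      have "(\<Sum>i. ?\<mu> (C i)) = (\<Sum>i. emeasure lborel (C i \<inter> \<Omega>)) + (\<Sum>i. emeasure N (C i \<inter> frontier \<Omega>))"
        by (simp add: \<mu>[OF Cb] suminf_add)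
      also have "(\<Sum>i. emeasure lborel (C i \<inter> \<Omega>)) = emeasure lborel (\<Union>i. C i \<inter> \<Omega>)"
        using Cb \<Omega> C(2) by (intro suminf_emeasure) (auto simp: disjoint_family_on_def)
      also have "(\<Sum>i. emeasure N (C i \<inter> frontier \<Omega>)) = emeasure N (\<Union>i. C i \<inter> frontier \<Omega>)"
        using sN[OF Cb] C(2) by (intro suminf_emeasure) (auto simp: disjoint_family_on_def)
      also have "emeasure lborel (\<Union>i. C i \<inter> \<Omega>) + \<dots> = ?\<mu> (\<Union>i. C i)"
        using Cb by (subst \<mu>) auto
      finally show "(\<Sum>i. ?\<mu> (C i)) = ?\<mu> (\<Union>i. C i)" .
    qed
  qed
  then show ?thesis .
qed

text \<open>
  A function \<open>f\<close> on \<open>\<Omega> \<union> frontier \<Omega>\<close> corresponds to the pair of its restrictions to \<open>\<Omega>\<close> and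
  \<open>frontier \<Omega>\<close>.  As values outside of the respective sets are irrelevant, this pair is \<open>(f, f)\<close>.
\<close>

definition glue :: "'a::euclidean_space set \<Rightarrow> 'a pair \<Rightarrow> 'a \<Rightarrow> complex" where
  "glue \<Omega> u = (\<lambda>x. if x \<in> \<Omega> then fst u x else snd u x)"

definition on_X ::
    "'a::euclidean_space set \<Rightarrow> (real \<Rightarrow> 'a pair \<Rightarrow> 'a pair) \<Rightarrow> real \<Rightarrow> ('a \<Rightarrow> complex) \<Rightarrow> ('a \<Rightarrow> complex)"
  where
  "on_X \<Omega> T = (\<lambda>t f. glue \<Omega> (T t (f, f)))"

end

theory Submission
  imports Defs
begin

text \<open>
  Conjugation commutes with the operator, hence with the semigroup, which is therefore real.

  For the negative parts, let \<open>w\<close> be the projection of an element \<open>u\<close> of the form domain to a closed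
  convex set that is invariant under the semigroup (the positive cone, or the unit ball of \<open>L\<^sup>\<infinity>\<close>).
  Then \<open>\<langle>w - T t w, u - w\<rangle> \<ge> 0\<close>, and since the semigroup is symmetric and contractive, the approximating
  forms \<open>\<langle>w - T t w, w\<rangle> / t\<close> are bounded by the form at \<open>u\<close>.  This puts \<open>w\<close> into the form domain, so that
  \<open>w\<close> has a weak Laplacian in \<open>L\<^sup>2\<close>.  But for a test function \<open>u\<close> that is affine near a point, \<open>w\<close> can be given
  a kink along a hyperplane through this point, and the distributional Laplacian of a kink is a
  surface measure.

  As the trace is defined by a closure, the form is closed without a trace theorem; only the
  finiteness of the surface measure is needed for its linearity.  The resolvents that replace the
  spectral theorem come from the Riesz representation theorem for the form.
\<close>

section \<open>Spaces with a complete semi-inner product\<close>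

text \<open>No initial datum and time are exhibited at which positivity or contractivity fails. The
  criterion that breaks is not an inequality for the form but the invariance of its domain:
  truncation respects first-order regularity, while the domain asks for a Laplacian in L2. Each
  property is therefore refuted by forcing one truncated function into the domain. The inequality
  \<open>ip (w - T t w) (u - w) \<ge> 0\<close> is the variational inequality of a projection, as
  \<open>T t w\<close> stays in the convex set. For the cone and the unit ball the projection is a
  pointwise truncation, so the inequality is checked pointwise. Test functions serve as
  \<open>u\<close>, so that the Neumann condition and the trace are harmless and the kink lies
  inside \<Omega>. Two obstacles shape the rest. The form bounds the Laplacian but contains no
  gradient; closedness depends on recovering the gradient from the Neumann condition tested with the
  function itself. The semigroup is known only through its right derivative at 0, so local
  boundedness, two-sided derivatives of orbits, symmetry and contractivity have to be derived; the
  last uses that \<gamma> \<ge> 0 makes the form nonnegative.\<close>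

text \<open>
  Elements of \<open>L\<^sup>2\<close>-spaces are functions rather than equivalence classes, so that inner products are
  only semi-definite and live on a carrier set.  Scalars are real: the complex Hilbert space is
  treated with the real part of its inner product.
\<close>

locale semi_inner_product =
  fixes S :: "'v::ab_group_add set" and sc :: "real \<Rightarrow> 'v \<Rightarrow> 'v" and ip :: "'v \<Rightarrow> 'v \<Rightarrow> real"
  assumes zero_mem [simp]: "0 \<in> S"
    and add_mem [simp]: "x \<in> S \<Longrightarrow> y \<in> S \<Longrightarrow> x + y \<in> S"
    and sc_mem [simp]: "x \<in> S \<Longrightarrow> sc c x \<in> S"
    and sc_minus_one: "x \<in> S \<Longrightarrow> sc (- 1) x = - x"
    and ip_add_left: "x \<in> S \<Longrightarrow> y \<in> S \<Longrightarrow> z \<in> S \<Longrightarrow> ip (x + y) z = ip x z + ip y z"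
    and ip_sc_left: "x \<in> S \<Longrightarrow> z \<in> S \<Longrightarrow> ip (sc c x) z = c * ip x z"
    and ip_sym: "x \<in> S \<Longrightarrow> y \<in> S \<Longrightarrow> ip x y = ip y x"
    and ip_nonneg [simp]: "x \<in> S \<Longrightarrow> 0 \<le> ip x x"
begin

definition nm :: "'v \<Rightarrow> real" where
  "nm x = sqrt (ip x x)"

definition equiv :: "'v \<Rightarrow> 'v \<Rightarrow> bool" where
  "equiv x y \<longleftrightarrow> nm (x - y) = 0"

lemma minus_mem [simp]: "x \<in> S \<Longrightarrow> - x \<in> S"
  using sc_mem[of x "-1"] sc_minus_one by simp

lemma diff_mem [simp]: "x \<in> S \<Longrightarrow> y \<in> S \<Longrightarrow> x - y \<in> S"
  using add_mem[of x "- y"] by simp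

lemma ip_minus_left: "x \<in> S \<Longrightarrow> z \<in> S \<Longrightarrow> ip (- x) z = - ip x z"
  using ip_sc_left[of x z "-1"] sc_minus_one by simp

lemma ip_diff_left: "x \<in> S \<Longrightarrow> y \<in> S \<Longrightarrow> z \<in> S \<Longrightarrow> ip (x - y) z = ip x z - ip y z"
  using ip_add_left[of x "- y" z] ip_minus_left[of y z] by simp

lemma ip_add_right: "x \<in> S \<Longrightarrow> y \<in> S \<Longrightarrow> z \<in> S \<Longrightarrow> ip x (y + z) = ip x y + ip x z"
  using ip_add_left[of y z x] by (simp add: ip_sym[of x])

lemma ip_sc_right: "x \<in> S \<Longrightarrow> z \<in> S \<Longrightarrow> ip x (sc c z) = c * ip x z"
  using ip_sc_left[of z x c] by (simp add: ip_sym[of x])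

lemma ip_minus_right: "x \<in> S \<Longrightarrow> z \<in> S \<Longrightarrow> ip x (- z) = - ip x z"
  using ip_minus_left[of z x] by (simp add: ip_sym[of x])

lemma ip_diff_right: "x \<in> S \<Longrightarrow> y \<in> S \<Longrightarrow> z \<in> S \<Longrightarrow> ip x (y - z) = ip x y - ip x z"
  using ip_diff_left[of y z x] by (simp add: ip_sym[of x])

lemmas ip_linear = ip_add_left ip_sc_left ip_minus_left ip_diff_left
  ip_add_right ip_sc_right ip_minus_right ip_diff_right

lemma ip_zero_left [simp]: "z \<in> S \<Longrightarrow> ip 0 z = 0"
  using ip_add_left[of 0 0 z] by simp

lemma nm_sq: "x \<in> S \<Longrightarrow> (nm x)\<^sup>2 = ip x x"
  by (simp add: nm_def)

lemma nm_nonneg [simp]: "x \<in> S \<Longrightarrow> 0 \<le> nm x"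
  by (simp add: nm_def)

lemma nm_le_zero_iff [simp]: "x \<in> S \<Longrightarrow> nm x \<le> 0 \<longleftrightarrow> nm x = 0"
  using nm_nonneg[of x] by linarith

lemma nm_zero [simp]: "nm 0 = 0"
  by (simp add: nm_def)

text \<open>The quadratic polynomial in \<open>c\<close> is nonnegative. As \<open>ip\<close> is
  only semi-definite, \<open>ip y y = 0\<close> does not make \<open>y\<close> zero; the polynomial
  is then affine in \<open>c\<close>, and unless its slope vanishes the chosen \<open>c\<close>
  gives it the value -1. In the other case \<open>c\<close> is the minimiser.\<close>

lemma cauchy_schwarz_sq:
  assumes [simp]: "x \<in> S" "y \<in> S"
  shows "(ip x y)\<^sup>2 \<le> ip x x * ip y y"
proof -
  have *: "0 \<le> ip x x + 2 * c * ip x y + c\<^sup>2 * ip y y" for c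
    using ip_nonneg[of "x + sc c y"] ip_sym[of y x]
    by (simp add: ip_linear power2_eq_square algebra_simps)
  show ?thesis
  proof (cases "ip y y = 0")
    case True
    have "ip x y = 0"
    proof (rule ccontr)
      assume "ip x y \<noteq> 0"
      with *[of "- (ip x x + 1) / (2 * ip x y)"] True show False by (simp add: field_simps)
    qed
    then show ?thesis by simp
  next
    case False
    then have p: "ip y y > 0" using ip_nonneg[OF assms(2)] by linarith
    show ?thesis using *[of "- ip x y / ip y y"] p
      by (simp add: field_simps power2_eq_square)
  qed
qed

lemma cauchy_schwarz: "x \<in> S \<Longrightarrow> y \<in> S \<Longrightarrow> \<bar>ip x y\<bar> \<le> nm x * nm y"
  using cauchy_schwarz_sq[of x y]
  by (metis nm_def real_sqrt_abs real_sqrt_le_iff real_sqrt_mult)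

lemma nm_triangle:
  assumes [simp]: "x \<in> S" "y \<in> S"
  shows "nm (x + y) \<le> nm x + nm y"
proof (rule power2_le_imp_le)
  show "(nm (x + y))\<^sup>2 \<le> (nm x + nm y)\<^sup>2"
    using cauchy_schwarz[of x y] ip_sym[of x y]
    by (simp add: nm_sq power2_sum ip_linear abs_le_iff)
qed simp

lemma nm_minus: "x \<in> S \<Longrightarrow> nm (- x) = nm x"
  by (simp add: nm_def ip_linear)

lemma nm_sc: "x \<in> S \<Longrightarrow> nm (sc c x) = \<bar>c\<bar> * nm x"
  by (simp add: nm_def ip_linear real_sqrt_mult flip: power2_eq_square)
     (metis power2_eq_square mult.assoc real_sqrt_abs real_sqrt_mult)

lemma nm_diff_commute: "x \<in> S \<Longrightarrow> y \<in> S \<Longrightarrow> nm (x - y) = nm (y - x)"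
  using nm_minus[of "x - y"] by simp

lemma nm_triangle_diff: "x \<in> S \<Longrightarrow> y \<in> S \<Longrightarrow> nm (x - y) \<le> nm x + nm y"
  using nm_triangle[of x "- y"] nm_minus[of y] by simp

lemma nm_triangle3: "x \<in> S \<Longrightarrow> y \<in> S \<Longrightarrow> z \<in> S \<Longrightarrow> nm (x - z) \<le> nm (x - y) + nm (y - z)"
  using nm_triangle[of "x - y" "y - z"] by simp

lemma nm_reverse_triangle: "x \<in> S \<Longrightarrow> y \<in> S \<Longrightarrow> \<bar>nm x - nm y\<bar> \<le> nm (x - y)"
  using nm_triangle[of "x - y" y] nm_triangle[of "y - x" x] nm_diff_commute[of x y] by auto

lemma ip_null: "x \<in> S \<Longrightarrow> y \<in> S \<Longrightarrow> nm x = 0 \<Longrightarrow> ip x y = 0"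
  using cauchy_schwarz[of x y] by simp

section \<open>Vectors at distance zero, limits and derivatives in the seminorm\<close>

lemma equiv_refl [simp]: "equiv x x"
  by (simp add: equiv_def)

lemma equiv_sym: "x \<in> S \<Longrightarrow> y \<in> S \<Longrightarrow> equiv x y \<Longrightarrow> equiv y x"
  by (simp add: equiv_def nm_diff_commute)

lemma equiv_trans: "x \<in> S \<Longrightarrow> y \<in> S \<Longrightarrow> z \<in> S \<Longrightarrow> equiv x y \<Longrightarrow> equiv y z \<Longrightarrow> equiv x z"
  using nm_triangle3[of x y z] by (simp add: equiv_def)

lemma equiv_nm: "x \<in> S \<Longrightarrow> y \<in> S \<Longrightarrow> equiv x y \<Longrightarrow> nm x = nm y"
  using nm_reverse_triangle[of x y] by (simp add: equiv_def)

lemma equiv_add: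
  assumes "x \<in> S" "y \<in> S" "x' \<in> S" "y' \<in> S" "equiv x x'" "equiv y y'"
  shows "equiv (x + y) (x' + y')"
  using nm_triangle[of "x - x'" "y - y'"] assms
  by (simp add: equiv_def add_diff_add)

text \<open>Scalars are not assumed to distribute over sums. Expanding the square of the seminorm by
  bilinearity of \<open>ip\<close> shows that they do so up to a null vector, which is what
  \<open>equiv_sc\<close> uses.\<close>

lemma sc_diff_equiv:
  assumes [simp]: "x \<in> S" "y \<in> S"
  shows "equiv (sc c (x - y)) (sc c x - sc c y)"
  using ip_sym[of x y] by (simp add: equiv_def nm_def ip_linear algebra_simps)

lemma equiv_sc: "x \<in> S \<Longrightarrow> y \<in> S \<Longrightarrow> equiv x y \<Longrightarrow> equiv (sc c x) (sc c y)"
  using equiv_nm[OF _ _ sc_diff_equiv[of x y c]] nm_sc[of "x - y" c] by (simp add: equiv_def)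

lemma equiv_diff:
  assumes "x \<in> S" "y \<in> S" "x' \<in> S" "y' \<in> S" "equiv x x'" "equiv y y'"
  shows "equiv (x - y) (x' - y')"
  using equiv_add[of x "- y" x' "- y'"] assms nm_diff_commute[of y y'] by (simp add: equiv_def)

lemma equiv_ip: "x \<in> S \<Longrightarrow> y \<in> S \<Longrightarrow> z \<in> S \<Longrightarrow> equiv x y \<Longrightarrow> ip x z = ip y z"
  using ip_null[of "x - y" z] by (simp add: equiv_def ip_linear)

lemma nm_limit_unique:
  assumes "x \<in> S" "y \<in> S" "\<And>i. X i \<in> S" "F \<noteq> bot"
    and "((\<lambda>i. nm (X i - x)) \<longlongrightarrow> 0) F" "((\<lambda>i. nm (X i - y)) \<longlongrightarrow> 0) F"
  shows "equiv x y"
proof -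
  have "((\<lambda>i. nm (X i - x) + nm (X i - y)) \<longlongrightarrow> 0 + 0) F"
    by (intro tendsto_add assms)
  moreover have "nm (x - y) \<le> nm (X i - x) + nm (X i - y)" for i
    using nm_triangle3[of x "X i" y] nm_diff_commute[of x "X i"] assms by simp
  ultimately have "nm (x - y) \<le> 0 + 0"
    using assms(4) by (intro tendsto_lowerbound[where F = F]) auto
  then show ?thesis using assms by (simp add: equiv_def)
qed

lemma tendsto_ip:
  assumes S: "\<And>i. X i \<in> S" "\<And>i. Y i \<in> S" "x \<in> S" "y \<in> S"
    and X: "((\<lambda>i. nm (X i - x)) \<longlongrightarrow> 0) F" and Y: "((\<lambda>i. nm (Y i - y)) \<longlongrightarrow> 0) F"
  shows "((\<lambda>i. ip (X i) (Y i)) \<longlongrightarrow> ip x y) F"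
proof -
  have "((\<lambda>i. ip (X i) (Y i) - ip x y) \<longlongrightarrow> 0) F"
  proof (rule Lim_null_comparison)
    have "((\<lambda>i. nm (X i - x) * (nm (Y i - y) + nm y) + nm x * nm (Y i - y)) \<longlongrightarrow> 0 * (0 + nm y) + nm x * 0) F"
      by (intro tendsto_intros X Y)
    then show "((\<lambda>i. nm (X i - x) * (nm (Y i - y) + nm y) + nm x * nm (Y i - y)) \<longlongrightarrow> 0) F" by simp
    have "norm (ip (X i) (Y i) - ip x y) \<le> nm (X i - x) * (nm (Y i - y) + nm y) + nm x * nm (Y i - y)" for i
    proof -
      have "ip (X i) (Y i) - ip x y = ip (X i - x) (Y i) + ip x (Y i - y)"
        using S by (simp add: ip_linear)
      then have "norm (ip (X i) (Y i) - ip x y) \<le> \<bar>ip (X i - x) (Y i)\<bar> + \<bar>ip x (Y i - y)\<bar>"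
        by simp
      also have "\<dots> \<le> nm (X i - x) * nm (Y i) + nm x * nm (Y i - y)"
        using S by (intro add_mono cauchy_schwarz) auto
      also have "\<dots> \<le> nm (X i - x) * (nm (Y i - y) + nm y) + nm x * nm (Y i - y)"
        using S nm_triangle[of "Y i - y" y] by (intro add_mono mult_left_mono) auto
      finally show ?thesis .
    qed
    then show "\<forall>\<^sub>F i in F. norm (ip (X i) (Y i) - ip x y)
        \<le> nm (X i - x) * (nm (Y i - y) + nm y) + nm x * nm (Y i - y)" by simp
  qed
  then show ?thesis by (rule LIM_zero_cancel)
qed

text \<open>The type of vectors carries no topology, so differentiability is expressed by the
  seminorm of difference quotients. The quotient of \<open>ip (p s) (q s)\<close> is split with
  \<open>q\<close> at the moving point and \<open>p\<close> at the base point; joint continuity of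
  \<open>ip\<close> then gives the product rule.\<close>

lemma has_derivative_ip:
  fixes t0 :: real
  assumes S [simp]: "\<And>s. s \<in> A \<Longrightarrow> p s \<in> S" "\<And>s. s \<in> A \<Longrightarrow> q s \<in> S" "p' \<in> S" "q' \<in> S" "t0 \<in> A"
    and p: "((\<lambda>s. nm (sc (inverse (s - t0)) (p s - p t0) - p')) \<longlongrightarrow> 0) (at t0 within A)"
    and q: "((\<lambda>s. nm (sc (inverse (s - t0)) (q s - q t0) - q')) \<longlongrightarrow> 0) (at t0 within A)"
    and qc: "((\<lambda>s. nm (q s - q t0)) \<longlongrightarrow> 0) (at t0 within A)"
  shows "((\<lambda>s. ip (p s) (q s)) has_real_derivative (ip p' (q t0) + ip (p t0) q')) (at t0 within A)"
  unfolding has_field_derivative_iff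
proof (rule Lim_transform_eventually)
  \<comment> \<open>\<open>tendsto_ip\<close> asks for membership in \<open>S\<close> at every
    index, but \<open>p s\<close> and \<open>q s\<close> are known to lie in \<open>S\<close> only
    for \<open>s\<close> in \<open>A\<close>. Off \<open>A\<close> the functions are replaced by
    their values at \<open>t0\<close>, which the filter does not see.\<close>
  define clip where "clip g s = (if s \<in> A then g s else g t0)" for g :: "real \<Rightarrow> 'v" and s
  let ?P = "clip (\<lambda>s. sc (inverse (s - t0)) (p s - p t0))"
  let ?Q = "clip (\<lambda>s. sc (inverse (s - t0)) (q s - q t0))"
  have ev: "\<forall>\<^sub>F s in at t0 within A. s \<in> A" by (simp add: eventually_at_filter)
  have "((\<lambda>s. ip (?P s) (clip q s) + ip (p t0) (?Q s)) \<longlongrightarrow> ip p' (q t0) + ip (p t0) q') (at t0 within A)"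
  proof (intro tendsto_add tendsto_ip)
    show "((\<lambda>s. nm (?P s - p')) \<longlongrightarrow> 0) (at t0 within A)"
      by (rule Lim_transform_eventually[OF p]) (use ev in \<open>eventually_elim, simp add: clip_def\<close>)
    show "((\<lambda>s. nm (?Q s - q')) \<longlongrightarrow> 0) (at t0 within A)"
      by (rule Lim_transform_eventually[OF q]) (use ev in \<open>eventually_elim, simp add: clip_def\<close>)
    show "((\<lambda>s. nm (clip q s - q t0)) \<longlongrightarrow> 0) (at t0 within A)"
      by (rule Lim_transform_eventually[OF qc]) (use ev in \<open>eventually_elim, simp add: clip_def\<close>)
  qed (auto simp: clip_def)
  then show "((\<lambda>s. ip (?P s) (clip q s) + ip (p t0) (?Q s)) \<longlongrightarrow> ip p' (q t0) + ip (p t0) q') (at t0 within A)" .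
  show "\<forall>\<^sub>F s in at t0 within A. ip (?P s) (clip q s) + ip (p t0) (?Q s) =
      (ip (p s) (q s) - ip (p t0) (q t0)) / (s - t0)"
    using ev by eventually_elim (simp add: clip_def ip_linear divide_inverse algebra_simps)
qed

end

locale semi_hilbert = semi_inner_product +
  assumes complete: "(\<And>n. X n \<in> S) \<Longrightarrow>
    (\<And>e. e > 0 \<Longrightarrow> \<exists>N. \<forall>m\<ge>N. \<forall>n\<ge>N. ip (X m - X n) (X m - X n) < e) \<Longrightarrow>
    \<exists>x\<in>S. (\<lambda>n. ip (X n - x) (X n - x)) \<longlonglongrightarrow> 0"
begin

lemma nm_complete:
  fixes X :: "nat \<Rightarrow> 'a"
  assumes X: "\<And>n. X n \<in> S"
    and C: "\<And>e. e > 0 \<Longrightarrow> \<exists>N. \<forall>m\<ge>N. \<forall>n\<ge>N. nm (X m - X n) < e"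
  shows "\<exists>x\<in>S. (\<lambda>n. nm (X n - x)) \<longlonglongrightarrow> 0"
proof -
  have "\<exists>x\<in>S. (\<lambda>n. ip (X n - x) (X n - x)) \<longlonglongrightarrow> 0"
  proof (rule complete[OF X])
    fix e :: real assume "e > 0"
    then obtain N where "\<forall>m\<ge>N. \<forall>n\<ge>N. nm (X m - X n) < sqrt e" using C[of "sqrt e"] by auto
    then show "\<exists>N. \<forall>m\<ge>N. \<forall>n\<ge>N. ip (X m - X n) (X m - X n) < e" by (auto simp: nm_def)
  qed
  then show ?thesis using tendsto_real_sqrt[of _ 0] by (fastforce simp: nm_def)
qed

text \<open>
  The minimising sequence of \<open>ip v v - 2 * l v\<close> over a subspace is a Cauchy sequence by the
  parallelogram identity.
\<close>

lemma riesz_subspace: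
  assumes V: "V \<subseteq> S" "0 \<in> V" "\<And>x y. x \<in> V \<Longrightarrow> y \<in> V \<Longrightarrow> x + y \<in> V" "\<And>c x. x \<in> V \<Longrightarrow> sc c x \<in> V"
    and add: "\<And>x y. x \<in> V \<Longrightarrow> y \<in> V \<Longrightarrow> l (x + y) = l x + l y"
    and sc: "\<And>c x. x \<in> V \<Longrightarrow> l (sc c x) = c * l x"
    and bd: "\<And>x. x \<in> V \<Longrightarrow> \<bar>l x\<bar> \<le> C * nm x"
  obtains w X where "w \<in> S" "\<And>n::nat. X n \<in> V" "(\<lambda>n. nm (X n - w)) \<longlonglongrightarrow> 0" "\<And>v. v \<in> V \<Longrightarrow> ip w v = l v"
proof -
  have VS [simp]: "x \<in> V \<Longrightarrow> x \<in> S" for x using V by auto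
  define J where "J x = ip x x - 2 * l x" for x
  have low: "- C\<^sup>2 \<le> J x" if "x \<in> V" for x
  proof -
    have "J x = (nm x)\<^sup>2 - 2 * l x" using that by (simp add: J_def nm_sq)
    moreover have "l x \<le> C * nm x" using bd[OF that] by linarith
    moreover have "0 \<le> (nm x - C)\<^sup>2" by simp
    ultimately show ?thesis by (simp add: power2_diff algebra_simps)
  qed
  define m where "m = Inf (J ` V)"
  have bdd: "bdd_below (J ` V)" using low by (intro bdd_belowI[of _ "- C\<^sup>2"]) auto
  have m: "m \<le> J x" if "x \<in> V" for x unfolding m_def using that bdd by (intro cInf_lower) auto
  have "\<exists>x\<in>V. J x < m + e" if "e > 0" for e
  proof -
    have "Inf (J ` V) < m + e" using that by (simp add: m_def)
    then show ?thesis using V(2) by (subst (asm) cInf_less_iff) (auto intro: bdd)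
  qed
  then have "\<forall>n::nat. \<exists>x\<in>V. J x < m + 1 / real (Suc n)" by simp
  then obtain X where XV: "\<And>n::nat. X n \<in> V" and X: "\<And>n. J (X n) < m + 1 / real (Suc n)" by metis
  have par: "ip (x - y) (x - y) \<le> 2 * J x + 2 * J y - 4 * m" if [simp]: "x \<in> V" "y \<in> V" for x y
  proof -
    have "ip (x - y) (x - y) = 2 * J x + 2 * J y - 4 * J (sc (1/2) (x + y))"
      using ip_sym[of x y] by (simp add: J_def ip_linear sc add V(3) algebra_simps)
    then show ?thesis using m[of "sc (1/2) (x + y)"] V by simp
  qed
  have "\<exists>w\<in>S. (\<lambda>n. ip (X n - w) (X n - w)) \<longlonglongrightarrow> 0"
  proof (rule complete)
    fix e :: real assume "e > 0"
    then obtain N where N: "1 / real (Suc N) < e / 4" using nat_approx_posE[of "e/4"] by auto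
    have J: "J (X n) < m + e / 4" if "n \<ge> N" for n
    proof -
      have "1 / real (Suc n) \<le> 1 / real (Suc N)" using that by (simp add: field_simps)
      then show ?thesis using X[of n] N by linarith
    qed
    have "ip (X i - X j) (X i - X j) < e" if "i \<ge> N" "j \<ge> N" for i j
      using par[OF XV XV, of i j] J[OF that(1)] J[OF that(2)] by linarith
    then show "\<exists>N. \<forall>m\<ge>N. \<forall>n\<ge>N. ip (X m - X n) (X m - X n) < e" by blast
  qed (use XV in simp)
  then obtain w where w [simp]: "w \<in> S" and "(\<lambda>n. ip (X n - w) (X n - w)) \<longlonglongrightarrow> 0" by auto
  then have lim: "(\<lambda>n. nm (X n - w)) \<longlonglongrightarrow> 0"
    unfolding nm_def using tendsto_real_sqrt[of _ 0] by fastforce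
  have "ip w v = l v" if v: "v \<in> V" for v
  proof -
    have "(\<lambda>n. J (X n)) \<longlonglongrightarrow> m"
    proof (rule tendsto_sandwich[where f = "\<lambda>_. m" and h = "\<lambda>n. m + 1 / real (Suc n)"])
      show "(\<lambda>n. m + 1 / real (Suc n)) \<longlonglongrightarrow> m"
        using tendsto_add[OF tendsto_const lim_const_over_n[THEN LIMSEQ_Suc], of m 1] by simp
    qed (use m[OF XV] X in \<open>auto intro!: always_eventually less_imp_le\<close>)
    moreover have "(\<lambda>n. ip (X n) v) \<longlonglongrightarrow> ip w v"
      using tendsto_ip[of X "\<lambda>_. v" w v sequentially] lim XV v by simp
    ultimately have lim2: "(\<lambda>n. J (X n) + 2 * c * (ip (X n) v - l v) + c\<^sup>2 * ip v v) \<longlonglongrightarrow>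
        m + 2 * c * (ip w v - l v) + c\<^sup>2 * ip v v" for c
      by (intro tendsto_intros)
    have pos: "0 \<le> 2 * c * (ip w v - l v) + c\<^sup>2 * ip v v" for c
    proof -
      have "m \<le> J (X n) + 2 * c * (ip (X n) v - l v) + c\<^sup>2 * ip v v" for n
        using m[of "X n + sc c v"] ip_sym[of "X n" v] v V XV[of n]
        by (simp add: J_def ip_linear add sc power2_eq_square algebra_simps)
      then have "m \<le> m + 2 * c * (ip w v - l v) + c\<^sup>2 * ip v v"
        using lim2[of c] by (intro LIMSEQ_le_const) auto
      then show ?thesis by linarith
    qed
    \<comment> \<open>The optimal \<open>c\<close> would be \<open>- ?r / ip v v\<close>. Enlarging
      the denominator by 1 covers null vectors \<open>v\<close> as well and still leads to the upper
      bound \<open>- (q\<^sup>2 * ?k)\<close>.\<close>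
    let ?r = "ip w v - l v" and ?k = "ip v v + 1"
    have k: "?k > 0" using ip_nonneg[of v] v by (simp add: add_nonneg_pos)
    define q where "q = ?r / ?k"
    have q: "?r = q * ?k" using k by (simp add: q_def)
    have "0 \<le> 2 * (- q) * ?r + (- q)\<^sup>2 * ip v v" by (rule pos)
    also have "\<dots> \<le> 2 * (- q) * ?r + (- q)\<^sup>2 * ?k" by (intro add_left_mono mult_left_mono) auto
    also have "\<dots> = - (q\<^sup>2 * ?k)" unfolding q by (simp add: power2_eq_square algebra_simps)
    finally have "?r\<^sup>2 / ?k \<le> 0" using k unfolding q by (simp add: power2_eq_square)
    then have "?r\<^sup>2 \<le> 0" using k by (simp add: divide_le_0_iff)
    then show ?thesis by simp
  qed
  \<comment> \<open>\<open>V\<close> need not be closed, so \<open>w\<close> is only a limit of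
    vectors of \<open>V\<close>. The minimising sequence is part of the conclusion because density
    statements are read off from it.\<close>
  then show thesis using that[of w X] w XV lim by blast
qed

text \<open>Representing \<open>ip x\<close> on \<open>V\<close> gives a vector \<open>w\<close>
  such that \<open>w - x\<close> is orthogonal to \<open>V\<close>, hence null. As \<open>w\<close>
  is a limit of vectors of \<open>V\<close>, so is \<open>x\<close>.\<close>

lemma dense_if_orthogonal_complement_null:
  assumes V: "V \<subseteq> S" "0 \<in> V" "\<And>x y. x \<in> V \<Longrightarrow> y \<in> V \<Longrightarrow> x + y \<in> V" "\<And>c x. x \<in> V \<Longrightarrow> sc c x \<in> V"
    and orth: "\<And>u. u \<in> S \<Longrightarrow> (\<And>v. v \<in> V \<Longrightarrow> ip u v = 0) \<Longrightarrow> nm u = 0"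
    and x: "x \<in> S" and e: "e > 0"
  shows "\<exists>v\<in>V. nm (v - x) < e"
proof -
  have VS: "v \<in> V \<Longrightarrow> v \<in> S" for v using V by auto
  obtain w X where w: "w \<in> S" "\<And>n::nat. X n \<in> V" "(\<lambda>n. nm (X n - w)) \<longlonglongrightarrow> 0"
      "\<And>v. v \<in> V \<Longrightarrow> ip w v = ip x v"
    by (rule riesz_subspace[where V = V and l = "ip x" and C = "nm x"])
      (use V x in \<open>auto simp: VS ip_linear cauchy_schwarz\<close>)
  have "nm (w - x) = 0" using w x by (intro orth) (auto simp: ip_linear VS)
  obtain n where "nm (X n - w) < e"
    using order_tendstoD(2)[OF w(3) e] by (auto simp: eventually_sequentially)
  then show ?thesis
    using nm_triangle3[of "X n" w x] w VS x \<open>nm (w - x) = 0\<close> by (intro bexI[of _ "X n"]) auto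
qed

text \<open>The gliding hump argument of Sokal, which avoids the Baire category theorem.\<close>

lemma uniform_boundedness:
  fixes p :: "nat \<Rightarrow> 'a \<Rightarrow> real"
  assumes add: "\<And>n x y. x \<in> S \<Longrightarrow> y \<in> S \<Longrightarrow> p n (x + y) \<le> p n x + p n y"
    and sc: "\<And>n c x. x \<in> S \<Longrightarrow> p n (sc c x) = \<bar>c\<bar> * p n x"
    and bd: "\<And>n. \<exists>C. \<forall>x\<in>S. p n x \<le> C * nm x"
    and pt: "\<And>x. x \<in> S \<Longrightarrow> \<exists>K. \<forall>n. p n x \<le> K"
  shows "\<exists>K. \<forall>n. \<forall>x\<in>S. p n x \<le> K * nm x"
proof (rule ccontr)
  assume neg: "\<not> ?thesis"
  have nonneg: "0 \<le> p n x" if "x \<in> S" for n x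
    using add[OF that minus_mem[OF that], of n] sc[OF that, of n "-1"] sc[of 0 n 0] sc_minus_one[OF that]
      sc[of 0 n "-1"] sc_minus_one[of 0] add[of 0 0 n] by auto
  have sub: "p n (x - y) \<le> p n x + p n y" if "x \<in> S" "y \<in> S" for n x y
    using add[of x "- y" n] sc[of y n "-1"] sc_minus_one[of y] that by simp
  define N where "N n = Sup (p n ` {x \<in> S. nm x \<le> 1})" for n
  have bdd: "bdd_above (p n ` {x \<in> S. nm x \<le> 1})" for n
  proof -
    obtain C where C: "\<forall>x\<in>S. p n x \<le> C * nm x" using bd by auto
    have "p n x \<le> \<bar>C\<bar>" if "x \<in> S" "nm x \<le> 1" for x
    proof -
      have "p n x \<le> C * nm x" using C that by auto
      also have "\<dots> \<le> \<bar>C\<bar> * 1" using that by (intro mult_mono) auto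
      finally show ?thesis by simp
    qed
    then show ?thesis by (intro bdd_aboveI[of _ "\<bar>C\<bar>"]) auto
  qed
  have N1: "p n x \<le> N n" if "x \<in> S" "nm x \<le> 1" for n x
    unfolding N_def using bdd that by (intro cSup_upper) auto
  have N: "p n x \<le> N n * nm x" if "x \<in> S" for n x
  proof (cases "nm x = 0")
    case True
    obtain C where "\<forall>x\<in>S. p n x \<le> C * nm x" using bd by auto
    then show ?thesis using that True by auto
  next
    case False
    then have "nm x > 0" using that by (simp add: order_less_le)
    then show ?thesis
      using N1[of "sc (1 / nm x) x" n] that by (simp add: nm_sc sc field_simps)
  qed
  have "\<exists>n. N n > 4 ^ k" for k :: nat
  proof (rule ccontr)
    assume a: "\<not> ?thesis"
    have "p n x \<le> 4 ^ k * nm x" if "x \<in> S" for n x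
    proof -
      have "N n * nm x \<le> 4 ^ k * nm x" using a that by (intro mult_right_mono) (auto simp: not_less)
      then show ?thesis using N[OF that, of n] by linarith
    qed
    with neg show False by blast
  qed
  then obtain n where n: "\<And>k::nat. N (n k) > 4 ^ k" by metis
  have "\<exists>y\<in>S. nm y \<le> 1 \<and> p (n k) y > 3/4 * N (n k)" for k
  proof -
    have "N (n k) > 0" using n[of k] by (meson less_trans zero_less_numeral zero_less_power)
    then have "3/4 * N (n k) < Sup (p (n k) ` {x \<in> S. nm x \<le> 1})" by (simp flip: N_def)
    then show ?thesis by (subst (asm) less_cSup_iff) (auto intro: bdd exI[of _ 0])
  qed
  then obtain y where y: "\<And>k. y k \<in> S" "\<And>k. nm (y k) \<le> 1" "\<And>k. p (n k) (y k) > 3/4 * N (n k)"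
    by metis
  \<comment> \<open>The sign is chosen so that \<open>p (n k)\<close> at the new point is at least
    its value at \<open>sc ((1/3)^k) (y k)\<close>; by subadditivity one of the two signs achieves
    this. Norms above \<open>4^k\<close> against step sizes \<open>(1/3)^k\<close> produce growth
    like \<open>(4/3)^k\<close>: the vector \<open>y k\<close> carries 3/4 of the norm
    \<open>N (n k)\<close>, all later steps together move by at most \<open>1/2 * (1/3)^k\<close>,
    and 3/4 - 1/2 = 1/4 is left over.\<close>
  define st where "st k z = (if p (n k) (z + sc ((1/3)^k) (y k)) \<ge> p (n k) (z - sc ((1/3)^k) (y k))
      then z + sc ((1/3)^k) (y k) else z - sc ((1/3)^k) (y k))" for k z
  define X where "X = rec_nat 0 st"
  have X0: "X 0 = 0" and XSuc: "X (Suc k) = st k (X k)" for k by (auto simp: X_def)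
  have XS [simp]: "X k \<in> S" for k
    by (induction k) (auto simp: X0 XSuc st_def y)
  have step: "nm (X (Suc k) - X k) \<le> (1/3)^k" for k
    using y[of k] by (auto simp: XSuc st_def nm_sc nm_minus mult_left_le)
  have big: "p (n k) (X (Suc k)) \<ge> (1/3)^k * p (n k) (y k)" for k
  proof -
    let ?y = "sc ((1/3)^k) (y k)" let ?a = "p (n k) (X k + ?y)" let ?b = "p (n k) (X k - ?y)"
    have "?y + ?y = (X k + ?y) - (X k - ?y)" by simp
    then have "p (n k) (?y + ?y) \<le> ?a + ?b" using sub[of "X k + ?y" "X k - ?y" "n k"] y by simp
    moreover have "p (n k) (?y + ?y) = 2 * p (n k) ?y"
    proof -
      \<comment> \<open>The two vectors are not known to be equal; they differ by a null vector. The
        bound of \<open>p\<close> by \<open>N\<close> times the seminorm makes \<open>p\<close>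
        blind to such a difference.\<close>
      have "equiv (?y + ?y) (sc 2 ?y)" using y by (simp add: equiv_def nm_def ip_linear)
      then have "p (n k) ((?y + ?y) - sc 2 ?y) \<le> 0" "p (n k) (sc 2 ?y - (?y + ?y)) \<le> 0"
        using N[of "(?y + ?y) - sc 2 ?y" "n k"] N[of "sc 2 ?y - (?y + ?y)" "n k"]
          nm_diff_commute[of "?y + ?y" "sc 2 ?y"] y by (auto simp: equiv_def)
      then show ?thesis
        using add[of "(?y + ?y) - sc 2 ?y" "sc 2 ?y" "n k"] add[of "sc 2 ?y - (?y + ?y)" "?y + ?y" "n k"] y
          sc[of ?y "n k" 2] by simp
    qed
    ultimately have "max ?a ?b \<ge> p (n k) ?y" by linarith
    moreover have "p (n k) (X (Suc k)) = max ?a ?b" by (simp add: XSuc st_def max_def)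
    ultimately show ?thesis using y sc[of "y k" "n k" "(1/3)^k"] by simp
  qed
  have far: "nm (X (k + j) - X k) \<le> 3/2 * ((1/3)^k - (1/3)^(k+j))" for k j
  proof (induction j)
    case (Suc j)
    have "nm (X (k + Suc j) - X k) \<le> nm (X (Suc (k + j)) - X (k + j)) + nm (X (k + j) - X k)"
      using nm_triangle3[of "X (k + Suc j)" "X (k + j)" "X k"] by simp
    also have "\<dots> \<le> (1/3)^(k+j) + 3/2 * ((1/3)^k - (1/3)^(k+j))" by (intro add_mono step Suc.IH)
    also have "\<dots> = 3/2 * ((1/3)^k - (1/3)^(k+Suc j))" by (simp add: field_simps)
    finally show ?case .
  qed simp
  have far': "nm (X l - X k) \<le> 3/2 * (1/3)^k" if "l \<ge> k" for k l
  proof -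
    have "(0::real) \<le> (1/3)^l" by simp
    moreover have "nm (X l - X k) \<le> 3/2 * ((1/3)^k - (1/3)^l)" using far[of k "l - k"] that by simp
    ultimately show ?thesis by argo
  qed
  have "\<exists>x\<in>S. (\<lambda>n. nm (X n - x)) \<longlonglongrightarrow> 0"
  proof (rule nm_complete[OF XS])
    fix e :: real assume "e > 0"
    then obtain k where k: "(1/3)^k < e / 3" using real_arch_pow_inv[of "e/3" "1/3"] by auto
    have "nm (X i - X j) < e" if "i \<ge> k" "j \<ge> k" for i j
      using nm_triangle3[of "X i" "X k" "X j"] nm_diff_commute[of "X k" "X j"] far'[OF that(1)] far'[OF that(2)] k
      by simp
    then show "\<exists>N. \<forall>m\<ge>N. \<forall>n\<ge>N. nm (X m - X n) < e" by blast
  qed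
  then obtain x where x: "x \<in> S" "(\<lambda>n. nm (X n - x)) \<longlonglongrightarrow> 0" by auto
  have dist: "nm (x - X (Suc k)) \<le> 1/2 * (1/3)^k" for k
  proof (rule tendsto_lowerbound[where F = sequentially])
    show "(\<lambda>l. nm (X l - x) + 1/2 * (1/3)^k) \<longlonglongrightarrow> 1/2 * (1/3)^k"
      using tendsto_add[OF x(2) tendsto_const, of "1/2 * (1/3)^k"] by simp
    show "\<forall>\<^sub>F l in sequentially. nm (x - X (Suc k)) \<le> nm (X l - x) + 1/2 * (1/3)^k"
      unfolding eventually_sequentially
    proof (intro exI[of _ "Suc k"] allI impI)
      fix l assume "Suc k \<le> l"
      show "nm (x - X (Suc k)) \<le> nm (X l - x) + 1/2 * (1/3)^k"
        using nm_triangle3[of x "X l" "X (Suc k)"] nm_diff_commute[of x "X l"] x far'[OF \<open>Suc k \<le> l\<close>] by simp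
    qed
  qed simp
  have grow: "1/4 * (4/3)^k \<le> p (n k) x" for k
  proof -
    have "p (n k) (X (Suc k)) \<le> p (n k) (X (Suc k) - x) + p (n k) x"
      using add[of "X (Suc k) - x" x "n k"] x by simp
    also have "p (n k) (X (Suc k) - x) \<le> N (n k) * nm (X (Suc k) - x)" using x by (intro N) auto
    also have "\<dots> \<le> N (n k) * (1/2 * (1/3)^k)"
      using dist[of k] nm_diff_commute[of x "X (Suc k)"] x less_trans[OF _ n[of k], of 0]
      by (intro mult_left_mono) auto
    finally have "p (n k) x \<ge> (1/3)^k * p (n k) (y k) - N (n k) * (1/2 * (1/3)^k)" using big[of k] by linarith
    moreover have "(1/3)^k * p (n k) (y k) \<ge> (1/3)^k * (3/4 * N (n k))"
      using y(3)[of k] by (intro mult_left_mono) auto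
    moreover have "(1/3)^k * (3/4 * N (n k)) - N (n k) * (1/2 * (1/3)^k) = 1/4 * ((1/3)^k * N (n k))"
      by (simp add: algebra_simps)
    moreover have "(4/3)^k \<le> (1/3)^k * N (n k)"
      using n[of k] by (simp add: power_divide field_simps)
    ultimately show ?thesis by linarith
  qed
  obtain K where K: "\<forall>n. p n x \<le> K" using pt[OF x(1)] by auto
  obtain k where "(4/3)^k > 4 * K" using real_arch_pow[of "4/3" "4 * K"] by auto
  moreover have "p (n k) x \<le> K" using K by blast
  ultimately show False using grow[of k] by linarith
qed

end

section \<open>Semigroups generated by the operator of a closed form\<close>

text \<open>\<open>D_complete\<close> says that the form is closed. \<open>gen\<close> says that the
  generator is exactly minus the operator of \<open>b\<close>: its left-to-right half differentiates
  orbits at 0, and the other half is what puts \<open>T s u\<close> back into the domain of the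
  operator in \<open>orbit_op\<close>. The semigroup laws hold only up to \<open>equiv\<close>,
  since operators act on representatives.\<close>

locale form_semigroup = semi_hilbert S sc ip
  for S :: "'v::ab_group_add set" and sc ip +
  fixes D :: "'v set" and b :: "'v \<Rightarrow> 'v \<Rightarrow> real" and T :: "real \<Rightarrow> 'v \<Rightarrow> 'v"
  assumes D_sub: "D \<subseteq> S" and D_zero: "0 \<in> D"
    and D_add: "u \<in> D \<Longrightarrow> v \<in> D \<Longrightarrow> u + v \<in> D" and D_sc: "u \<in> D \<Longrightarrow> sc c u \<in> D"
    and b_add: "u \<in> D \<Longrightarrow> v \<in> D \<Longrightarrow> w \<in> D \<Longrightarrow> b (u + v) w = b u w + b v w"
    and b_sc: "u \<in> D \<Longrightarrow> w \<in> D \<Longrightarrow> b (sc c u) w = c * b u w"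
    and b_sym: "u \<in> D \<Longrightarrow> v \<in> D \<Longrightarrow> b u v = b v u"
    and b_nonneg: "u \<in> D \<Longrightarrow> 0 \<le> b u u"
    and D_complete: "(\<And>n::nat. X n \<in> D) \<Longrightarrow>
      (\<And>e. e > 0 \<Longrightarrow> \<exists>N. \<forall>m\<ge>N. \<forall>n\<ge>N. ip (X m - X n) (X m - X n) < e) \<Longrightarrow>
      (\<And>e. e > 0 \<Longrightarrow> \<exists>N. \<forall>m\<ge>N. \<forall>n\<ge>N. b (X m - X n) (X m - X n) < e) \<Longrightarrow>
      \<exists>x\<in>D. (\<lambda>n. ip (X n - x) (X n - x)) \<longlonglongrightarrow> 0 \<and> (\<lambda>n. b (X n - x) (X n - x)) \<longlonglongrightarrow> 0"
    and T_mem [simp]: "t \<ge> 0 \<Longrightarrow> x \<in> S \<Longrightarrow> T t x \<in> S"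
    and T_add: "t \<ge> 0 \<Longrightarrow> x \<in> S \<Longrightarrow> y \<in> S \<Longrightarrow> equiv (T t (x + y)) (T t x + T t y)"
    and T_sc: "t \<ge> 0 \<Longrightarrow> x \<in> S \<Longrightarrow> equiv (T t (sc c x)) (sc c (T t x))"
    and T_bdd: "t \<ge> 0 \<Longrightarrow> \<exists>C. \<forall>x\<in>S. nm (T t x) \<le> C * nm x"
    and T_0: "x \<in> S \<Longrightarrow> equiv (T 0 x) x"
    and T_semi: "s \<ge> 0 \<Longrightarrow> t \<ge> 0 \<Longrightarrow> x \<in> S \<Longrightarrow> equiv (T (s + t) x) (T s (T t x))"
    and T_cont: "x \<in> S \<Longrightarrow> ((\<lambda>h. nm (T h x - x)) \<longlongrightarrow> 0) (at_right 0)"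
    and gen: "u \<in> S \<Longrightarrow> f \<in> S \<Longrightarrow>
      (u \<in> D \<and> (\<forall>v\<in>D. b u v = ip f v)) \<longleftrightarrow>
      ((\<lambda>h. nm (sc (inverse h) (T h u - u) + f)) \<longlongrightarrow> 0) (at_right 0)"
begin

definition op :: "'v \<Rightarrow> 'v \<Rightarrow> bool" where
  "op u f \<longleftrightarrow> u \<in> D \<and> f \<in> S \<and> (\<forall>v\<in>D. b u v = ip f v)"

lemma D_S [simp]: "u \<in> D \<Longrightarrow> u \<in> S"
  using D_sub by auto

lemma op_mem: "op u f \<Longrightarrow> u \<in> D" "op u f \<Longrightarrow> u \<in> S" "op u f \<Longrightarrow> f \<in> S"
  by (auto simp: op_def)

lemma op_form: "op u f \<Longrightarrow> v \<in> D \<Longrightarrow> b u v = ip f v"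
  by (auto simp: op_def)

lemma op_gen: "op u f \<Longrightarrow> ((\<lambda>h. nm (sc (inverse h) (T h u - u) + f)) \<longlongrightarrow> 0) (at_right 0)"
  using gen[of u f] by (auto simp: op_def)

lemma D_minus: "u \<in> D \<Longrightarrow> - u \<in> D"
  using D_sc[of u "-1"] sc_minus_one[of u] by simp

lemma D_diff: "u \<in> D \<Longrightarrow> v \<in> D \<Longrightarrow> u - v \<in> D"
  using D_add[of u "- v"] D_minus[of v] by simp

lemma b_minus: "u \<in> D \<Longrightarrow> w \<in> D \<Longrightarrow> b (- u) w = - b u w"
  using b_sc[of u w "-1"] sc_minus_one[of u] by simp

lemma b_diff: "u \<in> D \<Longrightarrow> v \<in> D \<Longrightarrow> w \<in> D \<Longrightarrow> b (u - v) w = b u w - b v w"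
  using b_add[of u "- v" w] b_minus[of v w] D_minus[of v] by simp

lemma b_diff_right: "u \<in> D \<Longrightarrow> v \<in> D \<Longrightarrow> w \<in> D \<Longrightarrow> b w (u - v) = b w u - b w v"
  using b_diff[of u v w] D_diff[of u v] by (simp add: b_sym[of w])

lemma op_add: "op u f \<Longrightarrow> op v g \<Longrightarrow> op (u + v) (f + g)"
  by (auto simp: op_def D_add b_add ip_linear)

lemma op_sc: "op u f \<Longrightarrow> op (sc c u) (sc c f)"
  by (auto simp: op_def D_sc b_sc ip_linear)

section \<open>Local boundedness, continuity and differentiability of orbits\<close>

lemma T_diff:
  assumes "t \<ge> 0" "x \<in> S" "y \<in> S"
  shows "equiv (T t (x - y)) (T t x - T t y)"
proof -
  have "equiv (T t (x - y)) (T t x + T t (- y))" using T_add[of t x "- y"] assms by simp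
  moreover have "equiv (T t (- y)) (- T t y)"
    using T_sc[of t y "-1"] assms by (simp add: sc_minus_one)
  ultimately show ?thesis
    using equiv_add[of "T t x" "T t (- y)" "T t x" "- T t y"] assms
      equiv_trans[of "T t (x - y)" "T t x + T t (- y)" "T t x - T t y"] by simp
qed

lemma T_nm_diff:
  assumes "t \<ge> 0" "x \<in> S" "y \<in> S"
  shows "nm (T t x - T t y) = nm (T t (x - y))"
  using equiv_nm[OF _ _ T_diff[OF assms]] assms by simp

lemma T_equiv: "t \<ge> 0 \<Longrightarrow> x \<in> S \<Longrightarrow> y \<in> S \<Longrightarrow> equiv x y \<Longrightarrow> equiv (T t x) (T t y)"
proof -
  assume *: "t \<ge> 0" "x \<in> S" "y \<in> S" "equiv x y"
  obtain C where "\<forall>z\<in>S. nm (T t z) \<le> C * nm z" using T_bdd[OF *(1)] by auto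
  then have "nm (T t (x - y)) \<le> C * nm (x - y)" using diff_mem[OF *(2,3)] by blast
  then show "equiv (T t x) (T t y)" using * T_nm_diff[of t x y] by (simp add: equiv_def)
qed

lemma T_bounded_nat:
  assumes t: "\<And>n::nat. 0 \<le> t n" and pt: "\<And>x. x \<in> S \<Longrightarrow> \<exists>K. \<forall>n. nm (T (t n) x) \<le> K"
  shows "\<exists>K. \<forall>n. \<forall>x\<in>S. nm (T (t n) x) \<le> K * nm x"
proof (rule uniform_boundedness)
  fix n x y assume xy: "x \<in> S" "y \<in> S"
  show "nm (T (t n) (x + y)) \<le> nm (T (t n) x) + nm (T (t n) y)"
    using equiv_nm[OF _ _ T_add[OF t xy]] nm_triangle[of "T (t n) x" "T (t n) y"] xy t by simp
next
  fix n c x assume "x \<in> S"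
  then show "nm (T (t n) (sc c x)) = \<bar>c\<bar> * nm (T (t n) x)"
    using equiv_nm[OF _ _ T_sc[OF t]] t by (simp add: nm_sc)
next
  fix n show "\<exists>C. \<forall>x\<in>S. nm (T (t n) x) \<le> C * nm x" by (rule T_bdd[OF t])
qed (rule pt)

text \<open>The bounds of the single operators \<open>T t\<close> carry no uniformity in
  \<open>t\<close>. If uniformity failed near 0, there would be times \<open>t n\<close> tending to
  0 at which the bound \<open>n\<close> is exceeded; but \<open>T (t n) x\<close> stays bounded for
  every \<open>x\<close> by strong continuity, against the uniform boundedness principle.\<close>

lemma T_locally_bounded: "\<exists>d>0. \<exists>M. \<forall>t\<in>{0..d}. \<forall>x\<in>S. nm (T t x) \<le> M * nm x"
proof (rule ccontr)
  assume neg: "\<not> ?thesis"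
  have "\<exists>t\<in>{0..1 / real (Suc n)}. \<exists>x\<in>S. nm (T t x) > real n * nm x" for n
  proof (rule ccontr)
    assume "\<not> ?thesis"
    then have "\<forall>t\<in>{0..1 / real (Suc n)}. \<forall>x\<in>S. nm (T t x) \<le> real n * nm x" by (meson not_le)
    moreover have "0 < 1 / real (Suc n)" by simp
    ultimately show False using neg by blast
  qed
  then obtain t where t: "\<And>n. t n \<in> {0..1 / real (Suc n)}" "\<And>n. \<exists>x\<in>S. nm (T (t n) x) > real n * nm x"
    by metis
  \<comment> \<open>Strong continuity is a limit over positive times, so \<open>t n = 0\<close> has
    to be excluded: \<open>T 0\<close> preserves the seminorm and cannot exceed the bound
    \<open>n \<ge> 1\<close>. For \<open>n = 0\<close> nothing can be said, but a single index does
    not affect the limit.\<close>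
  have pos: "0 < t n" if "n > 0" for n
  proof (rule ccontr)
    assume "\<not> 0 < t n"
    then have "t n = 0" using t(1)[of n] by auto
    then obtain x where x: "x \<in> S" "nm (T 0 x) > real n * nm x" using t(2)[of n] by auto
    moreover have "real n * nm x \<ge> 1 * nm x" using that x by (intro mult_right_mono) auto
    ultimately show False using equiv_nm[OF _ _ T_0[of x]] by simp
  qed
  have t0: "t \<longlonglongrightarrow> 0"
  proof (rule tendsto_sandwich[where f = "\<lambda>_. 0" and h = "\<lambda>n. 1 / real (Suc n)"])
    show "(\<lambda>n. 1 / real (Suc n)) \<longlonglongrightarrow> 0" using lim_const_over_n[THEN LIMSEQ_Suc, of 1] by simp
  qed (use t in auto)
  then have t0': "filterlim t (at_right 0) sequentially"
    unfolding filterlim_at eventually_sequentially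
    by (rule conjI[rotated], intro exI[of _ 1] allI) (use pos in \<open>auto simp: order_less_imp_not_eq2\<close>)
  have "\<exists>K. \<forall>n. nm (T (t n) x) \<le> K" if x: "x \<in> S" for x
  proof -
    have "(\<lambda>n. nm (T (t n) x - x)) \<longlonglongrightarrow> 0"
      using filterlim_compose[OF T_cont[OF x] t0'] .
    then have "Bseq (\<lambda>n. nm (T (t n) x - x))" by (intro convergent_imp_Bseq convergentI)
    then obtain K where K: "\<forall>n. norm (nm (T (t n) x - x)) \<le> K" by (auto simp: Bseq_def)
    have "nm (T (t n) x) \<le> K + nm x" for n
      using K[rule_format, of n] nm_triangle[of "T (t n) x - x" x] x t(1)[of n] by simp
    then show ?thesis by blast
  qed
  with T_bounded_nat[of t] t obtain K where K: "\<forall>n. \<forall>x\<in>S. nm (T (t n) x) \<le> K * nm x" by auto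
  obtain n where n: "real n \<ge> K" using real_arch_simple by blast
  obtain x where x: "x \<in> S" "nm (T (t n) x) > real n * nm x" using t(2) by auto
  moreover have "K * nm x \<le> real n * nm x" using n x by (intro mult_right_mono) auto
  moreover have "nm (T (t n) x) \<le> K * nm x" using K x by blast
  ultimately show False by linarith
qed

text \<open>The semigroup law writes \<open>T t\<close> as \<open>T d\<close> after
  \<open>T (t - d)\<close>, so that a bound on \<open>{0..d}\<close> is iterated until the interval
  is covered.\<close>

lemma T_bounded_on: "\<exists>M\<ge>0. \<forall>t\<in>{0..\<tau>}. \<forall>x\<in>S. nm (T t x) \<le> M * nm x"
proof -
  obtain d M0 where d: "d > 0" and M0: "\<And>t x. 0 \<le> t \<Longrightarrow> t \<le> d \<Longrightarrow> x \<in> S \<Longrightarrow> nm (T t x) \<le> M0 * nm x"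
    using T_locally_bounded by (auto simp: Ball_def)
  define M where "M = max M0 0"
  have M: "nm (T t x) \<le> M * nm x" if "0 \<le> t" "t \<le> d" "x \<in> S" for t x
    using M0[OF that] mult_right_mono[of M0 M "nm x"] that by (simp add: M_def)
  have M_nn: "M \<ge> 0" by (simp add: M_def)
  have *: "\<exists>K\<ge>0. \<forall>t\<in>{0..real n * d}. \<forall>x\<in>S. nm (T t x) \<le> K * nm x" for n
  proof (induction n)
    case 0
    then show ?case using M d M_nn by (intro exI[of _ M]) auto
  next
    case (Suc n)
    then obtain K where K: "K \<ge> 0" "\<And>t x. 0 \<le> t \<Longrightarrow> t \<le> real n * d \<Longrightarrow> x \<in> S \<Longrightarrow> nm (T t x) \<le> K * nm x" by auto
    have "nm (T t x) \<le> (M * K + M) * nm x" if t: "0 \<le> t" "t \<le> real (Suc n) * d" and x: "x \<in> S" for t x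
    proof (cases "t \<le> d")
      case True
      then have "nm (T t x) \<le> M * nm x" using t x by (intro M)
      moreover have "0 \<le> M * K * nm x" using M_nn K(1) x by simp
      ultimately show ?thesis by (simp add: algebra_simps)
    next
      case False
      then have "nm (T t x) = nm (T d (T (t - d) x))"
        using equiv_nm[OF _ _ T_semi[of d "t - d" x]] d x by simp
      also have "\<dots> \<le> M * nm (T (t - d) x)" using False d x by (intro M) auto
      also have "\<dots> \<le> M * (K * nm x)"
        using False t x M_nn by (intro mult_left_mono K) (auto simp: algebra_simps)
      also have "\<dots> \<le> (M * K + M) * nm x" using x M_nn by (simp add: algebra_simps)
      finally show ?thesis .
    qed
    then show ?case using K M_nn by (intro exI[of _ "M * K + M"]) auto
  qed
  obtain n where "\<tau> \<le> real n * d" using d reals_Archimedean3[of d] less_imp_le by blast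
  then have "{0..\<tau>} \<subseteq> {0..real n * d}" by auto
  then show ?thesis using *[of n] by blast
qed

lemma T_shift_diff:
  assumes "0 \<le> s" "s \<le> t" "x \<in> S"
  shows "equiv (T t x - T s x) (T s (T (t - s) x - x))"
proof -
  have "equiv (T t x) (T s (T (t - s) x))" using T_semi[of s "t - s" x] assms by simp
  then have "equiv (T t x - T s x) (T s (T (t - s) x) - T s x)"
    using assms by (intro equiv_diff) auto
  moreover have "equiv (T s (T (t - s) x) - T s x) (T s (T (t - s) x - x))"
    by (rule equiv_sym[OF _ _ T_diff]) (use assms in auto)
  ultimately show ?thesis by (rule equiv_trans[rotated 3]) (use assms in auto)
qed

text \<open>For \<open>s \<le> t\<close> the difference of the orbit is \<open>T s\<close> applied
  to \<open>T (t - s) x - x\<close>, and the operators \<open>T s\<close> are uniformly bounded on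
  the interval. Continuity from both sides thus reduces to continuity from the right at 0, with the
  gap \<open>\<bar>s - t0\<bar>\<close> as the time.\<close>

lemma orbit_continuous:
  assumes t0: "t0 \<in> {0..\<tau>}" and x: "x \<in> S"
  shows "((\<lambda>s. nm (T s x - T t0 x)) \<longlongrightarrow> 0) (at t0 within {0..\<tau>})"
proof -
  obtain M where M: "M \<ge> 0" "\<And>t x. 0 \<le> t \<Longrightarrow> t \<le> \<tau> \<Longrightarrow> x \<in> S \<Longrightarrow> nm (T t x) \<le> M * nm x"
    using T_bounded_on[of \<tau>] by auto
  have gap: "filterlim (\<lambda>s. \<bar>s - t0\<bar>) (at_right 0) (at t0 within {0..\<tau>})"
    unfolding filterlim_at
    by (auto intro!: tendsto_eq_intros simp: eventually_at_filter)
  have "((\<lambda>s. M * nm (T \<bar>s - t0\<bar> x - x)) \<longlongrightarrow> M * 0) (at t0 within {0..\<tau>})"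
    by (intro tendsto_mult tendsto_const filterlim_compose[OF T_cont[OF x] gap])
  then have lim: "((\<lambda>s. M * nm (T \<bar>s - t0\<bar> x - x)) \<longlongrightarrow> 0) (at t0 within {0..\<tau>})" by simp
  have bd: "nm (T t x - T s x) \<le> M * nm (T (t - s) x - x)" if "0 \<le> s" "s \<le> t" "t \<le> \<tau>" for s t
    using equiv_nm[OF _ _ T_shift_diff[of s t x]] M(2)[of s "T (t - s) x - x"] that x by simp
  show ?thesis
  proof (rule Lim_null_comparison[OF _ lim])
    have "norm (nm (T s x - T t0 x)) \<le> M * nm (T \<bar>s - t0\<bar> x - x)" if "s \<in> {0..\<tau>}" for s
      using bd[of s t0] bd[of t0 s] nm_diff_commute[of "T s x" "T t0 x"] that t0 x by (cases "s \<le> t0") auto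
    then show "\<forall>\<^sub>F s in at t0 within {0..\<tau>}. norm (nm (T s x - T t0 x)) \<le> M * nm (T \<bar>s - t0\<bar> x - x)"
      by (auto simp: eventually_at_filter)
  qed
qed

lemma equiv_quotient:
  assumes "0 \<le> s" "s \<le> t" and x: "x \<in> S" and f: "f \<in> S"
  shows "equiv (sc c (T t x - T s x) + T s f) (T s (sc c (T (t - s) x - x) + f))"
proof -
  have "equiv (sc c (T t x - T s x)) (sc c (T s (T (t - s) x - x)))"
    using assms by (intro equiv_sc T_shift_diff) auto
  moreover have "equiv (sc c (T s (T (t - s) x - x))) (T s (sc c (T (t - s) x - x)))"
    by (rule equiv_sym[OF _ _ T_sc]) (use assms in auto)
  ultimately have "equiv (sc c (T t x - T s x)) (T s (sc c (T (t - s) x - x)))"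
    by (rule equiv_trans[rotated 3]) (use assms in auto)
  then have "equiv (sc c (T t x - T s x) + T s f) (T s (sc c (T (t - s) x - x)) + T s f)"
    using assms by (intro equiv_add) auto
  moreover have "equiv (T s (sc c (T (t - s) x - x)) + T s f) (T s (sc c (T (t - s) x - x) + f))"
    by (rule equiv_sym[OF _ _ T_add]) (use assms in auto)
  ultimately show ?thesis by (rule equiv_trans[rotated 3]) (use assms in auto)
qed

text \<open>\<open>T s\<close> commutes with the difference quotient at 0 and is bounded, so the
  quotient of \<open>T s x\<close> tends to \<open>- T s f\<close>. The generator hypothesis, read
  backwards, turns this limit into membership in the operator.\<close>

lemma orbit_op:
  assumes op: "op x f" and s: "s \<ge> 0"
  shows "op (T s x) (T s f)"
proof -
  note [simp] = op_mem[OF op]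
  obtain M where M: "\<forall>x\<in>S. nm (T s x) \<le> M * nm x" using T_bdd[OF s] by auto
  have "((\<lambda>h. M * nm (sc (inverse h) (T h x - x) + f)) \<longlongrightarrow> M * 0) (at_right 0)"
    by (intro tendsto_intros op_gen[OF op])
  then have lim: "((\<lambda>h. M * nm (sc (inverse h) (T h x - x) + f)) \<longlongrightarrow> 0) (at_right 0)" by simp
  have "((\<lambda>h. nm (sc (inverse h) (T h (T s x) - T s x) + T s f)) \<longlongrightarrow> 0) (at_right 0)"
  proof (rule Lim_null_comparison[OF _ lim])
    have "norm (nm (sc (inverse h) (T h (T s x) - T s x) + T s f)) \<le> M * nm (sc (inverse h) (T h x - x) + f)"
      if h: "h > 0" for h
    proof -
      have "equiv (T h (T s x)) (T (s + h) x)"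
        by (subst add.commute, rule equiv_sym[OF _ _ T_semi]) (use s h in auto)
      then have "equiv (sc (inverse h) (T h (T s x) - T s x) + T s f) (sc (inverse h) (T (s + h) x - T s x) + T s f)"
        using s h by (intro equiv_add equiv_sc equiv_diff) auto
      then have "nm (sc (inverse h) (T h (T s x) - T s x) + T s f) = nm (sc (inverse h) (T (s + h) x - T s x) + T s f)"
        using s h by (intro equiv_nm) auto
      also have "\<dots> = nm (T s (sc (inverse h) (T h x - x) + f))"
        using equiv_nm[OF _ _ equiv_quotient[of s "s + h" x f "inverse h"]] s h by simp
      also have "\<dots> \<le> M * nm (sc (inverse h) (T h x - x) + f)" using M h by simp
      finally show ?thesis using s h by simp
    qed
    then show "\<forall>\<^sub>F h in at_right 0. norm (nm (sc (inverse h) (T h (T s x) - T s x) + T s f))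
        \<le> M * nm (sc (inverse h) (T h x - x) + f)"
      by (auto simp: eventually_at_filter)
  qed
  then show ?thesis using gen[of "T s x" "T s f"] s by (simp add: op_def)
qed

text \<open>A quotient between two times is \<open>T\<close> at the earlier time applied to the
  quotient at 0. From the left the earlier time is the moving one, so the limit first appears as
  \<open>- T s f\<close>; continuity of the orbit of \<open>f\<close> replaces it by
  \<open>- T t0 f\<close>.\<close>

lemma orbit_derivative:
  assumes op: "op x f" and t0: "t0 \<in> {0..\<tau>}"
  shows "((\<lambda>s. nm (sc (inverse (s - t0)) (T s x - T t0 x) - (- T t0 f))) \<longlongrightarrow> 0) (at t0 within {0..\<tau>})"
proof -
  note [simp] = op_mem[OF op]
  obtain M where M: "M \<ge> 0" "\<And>t x. 0 \<le> t \<Longrightarrow> t \<le> \<tau> \<Longrightarrow> x \<in> S \<Longrightarrow> nm (T t x) \<le> M * nm x"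
    using T_bounded_on[of \<tau>] by auto
  define r where "r h = nm (sc (inverse h) (T h x - x) + f)" for h
  have gap: "filterlim (\<lambda>s. \<bar>s - t0\<bar>) (at_right 0) (at t0 within {0..\<tau>})"
    unfolding filterlim_at
    by (auto intro!: tendsto_eq_intros simp: eventually_at_filter)
  have "((\<lambda>s. M * r \<bar>s - t0\<bar> + nm (T s f - T t0 f)) \<longlongrightarrow> M * 0 + 0) (at t0 within {0..\<tau>})"
    unfolding r_def
    by (intro tendsto_add tendsto_mult tendsto_const filterlim_compose[OF op_gen[OF op] gap]
        orbit_continuous[OF t0]) simp
  then have lim: "((\<lambda>s. M * r \<bar>s - t0\<bar> + nm (T s f - T t0 f)) \<longlongrightarrow> 0) (at t0 within {0..\<tau>})" by simp
  have quot: "nm (sc (inverse (t - s)) (T t x - T s x) + T s f) \<le> M * r (t - s)"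
    if "0 \<le> s" "s < t" "t \<le> \<tau>" for s t
    using equiv_nm[OF _ _ equiv_quotient[of s t x f "inverse (t - s)"]]
      M(2)[of s "sc (inverse (t - s)) (T (t - s) x - x) + f"] that by (simp add: r_def)
  have bd: "nm (sc (inverse (s - t0)) (T s x - T t0 x) + T t0 f) \<le> M * r \<bar>s - t0\<bar> + nm (T s f - T t0 f)"
    if s: "s \<in> {0..\<tau>}" "s \<noteq> t0" for s
  proof (cases "s > t0")
    case True
    then show ?thesis using quot[of t0 s] s t0 by (auto intro: add_increasing2)
  next
    case False
    then have st: "s < t0" using s by auto
    have "equiv (sc (inverse (s - t0)) (T s x - T t0 x)) (sc (inverse (t0 - s)) (T t0 x - T s x))"
    proof -
      have "inverse (s - t0) = - inverse (t0 - s)" using st by (simp add: field_simps)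
      then show ?thesis using s t0 ip_sym[of "T s x" "T t0 x"]
        by (simp add: equiv_def nm_def ip_linear algebra_simps)
    qed
    then have "nm (sc (inverse (s - t0)) (T s x - T t0 x) + T t0 f) = nm (sc (inverse (t0 - s)) (T t0 x - T s x) + T t0 f)"
      using s t0 by (intro equiv_nm equiv_add) auto
    also have "\<dots> \<le> nm (sc (inverse (t0 - s)) (T t0 x - T s x) + T s f) + nm (T t0 f - T s f)"
      using nm_triangle[of "sc (inverse (t0 - s)) (T t0 x - T s x) + T s f" "T t0 f - T s f"] s t0 by simp
    also have "\<dots> \<le> M * r \<bar>s - t0\<bar> + nm (T s f - T t0 f)"
      using quot[of s t0] st s t0 nm_diff_commute[of "T s f" "T t0 f"] by simp
    finally show ?thesis .
  qed
  show ?thesis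
    by (rule Lim_null_comparison[OF _ lim]) (use bd t0 in \<open>auto simp: eventually_at_filter\<close>)
qed

text \<open>The vector is \<open>l\<close> times the resolvent (l + A)^-1 applied to
  \<open>x\<close>, where A is the operator of \<open>b\<close>. It is the Riesz representative of
  \<open>l * ip x\<close> for the form \<open>b + l * ip\<close>, under which \<open>D\<close> is
  complete. The bound \<open>l \<ge> 1\<close> makes both \<open>b\<close> and \<open>ip\<close>
  smaller than this form without further constants.\<close>

lemma resolvent:
  assumes l: "l \<ge> 1" and x: "x \<in> S"
  obtains w where "op w (sc l (x - w))"
proof -
  let ?q = "\<lambda>u v. b u v + l * ip u v"
  interpret q: semi_inner_product D sc ?q
  proof unfold_locales
    fix x y assume "x \<in> D" "y \<in> D"
    then show "?q x y = ?q y x" using b_sym[of x y] ip_sym[of x y] by simp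
  qed (use l in \<open>auto simp: D_zero D_add D_sc sc_minus_one b_add b_sc b_nonneg ip_linear algebra_simps\<close>)
  interpret q: semi_hilbert D sc ?q
  proof unfold_locales
    fix X :: "nat \<Rightarrow> 'v" assume X: "\<And>n. X n \<in> D"
      and C: "\<And>e. e > 0 \<Longrightarrow> \<exists>N. \<forall>m\<ge>N. \<forall>n\<ge>N. ?q (X m - X n) (X m - X n) < e"
    have le: "ip (X m - X n) (X m - X n) \<le> ?q (X m - X n) (X m - X n)"
        "b (X m - X n) (X m - X n) \<le> ?q (X m - X n) (X m - X n)" for m n
      using X D_diff[of "X m" "X n"] b_nonneg[of "X m - X n"] l ip_nonneg[of "X m - X n"]
        mult_right_mono[of 1 l "ip (X m - X n) (X m - X n)"] by (auto simp: add_increasing)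
    have "\<exists>x\<in>D. (\<lambda>n. ip (X n - x) (X n - x)) \<longlonglongrightarrow> 0 \<and> (\<lambda>n. b (X n - x) (X n - x)) \<longlonglongrightarrow> 0"
    proof (rule D_complete[OF X])
      fix e :: real assume "e > 0"
      from C[OF this] show "\<exists>N. \<forall>m\<ge>N. \<forall>n\<ge>N. ip (X m - X n) (X m - X n) < e"
        using le(1) by (meson le_less_trans)
    next
      fix e :: real assume "e > 0"
      from C[OF this] show "\<exists>N. \<forall>m\<ge>N. \<forall>n\<ge>N. b (X m - X n) (X m - X n) < e"
        using le(2) by (meson le_less_trans)
    qed
    then obtain x where x: "x \<in> D" "(\<lambda>n. ip (X n - x) (X n - x)) \<longlonglongrightarrow> 0" "(\<lambda>n. b (X n - x) (X n - x)) \<longlonglongrightarrow> 0"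
      by auto
    have "(\<lambda>n. ?q (X n - x) (X n - x)) \<longlonglongrightarrow> 0 + l * 0"
      by (intro tendsto_intros x)
    then show "\<exists>x\<in>D. (\<lambda>n. ?q (X n - x) (X n - x)) \<longlonglongrightarrow> 0" using x(1) by auto
  qed
  have bd: "\<bar>l * ip x v\<bar> \<le> (l * nm x) * q.nm v" if v: "v \<in> D" for v
  proof -
    have "ip v v \<le> ?q v v" using b_nonneg[OF v] l mult_right_mono[of 1 l "ip v v"] v by (simp add: add_increasing)
    then have "nm v \<le> q.nm v" by (simp add: nm_def q.nm_def)
    then have "nm x * nm v \<le> nm x * q.nm v" using x by (intro mult_left_mono) auto
    then have "\<bar>ip x v\<bar> \<le> nm x * q.nm v" using cauchy_schwarz[of x v] x v by simp
    then show ?thesis using l by (simp add: abs_mult mult.assoc)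
  qed
  obtain w X where "w \<in> D" "\<And>v. v \<in> D \<Longrightarrow> ?q w v = l * ip x v"
    by (rule q.riesz_subspace[where V = D and l = "\<lambda>v. l * ip x v", OF _ _ _ _ _ _ bd])
      (use x D_zero in \<open>auto simp: D_add D_sc ip_linear algebra_simps\<close>)
  then have "op w (sc l (x - w))" using x by (auto simp: op_def ip_linear algebra_simps)
  then show thesis by (rule that)
qed

text \<open>A vector \<open>u\<close> orthogonal to the domain is tested with its own resolvent
  \<open>w\<close>: from \<open>b w w = - ip w w\<close> both sides vanish, so \<open>w\<close> is
  null. It remains to pass from \<open>w\<close> to \<open>u\<close>, and then density follows from
  the orthogonality criterion.\<close>

lemma op_dense_seq:
  assumes x: "x \<in> S"
  obtains U F where "\<And>n::nat. op (U n) (F n)" "(\<lambda>n. nm (U n - x)) \<longlonglongrightarrow> 0"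
proof -
  let ?V = "{u. \<exists>f. op u f}"
  have "\<exists>v\<in>?V. nm (v - x) < e" if "e > 0" for e
  proof (rule dense_if_orthogonal_complement_null[OF _ _ _ _ _ x that])
    show "?V \<subseteq> S" by (auto simp: op_mem)
    have "b 0 v = 0" if "v \<in> D" for v using b_add[of 0 0 v] D_zero that by simp
    then show "0 \<in> ?V" using D_zero by (auto simp: op_def intro!: exI[of _ 0])
  next
    fix u assume u: "u \<in> S" and orth: "\<And>v. v \<in> ?V \<Longrightarrow> ip u v = 0"
    obtain w where w: "op w (sc 1 (u - w))" using resolvent[of 1 u] u by auto
    note [simp] = op_mem[OF w]
    let ?f = "sc 1 (u - w)"
    have "b w w = - ip w w" using op_form[OF w, of w] orth[of w] w u by (auto simp: ip_linear)
    then have "ip w w = 0" using b_nonneg[OF op_mem(1)[OF w]] ip_nonneg[OF op_mem(2)[OF w]] by linarith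
    then have w0: "nm w = 0" by (simp add: nm_def)
    \<comment> \<open>A null \<open>w\<close> makes its image \<open>?f\<close> orthogonal to
      \<open>D\<close> only, and density is what is being proved. The generator gives more:
      \<open>T h w\<close> is null too, so the quotient plus \<open>?f\<close> has the constant
      seminorm \<open>nm ?f\<close>, which must equal its limit 0.\<close>
    have "nm (sc (inverse h) (T h w - w) + ?f) = nm ?f" if "h > 0" for h
    proof -
      obtain C where "\<forall>x\<in>S. nm (T h x) \<le> C * nm x" using T_bdd[OF less_imp_le[OF \<open>0 < h\<close>]] by blast
      then have "nm (T h w) \<le> C * nm w" by (rule bspec) simp
      then have "nm (T h w) = 0" using w0 that by simp
      then have "nm (T h w - w) = 0" using nm_triangle_diff[of "T h w" w] w0 that by simp
      then have "equiv (sc (inverse h) (T h w - w) + ?f) ?f" using that u by (simp add: equiv_def nm_sc)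
      then show ?thesis using that u by (intro equiv_nm) auto
    qed
    then have "((\<lambda>h::real. nm ?f) \<longlongrightarrow> 0) (at_right 0)"
      by (intro Lim_transform_eventually[OF op_gen[OF w]]) (auto simp: eventually_at_filter)
    then have "nm ?f = 0" by (simp add: tendsto_const_iff)
    then have "nm (u - w) = 0" using u by (simp add: nm_sc)
    then show "nm u = 0" using nm_reverse_triangle[of u w] w0 u by simp
  qed (auto dest: op_add op_sc)
  then have "\<forall>n::nat. \<exists>v f. op v f \<and> nm (v - x) < 1 / real (Suc n)" by fastforce
  then obtain U F where U: "\<And>n::nat. op (U n) (F n)" "\<And>n. nm (U n - x) < 1 / real (Suc n)" by metis
  have "(\<lambda>n. nm (U n - x)) \<longlonglongrightarrow> 0"
  proof (rule tendsto_sandwich[where f = "\<lambda>_. 0" and h = "\<lambda>n. 1 / real (Suc n)"])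
    show "(\<lambda>n. 1 / real (Suc n)) \<longlonglongrightarrow> 0" using lim_const_over_n[THEN LIMSEQ_Suc, of 1] by simp
  qed (use U(2) x op_mem(2)[OF U(1)] in \<open>auto simp: less_imp_le\<close>)
  with U that show thesis by blast
qed

lemma T_tendsto:
  assumes "t \<ge> 0" "\<And>n. U n \<in> S" "x \<in> S" "((\<lambda>n. nm (U n - x)) \<longlongrightarrow> 0) F"
  shows "((\<lambda>n. nm (T t (U n) - T t x)) \<longlongrightarrow> 0) F"
proof -
  obtain C where C: "\<forall>x\<in>S. nm (T t x) \<le> C * nm x" using T_bdd[OF assms(1)] by auto
  have lim: "((\<lambda>n. C * nm (U n - x)) \<longlongrightarrow> 0) F" using tendsto_mult_left[OF assms(4), of C] by simp
  show ?thesis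
    by (rule Lim_null_comparison[OF _ lim]) (use C assms in \<open>auto simp: T_nm_diff intro!: always_eventually\<close>)
qed

text \<open>The function \<open>s \<mapsto> ip (T s u) (J (T (t - s) v))\<close> is constant.\<close>

lemma intertwining_op:
  assumes J_mem [simp]: "\<And>x. x \<in> S \<Longrightarrow> J x \<in> S"
    and J_diff: "\<And>x y. x \<in> S \<Longrightarrow> y \<in> S \<Longrightarrow> J (x - y) = J x - J y"
    and J_sc: "\<And>c x. x \<in> S \<Longrightarrow> J (sc c x) = sc c (J x)"
    and J_ip: "\<And>x y. x \<in> S \<Longrightarrow> y \<in> S \<Longrightarrow> ip (J x) (J y) = ip x y"
    and J_op: "\<And>u f. op u f \<Longrightarrow> op (J u) (J f)"
    and u: "op u f" and v: "op v g" and t: "t \<ge> 0"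
  shows "ip (T t u) (J v) = ip u (J (T t v))"
proof -
  note [simp] = op_mem[OF u] op_mem[OF v]
  have J_nm: "nm (J x) = nm x" if "x \<in> S" for x using J_ip[OF that that] by (simp add: nm_def)
  define h where "h s = ip (T s u) (J (T (t - s) v))" for s
  have "(h has_real_derivative 0) (at s within {0..t})" if s: "s \<in> {0..t}" for s
  proof -
    have r: "filterlim (\<lambda>r. t - r) (at (t - s) within {0..t}) (at s within {0..t})"
      unfolding filterlim_at by (auto intro!: tendsto_eq_intros simp: eventually_at_filter)
    have "(h has_real_derivative (ip (- T s f) (J (T (t - s) v)) + ip (T s u) (J (T (t - s) g)))) (at s within {0..t})"
      unfolding h_def
    proof (rule has_derivative_ip)
      show "((\<lambda>r. nm (sc (inverse (r - s)) (T r u - T s u) - (- T s f))) \<longlongrightarrow> 0) (at s within {0..t})"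
        by (rule orbit_derivative[OF u s])
      have "((\<lambda>r. nm (sc (inverse ((t - r) - (t - s))) (T (t - r) v - T (t - s) v) - (- T (t - s) g))) \<longlongrightarrow> 0)
          (at s within {0..t})"
        using filterlim_compose[OF orbit_derivative[OF v, of "t - s" t] r] s by auto
      then show "((\<lambda>r. nm (sc (inverse (r - s)) (J (T (t - r) v) - J (T (t - s) v)) - J (T (t - s) g))) \<longlongrightarrow> 0)
          (at s within {0..t})"
      proof (rule Lim_transform_eventually)
        have "nm (sc (inverse ((t - r) - (t - s))) (T (t - r) v - T (t - s) v) - (- T (t - s) g)) =
            nm (sc (inverse (r - s)) (J (T (t - r) v) - J (T (t - s) v)) - J (T (t - s) g))"
          if rr: "r \<in> {0..t}" for r
        proof -
          let ?y = "T (t - r) v - T (t - s) v" and ?z = "T (t - s) g"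
          have y: "?y \<in> S" "?z \<in> S" using rr s by auto
          have "sc (inverse (r - s)) (J (T (t - r) v) - J (T (t - s) v)) - J (T (t - s) g) =
              J (sc (inverse (r - s)) ?y - ?z)"
            using y rr s by (simp add: J_diff J_sc)
          moreover have "nm (J (sc (inverse (r - s)) ?y - ?z)) = nm (?z - sc (inverse (r - s)) ?y)"
            using y nm_diff_commute[of ?z "sc (inverse (r - s)) ?y"] by (simp add: J_nm)
          moreover have "inverse ((t - r) - (t - s)) = - inverse (r - s)"
            by (simp flip: inverse_minus_eq)
          moreover have "equiv (sc (- inverse (r - s)) ?y - (- ?z)) (?z - sc (inverse (r - s)) ?y)"
            using y ip_sym[of ?y ?z] by (simp add: equiv_def nm_def ip_linear algebra_simps)
          ultimately show ?thesis
            using y equiv_nm[of "sc (- inverse (r - s)) ?y - (- ?z)" "?z - sc (inverse (r - s)) ?y"] by simp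
        qed
        then show "\<forall>\<^sub>F r in at s within {0..t}. nm (sc (inverse ((t - r) - (t - s))) (T (t - r) v - T (t - s) v) - (- T (t - s) g)) =
            nm (sc (inverse (r - s)) (J (T (t - r) v) - J (T (t - s) v)) - J (T (t - s) g))"
          by (auto simp: eventually_at_filter)
      qed
      have "((\<lambda>r. nm (T (t - r) v - T (t - s) v)) \<longlongrightarrow> 0) (at s within {0..t})"
        by (rule filterlim_compose[OF orbit_continuous[of "t - s" t v] r]) (use s in auto)
      then show "((\<lambda>r. nm (J (T (t - r) v) - J (T (t - s) v))) \<longlongrightarrow> 0) (at s within {0..t})"
      proof (rule Lim_transform_eventually)
        have "nm (T (t - r) v - T (t - s) v) = nm (J (T (t - r) v) - J (T (t - s) v))" if "r \<in> {0..t}" for r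
          using that s J_nm[of "T (t - r) v - T (t - s) v"] by (simp add: J_diff)
        then show "\<forall>\<^sub>F r in at s within {0..t}. nm (T (t - r) v - T (t - s) v) = nm (J (T (t - r) v) - J (T (t - s) v))"
          by (auto simp: eventually_at_filter)
      qed
    qed (use s in auto)
    \<comment> \<open>Both terms are, up to sign, the form at the pair \<open>T s u\<close>,
      \<open>J (T (t - s) v)\<close>, once read as an operator value in the first argument and once
      in the second. Symmetry of \<open>b\<close> makes them cancel.\<close>
    moreover have "ip (- T s f) (J (T (t - s) v)) + ip (T s u) (J (T (t - s) g)) = 0"
    proof -
      have p: "op (T s u) (T s f)" "op (J (T (t - s) v)) (J (T (t - s) g))"
        using s by (auto intro!: J_op orbit_op u v)
      then show ?thesis
        using op_form[OF p(1), of "J (T (t - s) v)"] op_form[OF p(2), of "T s u"]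
          b_sym[of "T s u" "J (T (t - s) v)"] ip_sym[of "T s u" "J (T (t - s) g)"] s
        by (auto simp: op_mem ip_linear)
    qed
    ultimately show ?thesis by simp
  qed
  then obtain c where "\<forall>s\<in>{0..t}. h s = c"
    using has_field_derivative_zero_constant[of "{0..t}" h] by auto
  then have "h t = h 0" using t by auto
  moreover have "h t = ip (T t u) (J v)"
  proof -
    have "equiv (J (T 0 v)) (J v)" using T_0[of v] J_nm[of "T 0 v - v"] by (simp add: equiv_def J_diff)
    then show ?thesis using equiv_ip[of "J (T 0 v)" "J v" "T t u"] t by (simp add: h_def ip_sym[of "T t u"])
  qed
  moreover have "h 0 = ip u (J (T t v))"
    using equiv_ip[OF _ _ _ T_0[of u], of "J (T t v)"] t by (simp add: h_def)
  ultimately show ?thesis by simp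
qed

text \<open>The intertwining identity with the identity map as \<open>J\<close> gives symmetry on
  the domain of the operator; density and continuity extend it to \<open>S\<close>.\<close>

lemma T_symmetric:
  assumes t: "t \<ge> 0" and [simp]: "x \<in> S" "y \<in> S"
  shows "ip (T t x) y = ip x (T t y)"
proof -
  obtain U F where U: "\<And>n. op (U n) (F n)" "(\<lambda>n. nm (U n - x)) \<longlonglongrightarrow> 0" using op_dense_seq[of x] by auto
  obtain V G where V: "\<And>n. op (V n) (G n)" "(\<lambda>n. nm (V n - y)) \<longlonglongrightarrow> 0" using op_dense_seq[of y] by auto
  note [simp] = op_mem(2)[OF U(1)] op_mem(2)[OF V(1)]
  have "ip (T t (U n)) (V n) = ip (U n) (T t (V n))" for n
    using intertwining_op[where J = "\<lambda>x. x", OF _ _ _ _ _ U(1) V(1) t] by auto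
  moreover have "(\<lambda>n. ip (T t (U n)) (V n)) \<longlonglongrightarrow> ip (T t x) y"
    using t U V by (intro tendsto_ip T_tendsto) (auto simp: op_mem)
  moreover have "(\<lambda>n. ip (U n) (T t (V n))) \<longlonglongrightarrow> ip x (T t y)"
    using t U V by (intro tendsto_ip T_tendsto) (auto simp: op_mem)
  ultimately show ?thesis by (simp add: LIMSEQ_unique)
qed

text \<open>After extension by density, the intertwining identity and symmetry of \<open>T t\<close>
  give equal inner products of \<open>T t (J y)\<close> and \<open>J (T t y)\<close> with every
  vector. Testing with their difference finishes the proof.\<close>

lemma T_intertwining:
  assumes J_mem [simp]: "\<And>x. x \<in> S \<Longrightarrow> J x \<in> S"
    and J_diff: "\<And>x y. x \<in> S \<Longrightarrow> y \<in> S \<Longrightarrow> J (x - y) = J x - J y"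
    and J_sc: "\<And>c x. x \<in> S \<Longrightarrow> J (sc c x) = sc c (J x)"
    and J_ip: "\<And>x y. x \<in> S \<Longrightarrow> y \<in> S \<Longrightarrow> ip (J x) (J y) = ip x y"
    and J_op: "\<And>u f. op u f \<Longrightarrow> op (J u) (J f)"
    and t: "t \<ge> 0" and [simp]: "y \<in> S"
  shows "equiv (T t (J y)) (J (T t y))"
proof -
  have J_nm: "nm (J x) = nm x" if "x \<in> S" for x using J_ip[OF that that] by (simp add: nm_def)
  have *: "ip x (T t (J y)) = ip x (J (T t y))" if [simp]: "x \<in> S" for x
  proof -
    obtain U F where U: "\<And>n. op (U n) (F n)" "(\<lambda>n. nm (U n - x)) \<longlonglongrightarrow> 0" using op_dense_seq[of x] by auto
    obtain V G where V: "\<And>n. op (V n) (G n)" "(\<lambda>n. nm (V n - y)) \<longlonglongrightarrow> 0" using op_dense_seq[of y] by auto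
    note [simp] = op_mem(2)[OF U(1)] op_mem(2)[OF V(1)]
    have J_lim: "(\<lambda>n. nm (J (X n) - J z)) \<longlonglongrightarrow> 0" if "(\<lambda>n. nm (X n - z)) \<longlonglongrightarrow> 0" "\<And>n. X n \<in> S" "z \<in> S" for X z
      using that J_nm[of "X _ - z"] by (simp add: J_diff flip: J_diff)
    have "ip (T t (U n)) (J (V n)) = ip (U n) (J (T t (V n)))" for n
      by (rule intertwining_op[where J = J, OF J_mem J_diff J_sc J_ip J_op U(1) V(1) t])
    moreover have "(\<lambda>n. ip (T t (U n)) (J (V n))) \<longlonglongrightarrow> ip (T t x) (J y)"
      using t U V by (intro tendsto_ip T_tendsto J_lim) (auto simp: op_mem)
    moreover have "(\<lambda>n. ip (U n) (J (T t (V n)))) \<longlonglongrightarrow> ip x (J (T t y))"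
      using t U V by (intro tendsto_ip T_tendsto J_lim) (auto simp: op_mem)
    ultimately have "ip (T t x) (J y) = ip x (J (T t y))" by (simp add: LIMSEQ_unique)
    then show ?thesis using T_symmetric[OF t, of x "J y"] by simp
  qed
  have "ip (T t (J y) - J (T t y)) (T t (J y) - J (T t y)) = 0"
    using *[of "T t (J y) - J (T t y)"] t
      ip_diff_right[of "T t (J y) - J (T t y)" "T t (J y)" "J (T t y)"] by simp
  then show ?thesis by (simp add: equiv_def nm_def)
qed

text \<open>On the domain of the operator the squared norm of the orbit has derivative
  \<open>- 2 * b (T s u) (T s u)\<close>, which is nonpositive because the form is. Density extends
  the estimate.\<close>

lemma T_contraction:
  assumes t: "t \<ge> 0" and [simp]: "x \<in> S"
  shows "nm (T t x) \<le> nm x"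
proof -
  have op: "nm (T t u) \<le> nm u" if u: "op u f" for u f
  proof (cases "t = 0")
    case True
    then show ?thesis using equiv_nm[OF _ _ T_0[of u]] op_mem[OF u] by simp
  next
    case False
    note [simp] = op_mem[OF u]
    have "((\<lambda>s. ip (T s u) (T s u)) has_real_derivative (ip (- T s f) (T s u) + ip (T s u) (- T s f))) (at s within {0..t})"
      if s: "s \<in> {0..t}" for s
      by (rule has_derivative_ip[OF _ _ _ _ _ orbit_derivative[OF u s] orbit_derivative[OF u s] orbit_continuous[OF s]])
        (use s in auto)
    then have "\<exists>s\<in>{0<..<t}. ip (T t u) (T t u) - ip (T 0 u) (T 0 u) = (ip (- T s f) (T s u) + ip (T s u) (- T s f)) * (t - 0)"
      using False t by (intro mvt_simple) (auto simp: has_field_derivative_def)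
    then obtain s where s: "s \<in> {0<..<t}"
        "ip (T t u) (T t u) - ip (T 0 u) (T 0 u) = (ip (- T s f) (T s u) + ip (T s u) (- T s f)) * t" by auto
    have "op (T s u) (T s f)" using s by (intro orbit_op u) auto
    then have "ip (T s f) (T s u) \<ge> 0" using op_form[of "T s u" "T s f" "T s u"] b_nonneg[of "T s u"] by (auto simp: op_mem)
    then have "(ip (- T s f) (T s u) + ip (T s u) (- T s f)) * t \<le> 0"
      using s t ip_sym[of "T s f" "T s u"] by (intro mult_nonpos_nonneg) (auto simp: ip_linear)
    with s have "ip (T t u) (T t u) \<le> ip (T 0 u) (T 0 u)" by linarith
    then have "nm (T t u) \<le> nm (T 0 u)" by (simp add: nm_def)
    then show ?thesis using equiv_nm[OF _ _ T_0[of u]] by simp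
  qed
  obtain U F where U: "\<And>n. op (U n) (F n)" "(\<lambda>n. nm (U n - x)) \<longlonglongrightarrow> 0" using op_dense_seq[of x] by auto
  note [simp] = op_mem(2)[OF U(1)]
  have nm_lim: "(\<lambda>n. nm (X n)) \<longlonglongrightarrow> nm z" if "(\<lambda>n. nm (X n - z)) \<longlonglongrightarrow> 0" "\<And>n. X n \<in> S" "z \<in> S" for X z
    unfolding nm_def using that by (intro tendsto_real_sqrt tendsto_ip)
  show ?thesis
    by (rule LIMSEQ_le[OF nm_lim[OF T_tendsto[OF t _ _ U(2)]] nm_lim[OF U(2)]])
      (use t U in \<open>auto simp: op_mem intro: op\<close>)
qed

text \<open>The approximating form of the semigroup, multiplied by \<open>t\<close>. Unlike
  \<open>b\<close> it is defined on all of \<open>S\<close>, which is what allows it to be evaluated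
  at a vector not yet known to lie in \<open>D\<close>.\<close>

definition app :: "real \<Rightarrow> 'v \<Rightarrow> 'v \<Rightarrow> real" where
  "app t x y = ip (x - T t x) y"

text \<open>Symmetry of \<open>T t\<close> makes this form symmetric, and contractivity together
  with the Cauchy-Schwarz inequality makes it nonnegative. It thereby has a Cauchy-Schwarz
  inequality of its own.\<close>

lemma app_semi_inner_product:
  assumes t: "t \<ge> 0"
  shows "semi_inner_product S sc (app t)"
proof unfold_locales
  fix x y z assume [simp]: "x \<in> S" "y \<in> S" "z \<in> S"
  show "app t (x + y) z = app t x z + app t y z"
    using equiv_ip[OF _ _ _ T_add[OF t, of x y], of z] t by (simp add: app_def ip_linear)
next
  fix x z c assume [simp]: "x \<in> S" "z \<in> S"
  show "app t (sc c x) z = c * app t x z"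
    using equiv_ip[OF _ _ _ T_sc[OF t, of x c], of z] t by (simp add: app_def ip_linear algebra_simps)
next
  fix x y assume [simp]: "x \<in> S" "y \<in> S"
  show "app t x y = app t y x"
    using T_symmetric[OF t, of x y] t ip_sym[of x y] ip_sym[of "T t y" x] by (simp add: app_def ip_linear)
next
  fix x assume [simp]: "x \<in> S"
  have "ip (T t x) x \<le> nm (T t x) * nm x" using cauchy_schwarz[of "T t x" x] t by simp
  also have "\<dots> \<le> nm x * nm x" using T_contraction[OF t, of x] by (intro mult_right_mono) auto
  also have "\<dots> = ip x x" by (simp add: nm_sq flip: power2_eq_square)
  finally show "0 \<le> app t x x" using t by (simp add: app_def ip_linear)
qed (auto simp: sc_minus_one)

text \<open>Only the first argument is differentiated, so the second may be any vector of
  \<open>S\<close>. \<open>projection_in_form_domain\<close> uses this with a truncation as second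
  argument.\<close>

lemma app_tendsto:
  assumes v: "op v g" and [simp]: "w \<in> S"
  shows "((\<lambda>h. app h v w / h) \<longlongrightarrow> ip g w) (at_right 0)"
proof -
  note [simp] = op_mem[OF v]
  have lim: "((\<lambda>h. nm (sc (inverse h) (T h v - v) + g) * nm w) \<longlongrightarrow> 0) (at_right 0)"
    using tendsto_mult_right[OF op_gen[OF v], of "nm w"] by simp
  have "((\<lambda>h. app h v w / h - ip g w) \<longlongrightarrow> 0) (at_right 0)"
  proof (rule Lim_null_comparison[OF _ lim])
    have "norm (app h v w / h - ip g w) \<le> nm (sc (inverse h) (T h v - v) + g) * nm w" if "h > 0" for h
    proof -
      have "app h v w / h - ip g w = - ip (sc (inverse h) (T h v - v) + g) w"
        using that by (simp add: app_def ip_linear divide_inverse algebra_simps)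
      then show ?thesis using cauchy_schwarz[of "sc (inverse h) (T h v - v) + g" w] that by simp
    qed
    then show "\<forall>\<^sub>F h in at_right 0. norm (app h v w / h - ip g w) \<le> nm (sc (inverse h) (T h v - v) + g) * nm w"
      by (auto simp: eventually_at_filter)
  qed
  then show ?thesis by (rule LIM_zero_cancel)
qed

text \<open>
  The difference quotients \<open>app t v v / t\<close> increase as \<open>t\<close> is halved, because
  \<open>s \<mapsto> ip (T s v) v\<close> is midpoint convex.
\<close>

lemma app_le_op:
  assumes v: "op v g" and t: "t > 0"
  shows "app t v v \<le> t * b v v"
proof -
  note [simp] = op_mem[OF v]
  have half: "app t v v / t \<le> app (t / 2) v v / (t / 2)" if "t > 0" for t
  proof -
    let ?y = "T (t / 2) v"
    \<comment> \<open>Symmetry moves half of the time to the other argument. Expanding the square of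
      \<open>?y - v\<close> is then the midpoint inequality.\<close>
    have "ip (T t v) v = ip ?y ?y"
      using equiv_ip[OF _ _ _ T_semi[of "t/2" "t/2" v], of v] T_symmetric[of "t/2" ?y v] that by simp
    moreover have "0 \<le> ip (?y - v) (?y - v)" using that by simp
    ultimately have "app t v v \<le> 2 * app (t / 2) v v"
      using that ip_sym[of ?y v] by (simp add: app_def ip_linear)
    then show ?thesis using that by (simp add: field_simps)
  qed
  have iter: "app t v v / t \<le> app (t / 2 ^ n) v v / (t / 2 ^ n)" for n
  proof (induction n)
    case (Suc n)
    have "app (t / 2 ^ n) v v / (t / 2 ^ n) \<le> app (t / 2 ^ n / 2) v v / (t / 2 ^ n / 2)"
      using t by (intro half) simp
    moreover have "t / 2 ^ Suc n = t / 2 ^ n / 2" by simp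
    ultimately show ?case using Suc by (simp only:)
  qed simp
  have "(\<lambda>n. t / 2 ^ n) \<longlonglongrightarrow> 0"
    using tendsto_mult_left[OF LIMSEQ_realpow_zero[of "1/2"], of t] by (simp add: power_divide)
  then have "filterlim (\<lambda>n. t / 2 ^ n) (at_right 0) sequentially"
    using t by (auto simp: filterlim_at)
  from filterlim_compose[OF app_tendsto[OF v, of v] this]
  have "(\<lambda>n. app (t / 2 ^ n) v v / (t / 2 ^ n)) \<longlonglongrightarrow> b v v"
    using op_form[OF v, of v] by simp
  then have "app t v v / t \<le> b v v"
    using iter by (intro LIMSEQ_le_const) auto
  then show ?thesis using t by (simp add: field_simps)
qed

text \<open>The bound is known on the domain of the operator and has to reach \<open>D\<close>.
  Resolvents of \<open>u\<close> converge to \<open>u\<close> in the norm of \<open>S\<close>, where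
  \<open>app t\<close> is continuous, and their form values do not exceed \<open>b u u\<close>; no
  convergence in the form is required.\<close>

lemma app_le_form:
  assumes u: "u \<in> D" and t: "t > 0"
  shows "app t u u \<le> t * b u u"
proof -
  note [simp] = u
  have "\<exists>w. op w (sc (real (Suc n)) (u - w))" for n using resolvent[of "real (Suc n)" u] by auto
  then obtain w where w: "\<And>n. op (w n) (sc (real (Suc n)) (u - w n))" by metis
  note [simp] = op_mem(1,2)[OF w]
  \<comment> \<open>Expand \<open>b u u\<close> around \<open>w n\<close>. The mixed term is known
    from the operator equation and equals minus \<open>real (Suc n)\<close> times the squared
    distance; the square of the difference is nonnegative and dropped.\<close>
  have est: "b (w n) (w n) + 2 * real (Suc n) * (nm (w n - u))\<^sup>2 \<le> b u u" for n
  proof -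
    have "b (w n) (w n - u) = - (real (Suc n) * (nm (w n - u))\<^sup>2)"
      using op_form[OF w, of "w n - u"] D_diff[of "w n" u] ip_sym[of "w n" u]
      by (simp add: ip_linear nm_sq algebra_simps del: of_nat_Suc)
    moreover have "0 \<le> b (w n - u) (w n - u)" by (intro b_nonneg D_diff) auto
    ultimately show ?thesis
      using b_sym[of u "w n"] by (simp add: b_diff b_diff_right D_diff algebra_simps)
  qed
  have bu: "0 \<le> b u u" using b_nonneg u by simp
  have "(\<lambda>n. (nm (w n - u))\<^sup>2) \<longlonglongrightarrow> 0"
  proof (rule tendsto_sandwich[where f = "\<lambda>_. 0" and h = "\<lambda>n. b u u / real (Suc n)"])
    show "(\<lambda>n. b u u / real (Suc n)) \<longlonglongrightarrow> 0" using lim_const_over_n[THEN LIMSEQ_Suc, of "b u u"] by simp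
    have "(nm (w n - u))\<^sup>2 \<le> b u u / real (Suc n)" for n
    proof -
      have "real (Suc n) * (nm (w n - u))\<^sup>2 \<le> b u u"
        using est[of n] b_nonneg[OF op_mem(1)[OF w[of n]]] mult_nonneg_nonneg[OF of_nat_0_le_iff zero_le_power2, of "Suc n" "nm (w n - u)"]
        by linarith
      then show ?thesis by (simp add: field_simps)
    qed
    then show "\<forall>\<^sub>F n in sequentially. (nm (w n - u))\<^sup>2 \<le> b u u / real (Suc n)" by simp
  qed auto
  then have wl: "(\<lambda>n. nm (w n - u)) \<longlonglongrightarrow> 0"
    using tendsto_real_sqrt[of "\<lambda>n. (nm (w n - u))\<^sup>2" 0] by simp
  have "(\<lambda>n. ip (w n) (w n) - ip (T t (w n)) (w n)) \<longlonglongrightarrow> ip u u - ip (T t u) u"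
    using t by (intro tendsto_diff tendsto_ip T_tendsto wl) auto
  then have lim: "(\<lambda>n. app t (w n) (w n)) \<longlonglongrightarrow> app t u u"
    using t by (simp add: app_def ip_linear)
  have "app t (w n) (w n) \<le> t * b u u" for n
  proof -
    have "app t (w n) (w n) \<le> t * b (w n) (w n)" by (rule app_le_op[OF w t])
    also have "\<dots> \<le> t * b u u"
    proof (rule mult_left_mono)
      show "b (w n) (w n) \<le> b u u"
        using est[of n] mult_nonneg_nonneg[OF of_nat_0_le_iff zero_le_power2, of "Suc n" "nm (w n - u)"] by linarith
    qed (use t in simp)
    finally show ?thesis .
  qed
  then show ?thesis using lim by (intro LIMSEQ_le_const2) auto
qed

text \<open>
  If \<open>w\<close> is the projection of \<open>u\<close> to a closed convex set that is invariant under the semigroup,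
  the assumption holds.  The resolvents \<open>n (n + A)\<^sup>-\<^sup>1 w\<close> then converge to \<open>w\<close>, and the form is
  increasing and bounded along them.
\<close>

lemma projection_in_form_domain:
  assumes u: "u \<in> D" and w: "w \<in> S" and proj: "\<And>t. t > 0 \<Longrightarrow> ip (w - T t w) (u - w) \<ge> 0"
  shows "\<exists>w'\<in>D. equiv w w'"
proof -
  note [simp] = u w
  define C where "C = b u u"
  have C: "C \<ge> 0" using b_nonneg[OF u] by (simp add: C_def)
  \<comment> \<open>The projection hypothesis reads \<open>app t w w \<le> app t w u\<close>, and
    Cauchy-Schwarz for \<open>app t\<close> turns this into a bound by \<open>app t u u\<close>,
    hence by the form at \<open>u\<close>.\<close>
  have ww: "app t w w \<le> t * C" if t: "t > 0" for t
  proof -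
    interpret a: semi_inner_product S sc "app t" by (rule app_semi_inner_product) (use t in simp)
    have le: "app t w w \<le> app t w u" using proj[OF t] t by (simp add: app_def ip_linear)
    have "app t w w \<le> app t u u"
    proof (cases "app t w w = 0")
      case True
      then show ?thesis using a.ip_nonneg[of u] by simp
    next
      case False
      then have p: "app t w w > 0" using a.ip_nonneg[OF w] by linarith
      have "(app t w w)\<^sup>2 \<le> (app t w u)\<^sup>2" using le p by (intro power_mono) auto
      also have "\<dots> \<le> app t w w * app t u u" by (rule a.cauchy_schwarz_sq) auto
      finally show ?thesis using p by (simp add: power2_eq_square)
    qed
    then show ?thesis using app_le_form[OF u t] by (simp add: C_def)
  qed
  \<comment> \<open>Cauchy-Schwarz for \<open>app h\<close>, divided by \<open>h\<^sup>2\<close>. In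
    the limit, pairing the operator value \<open>g\<close> of \<open>v\<close> with \<open>w\<close>
    is bounded by the form norm of \<open>v\<close>, although \<open>b\<close> cannot yet be
    evaluated at \<open>w\<close>.\<close>
  have key: "(ip g w)\<^sup>2 \<le> C * b v v" if v: "op v g" for v g
  proof -
    note [simp] = op_mem[OF v]
    have "((\<lambda>h. (app h v w / h)\<^sup>2) \<longlongrightarrow> (ip g w)\<^sup>2) (at_right 0)"
      by (intro tendsto_intros app_tendsto[OF v w])
    moreover have "\<forall>\<^sub>F h in at_right 0. (app h v w / h)\<^sup>2 \<le> C * b v v"
    proof -
      have "(app h v w / h)\<^sup>2 \<le> C * b v v" if h: "h > 0" for h
      proof -
        interpret a: semi_inner_product S sc "app h" by (rule app_semi_inner_product) (use h in simp)
        have "(app h v w)\<^sup>2 \<le> app h v v * app h w w" by (rule a.cauchy_schwarz_sq) auto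
        also have "\<dots> \<le> (h * b v v) * (h * C)"
          using a.ip_nonneg h b_nonneg[of v] by (intro mult_mono app_le_form ww) auto
        finally show ?thesis using h by (simp add: power_divide divide_le_eq power2_eq_square algebra_simps)
      qed
      then show ?thesis by (auto simp: eventually_at_filter)
    qed
    ultimately show ?thesis by (rule tendsto_upperbound) simp
  qed
  have "\<exists>v. op v (sc (real (Suc n)) (w - v))" for n using resolvent[of "real (Suc n)" w] by auto
  then obtain W where W: "\<And>n. op (W n) (sc (real (Suc n)) (w - W n))" by metis
  note [simp] = op_mem(1,2)[OF W]
  define d where "d n = w - W n" for n
  have dS [simp]: "d n \<in> S" for n by (simp add: d_def)
  define \<beta> where "\<beta> n = b (W n) (W n)" for n
  have bW: "b (W n) v = real (Suc n) * ip (d n) v" if "v \<in> D" for n v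
    using op_form[OF W that] that by (simp add: d_def ip_linear del: of_nat_Suc)
  have \<beta>0: "\<beta> n \<ge> 0" for n by (simp add: \<beta>_def b_nonneg)
  \<comment> \<open>\<open>X\<close> is the pairing of the operator value of \<open>W n\<close> with
    \<open>w\<close>. Splitting \<open>w\<close> into \<open>W n + d n\<close> shows that
    \<open>X\<close> is the sum of both quantities to be bounded; \<open>key\<close> gives
    \<open>X\<^sup>2 \<le> C * \<beta> n \<le> C * X\<close>, hence
    \<open>X \<le> C\<close>.\<close>
  have bounds: "\<beta> n \<le> C \<and> real (Suc n) * (nm (d n))\<^sup>2 \<le> C" for n
  proof -
    define X where "X = real (Suc n) * ip (d n) w"
    have w_eq: "w = W n + d n" by (simp add: d_def)
    have X: "X = \<beta> n + real (Suc n) * (nm (d n))\<^sup>2"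
      unfolding X_def by (subst w_eq) (simp add: \<beta>_def bW nm_sq ip_linear algebra_simps)
    have p: "0 \<le> real (Suc n) * (nm (d n))\<^sup>2" by (simp del: of_nat_Suc)
    have "X\<^sup>2 \<le> C * \<beta> n" using key[OF W[of n]] by (simp add: X_def \<beta>_def d_def ip_linear del: of_nat_Suc)
    also have "\<dots> \<le> C * X" using C X p by (intro mult_left_mono) auto
    finally have "X \<le> C" using C by (cases "X \<le> 0") (auto simp: power2_eq_square)
    then show ?thesis using X p \<beta>0[of n] by linarith
  qed
  have nmd: "(\<lambda>n. (nm (d n))\<^sup>2) \<longlonglongrightarrow> 0"
  proof (rule tendsto_sandwich[where f = "\<lambda>_. 0" and h = "\<lambda>n. C / real (Suc n)"])
    show "(\<lambda>n. C / real (Suc n)) \<longlonglongrightarrow> 0" using lim_const_over_n[THEN LIMSEQ_Suc, of C] by simp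
    have "(nm (d n))\<^sup>2 \<le> C / real (Suc n)" for n using bounds[of n] by (simp add: field_simps)
    then show "\<forall>\<^sub>F n in sequentially. (nm (d n))\<^sup>2 \<le> C / real (Suc n)" by simp
  qed auto
  then have Wl: "(\<lambda>n. nm (W n - w)) \<longlonglongrightarrow> 0"
    using tendsto_real_sqrt[of "\<lambda>n. (nm (d n))\<^sup>2" 0] nm_diff_commute[of w "W _"] by (simp add: d_def)
  \<comment> \<open>Written through the defects \<open>d\<close>, nonnegativity of the form on
    \<open>W m - W n\<close> forces the defects to shrink in norm as the index grows. Therefore
    \<open>b (W n) (W m - W n)\<close> is nonnegative, and expanding the square gives the bound by
    the increment of \<open>\<beta>\<close>. A bounded monotone \<open>\<beta>\<close> then makes
    \<open>W\<close> a Cauchy sequence for the form.\<close>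
  have mono: "b (W m - W n) (W m - W n) \<le> \<beta> m - \<beta> n" if mn: "n \<le> m" for m n
  proof -
    let ?l = "real (Suc n)" and ?m = "real (Suc m)" and ?x = "nm (d n)" and ?y = "nm (d m)"
    have WW: "W m - W n = d n - d m" by (simp add: d_def)
    have Wd: "W m - W n \<in> D" by (simp add: D_diff)
    have "0 \<le> b (W m - W n) (W m - W n)" by (intro b_nonneg Wd)
    also have "\<dots> = ?m * ip (d m) (d n - d m) - ?l * ip (d n) (d n - d m)"
      using Wd by (simp add: b_diff bW del: of_nat_Suc) (simp add: WW)
    also have "\<dots> = (?l + ?m) * ip (d n) (d m) - ?l * ?x\<^sup>2 - ?m * ?y\<^sup>2"
      using ip_sym[of "d m" "d n"] by (simp add: ip_linear nm_sq algebra_simps)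
    also have "\<dots> \<le> (?l + ?m) * (?x * ?y) - ?l * ?x\<^sup>2 - ?m * ?y\<^sup>2"
      using cauchy_schwarz[of "d n" "d m"] by (intro diff_right_mono mult_left_mono) auto
    also have "\<dots> = (?l * ?x - ?m * ?y) * (?y - ?x)" by (simp add: power2_eq_square algebra_simps)
    finally have nn: "0 \<le> (?l * ?x - ?m * ?y) * (?y - ?x)" .
    have yx: "?y \<le> ?x"
    proof (rule ccontr)
      assume "\<not> ?y \<le> ?x"
      then have "?l * ?x < ?m * ?y"
        using mn by (intro mult_le_less_imp_less) auto
      with nn \<open>\<not> ?y \<le> ?x\<close> show False by (simp add: zero_le_mult_iff)
    qed
    have "ip (d n) (d m) \<le> ?x * ?y" using cauchy_schwarz[of "d n" "d m"] by simp
    also have "\<dots> \<le> ?x * ?x" using yx by (intro mult_left_mono) auto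
    finally have "0 \<le> ?l * ip (d n) (d n - d m)" by (simp add: ip_linear nm_sq flip: power2_eq_square)
    moreover have "b (W n) (W m - W n) = ?l * ip (d n) (d n - d m)"
      using bW[OF Wd, of n] by (simp add: WW)
    ultimately have "b (W n) (W m) \<ge> \<beta> n" by (simp add: b_diff_right \<beta>_def)
    then show ?thesis using b_sym[of "W m" "W n"] by (simp add: b_diff b_diff_right D_diff \<beta>_def)
  qed
  have inc: "incseq \<beta>"
  proof (rule monoI)
    fix n m :: nat assume "n \<le> m"
    then show "\<beta> n \<le> \<beta> m" using mono[of n m] b_nonneg[of "W m - W n"] by (simp add: D_diff)
  qed
  then have "convergent \<beta>" using bounds by (meson incseq_convergent convergent_def)
  then have cau: "Cauchy \<beta>" by (rule convergent_Cauchy)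
  have "\<exists>x\<in>D. (\<lambda>n. ip (W n - x) (W n - x)) \<longlonglongrightarrow> 0 \<and> (\<lambda>n. b (W n - x) (W n - x)) \<longlonglongrightarrow> 0"
  proof (rule D_complete)
    fix e :: real assume e: "e > 0"
    obtain N where N: "\<And>n. n \<ge> N \<Longrightarrow> nm (W n - w) < sqrt e / 2"
      using order_tendstoD(2)[OF Wl, of "sqrt e / 2"] e by (auto simp: eventually_sequentially)
    have "ip (W m - W n) (W m - W n) < e" if "m \<ge> N" "n \<ge> N" for m n
    proof -
      have "nm (W m - W n) < sqrt e"
        using nm_triangle3[of "W m" w "W n"] nm_diff_commute[of w "W n"] N[OF that(1)] N[OF that(2)] by simp
      then show ?thesis by (simp add: nm_def)
    qed
    then show "\<exists>N. \<forall>m\<ge>N. \<forall>n\<ge>N. ip (W m - W n) (W m - W n) < e" by blast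
    obtain M where M: "\<And>m n. m \<ge> M \<Longrightarrow> n \<ge> M \<Longrightarrow> \<bar>\<beta> m - \<beta> n\<bar> < e"
      using cau e unfolding Cauchy_def dist_real_def by meson
    have "b (W m - W n) (W m - W n) < e" if "m \<ge> M" "n \<ge> M" for m n
    proof (cases "n \<le> m")
      case True
      then show ?thesis using mono[OF True] M[OF that] by linarith
    next
      case False
      then have "b (W n - W m) (W n - W m) < e" using mono[of m n] M[OF that] by linarith
      moreover have "b (W n - W m) (W n - W m) = b (W m - W n) (W m - W n)"
        using b_sym[of "W m" "W n"] by (simp add: b_diff b_diff_right D_diff)
      ultimately show ?thesis by simp
    qed
    then show "\<exists>N. \<forall>m\<ge>N. \<forall>n\<ge>N. b (W m - W n) (W m - W n) < e" by blast
  qed simp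
  then obtain x where x: "x \<in> D" "(\<lambda>n. ip (W n - x) (W n - x)) \<longlonglongrightarrow> 0" by auto
  then have "(\<lambda>n. nm (W n - x)) \<longlonglongrightarrow> 0" unfolding nm_def using tendsto_real_sqrt[of _ 0] by fastforce
  with Wl have "equiv w x" using x by (intro nm_limit_unique[where X = W and F = sequentially]) auto
  with x show ?thesis by blast
qed

end

section \<open>Square integrable functions\<close>

lemma L2_measurable [measurable_dest]: "f \<in> L2 M \<Longrightarrow> f \<in> borel_measurable M"
  by (simp add: L2_def)

lemma L2_integrable: "f \<in> L2 M \<Longrightarrow> integrable M (\<lambda>x. (cmod (f x))\<^sup>2)"
  by (simp add: L2_def)

lemma L2_I_bound:
  assumes "f \<in> borel_measurable M" "integrable M g" "AE x in M. (cmod (f x))\<^sup>2 \<le> g x"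
  shows "f \<in> L2 M"
  unfolding L2_def using assms
  by (auto intro!: Bochner_Integration.integrable_bound[OF assms(2)] elim!: eventually_mono)

lemma L2_zero [simp]: "(\<lambda>x. 0) \<in> L2 M"
  by (simp add: L2_def)

lemma norm_add_sq: "(cmod (a + b))\<^sup>2 \<le> 2 * (cmod a)\<^sup>2 + 2 * (cmod b)\<^sup>2"
proof -
  have "(cmod (a + b))\<^sup>2 \<le> (cmod a + cmod b)\<^sup>2" by (intro power_mono norm_triangle_ineq) auto
  also have "\<dots> \<le> 2 * (cmod a)\<^sup>2 + 2 * (cmod b)\<^sup>2"
    using zero_le_power2[of "cmod a - cmod b"] by (simp add: power2_sum power2_diff)
  finally show ?thesis .
qed

lemma L2_add: "f \<in> L2 M \<Longrightarrow> g \<in> L2 M \<Longrightarrow> (\<lambda>x. f x + g x) \<in> L2 M"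
  by (rule L2_I_bound[where g = "\<lambda>x. 2 * (cmod (f x))\<^sup>2 + 2 * (cmod (g x))\<^sup>2"])
    (auto simp: norm_add_sq intro!: L2_integrable intro: L2_measurable)

lemma L2_mult_bounded:
  assumes f: "f \<in> L2 M" and g [measurable]: "g \<in> borel_measurable M" and b: "AE x in M. cmod (g x) \<le> K"
  shows "(\<lambda>x. g x * f x) \<in> L2 M"
proof (rule L2_I_bound[where g = "\<lambda>x. K\<^sup>2 * (cmod (f x))\<^sup>2"])
  show "AE x in M. (cmod (g x * f x))\<^sup>2 \<le> K\<^sup>2 * (cmod (f x))\<^sup>2"
    using b by eventually_elim (auto simp: norm_mult power_mult_distrib intro!: mult_right_mono power_mono)
qed (use f in \<open>auto intro!: L2_integrable intro: L2_measurable\<close>)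

lemma L2_cmult: "f \<in> L2 M \<Longrightarrow> (\<lambda>x. c * f x) \<in> L2 M"
  by (rule L2_mult_bounded[where K = "cmod c"]) auto

lemma L2_minus: "f \<in> L2 M \<Longrightarrow> (\<lambda>x. - f x) \<in> L2 M"
  using L2_cmult[of f M "-1"] by simp

lemma L2_diff: "f \<in> L2 M \<Longrightarrow> g \<in> L2 M \<Longrightarrow> (\<lambda>x. f x - g x) \<in> L2 M"
  using L2_add[of f M "\<lambda>x. - g x"] L2_minus[of g M] by simp

lemma borel_measurable_cnj [measurable]: "f \<in> borel_measurable M \<Longrightarrow> (\<lambda>x. cnj (f x)) \<in> borel_measurable M"
  by (rule measurable_compose[OF _ borel_measurable_continuous_onI]) (auto intro: continuous_intros)

lemma L2_cnj: "f \<in> L2 M \<Longrightarrow> (\<lambda>x. cnj (f x)) \<in> L2 M"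
  by (auto simp: L2_def)

lemma L2_mult_integrable:
  assumes f: "f \<in> L2 M" and g: "g \<in> L2 M"
  shows "integrable M (\<lambda>x. f x * g x)"
proof (rule Bochner_Integration.integrable_bound)
  show "integrable M (\<lambda>x. (cmod (f x))\<^sup>2 + (cmod (g x))\<^sup>2)"
    using f g by (intro Bochner_Integration.integrable_add L2_integrable)
  have "cmod a * cmod b \<le> (cmod a)\<^sup>2 + (cmod b)\<^sup>2" for a b
    using zero_le_power2[of "cmod a - cmod b"] mult_nonneg_nonneg[of "cmod a" "cmod b"]
    by (simp add: power2_diff del: mult_nonneg_nonneg)
  then show "AE x in M. cmod (f x * g x) \<le> norm ((cmod (f x))\<^sup>2 + (cmod (g x))\<^sup>2)"
    by (auto simp: norm_mult)
qed (use f g in \<open>auto intro: L2_measurable\<close>)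

lemma L2_bounded:
  assumes "finite_measure M" "f \<in> borel_measurable M" "AE x in M. cmod (f x) \<le> K"
  shows "f \<in> L2 M"
proof -
  interpret finite_measure M by fact
  have "(\<lambda>x. 1) \<in> L2 M" by (simp add: L2_def)
  from L2_mult_bounded[OF this assms(2,3)] show ?thesis by simp
qed

lemma L2_integrable_finite:
  assumes "finite_measure M" "f \<in> L2 M"
  shows "integrable M f"
  using L2_mult_integrable[OF assms(2) L2_bounded[OF assms(1), of "\<lambda>x. 1" 1]] by simp

lemma norm_sq_eq_Re: "(cmod z)\<^sup>2 = Re (z * cnj z)"
  by (simp add: complex_mult_cnj cmod_power2)

text \<open>
  A sequence with \<open>\<integral>\<bar>X (k+1) - X k\<bar>\<^sup>2 \<le> 4\<^sup>-\<^sup>k\<close> converges almost everywhere, since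
  \<open>\<bar>z\<bar> \<le> 2\<^sup>k \<bar>z\<bar>\<^sup>2 + 2\<^sup>-\<^sup>k\<close>.
\<close>

lemma L2_fast_AE_convergent:
  assumes M: "finite_measure M" and X: "\<And>k. X k \<in> L2 M"
    and fast: "\<And>k::nat. (\<integral>x. (cmod (X (Suc k) x - X k x))\<^sup>2 \<partial>M) \<le> (1/4)^k"
  shows "AE x in M. convergent (\<lambda>k. X k x)"
proof -
  interpret finite_measure M by fact
  note [measurable] = L2_measurable[OF X]
  let ?d = "\<lambda>k x. X (Suc k) x - X k x"
  let ?m = "measure M (space M)"
  have dL2: "?d k \<in> L2 M" for k by (intro L2_diff X)
  have "(\<integral>\<^sup>+x. ennreal (cmod (?d k x)) \<partial>M) \<le> ennreal ((1 + ?m) * (1/2)^k)" for k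
  proof -
    have "(\<integral>\<^sup>+x. ennreal (cmod (?d k x)) \<partial>M) \<le> (\<integral>\<^sup>+x. ennreal (2^k * (cmod (?d k x))\<^sup>2 + (1/2)^k) \<partial>M)"
    proof (intro nn_integral_mono ennreal_leI)
      fix x
      have "a \<le> 2^k * a\<^sup>2 + (1/2)^k" if "a \<ge> 0" for a :: real
      proof -
        have "0 \<le> (2^k * a - 1)\<^sup>2 + 2^k * a" using that by simp
        then have "2^k * a \<le> 2^k * (2^k * a\<^sup>2 + (1/2)^k)"
          by (simp add: power2_eq_square algebra_simps power_divide)
        then show ?thesis by simp
      qed
      then show "cmod (?d k x) \<le> 2^k * (cmod (?d k x))\<^sup>2 + (1/2)^k" by simp
    qed
    also have "\<dots> = ennreal (\<integral>x. 2^k * (cmod (?d k x))\<^sup>2 + (1/2)^k \<partial>M)"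
      by (rule nn_integral_eq_integral) (auto intro!: L2_integrable dL2)
    also have "(\<integral>x. 2^k * (cmod (?d k x))\<^sup>2 + (1/2)^k \<partial>M) = 2^k * (\<integral>x. (cmod (?d k x))\<^sup>2 \<partial>M) + (1/2)^k * ?m"
      by (subst Bochner_Integration.integral_add) (auto intro!: L2_integrable dL2)
    also have "\<dots> \<le> 2^k * (1/4)^k + (1/2)^k * ?m"
      by (intro add_right_mono mult_left_mono fast) auto
    also have "\<dots> = (1 + ?m) * (1/2)^k" by (simp add: algebra_simps flip: power_mult_distrib)
    finally show ?thesis by (simp add: ennreal_leI)
  qed
  then have "(\<Sum>k. \<integral>\<^sup>+x. ennreal (cmod (?d k x)) \<partial>M) \<le> (\<Sum>k. ennreal ((1 + ?m) * (1/2)^k))"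
    by (intro suminf_le) auto
  also have "\<dots> = ennreal (\<Sum>k. (1 + ?m) * (1/2)^k)"
    by (rule suminf_ennreal2) (auto intro!: summable_mult summable_geometric)
  also have "\<dots> < \<infinity>" by simp
  finally have "(\<integral>\<^sup>+x. (\<Sum>k. ennreal (cmod (?d k x))) \<partial>M) \<noteq> \<infinity>"
    by (subst nn_integral_suminf) auto
  then have "AE x in M. (\<Sum>k. ennreal (cmod (?d k x))) \<noteq> \<infinity>"
    by (intro nn_integral_noteq_infinite) auto
  then show ?thesis
  proof eventually_elim
    case (elim x)
    then have "summable (\<lambda>k. cmod (?d k x))" by (intro summable_suminf_not_top) auto
    then have "summable (\<lambda>k. ?d k x)" by (rule summable_norm_cancel)
    then have "convergent (\<lambda>n. (\<Sum>k<n. ?d k x) + X 0 x)"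
      by (intro convergent_add convergent_const) (simp add: summable_iff_convergent)
    moreover have "(\<Sum>k<n. ?d k x) + X 0 x = X n x" for n by (induction n) (auto simp: algebra_simps)
    ultimately show ?case by simp
  qed
qed

text \<open>A fast subsequence converges almost everywhere. Fatou's lemma, applied to the distance
  of a fixed member from this subsequence, carries the Cauchy estimate over to the pointwise limit
  and gives convergence of the whole sequence.\<close>

lemma L2_complete:
  assumes M: "finite_measure M" and X: "\<And>n::nat. X n \<in> L2 M"
    and C: "\<And>e. e > 0 \<Longrightarrow> \<exists>N. \<forall>m\<ge>N. \<forall>n\<ge>N. (\<integral>x. (cmod (X m x - X n x))\<^sup>2 \<partial>M) < e"
  shows "\<exists>f\<in>L2 M. (\<lambda>n. \<integral>x. (cmod (X n x - f x))\<^sup>2 \<partial>M) \<longlonglongrightarrow> 0"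
proof -
  note [measurable] = L2_measurable[OF X]
  have "\<exists>N. \<forall>k. (\<forall>m\<ge>N k. \<forall>n\<ge>N k. (\<integral>x. (cmod (X m x - X n x))\<^sup>2 \<partial>M) < (1/4)^k)"
    using C[of "(1/4)^_"] by (intro choice) auto
  then obtain N where N: "\<And>k m n. m \<ge> N k \<Longrightarrow> n \<ge> N k \<Longrightarrow> (\<integral>x. (cmod (X m x - X n x))\<^sup>2 \<partial>M) < (1/4)^k"
    by blast
  \<comment> \<open>Accumulating the thresholds makes \<open>r\<close> increasing while keeping it
    above both \<open>N k\<close> and \<open>k\<close>.\<close>
  define r where "r k = (\<Sum>j\<le>k. N j + 1)" for k
  have rN: "N k \<le> r k" for k
    unfolding r_def using member_le_sum[of k "{..k}" "\<lambda>j. N j + 1"] by simp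
  have rS: "r k \<le> r (Suc k)" for k by (simp add: r_def)
  have rk: "k \<le> r k" for k by (induction k) (auto simp: r_def)
  have conv: "AE x in M. convergent (\<lambda>k. X (r k) x)"
    by (rule L2_fast_AE_convergent[OF M X]) (rule less_imp_le, rule N, use rN rS order_trans in blast, rule rN)
  define f where "f x = lim (\<lambda>k. X (r k) x)" for x
  have [measurable]: "f \<in> borel_measurable M" unfolding f_def by measurable
  have est: "(\<integral>\<^sup>+x. ennreal ((cmod (X n x - f x))\<^sup>2) \<partial>M) \<le> ennreal e"
    if "e > 0" "\<forall>m\<ge>n0. \<forall>n\<ge>n0. (\<integral>x. (cmod (X m x - X n x))\<^sup>2 \<partial>M) < e" "n \<ge> n0" for e n0 n
  proof -
    have "(\<integral>\<^sup>+x. ennreal ((cmod (X n x - f x))\<^sup>2) \<partial>M) =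
        (\<integral>\<^sup>+x. liminf (\<lambda>k. ennreal ((cmod (X n x - X (r k) x))\<^sup>2)) \<partial>M)"
    proof (rule nn_integral_cong_AE, use conv in eventually_elim)
      case (elim x)
      then have "(\<lambda>k. X (r k) x) \<longlonglongrightarrow> f x" unfolding f_def by (simp add: convergent_LIMSEQ_iff)
      then have "(\<lambda>k. ennreal ((cmod (X n x - X (r k) x))\<^sup>2)) \<longlonglongrightarrow> ennreal ((cmod (X n x - f x))\<^sup>2)"
        by (intro tendsto_intros)
      then show ?case by (intro lim_imp_Liminf[symmetric]) simp
    qed
    also have "\<dots> \<le> liminf (\<lambda>k. \<integral>\<^sup>+x. ennreal ((cmod (X n x - X (r k) x))\<^sup>2) \<partial>M)"
      by (rule nn_integral_liminf) measurable
    also have "\<dots> \<le> ennreal e"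
    proof (rule Liminf_le)
      show "\<forall>\<^sub>F k in sequentially. (\<integral>\<^sup>+x. ennreal ((cmod (X n x - X (r k) x))\<^sup>2) \<partial>M) \<le> ennreal e"
        unfolding eventually_sequentially
      proof (intro exI[of _ n0] allI impI)
        fix k assume "n0 \<le> k"
        then have "n0 \<le> r k" using rk[of k] by simp
        then have "(\<integral>x. (cmod (X n x - X (r k) x))\<^sup>2 \<partial>M) \<le> e" using that by (simp add: less_imp_le)
        then show "(\<integral>\<^sup>+x. ennreal ((cmod (X n x - X (r k) x))\<^sup>2) \<partial>M) \<le> ennreal e"
          by (subst nn_integral_eq_integral) (auto intro!: L2_integrable L2_diff X ennreal_leI)
      qed
    qed simp
    finally show ?thesis .
  qed
  have est2: "(\<lambda>x. X n x - f x) \<in> L2 M \<and> (\<integral>x. (cmod (X n x - f x))\<^sup>2 \<partial>M) \<le> e"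
    if "e > 0" "\<forall>m\<ge>n0. \<forall>n\<ge>n0. (\<integral>x. (cmod (X m x - X n x))\<^sup>2 \<partial>M) < e" "n \<ge> n0" for e n0 n
  proof -
    have le: "(\<integral>\<^sup>+x. ennreal ((cmod (X n x - f x))\<^sup>2) \<partial>M) \<le> ennreal e" by (rule est[OF that])
    then have int: "integrable M (\<lambda>x. (cmod (X n x - f x))\<^sup>2)"
      by (intro integrableI_bounded) (auto intro: le_less_trans)
    then have "ennreal (\<integral>x. (cmod (X n x - f x))\<^sup>2 \<partial>M) \<le> ennreal e"
      using le by (subst (asm) nn_integral_eq_integral) auto
    then show ?thesis using int that(1) by (auto simp: L2_def)
  qed
  obtain n0 where "\<forall>m\<ge>n0. \<forall>n\<ge>n0. (\<integral>x. (cmod (X m x - X n x))\<^sup>2 \<partial>M) < 1" using C[of 1] by auto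
  then have "(\<lambda>x. X n0 x - f x) \<in> L2 M" using est2[of 1 n0 n0] by auto
  from L2_diff[OF X[of n0] this] have fL2: "f \<in> L2 M" by simp
  have "(\<lambda>n. \<integral>x. (cmod (X n x - f x))\<^sup>2 \<partial>M) \<longlonglongrightarrow> 0"
  proof (rule LIMSEQ_I)
    fix e :: real assume e: "e > 0"
    then obtain n0 where n0: "\<forall>m\<ge>n0. \<forall>n\<ge>n0. (\<integral>x. (cmod (X m x - X n x))\<^sup>2 \<partial>M) < e / 2" using C[of "e/2"] by auto
    have "norm ((\<integral>x. (cmod (X n x - f x))\<^sup>2 \<partial>M) - 0) < e" if "n \<ge> n0" for n
      using est2[OF _ n0 that] e by simp
    then show "\<exists>n0. \<forall>n\<ge>n0. norm ((\<integral>x. (cmod (X n x - f x))\<^sup>2 \<partial>M) - 0) < e" by blast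
  qed
  with fL2 show ?thesis by blast
qed

abbreviation real_scale :: "real \<Rightarrow> ('x \<Rightarrow> complex) \<Rightarrow> 'x \<Rightarrow> complex" where
  "real_scale c f \<equiv> \<lambda>x. complex_of_real c * f x"

definition real_ip :: "'x measure \<Rightarrow> ('x \<Rightarrow> complex) \<Rightarrow> ('x \<Rightarrow> complex) \<Rightarrow> real" where
  "real_ip M f g = Re (\<integral>x. f x * cnj (g x) \<partial>M)"

lemma integral_Re: "integrable M f \<Longrightarrow> Re (\<integral>x. f x \<partial>M) = (\<integral>x. Re (f x) \<partial>M)"
  by (simp add: integral_Re)

lemma real_ip_self:
  assumes "f \<in> L2 M" shows "real_ip M f f = (\<integral>x. (cmod (f x))\<^sup>2 \<partial>M)"
  unfolding real_ip_def norm_sq_eq_Re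
  by (intro integral_Re L2_mult_integrable L2_cnj assms)

lemma semi_hilbert_L2:
  assumes M: "finite_measure M"
  shows "semi_hilbert (L2 M) real_scale (real_ip M)"
proof unfold_locales
  fix x y z :: "'a \<Rightarrow> complex" and c
  assume xyz: "x \<in> L2 M" "y \<in> L2 M" "z \<in> L2 M"
  show "x + y \<in> L2 M" using xyz L2_add[of x M y] by (simp add: plus_fun_def)
  show "real_ip M (x + y) z = real_ip M x z + real_ip M y z"
    using xyz by (simp add: real_ip_def plus_fun_def distrib_right L2_mult_integrable L2_cnj)
next
  fix x z :: "'a \<Rightarrow> complex" and c
  assume xyz: "x \<in> L2 M" "z \<in> L2 M"
  show "real_scale c x \<in> L2 M" using xyz by (intro L2_cmult)
  show "real_scale (- 1) x = - x" by (simp add: fun_eq_iff)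
  show "real_ip M (real_scale c x) z = c * real_ip M x z"
    using xyz by (simp add: real_ip_def mult.assoc)
  have "real_ip M x z = Re (cnj (\<integral>y. x y * cnj (z y) \<partial>M))" by (simp add: real_ip_def)
  also have "\<dots> = Re (\<integral>y. cnj (x y * cnj (z y)) \<partial>M)"
    by (rule arg_cong[of _ _ Re], rule Bochner_Integration.integral_cnj[symmetric])
  also have "\<dots> = real_ip M z x" by (simp add: real_ip_def mult.commute)
  finally show "real_ip M x z = real_ip M z x" .
  show "0 \<le> real_ip M x x" using xyz by (simp add: real_ip_self)
next
  fix X :: "nat \<Rightarrow> 'a \<Rightarrow> complex"
  assume X: "\<And>n. X n \<in> L2 M"
    and C: "\<And>e. e > 0 \<Longrightarrow> \<exists>N. \<forall>m\<ge>N. \<forall>n\<ge>N. real_ip M (X m - X n) (X m - X n) < e"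
  have eq: "real_ip M (X m - g) (X m - g) = (\<integral>x. (cmod (X m x - g x))\<^sup>2 \<partial>M)" if "g \<in> L2 M" for m g
    using real_ip_self[of "X m - g" M] L2_diff[OF X[of m] that] by (simp add: fun_diff_def)
  have "\<exists>f\<in>L2 M. (\<lambda>n. \<integral>x. (cmod (X n x - f x))\<^sup>2 \<partial>M) \<longlonglongrightarrow> 0"
    by (rule L2_complete[OF M X]) (use C in \<open>simp add: eq X\<close>)
  then show "\<exists>x\<in>L2 M. (\<lambda>n. real_ip M (X n - x) (X n - x)) \<longlonglongrightarrow> 0"
    by (auto simp: eq)
qed (simp_all add: zero_fun_def)

lemma semi_hilbert_Times:
  fixes S :: "('x \<Rightarrow> complex) set" and R :: "('y \<Rightarrow> complex) set"
  assumes "semi_hilbert S real_scale p" "semi_hilbert R real_scale q"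
  shows "semi_hilbert (S \<times> R) (\<lambda>c u. (real_scale c (fst u), real_scale c (snd u)))
    (\<lambda>u v. p (fst u) (fst v) + q (snd u) (snd v))"
proof -
  interpret p: semi_hilbert S real_scale p by fact
  interpret q: semi_hilbert R real_scale q by fact
  show ?thesis
  proof unfold_locales
    fix x y :: "('x \<Rightarrow> complex) \<times> ('y \<Rightarrow> complex)" assume "x \<in> S \<times> R" "y \<in> S \<times> R"
    then show "p (fst x) (fst y) + q (snd x) (snd y) = p (fst y) (fst x) + q (snd y) (snd x)"
      using p.ip_sym[of "fst x" "fst y"] q.ip_sym[of "snd x" "snd y"] by auto
  next
    fix X :: "nat \<Rightarrow> ('x \<Rightarrow> complex) \<times> ('y \<Rightarrow> complex)"
    let ?P = "\<lambda>u v. p (fst u) (fst v) + q (snd u) (snd v)"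
    assume X: "\<And>n. X n \<in> S \<times> R"
      and C: "\<And>e. e > 0 \<Longrightarrow> \<exists>N. \<forall>m\<ge>N. \<forall>n\<ge>N. ?P (X m - X n) (X m - X n) < e"
    have XS [simp]: "fst (X n) \<in> S" "snd (X n) \<in> R" for n using X[of n] by auto
    have le: "p (fst (X m) - fst (X n)) (fst (X m) - fst (X n)) \<le> ?P (X m - X n) (X m - X n)"
      "q (snd (X m) - snd (X n)) (snd (X m) - snd (X n)) \<le> ?P (X m - X n) (X m - X n)" for m n
      by auto
    have "\<exists>x\<in>S. (\<lambda>n. p (fst (X n) - x) (fst (X n) - x)) \<longlonglongrightarrow> 0"
      by (rule p.complete) (use C le(1) in \<open>auto, meson le_less_trans\<close>)
    moreover have "\<exists>x\<in>R. (\<lambda>n. q (snd (X n) - x) (snd (X n) - x)) \<longlonglongrightarrow> 0"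
      by (rule q.complete) (use C le(2) in \<open>auto, meson le_less_trans\<close>)
    ultimately obtain x y where xy: "x \<in> S" "(\<lambda>n. p (fst (X n) - x) (fst (X n) - x)) \<longlonglongrightarrow> 0"
        "y \<in> R" "(\<lambda>n. q (snd (X n) - y) (snd (X n) - y)) \<longlonglongrightarrow> 0" by auto
    have "(\<lambda>n. ?P (X n - (x, y)) (X n - (x, y))) \<longlonglongrightarrow> 0"
      using tendsto_add[OF xy(2,4)] by simp
    then show "\<exists>x\<in>S \<times> R. (\<lambda>n. ?P (X n - x) (X n - x)) \<longlonglongrightarrow> 0" using xy by auto
  next
    fix x :: "('x \<Rightarrow> complex) \<times> ('y \<Rightarrow> complex)" assume "x \<in> S \<times> R"
    then show "(real_scale (- 1) (fst x), real_scale (- 1) (snd x)) = - x"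
      using p.sc_minus_one[of "fst x"] q.sc_minus_one[of "snd x"] by (auto simp: prod_eq_iff)
  qed (auto simp: p.ip_add_left q.ip_add_left p.ip_sc_left q.ip_sc_left p.sc_mem q.sc_mem zero_prod_def distrib_left)
qed

lemma real_ip_cong_AE:
  assumes "f \<in> L2 M" "g \<in> L2 M" "f' \<in> L2 M" "g' \<in> L2 M" "AE x in M. f x = f' x" "AE x in M. g x = g' x"
  shows "real_ip M f g = real_ip M f' g'"
  unfolding real_ip_def
  by (intro arg_cong[of _ _ Re] integral_cong_AE)
    (use assms in \<open>auto intro!: borel_measurable_times borel_measurable_cnj intro: L2_measurable\<close>)

section \<open>Smooth functions\<close>

lemma partial_eq: "(f has_derivative f') (at x) \<Longrightarrow> partial i f x = f' i"
  unfolding partial_def using frechet_derivative_at by metis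

lemma partial_add:
  "f differentiable (at x) \<Longrightarrow> g differentiable (at x) \<Longrightarrow>
    partial i (\<lambda>x. f x + g x) x = partial i f x + partial i g x"
  unfolding partial_def[of i f] partial_def[of i g]
  by (intro partial_eq[OF has_derivative_add, THEN trans]) (auto simp: frechet_derivative_works[symmetric])

lemma partial_mult:
  "f differentiable (at x) \<Longrightarrow> g differentiable (at x) \<Longrightarrow>
    partial i (\<lambda>x. f x * g x) x = f x * partial i g x + partial i f x * g x"
  unfolding partial_def[of i f] partial_def[of i g]
  by (intro partial_eq[OF has_derivative_mult, THEN trans]) (auto simp: frechet_derivative_works[symmetric])

lemma partial_cnj:
  "f differentiable (at x) \<Longrightarrow> partial i (\<lambda>x. cnj (f x)) x = cnj (partial i f x)"
  unfolding partial_def[of i f]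
  by (intro partial_eq[OF has_derivative_cnj, THEN trans]) (auto simp: frechet_derivative_works[symmetric])

text \<open>The derivative is written with products and inverses only, so that the induction in
  \<open>C_times_inverse\<close> can treat it by \<open>C_times_mult\<close> and its own
  hypothesis.\<close>

lemma partial_inverse:
  "f differentiable (at x) \<Longrightarrow> f x \<noteq> 0 \<Longrightarrow>
    partial i (\<lambda>x. inverse (f x)) x = (- 1) * (partial i f x * (inverse (f x) * inverse (f x)))"
  unfolding partial_def[of i f]
  by (intro partial_eq[OF Deriv.has_derivative_inverse, THEN trans]) (auto simp: frechet_derivative_works[symmetric])

lemma partial_const [simp]: "partial i (\<lambda>x. c) = (\<lambda>x. 0)"
  by (intro ext partial_eq has_derivative_const)

lemma C_times_continuous: "C_times n f \<Longrightarrow> continuous_on UNIV f"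
  by (cases n) (auto simp: continuous_on_eq_continuous_at differentiable_imp_continuous_within)

text \<open>Product and quotient rules keep factors undifferentiated; this lowers their order to the
  one the induction hypotheses speak about.\<close>

lemma C_times_Suc_imp: "C_times (Suc n) f \<Longrightarrow> C_times n f"
proof (induction n arbitrary: f)
  case 0
  then show ?case using C_times_continuous[of 1 f] by simp
next
  case (Suc n)
  then show ?case by (metis C_times.simps(2))
qed

lemma C_times_const: "C_times n (\<lambda>x. c)"
  by (induction n arbitrary: c) auto

lemma C_times_add: "C_times n f \<Longrightarrow> C_times n g \<Longrightarrow> C_times n (\<lambda>x. f x + g x)"
proof (induction n arbitrary: f g)
  case 0
  then show ?case by (simp add: continuous_on_add)
next
  case (Suc n)
  then have "partial i (\<lambda>x. f x + g x) = (\<lambda>x. partial i f x + partial i g x)" for i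
    by (auto intro!: ext partial_add)
  with Suc show ?case by auto
qed

lemma C_times_mult: "C_times n f \<Longrightarrow> C_times n g \<Longrightarrow> C_times n (\<lambda>x. f x * g x)"
proof (induction n arbitrary: f g)
  case 0
  then show ?case by (simp add: continuous_on_mult)
next
  case (Suc n)
  then have "partial i (\<lambda>x. f x * g x) = (\<lambda>x. f x * partial i g x + partial i f x * g x)" for i
    by (auto intro!: ext partial_mult)
  moreover have "C_times n (\<lambda>x. f x * partial i g x + partial i f x * g x)" if "i \<in> Basis" for i
    using Suc that C_times_Suc_imp[OF Suc.prems(1)] C_times_Suc_imp[OF Suc.prems(2)]
    by (intro C_times_add Suc.IH) auto
  ultimately show ?case using Suc.prems by auto
qed

lemma C_times_inverse: "C_times n f \<Longrightarrow> (\<And>x. f x \<noteq> 0) \<Longrightarrow> C_times n (\<lambda>x. inverse (f x))"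
proof (induction n arbitrary: f)
  case 0
  then show ?case by (simp add: continuous_on_inverse)
next
  case (Suc n)
  then have "partial i (\<lambda>x. inverse (f x)) = (\<lambda>x. (- 1) * (partial i f x * (inverse (f x) * inverse (f x))))" for i
    by (intro ext partial_inverse) auto
  moreover have "C_times n (\<lambda>x. (- 1) * (partial i f x * (inverse (f x) * inverse (f x))))" if "i \<in> Basis" for i
    using Suc that C_times_Suc_imp[OF Suc.prems(1)]
    by (intro C_times_mult C_times_const Suc.IH) auto
  ultimately show ?case using Suc.prems by auto
qed

lemma C_times_cnj: "C_times n f \<Longrightarrow> C_times n (\<lambda>x. cnj (f x))"
proof (induction n arbitrary: f)
  case 0
  then show ?case by (simp add: continuous_on_cnj)
next
  case (Suc n)
  then have "partial i (\<lambda>x. cnj (f x)) = (\<lambda>x. cnj (partial i f x))" for i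
    by (auto intro!: ext partial_cnj)
  moreover have "(\<lambda>x. cnj (f x)) differentiable (at x)" for x
    using Suc.prems has_derivative_cnj unfolding differentiable_def C_times.simps by blast
  ultimately show ?case using Suc by auto
qed

lemma smooth_iff:
  "smooth f \<longleftrightarrow> (\<forall>x. f differentiable (at x)) \<and> (\<forall>i\<in>Basis. smooth (partial i f))"
proof
  assume f: "smooth f"
  then have "C_times (Suc k) f" for k unfolding smooth_def by blast
  then show "(\<forall>x. f differentiable (at x)) \<and> (\<forall>i\<in>Basis. smooth (partial i f))"
    by (auto simp: smooth_def)
next
  assume f: "(\<forall>x. f differentiable (at x)) \<and> (\<forall>i\<in>Basis. smooth (partial i f))"
  then have S: "C_times (Suc k) f" for k by (auto simp: smooth_def)
  then show "smooth f" unfolding smooth_def using C_times_Suc_imp by blast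
qed

lemma smooth_differentiable: "smooth f \<Longrightarrow> f differentiable (at x)"
  using smooth_iff by blast

lemma smooth_partial: "smooth f \<Longrightarrow> i \<in> Basis \<Longrightarrow> smooth (partial i f)"
  using smooth_iff by blast

lemma smooth_continuous: "smooth f \<Longrightarrow> continuous_on UNIV f"
  using C_times_continuous smooth_def by blast

lemma smooth_measurable [measurable_dest]: "smooth f \<Longrightarrow> f \<in> borel_measurable borel"
  by (intro borel_measurable_continuous_onI smooth_continuous)

lemma smooth_const: "smooth (\<lambda>x. c)"
  by (simp add: smooth_def C_times_const)

lemma smooth_add: "smooth f \<Longrightarrow> smooth g \<Longrightarrow> smooth (\<lambda>x. f x + g x)"
  by (simp add: smooth_def C_times_add)

lemma smooth_mult: "smooth f \<Longrightarrow> smooth g \<Longrightarrow> smooth (\<lambda>x. f x * g x)"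
  by (simp add: smooth_def C_times_mult)

lemma smooth_inverse: "smooth f \<Longrightarrow> (\<And>x. f x \<noteq> 0) \<Longrightarrow> smooth (\<lambda>x. inverse (f x))"
  by (simp add: smooth_def C_times_inverse)

lemma smooth_cnj: "smooth f \<Longrightarrow> smooth (\<lambda>x. cnj (f x))"
  by (simp add: smooth_def C_times_cnj)

lemma smooth_diff: "smooth f \<Longrightarrow> smooth g \<Longrightarrow> smooth (\<lambda>x. f x - g x)"
  using smooth_add[of f "\<lambda>x. (- 1) * g x"] smooth_mult[OF smooth_const, of g "- 1"] by simp

lemma smooth_sum: "(\<And>i. i \<in> I \<Longrightarrow> smooth (f i)) \<Longrightarrow> smooth (\<lambda>x. \<Sum>i\<in>I. f i x)"
  by (induction I rule: infinite_finite_induct) (auto intro: smooth_const smooth_add)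

lemma smooth_prod: "(\<And>i. i \<in> I \<Longrightarrow> smooth (f i)) \<Longrightarrow> smooth (\<lambda>x. \<Prod>i\<in>I. f i x)"
  by (induction I rule: infinite_finite_induct) (auto intro: smooth_const smooth_mult)

lemma smooth_inner: "smooth (\<lambda>x. complex_of_real (x \<bullet> v))"
proof -
  have d: "((\<lambda>x. complex_of_real (x \<bullet> v)) has_derivative (\<lambda>y. complex_of_real (y \<bullet> v))) (at x)" for x
    by (auto intro!: derivative_eq_intros)
  have "partial i (\<lambda>x. complex_of_real (x \<bullet> v)) = (\<lambda>x. complex_of_real (i \<bullet> v))" for i
    by (intro ext partial_eq[OF d])
  then show ?thesis
    by (subst smooth_iff) (use d in \<open>auto simp: differentiable_def smooth_const\<close>)
qed

lemma smooth_dist_sq: "smooth (\<lambda>x. complex_of_real ((dist x p)\<^sup>2))"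
proof -
  have "complex_of_real ((dist x p)\<^sup>2) =
      (\<Sum>i\<in>Basis. (complex_of_real (x \<bullet> i) - complex_of_real (p \<bullet> i)) * (complex_of_real (x \<bullet> i) - complex_of_real (p \<bullet> i)))" for x
  proof -
    have "(dist x p)\<^sup>2 = (x - p) \<bullet> (x - p)" by (simp only: dist_norm power2_norm_eq_inner)
    also have "\<dots> = (\<Sum>i\<in>Basis. ((x - p) \<bullet> i) * ((x - p) \<bullet> i))" by (rule euclidean_inner)
    finally show ?thesis by (simp add: inner_diff_left)
  qed
  then show ?thesis
    by (simp only:) (intro smooth_sum smooth_mult smooth_diff smooth_inner smooth_const)
qed

section \<open>Bump functions\<close>

text \<open>For \<open>k = 0\<close> this is the classical flat function exp(-1/s), extended by 0.
  Allowing powers of \<open>s\<close> in the denominator closes the family under differentiation up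
  to linear combinations, so that one induction on the order, over all \<open>k\<close> at once,
  proves smoothness.\<close>

definition flat_exp :: "nat \<Rightarrow> real \<Rightarrow> real" where
  "flat_exp k s = (if s > 0 then exp (- 1 / s) / s ^ k else 0)"

lemma flat_tendsto_0: "(flat_exp k \<longlongrightarrow> 0) (at 0)"
proof (rule filterlim_split_at)
  show "(flat_exp k \<longlongrightarrow> 0) (at_left 0)"
    by (rule Lim_transform_eventually[OF tendsto_const]) (auto simp: flat_exp_def eventually_at_filter)
  have "((\<lambda>s::real. inverse s ^ k / exp (inverse s)) \<longlongrightarrow> 0) (at_right 0)"
    by (rule filterlim_compose[OF tendsto_power_div_exp_0 filterlim_inverse_at_top_right])
  then show "(flat_exp k \<longlongrightarrow> 0) (at_right 0)"
    by (rule Lim_transform_eventually)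
      (auto simp: flat_exp_def eventually_at_filter exp_minus power_inverse divide_inverse)
qed

lemma flat_has_derivative:
  "(flat_exp k has_real_derivative (flat_exp (k + 2) s - real k * flat_exp (k + 1) s)) (at s)"
proof (cases s "0 :: real" rule: linorder_cases)
  case less
  have "((\<lambda>_. 0) has_real_derivative 0) (at s)" by simp
  then have "(flat_exp k has_real_derivative 0) (at s)"
    by (rule DERIV_cong_ev[THEN iffD1, rotated 3])
      (use less in \<open>auto simp: flat_exp_def eventually_nhds intro!: exI[of _ "{..<0}"]\<close>)
  then show ?thesis using less by (simp add: flat_exp_def)
next
  case equal
  \<comment> \<open>The difference quotient at 0 is the next member \<open>flat_exp (k + 1)\<close>
    of the family, whose limit at 0 is already known.\<close>
  have "((\<lambda>h. flat_exp k h / h) \<longlongrightarrow> 0) (at 0)"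
    by (rule Lim_transform_eventually[OF flat_tendsto_0[of "k + 1"]])
      (auto simp: flat_exp_def eventually_at_filter)
  then show ?thesis using equal by (simp add: has_field_derivative_iff flat_exp_def)
next
  case greater
  have "((\<lambda>s. exp (- 1 / s) / s ^ k) has_real_derivative
      ((exp (- 1 / s) * (1 / s\<^sup>2)) * s ^ k - exp (- 1 / s) * (real k * s ^ (k - 1))) / (s ^ k * s ^ k)) (at s)"
    using greater by (auto intro!: derivative_eq_intros simp: power2_eq_square)
  also have "((exp (- 1 / s) * (1 / s\<^sup>2)) * s ^ k - exp (- 1 / s) * (real k * s ^ (k - 1))) / (s ^ k * s ^ k) =
      flat_exp (k + 2) s - real k * flat_exp (k + 1) s"
  proof -
    define E where "E = exp (- 1 / s)"
    have "((E * (1 / s\<^sup>2)) * s ^ k - E * (real k * s ^ (k - 1))) / (s ^ k * s ^ k) = E / s ^ (k + 2) - real k * (E / s ^ (k + 1))"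
    proof (cases k)
      case (Suc m)
      then show ?thesis using greater
        by (simp add: diff_divide_distrib power2_eq_square)
    qed (simp add: power2_eq_square)
    then show ?thesis using greater by (simp add: flat_exp_def E_def)
  qed
  finally show ?thesis
    by (rule DERIV_cong_ev[THEN iffD1, rotated 3])
      (use greater in \<open>auto simp: flat_exp_def eventually_nhds intro!: exI[of _ "{0<..}"]\<close>)
qed

lemma flat_nonneg: "0 \<le> flat_exp k s"
  by (simp add: flat_exp_def)

lemma flat_le_1: "flat_exp 0 s \<le> 1"
  by (simp add: flat_exp_def)

lemma flat_pos: "s > 0 \<Longrightarrow> 0 < flat_exp k s"
  by (simp add: flat_exp_def)

lemma flat_eq_0: "s \<le> 0 \<Longrightarrow> flat_exp k s = 0"
  by (simp add: flat_exp_def)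

text \<open>\<open>smooth\<close> speaks of complex-valued functions, while \<open>flat_exp\<close>
  takes a real argument. Taking real parts recovers a real derivative to which the chain rule
  applies.\<close>

lemma of_real_smooth_derivative:
  assumes "smooth (\<lambda>x. complex_of_real (h x))"
  obtains h' where "(h has_derivative h') (at x)" "\<And>i. partial i (\<lambda>x. complex_of_real (h x)) x = complex_of_real (h' i)"
proof -
  obtain D where "((\<lambda>x. complex_of_real (h x)) has_derivative D) (at x)"
    using smooth_differentiable[OF assms] by (auto simp: differentiable_def)
  from has_derivative_Re[OF this] have h: "(h has_derivative (\<lambda>v. Re (D v))) (at x)" by simp
  show thesis
    by (rule that[OF h]) (intro partial_eq has_derivative_of_real h)
qed

lemma flat_partial:
  assumes "smooth (\<lambda>x. complex_of_real (h x))"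
  shows "(\<lambda>x. complex_of_real (flat_exp k (h x))) differentiable (at x)"
    and "partial i (\<lambda>x. complex_of_real (flat_exp k (h x))) x =
      (complex_of_real (flat_exp (k + 2) (h x)) - of_nat k * complex_of_real (flat_exp (k + 1) (h x))) *
        partial i (\<lambda>x. complex_of_real (h x)) x"
proof -
  obtain h' where h': "(h has_derivative h') (at x)" "\<And>i. partial i (\<lambda>x. complex_of_real (h x)) x = complex_of_real (h' i)"
    using of_real_smooth_derivative[OF assms, of x] by blast
  have "((\<lambda>x. flat_exp k (h x)) has_derivative (\<lambda>v. (flat_exp (k + 2) (h x) - real k * flat_exp (k + 1) (h x)) * h' v)) (at x)"
    using has_derivative_compose[OF h'(1) flat_has_derivative[of k "h x", unfolded has_field_derivative_def]] .
  from has_derivative_of_real[OF this, where 'a = complex]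
  have d: "((\<lambda>x. complex_of_real (flat_exp k (h x))) has_derivative
      (\<lambda>v. complex_of_real ((flat_exp (k + 2) (h x) - real k * flat_exp (k + 1) (h x)) * h' v))) (at x)" .
  then show "(\<lambda>x. complex_of_real (flat_exp k (h x))) differentiable (at x)" by (auto simp: differentiable_def)
  show "partial i (\<lambda>x. complex_of_real (flat_exp k (h x))) x =
      (complex_of_real (flat_exp (k + 2) (h x)) - of_nat k * complex_of_real (flat_exp (k + 1) (h x))) *
        partial i (\<lambda>x. complex_of_real (h x)) x"
    by (simp add: partial_eq[OF d] h'(2))
qed

lemma smooth_flat:
  assumes h: "smooth (\<lambda>x. complex_of_real (h x))"
  shows "smooth (\<lambda>x. complex_of_real (flat_exp k (h x)))"
proof -
  have "C_times n (\<lambda>x. complex_of_real (flat_exp k (h x)))" for n k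
  proof (induction n arbitrary: k)
    case 0
    show ?case unfolding C_times.simps continuous_on_eq_continuous_at[OF open_UNIV]
      by (intro ballI differentiable_imp_continuous_within flat_partial(1)[OF h])
  next
    case (Suc n)
    have eq: "partial i (\<lambda>x. complex_of_real (flat_exp k (h x))) = (\<lambda>x. (complex_of_real (flat_exp (k + 2) (h x)) + (- of_nat k) *
        complex_of_real (flat_exp (k + 1) (h x))) * partial i (\<lambda>x. complex_of_real (h x)) x)" for i
      by (intro ext) (simp add: flat_partial(2)[OF h])
    have "C_times n (partial i (\<lambda>x. complex_of_real (h x)))" if "i \<in> Basis" for i
      using smooth_partial[OF h that] by (simp add: smooth_def)
    then have "C_times n (partial i (\<lambda>x. complex_of_real (flat_exp k (h x))))" if "i \<in> Basis" for i
      unfolding eq using that by (intro C_times_mult C_times_add C_times_const Suc.IH)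
    then show ?case using flat_partial(1)[OF h] by simp
  qed
  then show ?thesis by (simp add: smooth_def)
qed

text \<open>The factor \<open>n\<close> only sharpens the bump: for growing \<open>n\<close> it
  tends to the indicator of the open ball. The approximation of open sets uses the limit, the kink
  argument the single function with \<open>n = 1\<close>.\<close>

definition bump :: "real \<Rightarrow> 'a::euclidean_space \<Rightarrow> real \<Rightarrow> 'a \<Rightarrow> real" where
  "bump n p r x = flat_exp 0 (n * (r\<^sup>2 - (dist x p)\<^sup>2))"

lemma smooth_bump: "smooth (\<lambda>x. complex_of_real (bump n p r x))"
proof -
  have "smooth (\<lambda>x. complex_of_real n * (complex_of_real (r\<^sup>2) - complex_of_real ((dist x p)\<^sup>2)))"
    by (intro smooth_mult smooth_diff smooth_const smooth_dist_sq)
  then have "smooth (\<lambda>x. complex_of_real (n * (r\<^sup>2 - (dist x p)\<^sup>2)))" by simp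
  then show ?thesis unfolding bump_def by (rule smooth_flat)
qed

lemma bump_range: "0 \<le> bump n p r x" "bump n p r x \<le> 1"
  by (simp_all add: bump_def flat_nonneg flat_le_1)

lemma bump_outside: "n > 0 \<Longrightarrow> r \<ge> 0 \<Longrightarrow> x \<notin> ball p r \<Longrightarrow> bump n p r x = 0"
  unfolding bump_def
  by (intro flat_eq_0) (auto simp: mult_le_0_iff not_less dist_commute intro!: power_mono)

lemma bump_tendsto:
  assumes "x \<in> ball p r"
  shows "(\<lambda>n. bump (real (Suc n)) p r x) \<longlonglongrightarrow> 1"
proof -
  let ?c = "r\<^sup>2 - (dist x p)\<^sup>2"
  have c: "?c > 0" using assms by (simp add: dist_commute power_strict_mono)
  have "(\<lambda>n. exp (- ((1 / ?c) / real (Suc n)))) \<longlonglongrightarrow> exp (- 0)"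
    by (intro tendsto_exp tendsto_minus lim_const_over_n[THEN LIMSEQ_Suc])
  moreover have "bump (real (Suc n)) p r x = exp (- ((1 / ?c) / real (Suc n)))" for n
    using c by (simp add: bump_def flat_exp_def zero_less_mult_iff del: of_nat_Suc)
  ultimately show ?thesis by simp
qed

text \<open>Differentiating \<open>flat_exp 0\<close> gives \<open>flat_exp 2\<close>. The formula
  is made explicit for its sign: inside the ball, on the side of \<open>p\<close> to which
  \<open>i\<close> points, the derivative is strictly negative.\<close>

lemma bump_partial:
  assumes "i \<in> Basis"
  shows "partial i (\<lambda>x. complex_of_real (bump 1 p r x)) x =
    complex_of_real (- 2 * ((x - p) \<bullet> i) * flat_exp 2 (r\<^sup>2 - (dist x p)\<^sup>2))"
proof -
  have "smooth (\<lambda>x. complex_of_real (r\<^sup>2) - complex_of_real ((dist x p)\<^sup>2))"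
    by (intro smooth_diff smooth_const smooth_dist_sq)
  then have s: "smooth (\<lambda>x. complex_of_real (r\<^sup>2 - (dist x p)\<^sup>2))" by simp
  have "((\<lambda>x. r\<^sup>2 - (x - p) \<bullet> (x - p)) has_derivative (\<lambda>v. - ((x - p) \<bullet> v + v \<bullet> (x - p)))) (at x)"
    by (auto intro!: derivative_eq_intros)
  then have "((\<lambda>x. r\<^sup>2 - (dist x p)\<^sup>2) has_derivative (\<lambda>v. - ((x - p) \<bullet> v + v \<bullet> (x - p)))) (at x)"
    by (simp add: dist_norm power2_norm_eq_inner)
  from partial_eq[OF has_derivative_of_real[OF this]] flat_partial(2)[OF s, of i 0 x]
  show ?thesis by (simp add: bump_def inner_commute numeral_2_eq_2)
qed

text \<open>The classical quotient of flat functions. The first one vanishes at distance at least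
  \<open>s\<close> from \<open>p\<close>, the second at distance at most \<open>r\<close>, and for
  \<open>r < s\<close> they never vanish together.\<close>

definition cutoff :: "'a::euclidean_space \<Rightarrow> real \<Rightarrow> real \<Rightarrow> 'a \<Rightarrow> real" where
  "cutoff p r s x = flat_exp 0 (s\<^sup>2 - (dist x p)\<^sup>2) *
    inverse (flat_exp 0 (s\<^sup>2 - (dist x p)\<^sup>2) + flat_exp 0 ((dist x p)\<^sup>2 - r\<^sup>2))"

lemma smooth_cutoff:
  assumes "0 < r" "r < s"
  shows "smooth (\<lambda>x. complex_of_real (cutoff p r s x))"
proof -
  let ?A = "\<lambda>x. flat_exp 0 (s\<^sup>2 - (dist x p)\<^sup>2)" and ?B = "\<lambda>x. flat_exp 0 ((dist x p)\<^sup>2 - r\<^sup>2)"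
  have "smooth (\<lambda>x. complex_of_real (s\<^sup>2) - complex_of_real ((dist x p)\<^sup>2))"
    "smooth (\<lambda>x. complex_of_real ((dist x p)\<^sup>2) - complex_of_real (r\<^sup>2))"
    by (intro smooth_diff smooth_const smooth_dist_sq)+
  then have "smooth (\<lambda>x. complex_of_real (?A x))" "smooth (\<lambda>x. complex_of_real (?B x))"
    by (auto intro!: smooth_flat)
  moreover have "?A x + ?B x \<noteq> 0" for x
  proof -
    have "r\<^sup>2 < s\<^sup>2" using assms by (intro power_strict_mono) auto
    then have "s\<^sup>2 - (dist x p)\<^sup>2 > 0 \<or> (dist x p)\<^sup>2 - r\<^sup>2 > 0" by linarith
    then have "?A x + ?B x > 0"
      by (elim disjE) (simp_all add: add_pos_nonneg add_nonneg_pos flat_pos flat_nonneg)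
    then show ?thesis by simp
  qed
  then have "complex_of_real (?A x) + complex_of_real (?B x) \<noteq> 0" for x
    by (metis of_real_add of_real_eq_0_iff)
  ultimately have "smooth (\<lambda>x. complex_of_real (?A x) * inverse (complex_of_real (?A x) + complex_of_real (?B x)))"
    by (intro smooth_mult smooth_inverse smooth_add)
  then show ?thesis by (simp add: cutoff_def)
qed

lemma cutoff_inside: "0 < r \<Longrightarrow> r < s \<Longrightarrow> x \<in> cball p r \<Longrightarrow> cutoff p r s x = 1"
proof -
  assume a: "0 < r" "r < s" "x \<in> cball p r"
  then have "(dist x p)\<^sup>2 \<le> r\<^sup>2" "r\<^sup>2 < s\<^sup>2" by (auto simp: dist_commute intro!: power_mono power_strict_mono)
  then show ?thesis using flat_pos[of "s\<^sup>2 - (dist x p)\<^sup>2" 0] by (simp add: cutoff_def flat_eq_0[of "(dist x p)\<^sup>2 - r\<^sup>2"])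
qed

lemma cutoff_outside: "0 < s \<Longrightarrow> x \<notin> cball p s \<Longrightarrow> cutoff p r s x = 0"
  by (auto simp: cutoff_def dist_commute not_le intro!: flat_eq_0 power_mono)

section \<open>Test functions\<close>

lemma partial_outside:
  assumes "closed K" "\<And>x. x \<notin> K \<Longrightarrow> f x = 0" "x \<notin> K"
  shows "partial i f x = 0"
proof -
  have "((\<lambda>_. 0) has_derivative (\<lambda>_. 0)) (at x)" by simp
  then have "(f has_derivative (\<lambda>_. 0)) (at x)"
    by (rule has_derivative_transform_within_open[of _ _ x UNIV "- K"]) (use assms in auto)
  then show ?thesis by (rule partial_eq)
qed

lemma test_functions_I:
  "smooth f \<Longrightarrow> compact K \<Longrightarrow> K \<subseteq> \<Omega> \<Longrightarrow> (\<And>x. x \<notin> K \<Longrightarrow> f x = 0) \<Longrightarrow> f \<in> test_functions \<Omega>"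
  by (auto simp: test_functions_def)

lemma test_functions_smooth: "f \<in> test_functions \<Omega> \<Longrightarrow> smooth f"
  by (simp add: test_functions_def)

lemma test_functions_outside: "f \<in> test_functions \<Omega> \<Longrightarrow> x \<notin> \<Omega> \<Longrightarrow> f x = 0"
  by (auto simp: test_functions_def)

lemma test_functions_mono: "\<Omega> \<subseteq> \<Omega>' \<Longrightarrow> f \<in> test_functions \<Omega> \<Longrightarrow> f \<in> test_functions \<Omega>'"
  by (auto simp: test_functions_def)

lemma test_functions_partial:
  assumes "f \<in> test_functions \<Omega>" "i \<in> Basis"
  shows "partial i f \<in> test_functions \<Omega>"
proof -
  obtain K where K: "compact K" "K \<subseteq> \<Omega>" "\<And>x. x \<notin> K \<Longrightarrow> f x = 0" using assms(1) by (auto simp: test_functions_def)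
  show ?thesis
    by (rule test_functions_I[OF smooth_partial K(1,2)])
      (use assms K in \<open>auto simp: test_functions_def intro: partial_outside compact_imp_closed\<close>)
qed

lemma test_functions_mult: "f \<in> test_functions \<Omega> \<Longrightarrow> smooth g \<Longrightarrow> (\<lambda>x. g x * f x) \<in> test_functions \<Omega>"
  by (auto simp: test_functions_def intro!: smooth_mult)

lemma test_functions_cmult: "f \<in> test_functions \<Omega> \<Longrightarrow> (\<lambda>x. c * f x) \<in> test_functions \<Omega>"
  by (rule test_functions_mult[OF _ smooth_const])

lemma test_functions_cnj: "f \<in> test_functions \<Omega> \<Longrightarrow> (\<lambda>x. cnj (f x)) \<in> test_functions \<Omega>"
  by (auto simp: test_functions_def intro!: smooth_cnj)

lemma test_functions_add:
  assumes "f \<in> test_functions \<Omega>" "g \<in> test_functions \<Omega>"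
  shows "(\<lambda>x. f x + g x) \<in> test_functions \<Omega>"
proof -
  obtain K L where "compact K" "K \<subseteq> \<Omega>" "\<And>x. x \<notin> K \<Longrightarrow> f x = 0" "compact L" "L \<subseteq> \<Omega>" "\<And>x. x \<notin> L \<Longrightarrow> g x = 0"
    using assms by (auto simp: test_functions_def)
  then show ?thesis
    using assms by (intro test_functions_I[where K = "K \<union> L"]) (auto intro: smooth_add test_functions_smooth)
qed

lemma test_functions_zero: "(\<lambda>x. 0) \<in> test_functions \<Omega>"
  by (rule test_functions_I[where K = "{}"]) (auto intro: smooth_const)

lemma test_functions_sum:
  "(\<And>i. i \<in> I \<Longrightarrow> f i \<in> test_functions \<Omega>) \<Longrightarrow> (\<lambda>x. \<Sum>i\<in>I. f i x) \<in> test_functions \<Omega>"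
  by (induction I rule: infinite_finite_induct) (auto intro: test_functions_zero test_functions_add)

lemma test_functions_laplacian:
  "f \<in> test_functions \<Omega> \<Longrightarrow> (\<lambda>x. \<Sum>i\<in>Basis. partial i (partial i f) x) \<in> test_functions \<Omega>"
  by (intro test_functions_sum test_functions_partial)

lemma test_functions_bounded:
  assumes "f \<in> test_functions \<Omega>"
  obtains M where "\<And>x. cmod (f x) \<le> M"
proof -
  obtain K where K: "compact K" "\<And>x. x \<notin> K \<Longrightarrow> f x = 0" using assms by (auto simp: test_functions_def)
  have "compact (f ` K)"
    using K assms by (intro compact_continuous_image)
      (auto intro: continuous_on_subset[OF smooth_continuous[OF test_functions_smooth]])
  then obtain M where "\<And>x. x \<in> K \<Longrightarrow> cmod (f x) \<le> M"
    by (metis bounded_iff compact_imp_bounded imageI)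
  then have "cmod (f x) \<le> max M 0" for x using K(2)[of x] by (cases "x \<in> K") (auto simp: le_max_iff_disj)
  then show thesis by (rule that)
qed

lemma test_functions_measurable: "f \<in> test_functions \<Omega> \<Longrightarrow> f \<in> borel_measurable borel"
  by (intro smooth_measurable test_functions_smooth)

lemma test_functions_integrable:
  assumes "f \<in> test_functions \<Omega>"
  shows "integrable lborel f"
proof -
  obtain K where K: "compact K" "\<And>x. x \<notin> K \<Longrightarrow> f x = 0" using assms by (auto simp: test_functions_def)
  have "integrable lborel (\<lambda>x. indicator K x *\<^sub>R f x)"
    using K assms by (intro borel_integrable_compact)
      (auto intro: continuous_on_subset[OF smooth_continuous[OF test_functions_smooth]])
  also have "(\<lambda>x. indicator K x *\<^sub>R f x) = f" using K(2) by (auto simp: indicator_def)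
  finally show ?thesis .
qed

section \<open>Integration by parts\<close>

lemma lborel_integral_translate:
  fixes F :: "'a::euclidean_space \<Rightarrow> complex"
  assumes "F \<in> borel_measurable borel"
  shows "(\<integral>x. F (x + c) \<partial>lborel) = (\<integral>x. F x \<partial>lborel)"
proof -
  have "(\<integral>x. F x \<partial>lborel) = (\<integral>x. F x \<partial>distr lborel borel ((+) c))" by (simp add: lborel_distr_plus)
  also have "\<dots> = (\<integral>x. F (c + x) \<partial>lborel)" using assms by (subst integral_distr) auto
  finally show ?thesis by (simp add: add.commute)
qed

text \<open>
  Integration by parts in arbitrary dimension without Fubini: the integrals of the difference
  quotients vanish by translation invariance.
\<close>

lemma integral_directional_derivative:
  fixes F :: "'a::euclidean_space \<Rightarrow> complex"
  assumes F: "continuous_on UNIV F" and K: "compact K" "\<And>x. x \<notin> K \<Longrightarrow> F x = 0"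
    and lip: "\<And>x h. \<bar>h\<bar> \<le> 1 \<Longrightarrow> cmod (F (x + h *\<^sub>R j) - F x) \<le> L * \<bar>h\<bar>" and j: "norm j = 1"
    and D: "D \<in> borel_measurable borel"
    and lim: "AE x in lborel. (\<lambda>n. of_nat (Suc n) * (F (x + (1 / real (Suc n)) *\<^sub>R j) - F x)) \<longlonglongrightarrow> D x"
  shows "(\<integral>x. D x \<partial>lborel) = 0"
proof -
  have Fm [measurable]: "F \<in> borel_measurable borel" using F by (rule borel_measurable_continuous_onI)
  have L: "L \<ge> 0" using lip[of 1 0] order_trans[OF norm_ge_zero] by force
  have Fi: "integrable lborel F"
  proof -
    have "integrable lborel (\<lambda>x. indicator K x *\<^sub>R F x)"
      using K F by (intro borel_integrable_compact) (auto intro: continuous_on_subset)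
    also have "(\<lambda>x. indicator K x *\<^sub>R F x) = F" using K(2) by (auto simp: indicator_def)
    finally show ?thesis .
  qed
  obtain R where R: "\<And>x. x \<in> K \<Longrightarrow> norm x \<le> R" using compact_imp_bounded[OF K(1)] by (auto simp: bounded_iff)
  define s where "s n x = of_nat (Suc n) * (F (x + (1 / real (Suc n)) *\<^sub>R j) - F x)" for n x
  have [measurable]: "s n \<in> borel_measurable borel" for n unfolding s_def by measurable
  have s0: "(\<integral>x. s n x \<partial>lborel) = 0" for n
  proof -
    let ?c = "(1 / real (Suc n)) *\<^sub>R j"
    have "integrable lborel (\<lambda>x. F (x + ?c))"
      using Fi by (subst (asm) lborel_distr_plus[of ?c, symmetric], subst (asm) integrable_distr_eq)
        (auto simp: add.commute)
    then show ?thesis using Fi by (simp add: s_def lborel_integral_translate del: of_nat_Suc)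
  qed
  \<comment> \<open>The increments have length at most 1, so both points of a quotient miss
    \<open>K\<close> outside the ball of radius \<open>R + 1\<close>. Inside, the Lipschitz bound
    cancels the factor in front of the difference.\<close>
  have bound: "cmod (s n x) \<le> L * indicator (cball 0 (R + 1)) x" for n x
  proof (cases "x \<in> cball 0 (R + 1)")
    case True
    have "cmod (s n x) = real (Suc n) * cmod (F (x + (1 / real (Suc n)) *\<^sub>R j) - F x)"
      by (simp add: s_def norm_mult del: of_nat_Suc)
    also have "\<dots> \<le> real (Suc n) * (L * \<bar>1 / real (Suc n)\<bar>)" by (intro mult_left_mono lip) auto
    finally show ?thesis using True by simp
  next
    case False
    let ?y = "x + (1 / real (Suc n)) *\<^sub>R j"
    have "norm x \<le> norm ?y + 1"
    proof -
      have "norm x \<le> norm ?y + norm ((1 / real (Suc n)) *\<^sub>R j)"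
        using norm_triangle_ineq4[of ?y "(1 / real (Suc n)) *\<^sub>R j"] by simp
      also have "norm ((1 / real (Suc n)) *\<^sub>R j) \<le> 1" using j by simp
      finally show ?thesis by simp
    qed
    then have "x \<notin> K" "?y \<notin> K" using R[of x] R[of ?y] False by auto
    then show ?thesis using K(2) L by (simp add: s_def)
  qed
  have "(\<lambda>n. \<integral>x. s n x \<partial>lborel) \<longlonglongrightarrow> (\<integral>x. D x \<partial>lborel)"
  proof (rule integral_dominated_convergence[where w = "\<lambda>x. L * indicator (cball 0 (R + 1)) x"])
    show "integrable lborel (\<lambda>x::'a. L * indicator (cball 0 (R + 1)) x :: real)"
      using emeasure_bounded_finite[OF bounded_cball, of "0::'a" "R + 1"]
      by (intro Bochner_Integration.integrable_mult_right integrable_real_indicator) auto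
    show "AE x in lborel. (\<lambda>n. s n x) \<longlonglongrightarrow> D x" using lim by (simp add: s_def)
  qed (use bound D in auto)
  then show ?thesis by (simp add: s0 LIMSEQ_const_iff)
qed

text \<open>Restriction to a line in direction \<open>j\<close> leaves the mean value inequality in
  one variable, so only this one partial derivative has to be bounded.\<close>

lemma lipschitz_direction:
  assumes f: "\<And>x. f differentiable (at x)" and M: "\<And>x. cmod (partial j f x) \<le> M"
  shows "cmod (f (x + h *\<^sub>R j) - f x) \<le> M * \<bar>h\<bar>"
proof -
  define g where "g t = f (x + t *\<^sub>R j)" for t
  have d: "(g has_derivative (\<lambda>s. s *\<^sub>R partial j f (x + t *\<^sub>R j))) (at t within UNIV)" for t
  proof -
    have "(f has_derivative frechet_derivative f (at (x + t *\<^sub>R j))) (at (x + t *\<^sub>R j))"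
      using f frechet_derivative_works by blast
    moreover have "((\<lambda>t. x + t *\<^sub>R j) has_derivative (\<lambda>s. s *\<^sub>R j)) (at t)"
      by (auto intro!: derivative_eq_intros)
    ultimately have "(g has_derivative (\<lambda>s. frechet_derivative f (at (x + t *\<^sub>R j)) (s *\<^sub>R j))) (at t)"
      unfolding g_def by (rule has_derivative_compose[rotated])
    moreover have "linear (frechet_derivative f (at (x + t *\<^sub>R j)))"
      using f by (rule linear_frechet_derivative)
    ultimately show ?thesis by (simp add: partial_def linear_scale)
  qed
  have "cmod (g h - g 0) \<le> M * norm (h - 0)"
  proof (rule differentiable_bound[OF convex_UNIV d])
    fix t
    show "onorm (\<lambda>s. s *\<^sub>R partial j f (x + t *\<^sub>R j)) \<le> M"
    proof (rule onorm_le)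
      fix s show "norm (s *\<^sub>R partial j f (x + t *\<^sub>R j)) \<le> M * norm s"
        using mult_right_mono[OF M, of "\<bar>s\<bar>"] by (simp add: mult.commute)
    qed
  qed auto
  then show ?thesis by (simp add: g_def)
qed

lemma directional_limit:
  fixes f :: "'a::euclidean_space \<Rightarrow> complex"
  assumes "f differentiable (at x)"
  shows "(\<lambda>n. of_nat (Suc n) * (f (x + (1 / real (Suc n)) *\<^sub>R j) - f x)) \<longlonglongrightarrow> partial j f x"
proof -
  have fd: "(f has_derivative frechet_derivative f (at x)) (at x)" using assms frechet_derivative_works by blast
  have "((\<lambda>t. x + t *\<^sub>R j) has_derivative (\<lambda>s. s *\<^sub>R j)) (at (0::real))"
    by (auto intro!: derivative_eq_intros)
  from has_derivative_compose[OF this, of f "frechet_derivative f (at x)"] fd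
  have "((\<lambda>t. f (x + t *\<^sub>R j)) has_derivative (\<lambda>s. frechet_derivative f (at x) (s *\<^sub>R j))) (at 0)" by simp
  moreover have "linear (frechet_derivative f (at x))" using assms by (rule linear_frechet_derivative)
  ultimately have "((\<lambda>t. f (x + t *\<^sub>R j)) has_derivative (\<lambda>s. s *\<^sub>R partial j f x)) (at 0)"
    by (simp add: partial_def linear_scale)
  then have "((\<lambda>h. norm (f (x + h *\<^sub>R j) - f x - h *\<^sub>R partial j f x) / norm h) \<longlongrightarrow> 0) (at 0)"
    by (simp add: has_derivative_at)
  moreover have "filterlim (\<lambda>n. 1 / real (Suc n)) (at 0) sequentially"
    unfolding filterlim_at using lim_const_over_n[THEN LIMSEQ_Suc, of 1] by simp
  ultimately have "(\<lambda>n. norm (f (x + (1 / real (Suc n)) *\<^sub>R j) - f x - (1 / real (Suc n)) *\<^sub>R partial j f x) / norm (1 / real (Suc n))) \<longlonglongrightarrow> 0"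
    by (rule filterlim_compose)
  moreover have "norm (f (x + (1 / real (Suc n)) *\<^sub>R j) - f x - (1 / real (Suc n)) *\<^sub>R partial j f x) / norm (1 / real (Suc n)) =
      norm (of_nat (Suc n) * (f (x + (1 / real (Suc n)) *\<^sub>R j) - f x) - partial j f x)" for n
  proof -
    let ?d = "f (x + (1 / real (Suc n)) *\<^sub>R j) - f x"
    have "?d - (1 / real (Suc n)) *\<^sub>R partial j f x = (1 / real (Suc n)) *\<^sub>R (of_nat (Suc n) * ?d - partial j f x)"
      by (simp add: scaleR_conv_of_real right_diff_distrib del: of_nat_Suc)
    then show ?thesis by (simp only: norm_scaleR) simp
  qed
  ultimately have "(\<lambda>n. norm (of_nat (Suc n) * (f (x + (1 / real (Suc n)) *\<^sub>R j) - f x) - partial j f x)) \<longlonglongrightarrow> 0"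
    by simp
  then show ?thesis by (rule LIM_zero_cancel[OF tendsto_norm_zero_cancel])
qed

text \<open>The factor \<open>p\<close> is only Lipschitz along \<open>j\<close> with a limit of
  forward quotients almost everywhere, so that a function with a kink along a hyperplane qualifies.
  The compact support of \<open>q\<close> makes the product globally Lipschitz along
  \<open>j\<close> even for unbounded \<open>p\<close>, and
  \<open>integral_directional_derivative\<close> applies to it.\<close>

lemma integration_by_parts:
  fixes p :: "'a::euclidean_space \<Rightarrow> complex"
  assumes j: "j \<in> Basis" and q: "q \<in> test_functions UNIV"
    and p: "continuous_on UNIV p" and lip: "\<And>x h. cmod (p (x + h *\<^sub>R j) - p x) \<le> L * \<bar>h\<bar>"
    and p': "p' \<in> borel_measurable borel"
    and lim: "AE x in lborel. (\<lambda>n. of_nat (Suc n) * (p (x + (1 / real (Suc n)) *\<^sub>R j) - p x)) \<longlonglongrightarrow> p' x"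
  shows "(\<integral>x. p x * partial j q x + p' x * q x \<partial>lborel) = 0"
proof -
  have qs: "smooth q" using q by (rule test_functions_smooth)
  obtain K where K: "compact K" "\<And>x. x \<notin> K \<Longrightarrow> q x = 0" using q by (auto simp: test_functions_def)
  obtain Mq where Mq: "\<And>x. cmod (q x) \<le> Mq" using test_functions_bounded[OF q] by blast
  obtain Mj where Mj: "\<And>x. cmod (partial j q x) \<le> Mj"
    using test_functions_bounded[OF test_functions_partial[OF q j]] by blast
  have "compact (p ` K)" using K p by (intro compact_continuous_image) (auto intro: continuous_on_subset)
  then obtain Mp where "\<forall>x\<in>p ` K. cmod x \<le> Mp" using compact_imp_bounded bounded_iff by metis
  then have Mp: "\<And>x. x \<in> K \<Longrightarrow> cmod (p x) \<le> Mp" by auto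
  have L: "L \<ge> 0" using lip[of 0 1] order_trans[OF norm_ge_zero] by force
  have Mj0: "Mj \<ge> 0" and Mq0: "Mq \<ge> 0" using Mj Mq order_trans[OF norm_ge_zero] by blast+
  have qlip: "cmod (q (x + h *\<^sub>R j) - q x) \<le> Mj * \<bar>h\<bar>" for x h
    using smooth_differentiable[OF qs] Mj by (rule lipschitz_direction)
  show ?thesis
  proof (rule integral_directional_derivative[where F = "\<lambda>x. p x * q x" and K = K and L = "\<bar>Mp\<bar> * Mj + L * Mq"])
    show "continuous_on UNIV (\<lambda>x. p x * q x)" using p smooth_continuous[OF qs] by (rule continuous_on_mult)
    fix x :: 'a and h :: real
    let ?y = "x + h *\<^sub>R j"
    \<comment> \<open>Values of \<open>p\<close> are bounded on \<open>K\<close> only, so the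
      increment of the product is split with \<open>p\<close> taken at whichever of the two points
      lies in \<open>K\<close>; if neither does, both products vanish.\<close>
    have pq: "cmod (a * (b - c)) + cmod ((a' - b') * c') \<le> (\<bar>Mp\<bar> * Mj + L * Mq) * \<bar>h\<bar>"
      if "cmod a \<le> Mp" "cmod (b - c) \<le> Mj * \<bar>h\<bar>" "cmod (a' - b') \<le> L * \<bar>h\<bar>" "cmod c' \<le> Mq" for a b c a' b' c'
    proof -
      have "cmod a * cmod (b - c) \<le> \<bar>Mp\<bar> * (Mj * \<bar>h\<bar>)" using that Mj0 by (intro mult_mono) auto
      moreover have "cmod (a' - b') * cmod c' \<le> (L * \<bar>h\<bar>) * Mq" using that L by (intro mult_mono) auto
      ultimately have "cmod a * cmod (b - c) + cmod (a' - b') * cmod c' \<le> \<bar>Mp\<bar> * (Mj * \<bar>h\<bar>) + (L * \<bar>h\<bar>) * Mq"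
        by (rule add_mono)
      also have "\<dots> = (\<bar>Mp\<bar> * Mj + L * Mq) * \<bar>h\<bar>" by (simp add: algebra_simps)
      finally show ?thesis by (simp only: norm_mult)
    qed
    show "cmod (p ?y * q ?y - p x * q x) \<le> (\<bar>Mp\<bar> * Mj + L * Mq) * \<bar>h\<bar>"
    proof (cases "x \<in> K")
      case True
      have "p ?y * q ?y - p x * q x = p x * (q ?y - q x) + (p ?y - p x) * q ?y" by (simp add: algebra_simps)
      then show ?thesis
        using norm_triangle_ineq[of "p x * (q ?y - q x)" "(p ?y - p x) * q ?y"]
          pq[OF Mp[OF True] qlip[of x h] lip[of x h] Mq[of ?y]] by simp
    next
      case False
      then have x0: "q x = 0" by (rule K(2))
      show ?thesis
      proof (cases "?y \<in> K")
        case True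
        then show ?thesis using pq[OF Mp[OF True] qlip[of x h] lip[of x h] Mq[of x]] x0 by simp
      next
        case False
        then show ?thesis using K(2) x0 L Mj0 Mq0 by simp
      qed
    qed
  next
    show "(\<lambda>x. p x * partial j q x + p' x * q x) \<in> borel_measurable borel"
      using p' borel_measurable_continuous_onI[OF p] smooth_measurable[OF qs] smooth_measurable[OF smooth_partial[OF qs j]]
      by measurable
    show "AE x in lborel. (\<lambda>n. of_nat (Suc n) * (p (x + (1 / real (Suc n)) *\<^sub>R j) * q (x + (1 / real (Suc n)) *\<^sub>R j) - p x * q x))
        \<longlonglongrightarrow> p x * partial j q x + p' x * q x"
      using lim
    proof eventually_elim
      case (elim x)
      let ?y = "\<lambda>n. x + (1 / real (Suc n)) *\<^sub>R j"
      have y: "?y \<longlonglongrightarrow> x"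
        using tendsto_add[OF tendsto_const tendsto_scaleR[OF lim_const_over_n[THEN LIMSEQ_Suc, of 1] tendsto_const], of x j]
        by simp
      have "isCont p x" using p by (simp add: continuous_on_eq_continuous_at)
      then have py: "(\<lambda>n. p (?y n)) \<longlonglongrightarrow> p x" using y by (rule isCont_tendsto_compose)
      have "(\<lambda>n. p (?y n) * (of_nat (Suc n) * (q (?y n) - q x)) + of_nat (Suc n) * (p (?y n) - p x) * q x)
          \<longlonglongrightarrow> p x * partial j q x + p' x * q x"
        by (intro tendsto_add tendsto_mult py elim tendsto_const directional_limit smooth_differentiable[OF qs])
      then show ?case by (rule Lim_transform_eventually) (simp add: algebra_simps)
    qed
  qed (use K j in auto)
qed

lemma integral_partial_test_function:
  assumes "i \<in> Basis" "q \<in> test_functions UNIV"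
  shows "(\<integral>x. partial i q x \<partial>lborel) = 0"
  using integration_by_parts[OF assms, of "\<lambda>_. 1" 0 "\<lambda>_. 0"] by simp

lemma integration_by_parts_smooth:
  assumes j: "j \<in> Basis" and q: "q \<in> test_functions UNIV" and p: "p \<in> test_functions UNIV"
  shows "(\<integral>x. p x * partial j q x \<partial>lborel) = - (\<integral>x. partial j p x * q x \<partial>lborel)"
proof -
  note d = smooth_differentiable[OF test_functions_smooth[OF p]] smooth_differentiable[OF test_functions_smooth[OF q]]
  have "(\<integral>x. partial j (\<lambda>x. p x * q x) x \<partial>lborel) = 0"
    by (intro integral_partial_test_function j test_functions_mult q test_functions_smooth[OF p])
  then have "(\<integral>x. p x * partial j q x + partial j p x * q x \<partial>lborel) = 0"
    by (simp add: partial_mult[OF d])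
  moreover have "integrable lborel (\<lambda>x. p x * partial j q x)" "integrable lborel (\<lambda>x. partial j p x * q x)"
    by (intro test_functions_integrable[where \<Omega> = UNIV] test_functions_mult test_functions_partial p q j
        test_functions_smooth[OF p] test_functions_smooth[OF test_functions_partial[OF p j]])+
  ultimately show ?thesis by (simp add: eq_neg_iff_add_eq_0)
qed

section \<open>The fundamental lemma of the calculus of variations\<close>

text \<open>By Lindelof's theorem \<open>G\<close> is a countable union of balls whose closures lie
  in \<open>G\<close>. At a point of \<open>G\<close> the product of the factors
  \<open>1 - bump\<close> over the first \<open>n\<close> balls is eventually dominated by the
  factor of a ball containing the point, which tends to 0 because the sharpness grows with
  \<open>n\<close>. Each function involves finitely many balls, so its support is compact.\<close>

lemma smooth_approx_open:
  fixes G :: "'a::euclidean_space set"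
  assumes G: "open G"
  obtains \<psi> :: "nat \<Rightarrow> 'a \<Rightarrow> real" where "\<And>n. (\<lambda>x. complex_of_real (\<psi> n x)) \<in> test_functions G"
    "\<And>n x. 0 \<le> \<psi> n x \<and> \<psi> n x \<le> 1" "\<And>x. (\<lambda>n. \<psi> n x) \<longlonglongrightarrow> indicator G x"
proof -
  define \<F> where "\<F> = {B. \<exists>p r. B = ball p r \<and> r > 0 \<and> cball p r \<subseteq> G}"
  obtain \<F>' where F': "\<F>' \<subseteq> \<F>" "countable \<F>'" "\<Union>\<F>' = \<Union>\<F>"
    using Lindelof[of \<F>] by (auto simp: \<F>_def)
  have UF: "\<Union>\<F> = G"
  proof
    show "\<Union>\<F> \<subseteq> G" unfolding \<F>_def using ball_subset_cball by blast
    show "G \<subseteq> \<Union>\<F>"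
    proof
      fix x assume "x \<in> G"
      then obtain r where r: "r > 0" "cball x r \<subseteq> G" using G open_contains_cball by blast
      then have "ball x r \<in> \<F>" by (auto simp: \<F>_def)
      then show "x \<in> \<Union>\<F>" using r by (intro UnionI[of "ball x r"]) auto
    qed
  qed
  show thesis
  proof (cases "\<F>' = {}")
    case True
    then have "G = {}" using F' UF by auto
    then show thesis by (intro that[of "\<lambda>_ _. 0"]) (auto intro: test_functions_zero)
  next
    case False
    then obtain B :: "nat \<Rightarrow> 'a set" where B: "range B = \<F>'" using range_from_nat_into[OF False F'(2)] by blast
    have "B k \<in> \<F>" for k using B F'(1) by blast
    then have "\<exists>p r. B k = ball p r \<and> r > 0 \<and> cball p r \<subseteq> G" for k
      by (simp add: \<F>_def)
    then obtain p r where pr: "\<And>k::nat. B k = ball (p k) (r k)" "\<And>k. r k > 0" "\<And>k. cball (p k) (r k) \<subseteq> G" by metis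
    have UB: "(\<Union>k. ball (p k) (r k)) = G" using B F'(3) UF pr(1) by auto
    define \<psi> where "\<psi> n x = 1 - (\<Prod>k<n. 1 - bump (real (Suc n)) (p k) (r k) x)" for n x
    have P: "0 \<le> (\<Prod>k<n. 1 - bump (real (Suc n)) (p k) (r k) x)" "(\<Prod>k<n. 1 - bump (real (Suc n)) (p k) (r k) x) \<le> 1" for n x
      using bump_range by (auto intro!: prod_nonneg prod_le_1)
    show thesis
    proof (rule that)
      fix n
      show "(\<lambda>x. complex_of_real (\<psi> n x)) \<in> test_functions G"
      proof (rule test_functions_I[where K = "\<Union>k<n. cball (p k) (r k)"])
        have "smooth (\<lambda>x. 1 - (\<Prod>k<n. 1 - complex_of_real (bump (real (Suc n)) (p k) (r k) x)))"
          by (intro smooth_diff smooth_const smooth_prod smooth_bump)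
        then show "smooth (\<lambda>x. complex_of_real (\<psi> n x))" by (simp add: \<psi>_def)
        fix x assume "x \<notin> (\<Union>k<n. cball (p k) (r k))"
        then have "x \<notin> ball (p k) (r k)" if "k < n" for k
          using that ball_subset_cball[of "p k" "r k"] by blast
        then have "bump (real (Suc n)) (p k) (r k) x = 0" if "k < n" for k
          using that pr(2)[of k] by (intro bump_outside) auto
        then show "complex_of_real (\<psi> n x) = 0" by (simp add: \<psi>_def)
      qed (use pr(3) in \<open>auto intro!: compact_UN\<close>)
    next
      fix n x show "0 \<le> \<psi> n x \<and> \<psi> n x \<le> 1" using P[of n x] by (simp add: \<psi>_def)
    next
      fix x show "(\<lambda>n. \<psi> n x) \<longlonglongrightarrow> indicator G x"
      proof (cases "x \<in> G")
        case True
        then obtain m where m: "x \<in> ball (p m) (r m)" using UB by auto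
        have "(\<lambda>n. 1 - bump (real (Suc n)) (p m) (r m) x) \<longlonglongrightarrow> 1 - 1"
          by (intro tendsto_diff tendsto_const bump_tendsto m)
        then have lim: "(\<lambda>n. 1 - bump (real (Suc n)) (p m) (r m) x) \<longlonglongrightarrow> 0" by simp
        have "(\<lambda>n. \<Prod>k<n. 1 - bump (real (Suc n)) (p k) (r k) x) \<longlonglongrightarrow> 0"
        proof (rule tendsto_sandwich[OF _ _ tendsto_const lim])
          have "(\<Prod>k<n. 1 - bump (real (Suc n)) (p k) (r k) x) \<le> 1 - bump (real (Suc n)) (p m) (r m) x" if "n > m" for n
          proof -
            have "(\<Prod>k<n. 1 - bump (real (Suc n)) (p k) (r k) x) = (1 - bump (real (Suc n)) (p m) (r m) x) *
                (\<Prod>k\<in>{..<n} - {m}. 1 - bump (real (Suc n)) (p k) (r k) x)"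
              using that by (intro prod.remove) auto
            also have "\<dots> \<le> (1 - bump (real (Suc n)) (p m) (r m) x) * 1"
              using bump_range by (intro mult_left_mono prod_le_1) auto
            finally show ?thesis by simp
          qed
          then show "\<forall>\<^sub>F n in sequentially. (\<Prod>k<n. 1 - bump (real (Suc n)) (p k) (r k) x) \<le> 1 - bump (real (Suc n)) (p m) (r m) x"
            by (auto simp: eventually_sequentially intro!: exI[of _ "Suc m"])
        qed (use P in auto)
        then show ?thesis using True tendsto_diff[OF tendsto_const[of "1::real"]] by (force simp: \<psi>_def)
      next
        case False
        then have "bump (real (Suc n)) (p k) (r k) x = 0" for n k
          using UB pr(2)[of k] by (intro bump_outside) auto
        then show ?thesis using False by (simp add: \<psi>_def)
      qed
    qed
  qed
qed

text \<open>Dominated convergence along \<open>smooth_approx_open\<close> makes the integral of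
  \<open>f\<close> over each open subset of \<open>G\<close> vanish. Open sets form an
  intersection-stable generator, so the restriction of \<open>f\<close> to \<open>G\<close>
  integrates to 0 over every Borel set, and uniqueness of densities concludes.\<close>

lemma fundamental_lemma:
  fixes f :: "'a::euclidean_space \<Rightarrow> complex"
  assumes G: "open G" and f: "integrable lborel f"
    and test: "\<And>\<psi>. \<psi> \<in> test_functions G \<Longrightarrow> (\<integral>x. f x * \<psi> x \<partial>lborel) = 0"
  shows "AE x in lborel. x \<in> G \<longrightarrow> f x = 0"
proof -
  have opn: "(\<integral>x. indicator U x *\<^sub>R f x \<partial>lborel) = 0" if U: "open U" "U \<subseteq> G" for U
  proof -
    obtain \<psi> :: "nat \<Rightarrow> 'a \<Rightarrow> real" where \<psi>: "\<And>n. (\<lambda>x. complex_of_real (\<psi> n x)) \<in> test_functions U"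
      "\<And>n x. 0 \<le> \<psi> n x \<and> \<psi> n x \<le> 1" "\<And>x. (\<lambda>n. \<psi> n x) \<longlonglongrightarrow> indicator U x"
      using smooth_approx_open[OF U(1)] by blast
    have "(\<lambda>n. \<integral>x. f x * complex_of_real (\<psi> n x) \<partial>lborel) \<longlonglongrightarrow> (\<integral>x. f x * complex_of_real (indicator U x) \<partial>lborel)"
    proof (rule integral_dominated_convergence[where w = "\<lambda>x. cmod (f x)"])
      show "AE x in lborel. (\<lambda>n. f x * complex_of_real (\<psi> n x)) \<longlonglongrightarrow> f x * complex_of_real (indicator U x)"
        by (intro always_eventually allI tendsto_intros \<psi>(3))
      show "AE x in lborel. cmod (f x * complex_of_real (\<psi> n x)) \<le> cmod (f x)" for n
        using \<psi>(2)[of n] by (intro always_eventually allI) (auto simp: norm_mult intro!: mult_left_le)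
      show "(\<lambda>x. f x * complex_of_real (\<psi> n x)) \<in> borel_measurable lborel" for n
        using f test_functions_measurable[OF \<psi>(1)[of n]] by auto
      show "(\<lambda>x. f x * complex_of_real (indicator U x)) \<in> borel_measurable lborel" using f U(1) by auto
    qed (use f in auto)
    moreover have "(\<integral>x. f x * complex_of_real (\<psi> n x) \<partial>lborel) = 0" for n
      by (intro test test_functions_mono[OF U(2)] \<psi>(1))
    ultimately have "(\<integral>x. f x * complex_of_real (indicator U x) \<partial>lborel) = 0" by (simp add: LIMSEQ_const_iff)
    then show ?thesis by (simp add: scaleR_conv_of_real mult.commute)
  qed
  define g where "g x = indicator G x *\<^sub>R f x" for x
  have gi: "integrable lborel g" unfolding g_def using f G by (intro integrable_mult_indicator) auto
  have gs: "set_integrable lborel A g" if "A \<in> sets borel" for A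
    unfolding set_integrable_def using that by (intro integrable_mult_indicator gi) auto
  have "set_lebesgue_integral lborel A g = 0" if A: "A \<in> sets lborel" for A
  proof -
    have "Int_stable {S :: 'a set. open S}" "{S :: 'a set. open S} \<subseteq> Pow UNIV"
      by (auto simp: Int_stable_def)
    moreover have "A \<in> sigma_sets UNIV {S. open S}" using A by (simp add: borel_def)
    ultimately show ?thesis
    proof (induction A rule: sigma_sets_induct_disjoint)
      case (basic A)
      then have "(\<integral>x. indicator (A \<inter> G) x *\<^sub>R f x \<partial>lborel) = 0" using G by (intro opn) auto
      then show ?case by (simp add: set_lebesgue_integral_def g_def indicator_inter_arith)
    next
      case (compl A)
      then have [measurable]: "A \<in> sets borel" by (simp add: borel_def)
      have "(\<integral>x. g x \<partial>lborel) = 0" using opn[OF G] by (simp add: g_def)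
      moreover have "(\<integral>x. g x \<partial>lborel) = set_lebesgue_integral lborel A g + set_lebesgue_integral lborel (UNIV - A) g"
      proof -
        have "integrable lborel (\<lambda>x. indicator A x *\<^sub>R g x)" "integrable lborel (\<lambda>x. indicator (UNIV - A) x *\<^sub>R g x)"
          by (intro integrable_mult_indicator gi; simp)+
        from Bochner_Integration.integral_add[OF this]
        have "(\<integral>x. indicator A x *\<^sub>R g x + indicator (UNIV - A) x *\<^sub>R g x \<partial>lborel) =
            set_lebesgue_integral lborel A g + set_lebesgue_integral lborel (UNIV - A) g"
          unfolding set_lebesgue_integral_def .
        moreover have "(\<lambda>x. indicator A x *\<^sub>R g x + indicator (UNIV - A) x *\<^sub>R g x) = g"
          by (auto simp: fun_eq_iff indicator_def)
        ultimately show ?thesis by simp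
      qed
      ultimately show ?case using compl by simp
    next
      case (union A)
      then have [measurable]: "A i \<in> sets borel" for i by (auto simp: borel_def)
      have "set_lebesgue_integral lborel (\<Union>i. A i) g = (\<Sum>i. set_lebesgue_integral lborel (A i) g)"
        using union(1) by (intro lebesgue_integral_countable_add gs) (auto simp: disjoint_family_on_def)
      then show ?case using union by simp
    qed (simp add: set_lebesgue_integral_def)
  qed
  then have "AE x in lborel. g x = 0"
    by (intro sigma_finite_measure.density_unique_banach[OF sigma_finite_lborel] gi) (auto simp: set_lebesgue_integral_def)
  then show ?thesis by eventually_elim (auto simp: g_def)
qed

section \<open>The domain as a measure space\<close>

lemma space_vol [simp]: "space (vol \<Omega>) = \<Omega>"
  by (simp add: vol_def space_restrict_space)

lemma vol_integral:
  fixes f :: "'a::euclidean_space \<Rightarrow> 'b::{banach, second_countable_topology}"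
  shows "open \<Omega> \<Longrightarrow> (\<integral>x. f x \<partial>vol \<Omega>) = (\<integral>x. indicator \<Omega> x *\<^sub>R f x \<partial>lborel)"
  unfolding vol_def by (subst integral_restrict_space) auto

lemma vol_integrable:
  fixes f :: "'a::euclidean_space \<Rightarrow> 'b::{banach, second_countable_topology}"
  shows "open \<Omega> \<Longrightarrow> integrable (vol \<Omega>) f \<longleftrightarrow> integrable lborel (\<lambda>x. indicator \<Omega> x *\<^sub>R f x)"
  unfolding vol_def by (subst integrable_restrict_space) auto

lemma vol_AE: "open \<Omega> \<Longrightarrow> (AE x in vol \<Omega>. P x) \<longleftrightarrow> (AE x in lborel. x \<in> \<Omega> \<longrightarrow> P x)"
  unfolding vol_def by (subst AE_restrict_space_iff) auto

lemma finite_measure_vol: "open \<Omega> \<Longrightarrow> bounded \<Omega> \<Longrightarrow> finite_measure (vol \<Omega>)"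
  using emeasure_bounded_finite[of \<Omega>]
  by (intro finite_measureI) (auto simp: vol_def space_restrict_space emeasure_restrict_space)

lemma vol_measurable: "f \<in> borel_measurable borel \<Longrightarrow> f \<in> borel_measurable (vol \<Omega>)"
  unfolding vol_def by (intro measurable_restrict_space1) simp

lemma surf_measurable: "f \<in> borel_measurable borel \<Longrightarrow> f \<in> borel_measurable (surf \<Omega>)"
  unfolding surf_def by (intro measurable_restrict_space1) (simp cong: measurable_cong_sets)

lemma vol_integral_test:
  fixes f :: "'a::euclidean_space \<Rightarrow> complex"
  assumes "open \<Omega>" "\<And>x. x \<notin> \<Omega> \<Longrightarrow> g x = 0"
  shows "(\<integral>x. f x * g x \<partial>vol \<Omega>) = (\<integral>x. f x * g x \<partial>lborel)"
  unfolding vol_integral[OF assms(1)]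
  by (intro Bochner_Integration.integral_cong) (use assms(2) in \<open>auto simp: indicator_def\<close>)

lemma test_functions_L2:
  assumes "finite_measure (vol \<Omega>)" "f \<in> test_functions \<Omega>'"
  shows "f \<in> L2 (vol \<Omega>)"
proof -
  obtain M where "\<And>x. cmod (f x) \<le> M" using test_functions_bounded[OF assms(2)] by blast
  then show ?thesis
    by (intro L2_bounded[where K = M] assms(1) vol_measurable test_functions_measurable[OF assms(2)]) auto
qed

text \<open>\<open>G\<close> is kept separate from \<Omega> because the kink argument tests on open
  half balls inside the domain.\<close>

lemma fundamental_lemma_L2:
  assumes \<Omega>: "open \<Omega>" "finite_measure (vol \<Omega>)" and G: "open G" "G \<subseteq> \<Omega>" and f: "f \<in> L2 (vol \<Omega>)"
    and test: "\<And>\<psi>. \<psi> \<in> test_functions G \<Longrightarrow> (\<integral>x. f x * \<psi> x \<partial>vol \<Omega>) = 0"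
  shows "AE x in lborel. x \<in> G \<longrightarrow> f x = 0"
proof -
  have "AE x in lborel. x \<in> G \<longrightarrow> indicator \<Omega> x *\<^sub>R f x = 0"
  proof (rule fundamental_lemma[OF G(1)])
    show "integrable lborel (\<lambda>x. indicator \<Omega> x *\<^sub>R f x)"
      using L2_integrable_finite[OF \<Omega>(2) f] by (simp add: vol_integrable[OF \<Omega>(1)])
    fix \<psi> assume "\<psi> \<in> test_functions G"
    from test[OF this] show "(\<integral>x. (indicator \<Omega> x *\<^sub>R f x) * \<psi> x \<partial>lborel) = 0"
      by (simp add: vol_integral[OF \<Omega>(1)])
  qed
  then show ?thesis by eventually_elim (use G in \<open>auto simp: indicator_def\<close>)
qed

section \<open>A kink is not in the domain of the Laplacian\<close>

lemma integrable_mult_test: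
  assumes "continuous_on UNIV p" "q \<in> test_functions \<Omega>"
  shows "integrable lborel (\<lambda>x. p x * q x)"
proof -
  obtain K where K: "compact K" "\<And>x. x \<notin> K \<Longrightarrow> q x = 0" using assms by (auto simp: test_functions_def)
  have "integrable lborel (\<lambda>x. indicator K x *\<^sub>R (p x * q x))"
    using K assms by (intro borel_integrable_compact continuous_on_mult)
      (auto intro: continuous_on_subset[OF smooth_continuous[OF test_functions_smooth]] continuous_on_subset)
  also have "(\<lambda>x. indicator K x *\<^sub>R (p x * q x)) = (\<lambda>x. p x * q x)" using K(2) by (auto simp: indicator_def)
  finally show ?thesis .
qed

lemma AE_not_in_hyperplane:
  fixes x0 i :: "'a::euclidean_space"
  assumes "i \<in> Basis"
  shows "AE x in lborel. (x - x0) \<bullet> i \<noteq> 0"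
proof -
  have "i \<noteq> 0" using assms nonzero_Basis by blast
  then have "negligible {x. i \<bullet> x = i \<bullet> x0}" by (intro negligible_hyperplane) auto
  moreover have "{x. i \<bullet> x = i \<bullet> x0} = {x. (x - x0) \<bullet> i = 0}"
    by (auto simp: inner_diff_left inner_commute[of i])
  ultimately have "{x. (x - x0) \<bullet> i = 0} \<in> null_sets lebesgue" by (simp add: negligible_iff_null_sets)
  then have "AE x in lebesgue. (x - x0) \<bullet> i \<noteq> 0" by (auto simp: AE_iff_null_sets dest: AE_not_in)
  then show ?thesis by (simp add: AE_completion_iff)
qed

text \<open>One integration by parts suffices. Only direction \<open>i\<close> contributes, where
  the derivative of \<open>p\<close> is \<open>b + a * indicator H x\<close> off the hyperplane; the
  constant part drops out because a derivative of a test function has integral 0. Stopping at the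
  half-space integral avoids any integral over the hyperplane itself.\<close>

lemma integral_kink_laplacian:
  fixes x0 i :: "'a::euclidean_space" and a b c :: complex
  assumes i: "i \<in> Basis" and \<psi>: "\<psi> \<in> test_functions UNIV"
  defines "y \<equiv> \<lambda>x. (x - x0) \<bullet> i"
  defines "p \<equiv> \<lambda>x. c + b * of_real (y x) + a * of_real (max 0 (y x))"
  shows "(\<integral>x. p x * (\<Sum>j\<in>Basis. partial j (partial j \<psi>) x) \<partial>lborel) =
    - a * (\<integral>x. indicator {x. y x > 0} x *\<^sub>R partial i \<psi> x \<partial>lborel)"
proof -
  define H where "H = {x. y x > 0}"
  have [measurable]: "H \<in> sets borel" unfolding H_def y_def by measurable
  define p' where "p' j x = (if j = i then b + a * indicator H x else 0)" for j x
  have pc: "continuous_on UNIV p" unfolding p_def y_def by (intro continuous_intros)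
  have p'm: "p' j \<in> borel_measurable borel" for j unfolding p'_def by measurable
  have hyper: "AE x in lborel. y x \<noteq> 0"
    unfolding y_def using i by (rule AE_not_in_hyperplane)
  have yj: "y (x + h *\<^sub>R j) = y x + h * (if j = i then 1 else 0)" if "j \<in> Basis" for x h j
    using i that by (simp add: y_def inner_add_left inner_diff_left inner_Basis)
  have ibp: "(\<integral>x. p x * partial j (partial j \<psi>) x + p' j x * partial j \<psi> x \<partial>lborel) = 0" if j: "j \<in> Basis" for j
  proof (rule integration_by_parts[OF j test_functions_partial[OF \<psi> j] pc, where L = "cmod b + cmod a"])
    fix x :: 'a and h :: real
    let ?d = "h * (if j = i then 1 else 0)"
    have "p (x + h *\<^sub>R j) - p x = b * of_real ?d + a * of_real (max 0 (y x + ?d) - max 0 (y x))"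
      by (simp add: p_def yj[OF j] algebra_simps)
    then have "cmod (p (x + h *\<^sub>R j) - p x) \<le> cmod (b * of_real ?d) + cmod (a * of_real (max 0 (y x + ?d) - max 0 (y x)))"
      using norm_triangle_ineq by metis
    also have "\<dots> \<le> cmod b * \<bar>h\<bar> + cmod a * \<bar>h\<bar>"
      unfolding norm_mult norm_of_real by (intro add_mono mult_left_mono) auto
    finally show "cmod (p (x + h *\<^sub>R j) - p x) \<le> (cmod b + cmod a) * \<bar>h\<bar>" by (simp add: distrib_right)
  next
    show "p' j \<in> borel_measurable borel" by (rule p'm)
    show "AE x in lborel. (\<lambda>n. of_nat (Suc n) * (p (x + (1 / real (Suc n)) *\<^sub>R j) - p x)) \<longlonglongrightarrow> p' j x"
      using hyper
    proof eventually_elim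
      case (elim x)
      show ?case
      proof (cases "j = i")
        case False
        then show ?thesis by (simp add: p_def yj[OF j] p'_def)
      next
        case True
        have inv: "of_nat (Suc n) * of_real (1 / real (Suc n)) = (1 :: complex)" for n
          by (simp del: of_nat_Suc)
        show ?thesis
        proof (cases "y x > 0")
          case y: True
          have "of_nat (Suc n) * (p (x + (1 / real (Suc n)) *\<^sub>R j) - p x) =
              (b + a) * (of_nat (Suc n) * of_real (1 / real (Suc n)))" for n
            using y True unfolding p_def yj[OF j] by (simp add: max_def algebra_simps del: of_nat_Suc of_real_divide)
          then show ?thesis using y True unfolding inv by (simp add: p'_def H_def)
        next
          case False
          then have y: "y x < 0" using elim by simp
          have "(\<lambda>n. 1 / real (Suc n)) \<longlonglongrightarrow> 0" using lim_const_over_n[THEN LIMSEQ_Suc, of 1] by simp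
          then have ev: "\<forall>\<^sub>F n in sequentially. 1 / real (Suc n) < - y x" using y by (intro order_tendstoD) auto
          have "\<forall>\<^sub>F n in sequentially. b = of_nat (Suc n) * (p (x + (1 / real (Suc n)) *\<^sub>R j) - p x)"
            using ev
          proof eventually_elim
            case (elim n)
            then have "of_nat (Suc n) * (p (x + (1 / real (Suc n)) *\<^sub>R j) - p x) =
                b * (of_nat (Suc n) * of_real (1 / real (Suc n)))"
              using y True unfolding p_def yj[OF j] by (simp add: max_def algebra_simps del: of_nat_Suc of_real_divide)
            then show ?case unfolding inv by simp
          qed
          then have "(\<lambda>n. of_nat (Suc n) * (p (x + (1 / real (Suc n)) *\<^sub>R j) - p x)) \<longlonglongrightarrow> b"
            by (rule Lim_transform_eventually[OF tendsto_const])
          then show ?thesis using False True by (simp add: p'_def H_def)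
        qed
      qed
    qed
  qed
  have i1: "integrable lborel (\<lambda>x. p x * partial j (partial j \<psi>) x)" if "j \<in> Basis" for j
    by (rule integrable_mult_test[OF pc test_functions_partial[OF test_functions_partial[OF \<psi> that] that]])
  have ti: "integrable lborel (partial j \<psi>)" if "j \<in> Basis" for j
    by (rule test_functions_integrable[OF test_functions_partial[OF \<psi> that]])
  have hi: "integrable lborel (\<lambda>x. indicator H x *\<^sub>R partial i \<psi> x)"
    by (intro integrable_mult_indicator ti i) simp
  have p'i: "p' i x * partial i \<psi> x = b * partial i \<psi> x + a * (indicator H x *\<^sub>R partial i \<psi> x)" for x
    by (simp add: p'_def indicator_def algebra_simps)
  have i2: "integrable lborel (\<lambda>x. p' j x * partial j \<psi> x)" if "j \<in> Basis" for j
  proof (cases "j = i")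
    case True
    then show ?thesis unfolding p'i using ti[OF i] hi
      by (simp only: p'i True) (intro Bochner_Integration.integrable_add Bochner_Integration.integrable_mult_right)
  qed (simp add: p'_def)
  have "(\<integral>x. p x * (\<Sum>j\<in>Basis. partial j (partial j \<psi>) x) \<partial>lborel) = (\<Sum>j\<in>Basis. \<integral>x. p x * partial j (partial j \<psi>) x \<partial>lborel)"
    unfolding sum_distrib_left by (rule Bochner_Integration.integral_sum) (rule i1)
  also have "\<dots> = (\<Sum>j\<in>Basis. - (\<integral>x. p' j x * partial j \<psi> x \<partial>lborel))"
    using ibp i1 i2 by (intro sum.cong refl) (simp add: eq_neg_iff_add_eq_0)
  also have "\<dots> = - (\<integral>x. p' i x * partial i \<psi> x \<partial>lborel)"
    using i by (subst sum.remove[OF finite_Basis i]) (simp add: p'_def)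
  also have "(\<integral>x. p' i x * partial i \<psi> x \<partial>lborel) = a * (\<integral>x. indicator H x *\<^sub>R partial i \<psi> x \<partial>lborel)"
    unfolding p'i Bochner_Integration.integral_add[OF Bochner_Integration.integrable_mult_right[OF ti[OF i], of b]
        Bochner_Integration.integrable_mult_right[OF hi, of a]] integral_mult_right_zero
    by (simp add: integral_partial_test_function[OF i \<psi>])
  finally show ?thesis by (simp add: H_def)
qed

text \<open>Test functions supported in either open half of the ball see an affine function, so
  \<open>g\<close> vanishes on both halves, and the hyperplane between them is null. Hence
  \<open>g\<close> is zero in the ball, and the half-space integral of
  \<open>partial i \<psi>\<close> would vanish for every test function of the ball. A bump centred
  at \<open>x0\<close> contradicts this.\<close>

lemma kink_no_weak_laplacian:
  fixes \<Omega> :: "'a::euclidean_space set" and a b c :: complex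
  assumes \<Omega>: "open \<Omega>" "finite_measure (vol \<Omega>)" and i: "i \<in> Basis"
    and r: "r > 0" "ball x0 r \<subseteq> \<Omega>" and a: "a \<noteq> 0"
    and f: "\<And>x. x \<in> ball x0 r \<Longrightarrow>
      f x = c + b * of_real ((x - x0) \<bullet> i) + a * of_real (max 0 ((x - x0) \<bullet> i))"
    and g: "g \<in> L2 (vol \<Omega>)" "has_weak_laplacian \<Omega> f g"
  shows False
proof -
  let ?B = "ball x0 r"
  define y where "y x = (x - x0) \<bullet> i" for x
  have yc: "continuous_on UNIV y" unfolding y_def by (intro continuous_intros)
  have opn: "open (?B \<inter> {x. y x > 0})" "open (?B \<inter> {x. y x < 0})"
    using yc by (auto intro!: open_Int open_Collect_less continuous_intros)
  have weak: "(\<integral>x. g x * \<psi> x \<partial>vol \<Omega>) = - a * (\<integral>x. indicator {x. y x > 0} x *\<^sub>R partial i \<psi> x \<partial>lborel)"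
    if \<psi>: "\<psi> \<in> test_functions ?B" for \<psi>
  proof -
    let ?\<Delta> = "\<lambda>x. \<Sum>j\<in>Basis. partial j (partial j \<psi>) x"
    have \<Delta>: "?\<Delta> \<in> test_functions ?B" using \<psi> by (rule test_functions_laplacian)
    have "(\<integral>x. g x * \<psi> x \<partial>vol \<Omega>) = (\<integral>x. f x * ?\<Delta> x \<partial>vol \<Omega>)"
      using g(2) test_functions_mono[OF r(2) \<psi>] by (simp add: has_weak_laplacian_def)
    also have "\<dots> = (\<integral>x. f x * ?\<Delta> x \<partial>lborel)"
      by (rule vol_integral_test[OF \<Omega>(1) test_functions_outside[OF test_functions_mono[OF r(2) \<Delta>]]])
    also have "\<dots> = (\<integral>x. (c + b * of_real ((x - x0) \<bullet> i) + a * of_real (max 0 ((x - x0) \<bullet> i))) * ?\<Delta> x \<partial>lborel)"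
    proof (intro Bochner_Integration.integral_cong refl)
      fix x show "f x * ?\<Delta> x = (c + b * of_real ((x - x0) \<bullet> i) + a * of_real (max 0 ((x - x0) \<bullet> i))) * ?\<Delta> x"
        using f[of x] test_functions_outside[OF \<Delta>, of x] by (cases "x \<in> ?B") auto
    qed
    finally show ?thesis
      using integral_kink_laplacian[OF i test_functions_mono[OF subset_UNIV \<psi>], of c b x0 a] by (simp add: y_def)
  qed
  have pos: "AE x in lborel. x \<in> ?B \<inter> {x. y x > 0} \<longrightarrow> g x = 0"
  proof (rule fundamental_lemma_L2[OF \<Omega> opn(1) _ g(1)])
    fix \<psi> assume \<psi>: "\<psi> \<in> test_functions (?B \<inter> {x. y x > 0})"
    have "(\<integral>x. indicator {x. y x > 0} x *\<^sub>R partial i \<psi> x \<partial>lborel) = (\<integral>x. partial i \<psi> x \<partial>lborel)"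
      using test_functions_outside[OF test_functions_partial[OF \<psi> i]]
      by (intro Bochner_Integration.integral_cong refl) (auto simp: indicator_def)
    also have "\<dots> = 0" using integral_partial_test_function[OF i test_functions_mono[OF subset_UNIV \<psi>]] .
    finally show "(\<integral>x. g x * \<psi> x \<partial>vol \<Omega>) = 0" using weak[OF test_functions_mono[OF Int_lower1 \<psi>]] by simp
  qed (use r in auto)
  have neg: "AE x in lborel. x \<in> ?B \<inter> {x. y x < 0} \<longrightarrow> g x = 0"
  proof (rule fundamental_lemma_L2[OF \<Omega> opn(2) _ g(1)])
    fix \<psi> assume \<psi>: "\<psi> \<in> test_functions (?B \<inter> {x. y x < 0})"
    have "(\<integral>x. indicator {x. y x > 0} x *\<^sub>R partial i \<psi> x \<partial>lborel) = (\<integral>x. 0 \<partial>(lborel :: 'a measure))"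
      using test_functions_outside[OF test_functions_partial[OF \<psi> i]]
      by (intro Bochner_Integration.integral_cong refl) (auto simp: indicator_def)
    then show "(\<integral>x. g x * \<psi> x \<partial>vol \<Omega>) = 0" using weak[OF test_functions_mono[OF Int_lower1 \<psi>]] by simp
  qed (use r in auto)
  have zero: "AE x in lborel. x \<in> ?B \<longrightarrow> g x = 0"
  proof -
    have "AE x in lborel. y x \<noteq> 0" unfolding y_def using i by (rule AE_not_in_hyperplane)
    with pos neg show ?thesis by eventually_elim (auto simp: neq_iff)
  qed
  \<comment> \<open>A smaller radius keeps the closed ball that carries the bump inside the open
    ball.\<close>
  define s where "s = r / 2"
  have s: "s > 0" "s < r" using r by (auto simp: s_def)
  define \<psi> where "\<psi> x = complex_of_real (bump 1 x0 s x)" for x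
  have \<psi>: "\<psi> \<in> test_functions ?B"
  proof (rule test_functions_I[of _ "cball x0 s"])
    show "smooth \<psi>" unfolding \<psi>_def by (rule smooth_bump)
    fix x assume "x \<notin> cball x0 s"
    then show "\<psi> x = 0" using s bump_outside[of 1 s x x0] by (auto simp: \<psi>_def)
  qed (use s in auto)
  \<comment> \<open>On the half-space \<open>- h\<close> is the derivative of the bump by
    \<open>bump_partial\<close>. Its sign is fixed, so a vanishing integral forces \<open>h\<close>
    to vanish almost everywhere, whereas \<open>h\<close> is positive on the open half ball
    \<open>U\<close>.\<close>
  define h where "h x = indicator {x. y x > 0} x * (2 * y x * flat_exp 2 (s\<^sup>2 - (dist x x0)\<^sup>2))" for x
  have h_nonneg: "0 \<le> h x" for x by (auto simp: h_def indicator_def flat_nonneg)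
  have h\<psi>: "indicator {x. y x > 0} x *\<^sub>R partial i \<psi> x = - complex_of_real (h x)" for x
    unfolding \<psi>_def bump_partial[OF i] by (simp add: h_def y_def indicator_def)
  have "(\<integral>x. g x * \<psi> x \<partial>vol \<Omega>) = (\<integral>x. 0 \<partial>vol \<Omega>)"
  proof (rule integral_cong_AE)
    show "(\<lambda>x. g x * \<psi> x) \<in> borel_measurable (vol \<Omega>)"
      using L2_measurable[OF g(1)] vol_measurable[OF test_functions_measurable[OF \<psi>]] by (rule borel_measurable_times)
    show "AE x in vol \<Omega>. g x * \<psi> x = 0"
      unfolding vol_AE[OF \<Omega>(1)] using zero
      by eventually_elim (use test_functions_outside[OF \<psi>] in auto)
  qed simp
  then have "(\<integral>x. - complex_of_real (h x) \<partial>lborel) = 0" using weak[OF \<psi>] a unfolding h\<psi> by simp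
  then have h0: "(\<integral>x. h x \<partial>lborel) = 0" by simp
  have hi: "integrable lborel h"
  proof -
    have "integrable lborel (\<lambda>x. indicator {x. y x > 0} x *\<^sub>R partial i \<psi> x)"
    proof (rule integrable_mult_indicator)
      show "{x. y x > 0} \<in> sets lborel" using open_Collect_less[OF continuous_on_const yc, of 0] by simp
      show "integrable lborel (partial i \<psi>)" by (rule test_functions_integrable[OF test_functions_partial[OF \<psi> i]])
    qed
    then have "integrable lborel (\<lambda>x. - complex_of_real (h x))" unfolding h\<psi> .
    from Bochner_Integration.integrable_minus[OF integrable_Re[OF this]] show ?thesis by simp
  qed
  define U where "U = ball x0 s \<inter> {x. y x > 0}"
  have "AE x in lborel. h x = 0"
    using integral_nonneg_eq_0_iff_AE[OF hi] h_nonneg h0 by simp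
  then have "AE x in lborel. x \<notin> U"
  proof eventually_elim
    case (elim x)
    show ?case
    proof
      assume x: "x \<in> U"
      then have "(dist x x0)\<^sup>2 < s\<^sup>2" by (auto simp: U_def dist_commute intro!: power_strict_mono)
      then have "h x > 0" using x flat_pos[of "s\<^sup>2 - (dist x x0)\<^sup>2" 2] by (simp add: U_def h_def)
      with elim show False by simp
    qed
  qed
  moreover have U: "open U" unfolding U_def using yc by (intro open_Int open_ball open_Collect_less continuous_on_const)
  ultimately have "U \<in> null_sets lborel" by (simp add: AE_iff_null_sets)
  then have "U \<in> null_sets lebesgue" by (rule null_sets_completionI)
  then have "negligible U" by (simp add: negligible_iff_null_sets)
  moreover have "x0 + (s / 2) *\<^sub>R i \<in> U"
    using i s by (auto simp: U_def y_def dist_norm)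
  ultimately show False using open_not_negligible[OF U] by blast
qed

section \<open>Norms in \<open>L\<^sup>2\<close>\<close>

lemma L2_norm_sq: "f \<in> L2 M \<Longrightarrow> (L2_norm M f)\<^sup>2 = real_ip M f f"
  by (simp add: L2_norm_def real_ip_self)

lemma L2_norm_nonneg: "0 \<le> L2_norm M f"
  by (simp add: L2_norm_def)

lemma L2_norm_cnj: "L2_norm M (\<lambda>x. cnj (f x)) = L2_norm M f"
  by (simp add: L2_norm_def)

lemma L2_norm_cmult: "L2_norm M (\<lambda>x. c * f x) = cmod c * L2_norm M f"
  by (simp add: L2_norm_def norm_mult power_mult_distrib real_sqrt_mult)

lemma L2_norm_cong_AE:
  assumes "f \<in> L2 M" "g \<in> L2 M" "AE x in M. f x = g x"
  shows "L2_norm M f = L2_norm M g"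
  unfolding L2_norm_def
  by (intro arg_cong[of _ _ sqrt] integral_cong_AE) (use assms in \<open>auto intro!: borel_measurable_power
    borel_measurable_norm[unfolded comp_def] intro: L2_measurable\<close>)

lemma L2_norm_triangle:
  assumes M: "finite_measure M" and f: "f \<in> L2 M" "g \<in> L2 M"
  shows "L2_norm M (\<lambda>x. f x + g x) \<le> L2_norm M f + L2_norm M g"
proof -
  interpret semi_hilbert "L2 M" real_scale "real_ip M" using M by (rule semi_hilbert_L2)
  have "nm h = L2_norm M h" if "h \<in> L2 M" for h
    using that by (simp add: nm_def L2_norm_def real_ip_self)
  then show ?thesis using nm_triangle[OF f] f L2_add[OF f] by (simp add: plus_fun_def)
qed

lemma L2_norm_triangle_diff:
  assumes "finite_measure M" "f \<in> L2 M" "g \<in> L2 M" "h \<in> L2 M"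
  shows "L2_norm M (\<lambda>x. f x - h x) \<le> L2_norm M (\<lambda>x. f x - g x) + L2_norm M (\<lambda>x. g x - h x)"
  using L2_norm_triangle[OF assms(1) L2_diff[OF assms(2,3)] L2_diff[OF assms(3,4)]] by simp

lemma L2_tendsto_add:
  assumes M: "finite_measure M" and f: "\<And>n. f n \<in> L2 M" "\<And>n. g n \<in> L2 M" "f' \<in> L2 M" "g' \<in> L2 M"
    and lim: "(\<lambda>n. L2_norm M (\<lambda>x. f n x - f' x)) \<longlonglongrightarrow> 0" "(\<lambda>n. L2_norm M (\<lambda>x. g n x - g' x)) \<longlonglongrightarrow> 0"
  shows "(\<lambda>n. L2_norm M (\<lambda>x. (f n x + g n x) - (f' x + g' x))) \<longlonglongrightarrow> 0"
proof (rule tendsto_sandwich[where f = "\<lambda>_. 0"])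
  show "(\<lambda>n. L2_norm M (\<lambda>x. f n x - f' x) + L2_norm M (\<lambda>x. g n x - g' x)) \<longlonglongrightarrow> 0"
    using tendsto_add[OF lim] by simp
  have "L2_norm M (\<lambda>x. (f n x + g n x) - (f' x + g' x)) \<le> L2_norm M (\<lambda>x. f n x - f' x) + L2_norm M (\<lambda>x. g n x - g' x)" for n
    using L2_norm_triangle[OF M L2_diff[OF f(1)[of n] f(3)] L2_diff[OF f(2)[of n] f(4)]] by (simp add: add_diff_add)
  then show "\<forall>\<^sub>F n in sequentially. L2_norm M (\<lambda>x. (f n x + g n x) - (f' x + g' x)) \<le>
      L2_norm M (\<lambda>x. f n x - f' x) + L2_norm M (\<lambda>x. g n x - g' x)" by simp
qed (auto simp: L2_norm_nonneg)

lemma L2_tendsto_cmult: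
  assumes "(\<lambda>n. L2_norm M (\<lambda>x. f n x - f' x)) \<longlonglongrightarrow> 0"
  shows "(\<lambda>n. L2_norm M (\<lambda>x. c * f n x - c * f' x)) \<longlonglongrightarrow> 0"
  using tendsto_mult_left[OF assms, of "cmod c"] by (simp add: L2_norm_cmult flip: right_diff_distrib)

lemma L2_tendsto_cnj:
  assumes "(\<lambda>n. L2_norm M (\<lambda>x. f n x - f' x)) \<longlonglongrightarrow> 0"
  shows "(\<lambda>n. L2_norm M (\<lambda>x. cnj (f n x) - cnj (f' x))) \<longlonglongrightarrow> 0"
  using assms by (simp add: L2_norm_cnj flip: complex_cnj_diff)

lemma L2_tendsto_cong_AE:
  assumes "(\<lambda>n. L2_norm M (\<lambda>x. f n x - g x)) \<longlonglongrightarrow> 0" "\<And>n. f n \<in> L2 M" "g \<in> L2 M"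
    "\<And>n. f' n \<in> L2 M" "g' \<in> L2 M" "\<And>n. AE x in M. f n x = f' n x" "AE x in M. g x = g' x"
  shows "(\<lambda>n. L2_norm M (\<lambda>x. f' n x - g' x)) \<longlonglongrightarrow> 0"
proof -
  have "L2_norm M (\<lambda>x. f n x - g x) = L2_norm M (\<lambda>x. f' n x - g' x)" for n
  proof (rule L2_norm_cong_AE)
    show "AE x in M. f n x - g x = f' n x - g' x" using assms(6)[of n] assms(7) by eventually_elim simp
  qed (intro L2_diff assms)+
  then show ?thesis using assms(1) by simp
qed

text \<open>\<open>real_ip\<close> sees only real parts. Multiplying the fixed factor by minus the
  imaginary unit turns the imaginary part of the integral into a real part.\<close>

lemma L2_tendsto_integral:
  assumes M: "finite_measure M" and f: "\<And>n. f n \<in> L2 M" "g \<in> L2 M" and h: "h \<in> L2 M"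
    and lim: "(\<lambda>n. L2_norm M (\<lambda>x. f n x - g x)) \<longlonglongrightarrow> 0"
  shows "(\<lambda>n. \<integral>x. f n x * h x \<partial>M) \<longlonglongrightarrow> (\<integral>x. g x * h x \<partial>M)"
proof -
  interpret semi_hilbert "L2 M" real_scale "real_ip M" using M by (rule semi_hilbert_L2)
  have "nm (f n - g) = L2_norm M (\<lambda>x. f n x - g x)" for n
    using real_ip_self[OF L2_diff[OF f(1)[of n] f(2)]] by (simp add: nm_def L2_norm_def fun_diff_def)
  then have nm: "(\<lambda>n. nm (f n - g)) \<longlonglongrightarrow> 0" using lim by simp
  have re: "(\<lambda>n. Re (\<integral>x. f n x * k x \<partial>M)) \<longlonglongrightarrow> Re (\<integral>x. g x * k x \<partial>M)" if k: "k \<in> L2 M" for k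
    using tendsto_ip[of f "\<lambda>_ x. cnj (k x)" g "\<lambda>x. cnj (k x)" sequentially] f L2_cnj[OF k] nm
    by (simp add: real_ip_def)
  have "Im (\<integral>x. f x * h x \<partial>M) = Re (\<integral>x. f x * (- \<i> * h x) \<partial>M)" for f
  proof -
    have "(\<lambda>x. f x * (- \<i> * h x)) = (\<lambda>x. - \<i> * (f x * h x))" by (simp add: fun_eq_iff)
    then show ?thesis by (simp only: integral_mult_right_zero) simp
  qed
  then have "(\<lambda>n. Im (\<integral>x. f n x * h x \<partial>M)) \<longlonglongrightarrow> Im (\<integral>x. g x * h x \<partial>M)"
    using re[OF L2_cmult[OF h, of "- \<i>"]] by simp
  then show ?thesis using re[OF h] by (intro tendsto_complex_iff[THEN iffD2] conjI)
qed

lemma L2_norm_Cauchy_complete: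
  assumes M: "finite_measure M" and f: "\<And>n::nat. f n \<in> L2 M"
    and C: "\<And>e. e > 0 \<Longrightarrow> \<exists>N. \<forall>m\<ge>N. \<forall>n\<ge>N. (L2_norm M (\<lambda>x. f m x - f n x))\<^sup>2 < e"
  shows "\<exists>g\<in>L2 M. (\<lambda>n. L2_norm M (\<lambda>x. f n x - g x)) \<longlonglongrightarrow> 0"
proof -
  have "\<exists>g\<in>L2 M. (\<lambda>n. \<integral>x. (cmod (f n x - g x))\<^sup>2 \<partial>M) \<longlonglongrightarrow> 0"
    by (rule L2_complete[OF M f]) (use C in \<open>simp add: L2_norm_def\<close>)
  then show ?thesis unfolding L2_norm_def using tendsto_real_sqrt[of _ 0] by fastforce
qed

section \<open>Weak derivatives\<close>

text \<open>
  Weak partial derivatives and the weak Laplacian are both given by an operator \<open>P\<close> on test functions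
  that is moved to the other side of the integral.
\<close>

definition has_weak :: "'a::euclidean_space set \<Rightarrow> (('a \<Rightarrow> complex) \<Rightarrow> 'a \<Rightarrow> complex) \<Rightarrow>
    ('a \<Rightarrow> complex) \<Rightarrow> ('a \<Rightarrow> complex) \<Rightarrow> bool" where
  "has_weak \<Omega> P u g \<longleftrightarrow>
    (\<forall>\<phi>\<in>test_functions \<Omega>. (\<integral>x. u x * P \<phi> x \<partial>vol \<Omega>) = (\<integral>x. g x * \<phi> x \<partial>vol \<Omega>))"

text \<open>Compatibility with conjugation is included because conjugates of weakly differentiable
  functions are needed for realness of the semigroup.\<close>

definition test_operator :: "'a::euclidean_space set \<Rightarrow> (('a \<Rightarrow> complex) \<Rightarrow> 'a \<Rightarrow> complex) \<Rightarrow> bool" where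
  "test_operator \<Omega> P \<longleftrightarrow> (\<forall>\<phi>\<in>test_functions \<Omega>. P \<phi> \<in> test_functions \<Omega> \<and>
    P (\<lambda>x. cnj (\<phi> x)) = (\<lambda>x. cnj (P \<phi> x)))"

text \<open>The minus sign absorbs the sign of a single integration by parts, so that first
  derivatives and the Laplacian fit the same scheme \<open>has_weak\<close>.\<close>

definition grad_op :: "'a::euclidean_space \<Rightarrow> ('a \<Rightarrow> complex) \<Rightarrow> 'a \<Rightarrow> complex" where
  "grad_op i \<phi> = (\<lambda>x. - partial i \<phi> x)"

definition lap_op :: "('a::euclidean_space \<Rightarrow> complex) \<Rightarrow> 'a \<Rightarrow> complex" where
  "lap_op \<phi> = (\<lambda>x. \<Sum>i\<in>Basis. partial i (partial i \<phi>) x)"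

lemma has_weak_partial_iff: "has_weak_partial \<Omega> i u g \<longleftrightarrow> has_weak \<Omega> (grad_op i) u g"
proof -
  have "A = - B \<longleftrightarrow> - A = B" for A B :: complex by auto
  then show ?thesis by (simp add: has_weak_partial_def has_weak_def grad_op_def)
qed

lemma has_weak_laplacian_iff: "has_weak_laplacian \<Omega> u g \<longleftrightarrow> has_weak \<Omega> lap_op u g"
  by (simp add: has_weak_laplacian_def has_weak_def lap_op_def)

lemma partial_cnj_test:
  "\<phi> \<in> test_functions \<Omega> \<Longrightarrow> partial i (\<lambda>x. cnj (\<phi> x)) = (\<lambda>x. cnj (partial i \<phi> x))"
  by (intro ext partial_cnj smooth_differentiable test_functions_smooth)

lemma test_operator_grad: "i \<in> Basis \<Longrightarrow> test_operator \<Omega> (grad_op i)"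
  using test_functions_cmult[of "partial i _" \<Omega> "- 1"]
  by (simp add: test_operator_def grad_op_def partial_cnj_test test_functions_partial)

lemma test_operator_lap: "test_operator \<Omega> lap_op"
  unfolding test_operator_def
proof (intro ballI conjI)
  fix \<phi> assume \<phi>: "\<phi> \<in> test_functions \<Omega>"
  show "lap_op \<phi> \<in> test_functions \<Omega>" unfolding lap_op_def using \<phi> by (rule test_functions_laplacian)
  show "lap_op (\<lambda>x. cnj (\<phi> x)) = (\<lambda>x. cnj (lap_op \<phi> x))"
    by (rule ext) (simp add: lap_op_def partial_cnj_test[OF \<phi>] partial_cnj_test[OF test_functions_partial[OF \<phi>]])
qed

locale finite_domain =
  fixes \<Omega> :: "'a::euclidean_space set"
  assumes \<Omega>_open: "open \<Omega>" and \<Omega>_finite: "finite_measure (vol \<Omega>)"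
begin

lemma test_L2: "\<phi> \<in> test_functions \<Omega> \<Longrightarrow> \<phi> \<in> L2 (vol \<Omega>)"
  using \<Omega>_finite by (rule test_functions_L2)

lemma has_weak_unique:
  assumes "g \<in> L2 (vol \<Omega>)" "h \<in> L2 (vol \<Omega>)" "has_weak \<Omega> P u g" "has_weak \<Omega> P u h"
  shows "AE x in vol \<Omega>. g x = h x"
proof -
  have "AE x in lborel. x \<in> \<Omega> \<longrightarrow> g x - h x = 0"
  proof (rule fundamental_lemma_L2[OF \<Omega>_open \<Omega>_finite \<Omega>_open subset_refl L2_diff[OF assms(1,2)]])
    fix \<psi> assume \<psi>: "\<psi> \<in> test_functions \<Omega>"
    then have "(\<integral>x. g x * \<psi> x \<partial>vol \<Omega>) = (\<integral>x. h x * \<psi> x \<partial>vol \<Omega>)"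
      using assms(3,4) by (simp add: has_weak_def)
    then show "(\<integral>x. (g x - h x) * \<psi> x \<partial>vol \<Omega>) = 0"
      using assms(1,2) test_L2[OF \<psi>] by (simp add: left_diff_distrib L2_mult_integrable)
  qed
  then show ?thesis by (simp add: vol_AE[OF \<Omega>_open])
qed

lemma has_weak_add:
  assumes P: "test_operator \<Omega> P" and "u \<in> L2 (vol \<Omega>)" "v \<in> L2 (vol \<Omega>)" "g \<in> L2 (vol \<Omega>)" "h \<in> L2 (vol \<Omega>)"
    and w: "has_weak \<Omega> P u g" "has_weak \<Omega> P v h"
  shows "has_weak \<Omega> P (\<lambda>x. u x + v x) (\<lambda>x. g x + h x)"
  unfolding has_weak_def
proof
  fix \<phi> assume \<phi>: "\<phi> \<in> test_functions \<Omega>"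
  have "P \<phi> \<in> L2 (vol \<Omega>)" "\<phi> \<in> L2 (vol \<Omega>)" using P \<phi> by (auto simp: test_operator_def intro: test_L2)
  then show "(\<integral>x. (u x + v x) * P \<phi> x \<partial>vol \<Omega>) = (\<integral>x. (g x + h x) * \<phi> x \<partial>vol \<Omega>)"
    using assms \<phi> by (simp add: distrib_right L2_mult_integrable has_weak_def)
qed

lemma has_weak_cmult: "has_weak \<Omega> P u g \<Longrightarrow> has_weak \<Omega> P (\<lambda>x. c * u x) (\<lambda>x. c * g x)"
  by (simp add: has_weak_def mult.assoc)

lemma has_weak_cnj:
  assumes P: "test_operator \<Omega> P" and w: "has_weak \<Omega> P u g"
  shows "has_weak \<Omega> P (\<lambda>x. cnj (u x)) (\<lambda>x. cnj (g x))"
  unfolding has_weak_def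
proof
  fix \<phi> assume \<phi>: "\<phi> \<in> test_functions \<Omega>"
  have "(\<integral>x. cnj (u x) * P \<phi> x \<partial>vol \<Omega>) = (\<integral>x. cnj (u x * P (\<lambda>x. cnj (\<phi> x)) x) \<partial>vol \<Omega>)"
    using P \<phi> by (simp add: test_operator_def)
  also have "\<dots> = cnj (\<integral>x. g x * cnj (\<phi> x) \<partial>vol \<Omega>)"
    using w test_functions_cnj[OF \<phi>] by (simp only: Bochner_Integration.integral_cnj has_weak_def)
  also have "\<dots> = (\<integral>x. cnj (g x) * \<phi> x \<partial>vol \<Omega>)"
    by (simp flip: Bochner_Integration.integral_cnj)
  finally show "(\<integral>x. cnj (u x) * P \<phi> x \<partial>vol \<Omega>) = (\<integral>x. cnj (g x) * \<phi> x \<partial>vol \<Omega>)" .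
qed

lemma has_weak_limit:
  assumes P: "test_operator \<Omega> P"
    and L2: "\<And>n. u n \<in> L2 (vol \<Omega>)" "\<And>n. g n \<in> L2 (vol \<Omega>)" "u' \<in> L2 (vol \<Omega>)" "g' \<in> L2 (vol \<Omega>)"
    and w: "\<And>n. has_weak \<Omega> P (u n) (g n)"
    and lim: "(\<lambda>n. L2_norm (vol \<Omega>) (\<lambda>x. u n x - u' x)) \<longlonglongrightarrow> 0"
      "(\<lambda>n. L2_norm (vol \<Omega>) (\<lambda>x. g n x - g' x)) \<longlonglongrightarrow> 0"
  shows "has_weak \<Omega> P u' g'"
  unfolding has_weak_def
proof
  fix \<phi> assume \<phi>: "\<phi> \<in> test_functions \<Omega>"
  have t: "P \<phi> \<in> L2 (vol \<Omega>)" "\<phi> \<in> L2 (vol \<Omega>)" using P \<phi> by (auto simp: test_operator_def intro: test_L2)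
  have "(\<lambda>n. \<integral>x. u n x * P \<phi> x \<partial>vol \<Omega>) \<longlonglongrightarrow> (\<integral>x. u' x * P \<phi> x \<partial>vol \<Omega>)"
    by (rule L2_tendsto_integral[OF \<Omega>_finite L2(1,3) t(1) lim(1)])
  moreover have "(\<lambda>n. \<integral>x. g n x * \<phi> x \<partial>vol \<Omega>) \<longlonglongrightarrow> (\<integral>x. g' x * \<phi> x \<partial>vol \<Omega>)"
    by (rule L2_tendsto_integral[OF \<Omega>_finite L2(2,4) t(2) lim(2)])
  moreover have "(\<integral>x. u n x * P \<phi> x \<partial>vol \<Omega>) = (\<integral>x. g n x * \<phi> x \<partial>vol \<Omega>)" for n
    using w[of n] \<phi> by (simp add: has_weak_def)
  ultimately show "(\<integral>x. u' x * P \<phi> x \<partial>vol \<Omega>) = (\<integral>x. g' x * \<phi> x \<partial>vol \<Omega>)"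
    by (simp add: LIMSEQ_unique)
qed

lemma H1_L2: "u \<in> H1 \<Omega> \<Longrightarrow> u \<in> L2 (vol \<Omega>)"
  by (simp add: H1_def)

lemma weak_partial_spec:
  assumes "u \<in> H1 \<Omega>" "i \<in> Basis"
  shows "weak_partial \<Omega> i u \<in> L2 (vol \<Omega>)" "has_weak \<Omega> (grad_op i) u (weak_partial \<Omega> i u)"
proof -
  have "\<exists>g. g \<in> L2 (vol \<Omega>) \<and> has_weak_partial \<Omega> i u g" using assms by (auto simp: H1_def)
  from someI_ex[OF this] show "weak_partial \<Omega> i u \<in> L2 (vol \<Omega>)" "has_weak \<Omega> (grad_op i) u (weak_partial \<Omega> i u)"
    by (auto simp: weak_partial_def has_weak_partial_iff)
qed

lemma weak_laplacian_spec:
  assumes "u \<in> H1_laplace \<Omega>"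
  shows "weak_laplacian \<Omega> u \<in> L2 (vol \<Omega>)" "has_weak \<Omega> lap_op u (weak_laplacian \<Omega> u)"
proof -
  have "\<exists>g. g \<in> L2 (vol \<Omega>) \<and> has_weak_laplacian \<Omega> u g" using assms by (auto simp: H1_laplace_def)
  from someI_ex[OF this] show "weak_laplacian \<Omega> u \<in> L2 (vol \<Omega>)" "has_weak \<Omega> lap_op u (weak_laplacian \<Omega> u)"
    by (auto simp: weak_laplacian_def has_weak_laplacian_iff)
qed

lemma H1_I: "u \<in> L2 (vol \<Omega>) \<Longrightarrow> (\<And>i. i \<in> Basis \<Longrightarrow> g i \<in> L2 (vol \<Omega>) \<and> has_weak \<Omega> (grad_op i) u (g i)) \<Longrightarrow> u \<in> H1 \<Omega>"
  by (auto simp: H1_def has_weak_partial_iff)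

lemma H1_laplace_I: "u \<in> H1 \<Omega> \<Longrightarrow> f \<in> L2 (vol \<Omega>) \<Longrightarrow> has_weak \<Omega> lap_op u f \<Longrightarrow> u \<in> H1_laplace \<Omega>"
  by (auto simp: H1_laplace_def has_weak_laplacian_iff)

lemma H1_laplace_H1: "u \<in> H1_laplace \<Omega> \<Longrightarrow> u \<in> H1 \<Omega>"
  by (simp add: H1_laplace_def)

lemma weak_partial_eq:
  assumes "g \<in> L2 (vol \<Omega>)" "has_weak \<Omega> (grad_op i) u g" "u \<in> H1 \<Omega>" "i \<in> Basis"
  shows "AE x in vol \<Omega>. weak_partial \<Omega> i u x = g x"
  by (rule has_weak_unique[OF weak_partial_spec(1)[OF assms(3,4)] assms(1) weak_partial_spec(2)[OF assms(3,4)] assms(2)])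

lemma weak_laplacian_eq:
  assumes "f \<in> L2 (vol \<Omega>)" "has_weak \<Omega> lap_op u f" "u \<in> H1_laplace \<Omega>"
  shows "AE x in vol \<Omega>. weak_laplacian \<Omega> u x = f x"
  by (rule has_weak_unique[OF weak_laplacian_spec(1)[OF assms(3)] assms(1) weak_laplacian_spec(2)[OF assms(3)] assms(2)])

lemma H1_add:
  assumes "u \<in> H1 \<Omega>" "v \<in> H1 \<Omega>"
  shows "(\<lambda>x. u x + v x) \<in> H1 \<Omega>"
    "i \<in> Basis \<Longrightarrow> AE x in vol \<Omega>. weak_partial \<Omega> i (\<lambda>x. u x + v x) x = weak_partial \<Omega> i u x + weak_partial \<Omega> i v x"
proof -
  have w: "(\<lambda>x. weak_partial \<Omega> i u x + weak_partial \<Omega> i v x) \<in> L2 (vol \<Omega>) \<and>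
      has_weak \<Omega> (grad_op i) (\<lambda>x. u x + v x) (\<lambda>x. weak_partial \<Omega> i u x + weak_partial \<Omega> i v x)" if "i \<in> Basis" for i
    using that assms by (auto intro!: L2_add has_weak_add test_operator_grad weak_partial_spec intro: H1_L2)
  show H1: "(\<lambda>x. u x + v x) \<in> H1 \<Omega>" by (rule H1_I[OF _ w]) (use assms in \<open>auto intro: L2_add H1_L2\<close>)
  show "i \<in> Basis \<Longrightarrow> AE x in vol \<Omega>. weak_partial \<Omega> i (\<lambda>x. u x + v x) x = weak_partial \<Omega> i u x + weak_partial \<Omega> i v x"
    using w H1 by (intro weak_partial_eq) auto
qed

lemma H1_cmult:
  assumes "u \<in> H1 \<Omega>"
  shows "(\<lambda>x. c * u x) \<in> H1 \<Omega>"
    "i \<in> Basis \<Longrightarrow> AE x in vol \<Omega>. weak_partial \<Omega> i (\<lambda>x. c * u x) x = c * weak_partial \<Omega> i u x"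
proof -
  have w: "(\<lambda>x. c * weak_partial \<Omega> i u x) \<in> L2 (vol \<Omega>) \<and>
      has_weak \<Omega> (grad_op i) (\<lambda>x. c * u x) (\<lambda>x. c * weak_partial \<Omega> i u x)" if "i \<in> Basis" for i
    using that assms by (auto intro!: L2_cmult has_weak_cmult weak_partial_spec)
  show H1: "(\<lambda>x. c * u x) \<in> H1 \<Omega>" by (rule H1_I[OF _ w]) (use assms in \<open>auto intro: L2_cmult H1_L2\<close>)
  show "i \<in> Basis \<Longrightarrow> AE x in vol \<Omega>. weak_partial \<Omega> i (\<lambda>x. c * u x) x = c * weak_partial \<Omega> i u x"
    using w H1 by (intro weak_partial_eq) auto
qed

lemma H1_cnj:
  assumes "u \<in> H1 \<Omega>"
  shows "(\<lambda>x. cnj (u x)) \<in> H1 \<Omega>"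
    "i \<in> Basis \<Longrightarrow> AE x in vol \<Omega>. weak_partial \<Omega> i (\<lambda>x. cnj (u x)) x = cnj (weak_partial \<Omega> i u x)"
proof -
  have w: "(\<lambda>x. cnj (weak_partial \<Omega> i u x)) \<in> L2 (vol \<Omega>) \<and>
      has_weak \<Omega> (grad_op i) (\<lambda>x. cnj (u x)) (\<lambda>x. cnj (weak_partial \<Omega> i u x))" if "i \<in> Basis" for i
    using that assms by (auto intro!: L2_cnj has_weak_cnj test_operator_grad weak_partial_spec)
  show H1: "(\<lambda>x. cnj (u x)) \<in> H1 \<Omega>" by (rule H1_I[OF _ w]) (use assms in \<open>auto intro: L2_cnj H1_L2\<close>)
  show "i \<in> Basis \<Longrightarrow> AE x in vol \<Omega>. weak_partial \<Omega> i (\<lambda>x. cnj (u x)) x = cnj (weak_partial \<Omega> i u x)"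
    using w H1 by (intro weak_partial_eq) auto
qed

lemma H1_laplace_add:
  assumes "u \<in> H1_laplace \<Omega>" "v \<in> H1_laplace \<Omega>"
  shows "(\<lambda>x. u x + v x) \<in> H1_laplace \<Omega>"
    "AE x in vol \<Omega>. weak_laplacian \<Omega> (\<lambda>x. u x + v x) x = weak_laplacian \<Omega> u x + weak_laplacian \<Omega> v x"
proof -
  have w: "(\<lambda>x. weak_laplacian \<Omega> u x + weak_laplacian \<Omega> v x) \<in> L2 (vol \<Omega>)"
    "has_weak \<Omega> lap_op (\<lambda>x. u x + v x) (\<lambda>x. weak_laplacian \<Omega> u x + weak_laplacian \<Omega> v x)"
    using assms by (auto intro!: L2_add has_weak_add test_operator_lap weak_laplacian_spec intro: H1_L2 H1_laplace_H1)
  show H: "(\<lambda>x. u x + v x) \<in> H1_laplace \<Omega>" by (rule H1_laplace_I[OF _ w]) (intro H1_add H1_laplace_H1 assms)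
  show "AE x in vol \<Omega>. weak_laplacian \<Omega> (\<lambda>x. u x + v x) x = weak_laplacian \<Omega> u x + weak_laplacian \<Omega> v x"
    by (rule weak_laplacian_eq[OF w H])
qed

lemma H1_laplace_cmult:
  assumes "u \<in> H1_laplace \<Omega>"
  shows "(\<lambda>x. c * u x) \<in> H1_laplace \<Omega>"
    "AE x in vol \<Omega>. weak_laplacian \<Omega> (\<lambda>x. c * u x) x = c * weak_laplacian \<Omega> u x"
proof -
  have w: "(\<lambda>x. c * weak_laplacian \<Omega> u x) \<in> L2 (vol \<Omega>)"
    "has_weak \<Omega> lap_op (\<lambda>x. c * u x) (\<lambda>x. c * weak_laplacian \<Omega> u x)"
    using assms by (auto intro!: L2_cmult has_weak_cmult weak_laplacian_spec)
  show H: "(\<lambda>x. c * u x) \<in> H1_laplace \<Omega>" by (rule H1_laplace_I[OF _ w]) (intro H1_cmult H1_laplace_H1 assms)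
  show "AE x in vol \<Omega>. weak_laplacian \<Omega> (\<lambda>x. c * u x) x = c * weak_laplacian \<Omega> u x"
    by (rule weak_laplacian_eq[OF w H])
qed

lemma H1_laplace_cnj:
  assumes "u \<in> H1_laplace \<Omega>"
  shows "(\<lambda>x. cnj (u x)) \<in> H1_laplace \<Omega>"
    "AE x in vol \<Omega>. weak_laplacian \<Omega> (\<lambda>x. cnj (u x)) x = cnj (weak_laplacian \<Omega> u x)"
proof -
  have w: "(\<lambda>x. cnj (weak_laplacian \<Omega> u x)) \<in> L2 (vol \<Omega>)"
    "has_weak \<Omega> lap_op (\<lambda>x. cnj (u x)) (\<lambda>x. cnj (weak_laplacian \<Omega> u x))"
    using assms by (auto intro!: L2_cnj has_weak_cnj test_operator_lap weak_laplacian_spec)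
  show H: "(\<lambda>x. cnj (u x)) \<in> H1_laplace \<Omega>" by (rule H1_laplace_I[OF _ w]) (intro H1_cnj H1_laplace_H1 assms)
  show "AE x in vol \<Omega>. weak_laplacian \<Omega> (\<lambda>x. cnj (u x)) x = cnj (weak_laplacian \<Omega> u x)"
    by (rule weak_laplacian_eq[OF w H])
qed

lemma test_function_H1_laplace:
  assumes \<phi>: "\<phi> \<in> test_functions \<Omega>"
  shows "\<phi> \<in> H1_laplace \<Omega>"
    and "i \<in> Basis \<Longrightarrow> AE x in vol \<Omega>. weak_partial \<Omega> i \<phi> x = partial i \<phi> x"
    and "AE x in vol \<Omega>. weak_laplacian \<Omega> \<phi> x = lap_op \<phi> x"
proof -
  have lb: "(\<integral>x. u x * v x \<partial>vol \<Omega>) = (\<integral>x. u x * v x \<partial>lborel)" if "v \<in> test_functions \<Omega>" for u v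
    by (rule vol_integral_test[OF \<Omega>_open test_functions_outside[OF that]])
  have parts: "(\<integral>x. u x * partial i v x \<partial>vol \<Omega>) = - (\<integral>x. partial i u x * v x \<partial>vol \<Omega>)"
    if "u \<in> test_functions \<Omega>" "v \<in> test_functions \<Omega>" "i \<in> Basis" for u v i
    using that integration_by_parts_smooth[OF that(3) test_functions_mono[OF subset_UNIV that(2)]
        test_functions_mono[OF subset_UNIV that(1)]]
    by (simp add: lb test_functions_partial)
  have w: "partial i \<phi> \<in> L2 (vol \<Omega>) \<and> has_weak \<Omega> (grad_op i) \<phi> (partial i \<phi>)" if i: "i \<in> Basis" for i
    using parts[OF \<phi> _ i] test_L2[OF test_functions_partial[OF \<phi> i]]
    by (simp add: has_weak_def grad_op_def)
  have H1: "\<phi> \<in> H1 \<Omega>" by (rule H1_I[OF test_L2[OF \<phi>] w])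
  have "lap_op \<phi> \<in> L2 (vol \<Omega>)" using test_operator_lap[of \<Omega>] \<phi> by (auto simp: test_operator_def intro: test_L2)
  moreover have "has_weak \<Omega> lap_op \<phi> (lap_op \<phi>)"
    unfolding has_weak_def
  proof
    fix \<psi> assume \<psi>: "\<psi> \<in> test_functions \<Omega>"
    have i1: "integrable (vol \<Omega>) (\<lambda>x. \<phi> x * partial i (partial i \<psi>) x)"
      "integrable (vol \<Omega>) (\<lambda>x. partial i (partial i \<phi>) x * \<psi> x)" if "i \<in> Basis" for i
      using that \<phi> \<psi> by (auto intro!: L2_mult_integrable test_L2 test_functions_partial)
    have "(\<integral>x. \<phi> x * lap_op \<psi> x \<partial>vol \<Omega>) = (\<Sum>i\<in>Basis. \<integral>x. \<phi> x * partial i (partial i \<psi>) x \<partial>vol \<Omega>)"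
      unfolding lap_op_def sum_distrib_left by (rule Bochner_Integration.integral_sum) (rule i1)
    also have "\<dots> = (\<Sum>i\<in>Basis. \<integral>x. partial i (partial i \<phi>) x * \<psi> x \<partial>vol \<Omega>)"
    proof (rule sum.cong[OF refl])
      fix i :: 'a assume i: "i \<in> Basis"
      show "(\<integral>x. \<phi> x * partial i (partial i \<psi>) x \<partial>vol \<Omega>) = (\<integral>x. partial i (partial i \<phi>) x * \<psi> x \<partial>vol \<Omega>)"
        using parts[OF \<phi> test_functions_partial[OF \<psi> i] i] parts[OF test_functions_partial[OF \<phi> i] \<psi> i] by simp
    qed
    also have "\<dots> = (\<integral>x. lap_op \<phi> x * \<psi> x \<partial>vol \<Omega>)"
      unfolding lap_op_def sum_distrib_right by (rule Bochner_Integration.integral_sum[symmetric]) (rule i1)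
    finally show "(\<integral>x. \<phi> x * lap_op \<psi> x \<partial>vol \<Omega>) = (\<integral>x. lap_op \<phi> x * \<psi> x \<partial>vol \<Omega>)" .
  qed
  ultimately show H: "\<phi> \<in> H1_laplace \<Omega>" and "AE x in vol \<Omega>. weak_laplacian \<Omega> \<phi> x = lap_op \<phi> x"
    by (auto intro!: H1_laplace_I[OF H1] weak_laplacian_eq)
  show "i \<in> Basis \<Longrightarrow> AE x in vol \<Omega>. weak_partial \<Omega> i \<phi> x = partial i \<phi> x"
    using w H1 by (intro weak_partial_eq) auto
qed

lemma inner_grad_eq_sum:
  assumes "u \<in> H1 \<Omega>" "v \<in> H1 \<Omega>"
  shows "inner_grad \<Omega> u v = (\<Sum>i\<in>Basis. \<integral>x. weak_partial \<Omega> i u x * cnj (weak_partial \<Omega> i v x) \<partial>vol \<Omega>)"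
  unfolding inner_grad_def
  by (rule Bochner_Integration.integral_sum) (intro L2_mult_integrable L2_cnj weak_partial_spec assms)

text \<open>The Neumann condition, tested against \<open>v\<close>, is linear in the triple \<open>(u, grad u, lap u)\<close>.\<close>

definition neumann_eq :: "('a \<Rightarrow> 'a \<Rightarrow> complex) \<Rightarrow> ('a \<Rightarrow> complex) \<Rightarrow> bool" where
  "neumann_eq g f \<longleftrightarrow> (\<forall>v\<in>H1 \<Omega>.
    (\<Sum>i\<in>Basis. \<integral>x. g i x * cnj (weak_partial \<Omega> i v x) \<partial>vol \<Omega>) = - (\<integral>x. f x * cnj (v x) \<partial>vol \<Omega>))"

text \<open>\<open>weak_partial\<close> and \<open>weak_laplacian\<close> are chosen representatives
  and do not commute literally with sums, multiples or limits. Integrals ignore null sets, so the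
  Neumann condition may be checked with any representatives at hand.\<close>

lemma neumann_domain_iff:
  assumes u: "u \<in> H1_laplace \<Omega>" and g: "\<And>i. i \<in> Basis \<Longrightarrow> g i \<in> L2 (vol \<Omega>)"
      "\<And>i. i \<in> Basis \<Longrightarrow> AE x in vol \<Omega>. weak_partial \<Omega> i u x = g i x"
    and f: "f \<in> L2 (vol \<Omega>)" "AE x in vol \<Omega>. weak_laplacian \<Omega> u x = f x"
  shows "u \<in> neumann_domain \<Omega> \<longleftrightarrow> neumann_eq g f"
proof -
  have "inner_grad \<Omega> u v = (\<Sum>i\<in>Basis. \<integral>x. g i x * cnj (weak_partial \<Omega> i v x) \<partial>vol \<Omega>)" if v: "v \<in> H1 \<Omega>" for v
    unfolding inner_grad_eq_sum[OF H1_laplace_H1[OF u] v]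
  proof (rule sum.cong[OF refl], rule integral_cong_AE)
    fix i :: 'a assume i: "i \<in> Basis"
    note [measurable] = L2_measurable[OF g(1)[OF i]] L2_measurable[OF weak_partial_spec(1)[OF H1_laplace_H1[OF u] i]]
      L2_measurable[OF weak_partial_spec(1)[OF v i]]
    show "(\<lambda>x. weak_partial \<Omega> i u x * cnj (weak_partial \<Omega> i v x)) \<in> borel_measurable (vol \<Omega>)"
      "(\<lambda>x. g i x * cnj (weak_partial \<Omega> i v x)) \<in> borel_measurable (vol \<Omega>)" by measurable
    show "AE x in vol \<Omega>. weak_partial \<Omega> i u x * cnj (weak_partial \<Omega> i v x) = g i x * cnj (weak_partial \<Omega> i v x)"
      using g(2)[OF i] by eventually_elim simp
  qed
  moreover have "inner_vol \<Omega> (weak_laplacian \<Omega> u) v = (\<integral>x. f x * cnj (v x) \<partial>vol \<Omega>)" if v: "v \<in> H1 \<Omega>" for v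
    unfolding inner_vol_def
  proof (rule integral_cong_AE)
    note [measurable] = L2_measurable[OF f(1)] L2_measurable[OF weak_laplacian_spec(1)[OF u]] L2_measurable[OF H1_L2[OF v]]
    show "(\<lambda>x. weak_laplacian \<Omega> u x * cnj (v x)) \<in> borel_measurable (vol \<Omega>)"
      "(\<lambda>x. f x * cnj (v x)) \<in> borel_measurable (vol \<Omega>)" by measurable
    show "AE x in vol \<Omega>. weak_laplacian \<Omega> u x * cnj (v x) = f x * cnj (v x)"
      using f(2) by eventually_elim simp
  qed
  ultimately show ?thesis using u by (simp add: neumann_domain_def neumann_eq_def)
qed

lemma neumann_domain_eq: "u \<in> neumann_domain \<Omega> \<Longrightarrow> neumann_eq (\<lambda>i. weak_partial \<Omega> i u) (weak_laplacian \<Omega> u)"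
  using neumann_domain_iff[of u "\<lambda>i. weak_partial \<Omega> i u" "weak_laplacian \<Omega> u"]
  by (auto simp: neumann_domain_def intro: weak_partial_spec weak_laplacian_spec H1_laplace_H1)

lemma neumann_domain_laplace: "u \<in> neumann_domain \<Omega> \<Longrightarrow> u \<in> H1_laplace \<Omega>"
  by (simp add: neumann_domain_def)

lemma neumann_domain_add:
  assumes u: "u \<in> neumann_domain \<Omega>" and v: "v \<in> neumann_domain \<Omega>"
  shows "(\<lambda>x. u x + v x) \<in> neumann_domain \<Omega>"
proof -
  note L = neumann_domain_laplace[OF u] neumann_domain_laplace[OF v]
  note H = H1_laplace_H1[OF L(1)] H1_laplace_H1[OF L(2)]
  show ?thesis
  proof (subst neumann_domain_iff[OF H1_laplace_add(1)[OF L] _ H1_add(2)[OF H] _ H1_laplace_add(2)[OF L]])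
    show "neumann_eq (\<lambda>i x. weak_partial \<Omega> i u x + weak_partial \<Omega> i v x) (\<lambda>x. weak_laplacian \<Omega> u x + weak_laplacian \<Omega> v x)"
      using neumann_domain_eq[OF u] neumann_domain_eq[OF v]
      by (simp add: neumann_eq_def distrib_right L2_mult_integrable L2_cnj weak_partial_spec H weak_laplacian_spec L H1_L2 sum.distrib)
  qed (auto intro!: L2_add weak_partial_spec weak_laplacian_spec H L)
qed

lemma neumann_domain_cmult:
  assumes u: "u \<in> neumann_domain \<Omega>"
  shows "(\<lambda>x. c * u x) \<in> neumann_domain \<Omega>"
proof -
  note L = neumann_domain_laplace[OF u]
  note H = H1_laplace_H1[OF L]
  show ?thesis
  proof (subst neumann_domain_iff[OF H1_laplace_cmult(1)[OF L] _ H1_cmult(2)[OF H] _ H1_laplace_cmult(2)[OF L]])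
    show "neumann_eq (\<lambda>i x. c * weak_partial \<Omega> i u x) (\<lambda>x. c * weak_laplacian \<Omega> u x)"
      using neumann_domain_eq[OF u] by (simp add: neumann_eq_def mult.assoc flip: sum_distrib_left)
  qed (auto intro!: L2_cmult weak_partial_spec weak_laplacian_spec H L)
qed

text \<open>The condition for \<open>u\<close>, tested with the conjugate of \<open>v\<close> and
  then conjugated, is the condition for the conjugate of \<open>u\<close> tested with
  \<open>v\<close>.\<close>

lemma neumann_domain_cnj:
  assumes u: "u \<in> neumann_domain \<Omega>"
  shows "(\<lambda>x. cnj (u x)) \<in> neumann_domain \<Omega>"
proof -
  note L = neumann_domain_laplace[OF u]
  note H = H1_laplace_H1[OF L]
  show ?thesis
  proof (subst neumann_domain_iff[OF H1_laplace_cnj(1)[OF L] _ H1_cnj(2)[OF H] _ H1_laplace_cnj(2)[OF L]])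
    show "neumann_eq (\<lambda>i x. cnj (weak_partial \<Omega> i u x)) (\<lambda>x. cnj (weak_laplacian \<Omega> u x))"
      unfolding neumann_eq_def
    proof
      fix v assume v: "v \<in> H1 \<Omega>"
      have "(\<Sum>i\<in>Basis. \<integral>x. cnj (weak_partial \<Omega> i u x) * cnj (weak_partial \<Omega> i v x) \<partial>vol \<Omega>) =
          (\<Sum>i\<in>Basis. \<integral>x. cnj (weak_partial \<Omega> i u x * cnj (weak_partial \<Omega> i (\<lambda>x. cnj (v x)) x)) \<partial>vol \<Omega>)"
      proof (rule sum.cong[OF refl], rule integral_cong_AE)
        fix i :: 'a assume i: "i \<in> Basis"
        note [measurable] = L2_measurable[OF weak_partial_spec(1)[OF H i]] L2_measurable[OF weak_partial_spec(1)[OF v i]]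
          L2_measurable[OF weak_partial_spec(1)[OF H1_cnj(1)[OF v] i]]
        show "(\<lambda>x. cnj (weak_partial \<Omega> i u x) * cnj (weak_partial \<Omega> i v x)) \<in> borel_measurable (vol \<Omega>)"
          "(\<lambda>x. cnj (weak_partial \<Omega> i u x * cnj (weak_partial \<Omega> i (\<lambda>x. cnj (v x)) x))) \<in> borel_measurable (vol \<Omega>)" by measurable
        show "AE x in vol \<Omega>. cnj (weak_partial \<Omega> i u x) * cnj (weak_partial \<Omega> i v x) =
            cnj (weak_partial \<Omega> i u x * cnj (weak_partial \<Omega> i (\<lambda>x. cnj (v x)) x))"
          using H1_cnj(2)[OF v i] by eventually_elim simp
      qed
      also have "\<dots> = cnj (\<Sum>i\<in>Basis. \<integral>x. weak_partial \<Omega> i u x * cnj (weak_partial \<Omega> i (\<lambda>x. cnj (v x)) x) \<partial>vol \<Omega>)"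
        by (simp only: Bochner_Integration.integral_cnj cnj_sum)
      also have "\<dots> = cnj (- (\<integral>x. weak_laplacian \<Omega> u x * cnj (cnj (v x)) \<partial>vol \<Omega>))"
        using neumann_domain_eq[OF u] H1_cnj(1)[OF v] by (simp only: neumann_eq_def)
      also have "\<dots> = - (\<integral>x. cnj (weak_laplacian \<Omega> u x) * cnj (v x) \<partial>vol \<Omega>)"
        by (simp flip: Bochner_Integration.integral_cnj)
      finally show "(\<Sum>i\<in>Basis. \<integral>x. cnj (weak_partial \<Omega> i u x) * cnj (weak_partial \<Omega> i v x) \<partial>vol \<Omega>) =
          - (\<integral>x. cnj (weak_laplacian \<Omega> u x) * cnj (v x) \<partial>vol \<Omega>)" .
    qed
  qed (auto intro!: L2_cnj weak_partial_spec weak_laplacian_spec H L)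
qed

text \<open>There is no boundary term: the conjugate of \<open>partial i \<phi>\<close> is itself a
  test function, so the definition of the weak derivative of \<open>v\<close> performs the
  integration by parts.\<close>

lemma test_function_neumann:
  assumes \<phi>: "\<phi> \<in> test_functions \<Omega>"
  shows "\<phi> \<in> neumann_domain \<Omega>"
proof (subst neumann_domain_iff[OF test_function_H1_laplace(1)[OF \<phi>] _ test_function_H1_laplace(2)[OF \<phi>] _
      test_function_H1_laplace(3)[OF \<phi>]])
  show lapL2: "lap_op \<phi> \<in> L2 (vol \<Omega>)" using test_operator_lap[of \<Omega>] \<phi> by (auto simp: test_operator_def intro: test_L2)
  show "partial i \<phi> \<in> L2 (vol \<Omega>)" if "i \<in> Basis" for i by (intro test_L2 test_functions_partial \<phi> that)
  show "neumann_eq (\<lambda>i. partial i \<phi>) (lap_op \<phi>)"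
    unfolding neumann_eq_def
  proof
    fix v assume v: "v \<in> H1 \<Omega>"
    have part: "(\<integral>x. partial i \<phi> x * cnj (weak_partial \<Omega> i v x) \<partial>vol \<Omega>) = - (\<integral>x. partial i (partial i \<phi>) x * cnj (v x) \<partial>vol \<Omega>)"
      if i: "i \<in> Basis" for i
    proof -
      have t: "(\<lambda>x. cnj (partial i \<phi> x)) \<in> test_functions \<Omega>" by (intro test_functions_cnj test_functions_partial \<phi> i)
      have "(\<integral>x. v x * (- partial i (\<lambda>x. cnj (partial i \<phi> x)) x) \<partial>vol \<Omega>) = (\<integral>x. weak_partial \<Omega> i v x * cnj (partial i \<phi> x) \<partial>vol \<Omega>)"
        using weak_partial_spec(2)[OF v i] t by (simp add: has_weak_def grad_op_def)
      then have "cnj (\<integral>x. v x * (- cnj (partial i (partial i \<phi>) x)) \<partial>vol \<Omega>) = cnj (\<integral>x. weak_partial \<Omega> i v x * cnj (partial i \<phi> x) \<partial>vol \<Omega>)"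
        using partial_cnj_test[OF test_functions_partial[OF \<phi> i], of i] by simp
      then show ?thesis by (simp add: mult.commute flip: Bochner_Integration.integral_cnj)
    qed
    have i1: "integrable (vol \<Omega>) (\<lambda>x. partial i (partial i \<phi>) x * cnj (v x))" if "i \<in> Basis" for i
      using that \<phi> v by (intro L2_mult_integrable test_L2[OF test_functions_partial] test_functions_partial L2_cnj H1_L2[OF v])
    show "(\<Sum>i\<in>Basis. \<integral>x. partial i \<phi> x * cnj (weak_partial \<Omega> i v x) \<partial>vol \<Omega>) = - (\<integral>x. lap_op \<phi> x * cnj (v x) \<partial>vol \<Omega>)"
      unfolding lap_op_def sum_distrib_right
      by (subst Bochner_Integration.integral_sum) (auto simp: i1 part sum_negf)
  qed
qed

end

section \<open>Finiteness of the surface measure\<close>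

text \<open>The set is described by \<open>m\<close> bounded coordinates that determine points in a
  Lipschitz way. Cutting the coordinate cube into \<open>N ^ m\<close> cells gives pieces of
  diameter at most \<open>L / N\<close>; the covering sum is \<open>N ^ m * (L / N) ^ m\<close> up
  to a constant and hence independent of the scale.\<close>

lemma hausdorff_outer_finite_grid:
  fixes A :: "'a::euclidean_space set" and p :: "'a \<Rightarrow> 'i \<Rightarrow> real"
  assumes I: "finite I" "card I = m" and R: "R \<ge> 0"
    and p: "\<And>x i. x \<in> A \<Longrightarrow> i \<in> I \<Longrightarrow> \<bar>p x i\<bar> \<le> R"
    and K: "K \<ge> 0" "\<And>x y. x \<in> A \<Longrightarrow> y \<in> A \<Longrightarrow> dist x y \<le> K * (\<Sum>i\<in>I. \<bar>p x i - p y i\<bar>)"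
  shows "hausdorff_outer m A < \<infinity>"
proof -
  define L where "L = K * (real m * (2 * R + 1))"
  have L: "L \<ge> 0" using K R by (simp add: L_def)
  define C where "C = unit_ball_vol (real m) * (L / 2) ^ m"
  have "hausdorff_pre m \<delta> A \<le> ennreal C" if \<delta>: "\<delta> > 0" for \<delta>
  proof -
    obtain N :: nat where N: "N > 0" "L / \<delta> \<le> real N"
      using real_arch_simple[of "max 1 (L / \<delta>)"] by (metis max.bounded_iff not_one_le_zero of_nat_0 of_nat_0_less_iff
        less_le_trans zero_less_one)
    then have N\<delta>: "L / real N \<le> \<delta>" using \<delta> by (simp add: field_simps)
    \<comment> \<open>The width \<open>2 * R + 1\<close> instead of \<open>2 * R\<close> keeps the
      index strictly below \<open>N\<close> at the upper end and avoids a division by 0 for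
      \<open>R = 0\<close>.\<close>
    define cell where "cell x i = nat \<lfloor>real N * (p x i + R) / (2 * R + 1)\<rfloor>" for x i
    have cell_lt: "cell x i < N" if "x \<in> A" "i \<in> I" for x i
    proof -
      have "real N * (p x i + R) < real N * (2 * R + 1)" "0 \<le> p x i + R"
        using p[OF that] R N by auto
      then have "real N * (p x i + R) / (2 * R + 1) < real N" "0 \<le> real N * (p x i + R) / (2 * R + 1)"
        using R by (auto simp: divide_less_eq)
      then show ?thesis unfolding cell_def by (simp add: nat_less_iff floor_less_iff)
    qed
    define F where "F = PiE I (\<lambda>_. {..<N})"
    have F: "finite F" "card F = N ^ m" using I by (auto simp: F_def finite_PiE card_PiE)
    obtain h where h: "bij_betw h {0..<card F} F" using ex_bij_betw_nat_finite[OF F(1)] by auto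
    define U where "U k = {x \<in> A. \<forall>i\<in>I. cell x i = k i}" for k
    define V where "V j = (if j < N ^ m then U (h j) else {})" for j
    have diam: "dist x y \<le> L / real N" if "x \<in> U k" "y \<in> U k" for x y k
    proof -
      have "\<bar>p x i - p y i\<bar> \<le> (2 * R + 1) / real N" if i: "i \<in> I" for i
      proof -
        let ?c = "\<lambda>x. real N * (p x i + R) / (2 * R + 1)"
        have xy: "x \<in> A" "y \<in> A" "cell x i = cell y i" using \<open>x \<in> U k\<close> \<open>y \<in> U k\<close> i by (auto simp: U_def)
        have nn: "0 \<le> ?c x" "0 \<le> ?c y" using p[OF xy(1) i] p[OF xy(2) i] R by auto
        then have "\<lfloor>?c x\<rfloor> = \<lfloor>?c y\<rfloor>" using xy(3) unfolding cell_def by (simp add: nat_eq_iff)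
        then have "\<bar>?c x - ?c y\<bar> \<le> 1" by linarith
        also have "?c x - ?c y = real N / (2 * R + 1) * (p x i - p y i)"
          by (subst diff_divide_distrib[symmetric]) (simp add: right_diff_distrib[symmetric])
        finally have "\<bar>real N / (2 * R + 1)\<bar> * \<bar>p x i - p y i\<bar> \<le> 1" by (simp only: abs_mult)
        then show ?thesis using N R by (simp add: field_simps)
      qed
      then have "(\<Sum>i\<in>I. \<bar>p x i - p y i\<bar>) \<le> real (card I) * ((2 * R + 1) / real N)"
        by (rule sum_bounded_above)
      then have "K * (\<Sum>i\<in>I. \<bar>p x i - p y i\<bar>) \<le> K * (real m * ((2 * R + 1) / real N))"
        using K I by (intro mult_left_mono) auto
      then show ?thesis using K(2)[of x y] that by (simp add: U_def L_def)
    qed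
    have diamV: "bounded (V j) \<and> diameter (V j) \<le> L / real N" for j
    proof (cases "V j = {}")
      case True
      then show ?thesis using L N by (simp add: diameter_def)
    next
      case False
      have d: "dist x y \<le> L / real N" if "x \<in> V j" "y \<in> V j" for x y
        using that diam[of x "h j" y] by (auto simp: V_def split: if_splits)
      obtain x where "x \<in> V j" using False by auto
      then have "bounded (V j)" unfolding bounded_def using d by blast
      moreover have "diameter (V j) \<le> L / real N"
        by (rule diameter_le) (use False d in \<open>auto simp: dist_norm\<close>)
      ultimately show ?thesis by simp
    qed
    have "A \<subseteq> (\<Union>j. V j)"
    proof
      fix x assume x: "x \<in> A"
      define k where "k = restrict (cell x) I"
      have "k \<in> F" using cell_lt[OF x] by (auto simp: F_def k_def)
      then have "k \<in> h ` {0..<card F}" using h by (simp add: bij_betw_def)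
      then obtain j where j: "j < card F" "h j = k" by auto
      then have "x \<in> V j" using x F by (auto simp: V_def U_def k_def)
      then show "x \<in> (\<Union>j. V j)" by blast
    qed
    then have "hausdorff_pre m \<delta> A \<le> (\<Sum>j. hausdorff_gauge m (V j))"
      unfolding hausdorff_pre_def using diamV N\<delta> by (intro INF_lower) (auto intro: order_trans)
    also have "\<dots> = (\<Sum>j<N^m. hausdorff_gauge m (V j))"
      by (rule suminf_finite) (auto simp: V_def hausdorff_gauge_def)
    also have "\<dots> \<le> (\<Sum>j<N^m. ennreal (unit_ball_vol (real m) * (L / real N / 2) ^ m))"
    proof (rule sum_mono)
      fix j
      have "0 \<le> diameter (V j)" using diamV[of j] diameter_ge_0 by blast
      then show "hausdorff_gauge m (V j) \<le> ennreal (unit_ball_vol (real m) * (L / real N / 2) ^ m)"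
        using diamV[of j] L N
        by (auto simp: hausdorff_gauge_def intro!: ennreal_leI mult_left_mono power_mono divide_right_mono)
    qed
    also have "\<dots> = ennreal (real (N ^ m) * (unit_ball_vol (real m) * (L / real N / 2) ^ m))"
      using L N by (subst ennreal_mult) (auto simp: ennreal_of_nat_eq_real_of_nat)
    also have "real (N ^ m) * (unit_ball_vol (real m) * (L / real N / 2) ^ m) = C"
      using N by (simp add: C_def power_divide)
    finally show ?thesis .
  qed
  then have "hausdorff_outer m A \<le> ennreal C"
    unfolding hausdorff_outer_def by (intro SUP_least) auto
  then show ?thesis by (rule le_less_trans) simp
qed

text \<open>The hyperplane below the graph need not be a coordinate plane. Instead of rotating it,
  one coordinate \<open>b\<close> with \<open>e \<bullet> b \<noteq> 0\<close> is dropped: the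
  remaining coordinates of the projection control its norm, and the Lipschitz bound of
  \<open>g\<close> controls the height.\<close>

lemma hausdorff_outer_lipschitz_graph:
  fixes e :: "'a::euclidean_space"
  assumes e: "norm e = 1" and g: "C-lipschitz_on {y. y \<bullet> e = 0} g" and A: "bounded A"
    and graph: "\<And>x. x \<in> A \<Longrightarrow> x \<bullet> e = g (x - (x \<bullet> e) *\<^sub>R e)"
  shows "hausdorff_outer (DIM('a) - 1) A < \<infinity>"
proof -
  obtain b where b: "b \<in> Basis" "e \<bullet> b \<noteq> 0"
    using e by (metis euclidean_all_zero_iff norm_zero zero_neq_one)
  define q where "q x = x - (x \<bullet> e) *\<^sub>R e" for x
  have qe: "q x \<bullet> e = 0" for x using e by (simp add: q_def inner_diff_left norm_eq_1)
  obtain R where R: "\<And>x. x \<in> A \<Longrightarrow> norm x \<le> R" "R > 0" using A by (auto simp: bounded_pos)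
  have C: "C \<ge> 0" using g by (simp add: lipschitz_on_def)
  define c where "c = 1 / \<bar>e \<bullet> b\<bar> + 1"
  have c: "c \<ge> 0" by (simp add: c_def)
  \<comment> \<open>The equation \<open>z \<bullet> e = 0\<close> is solved for the coordinate
    \<open>b\<close>; the other coordinates of the unit vector \<open>e\<close> are at most 1 in
    modulus. This is the origin of the two summands of \<open>c\<close>.\<close>
  have plane: "norm z \<le> c * (\<Sum>i\<in>Basis - {b}. \<bar>z \<bullet> i\<bar>)" if z: "z \<bullet> e = 0" for z
  proof -
    let ?s = "\<Sum>i\<in>Basis - {b}. \<bar>z \<bullet> i\<bar>"
    have "0 = (\<Sum>i\<in>Basis. (z \<bullet> i) * (e \<bullet> i))" using z by (simp add: euclidean_inner[of z e])
    also have "\<dots> = (z \<bullet> b) * (e \<bullet> b) + (\<Sum>i\<in>Basis - {b}. (z \<bullet> i) * (e \<bullet> i))"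
      using b by (intro sum.remove) auto
    finally have "\<bar>(z \<bullet> b) * (e \<bullet> b)\<bar> = \<bar>\<Sum>i\<in>Basis - {b}. (z \<bullet> i) * (e \<bullet> i)\<bar>" by linarith
    also have "\<dots> \<le> (\<Sum>i\<in>Basis - {b}. \<bar>(z \<bullet> i) * (e \<bullet> i)\<bar>)" by (rule sum_abs)
    also have "\<dots> \<le> ?s"
    proof (rule sum_mono)
      fix i assume "i \<in> Basis - {b}"
      then have "\<bar>e \<bullet> i\<bar> \<le> 1" using Basis_le_norm[of i e] e by auto
      then show "\<bar>(z \<bullet> i) * (e \<bullet> i)\<bar> \<le> \<bar>z \<bullet> i\<bar>" by (simp add: abs_mult mult_left_le)
    qed
    finally have "\<bar>z \<bullet> b\<bar> \<le> ?s / \<bar>e \<bullet> b\<bar>" using b by (simp add: abs_mult field_simps)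
    moreover have "norm z \<le> \<bar>z \<bullet> b\<bar> + ?s"
      using norm_le_l1[of z] b by (simp add: sum.remove[of Basis b])
    ultimately show ?thesis by (simp add: c_def algebra_simps)
  qed
  show ?thesis
  proof (rule hausdorff_outer_finite_grid[where I = "Basis - {b}" and p = "\<lambda>x i. q x \<bullet> i" and R = "2 * R"
        and K = "(1 + C) * c"])
    show "card (Basis - {b}) = DIM('a) - 1" using b by simp
  next
    fix x i assume x: "x \<in> A" and i: "i \<in> Basis - {b}"
    have "\<bar>q x \<bullet> i\<bar> \<le> norm (q x)" using i by (auto intro: Basis_le_norm)
    also have "\<dots> \<le> norm x + \<bar>x \<bullet> e\<bar> * norm e" unfolding q_def by (metis norm_scaleR norm_triangle_ineq4)
    also have "\<dots> \<le> norm x + norm x * norm e * norm e"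
      using Cauchy_Schwarz_ineq2[of x e] by (intro add_left_mono mult_right_mono) auto
    also have "\<dots> \<le> 2 * R" using e R(1)[OF x] by simp
    finally show "\<bar>q x \<bullet> i\<bar> \<le> 2 * R" .
  next
    fix x y assume xy: "x \<in> A" "y \<in> A"
    have "x - y = (q x - q y) + (x \<bullet> e - y \<bullet> e) *\<^sub>R e" by (simp add: q_def algebra_simps)
    then have "dist x y \<le> norm (q x - q y) + \<bar>x \<bullet> e - y \<bullet> e\<bar>"
      unfolding dist_norm using e by (metis norm_triangle_ineq norm_scaleR mult.right_neutral)
    also have "\<bar>x \<bullet> e - y \<bullet> e\<bar> = dist (g (q x)) (g (q y))"
      using graph xy by (simp add: q_def dist_real_def)
    also have "\<dots> \<le> C * norm (q x - q y)"
      using lipschitz_onD[OF g, of "q x" "q y"] qe by (simp add: dist_norm)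
    finally have "dist x y \<le> (1 + C) * norm (q x - q y)" by (simp add: algebra_simps)
    also have "\<dots> \<le> (1 + C) * (c * (\<Sum>i\<in>Basis - {b}. \<bar>(q x - q y) \<bullet> i\<bar>))"
      using C qe by (intro mult_left_mono plane) (auto simp: inner_diff_left)
    finally show "dist x y \<le> (1 + C) * c * (\<Sum>i\<in>Basis - {b}. \<bar>q x \<bullet> i - q y \<bullet> i\<bar>)"
      by (simp add: inner_diff_left mult.assoc)
  qed (use R C c in auto)
qed

text \<open>A boundary point of an open set is not in the set, so it does not lie above the graph.
  Were it strictly below, a neighbourhood of it would be below by continuity and miss the set,
  although the point is in the closure.\<close>

lemma frontier_in_graph:
  fixes \<Omega> :: "'a::euclidean_space set"
  assumes \<Omega>: "open \<Omega>" and e: "norm e = 1" and U: "open U" and g: "C-lipschitz_on {y. y \<bullet> e = 0} g"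
    and eq: "\<Omega> \<inter> U = {x \<in> U. g (x - (x \<bullet> e) *\<^sub>R e) < x \<bullet> e}" and x: "x \<in> frontier \<Omega> \<inter> U"
  shows "x \<bullet> e = g (x - (x \<bullet> e) *\<^sub>R e)"
proof (rule ccontr)
  assume ne: "\<not> ?thesis"
  let ?q = "\<lambda>x. x - (x \<bullet> e) *\<^sub>R e"
  have x\<Omega>: "x \<notin> \<Omega>" "x \<in> closure \<Omega>" using x \<Omega> by (auto simp: frontier_def interior_open)
  then have lt: "x \<bullet> e < g (?q x)" using ne eq x by force
  have cont: "continuous_on UNIV (\<lambda>x. g (?q x))"
  proof (rule continuous_on_compose2[OF lipschitz_on_continuous_on[OF g]])
    show "?q ` UNIV \<subseteq> {y. y \<bullet> e = 0}" using e by (auto simp: inner_diff_left norm_eq_1)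
  qed (auto intro!: continuous_intros)
  have "open {y. y \<bullet> e < g (?q y)}" using cont by (intro open_Collect_less continuous_intros) auto
  then have "open (U \<inter> {y. y \<bullet> e < g (?q y)})" using U by (rule open_Int[rotated])
  moreover have "x \<in> U \<inter> {y. y \<bullet> e < g (?q y)}" using x lt by auto
  ultimately have "\<Omega> \<inter> (U \<inter> {y. y \<bullet> e < g (?q y)}) \<noteq> {}"
    using x\<Omega>(2) open_Int_closure_eq_empty[of "U \<inter> {y. y \<bullet> e < g (?q y)}" \<Omega>] by blast
  then obtain y where "y \<in> \<Omega> \<inter> U" "y \<bullet> e < g (?q y)" by blast
  then show False using eq by force
qed

lemma hausdorff_outer_finite_UN:
  assumes "finite I" "\<And>i. i \<in> I \<Longrightarrow> hausdorff_outer m (A i) < \<infinity>"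
  shows "hausdorff_outer m (\<Union>i\<in>I. A i) < \<infinity>"
  using assms
proof (induction I rule: finite_induct)
  case (insert i I)
  have "hausdorff_outer m (\<Union>i\<in>insert i I. A i) \<le> hausdorff_outer m (A i) + hausdorff_outer m (\<Union>i\<in>I. A i)"
    using hausdorff_outer_subadd2 by simp
  also have "\<dots> < \<infinity>" using insert by (simp add: ennreal_add_less_top)
  finally show ?case .
qed (simp add: hausdorff_outer_empty)

text \<open>Near each boundary point the frontier is a bounded piece of a Lipschitz graph, and
  compactness of the frontier leaves finitely many such pieces.\<close>

lemma finite_measure_surf:
  fixes \<Omega> :: "'a::euclidean_space set"
  assumes "lipschitz_domain \<Omega>" "bounded \<Omega>"
  shows "finite_measure (surf \<Omega>)"
proof -
  let ?m = "DIM('a) - 1" and ?F = "frontier \<Omega>"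
  have \<Omega>: "open \<Omega>" "lipschitz_boundary \<Omega>" using assms(1) by (auto simp: lipschitz_domain_def)
  have "\<exists>V. open V \<and> z \<in> V \<and> hausdorff_outer ?m (?F \<inter> V) < \<infinity>" if z: "z \<in> ?F" for z
  proof -
    obtain e U g C where U: "norm e = 1" "open U" "z \<in> U" "C-lipschitz_on {y. y \<bullet> e = 0} g"
        "\<Omega> \<inter> U = {x \<in> U. g (x - (x \<bullet> e) *\<^sub>R e) < x \<bullet> e}"
      using \<Omega>(2) z unfolding lipschitz_boundary_def by meson
    have bF: "bounded ?F" using compact_imp_bounded[OF compact_frontier_bounded[OF assms(2)]] .
    have "hausdorff_outer ?m (?F \<inter> U) < \<infinity>"
    proof (rule hausdorff_outer_lipschitz_graph[OF U(1,4)])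
      show "bounded (?F \<inter> U)" using bF by (rule bounded_subset) auto
    qed (rule frontier_in_graph[OF \<Omega>(1) U(1,2,4,5)])
    then show ?thesis using U by blast
  qed
  then obtain V where V: "\<And>z. z \<in> ?F \<Longrightarrow> open (V z) \<and> z \<in> V z \<and> hausdorff_outer ?m (?F \<inter> V z) < \<infinity>" by metis
  have "compact ?F" using assms(2) by (rule compact_frontier_bounded)
  then obtain Z where Z: "Z \<subseteq> ?F" "finite Z" "?F \<subseteq> (\<Union>z\<in>Z. V z)"
    using compactE_image[of ?F ?F V] V by blast
  have "hausdorff_outer ?m ?F \<le> hausdorff_outer ?m (\<Union>z\<in>Z. ?F \<inter> V z)"
    using Z by (intro hausdorff_outer_mono) auto
  also have "\<dots> < \<infinity>" using V Z by (intro hausdorff_outer_finite_UN) auto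
  finally have "emeasure (surf \<Omega>) (space (surf \<Omega>)) < \<infinity>"
    by (simp add: surf_def space_restrict_space emeasure_restrict_space emeasure_hausdorff_measure)
  then show ?thesis by (intro finite_measureI) auto
qed

section \<open>Traces and the form\<close>

lemma Linf_bound:
  assumes "f \<in> Linf M"
  obtains K where "K \<ge> 0" "AE x in M. norm (f x) \<le> K"
proof -
  define E where "E = Linf_norm M f"
  have E: "E < \<infinity>" using assms by (simp add: Linf_def E_def)
  have AE: "AE x in M. ereal (norm (f x)) \<le> E" unfolding E_def Linf_norm_def by (rule esssup_AE)
  have "AE x in M. norm (f x) \<le> max 0 (real_of_ereal E)"
    using AE by eventually_elim (use E in \<open>cases E; auto\<close>)
  then show thesis by (intro that[of "max 0 (real_of_ereal E)"]) auto
qed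

lemma real_ip_weight:
  assumes "(\<lambda>x. complex_of_real (a x) * f x) \<in> L2 M" "f \<in> L2 M"
  shows "real_ip M (\<lambda>x. complex_of_real (a x) * f x) f = (\<integral>x. a x * (cmod (f x))\<^sup>2 \<partial>M)"
proof -
  have "Re (complex_of_real (a x) * f x * cnj (f x)) = a x * (cmod (f x))\<^sup>2" for x
    by (simp add: norm_sq_eq_Re mult.assoc del: complex_mult_cnj)
  then show ?thesis
    unfolding real_ip_def by (subst integral_Re) (simp_all add: L2_mult_integrable L2_cnj assms)
qed

locale wentzell =
  fixes \<Omega> :: "'a::euclidean_space set" and \<alpha> \<beta> \<gamma> :: "'a \<Rightarrow> real" and \<eta> :: real
  assumes \<Omega>: "lipschitz_domain \<Omega>" "bounded \<Omega>"
    and \<alpha>: "\<alpha> \<in> Linf (vol \<Omega>)" and \<beta>: "\<beta> \<in> Linf (surf \<Omega>)" and \<gamma>: "\<gamma> \<in> Linf (surf \<Omega>)"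
    and \<eta>: "\<eta> > 0" and \<alpha>_ge: "AE x in vol \<Omega>. \<alpha> x \<ge> \<eta>" and \<beta>_ge: "AE x in surf \<Omega>. \<beta> x \<ge> \<eta>"
    and \<gamma>_ge: "AE x in surf \<Omega>. \<gamma> x \<ge> 0"
begin

lemma open_domain: "open \<Omega>"
  using \<Omega>(1) by (simp add: lipschitz_domain_def)

sublocale finite_domain \<Omega>
  by (rule finite_domain.intro[OF open_domain finite_measure_vol[OF open_domain \<Omega>(2)]])

abbreviation wsurf :: "'a measure" where
  "wsurf \<equiv> density (surf \<Omega>) (\<lambda>x. ennreal (inverse (\<beta> x)))"

lemma finite_surf: "finite_measure (surf \<Omega>)"
  using \<Omega> by (rule finite_measure_surf)

lemma measurable_coeffs [measurable]:
  "\<alpha> \<in> borel_measurable (vol \<Omega>)" "\<beta> \<in> borel_measurable (surf \<Omega>)" "\<gamma> \<in> borel_measurable (surf \<Omega>)"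
  using \<alpha> \<beta> \<gamma> by (auto simp: Linf_def)

lemma inverse_\<beta>: "AE x in surf \<Omega>. 0 < inverse (\<beta> x) \<and> inverse (\<beta> x) \<le> inverse \<eta>"
  using \<beta>_ge by eventually_elim (use \<eta> in \<open>auto intro: le_imp_inverse_le\<close>)

lemma finite_wsurf: "finite_measure wsurf"
proof (rule finite_measureI)
  have "emeasure wsurf (space wsurf) = (\<integral>\<^sup>+x. ennreal (inverse (\<beta> x)) \<partial>surf \<Omega>)"
    by (auto simp: emeasure_density intro!: nn_integral_cong)
  also have "\<dots> \<le> (\<integral>\<^sup>+x. ennreal (inverse \<eta>) \<partial>surf \<Omega>)"
    by (rule nn_integral_mono_AE, use inverse_\<beta> in eventually_elim) (simp add: ennreal_leI)
  also have "\<dots> < \<infinity>"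
    using finite_measure.emeasure_finite[OF finite_surf, of "space (surf \<Omega>)"]
    by (simp add: ennreal_mult_eq_top_iff less_top[symmetric])
  finally show "emeasure wsurf (space wsurf) \<noteq> \<infinity>" by simp
qed

text \<open>The weight is positive almost everywhere on the boundary, so it does not change the null
  sets.\<close>

lemma AE_wsurf: "(AE x in wsurf. P x) \<longleftrightarrow> (AE x in surf \<Omega>. P x)"
proof -
  have "(AE x in wsurf. P x) \<longleftrightarrow> (AE x in surf \<Omega>. 0 < inverse (\<beta> x) \<longrightarrow> P x)"
    by (subst AE_density) auto
  also have "\<dots> \<longleftrightarrow> (AE x in surf \<Omega>. P x)"
  proof
    assume "AE x in surf \<Omega>. 0 < inverse (\<beta> x) \<longrightarrow> P x"
    with inverse_\<beta> show "AE x in surf \<Omega>. P x" by eventually_elim blast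
  qed (auto elim!: eventually_mono)
  finally show ?thesis .
qed

lemma integral_wsurf:
  fixes f :: "'a \<Rightarrow> 'b::{banach, second_countable_topology}"
  assumes "f \<in> borel_measurable (surf \<Omega>)"
  shows "(\<integral>x. f x \<partial>wsurf) = (\<integral>x. inverse (\<beta> x) *\<^sub>R f x \<partial>surf \<Omega>)"
  using assms inverse_\<beta> by (intro integral_density) (auto elim!: eventually_mono)

lemma integrable_wsurf:
  fixes f :: "'a \<Rightarrow> 'b::{banach, second_countable_topology}"
  assumes "f \<in> borel_measurable (surf \<Omega>)"
  shows "integrable wsurf f \<longleftrightarrow> integrable (surf \<Omega>) (\<lambda>x. inverse (\<beta> x) *\<^sub>R f x)"
  using assms inverse_\<beta> by (intro integrable_density) (auto elim!: eventually_mono)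

text \<open>An upper bound of \<open>\<beta>\<close> bounds the weight from below. The estimate
  links the weighted norm of the Hilbert space with the unweighted convergence by which traces are
  defined.\<close>

lemma wsurf_norm_bound:
  obtains K where "K \<ge> 0" "\<And>f. f \<in> L2 wsurf \<Longrightarrow> f \<in> L2 (surf \<Omega>) \<and> L2_norm (surf \<Omega>) f \<le> K * L2_norm wsurf f"
proof -
  obtain K where K: "K \<ge> 0" "AE x in surf \<Omega>. norm (\<beta> x) \<le> K" using Linf_bound[OF \<beta>] .
  have "f \<in> L2 (surf \<Omega>) \<and> L2_norm (surf \<Omega>) f \<le> sqrt K * L2_norm wsurf f" if f: "f \<in> L2 wsurf" for f
  proof -
    have fm [measurable]: "f \<in> borel_measurable (surf \<Omega>)" using L2_measurable[OF f] by simp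
    have i: "integrable (surf \<Omega>) (\<lambda>x. inverse (\<beta> x) *\<^sub>R (cmod (f x))\<^sup>2)"
      using L2_integrable[OF f] by (subst (asm) integrable_wsurf) auto
    have le: "AE x in surf \<Omega>. (cmod (f x))\<^sup>2 \<le> K * (inverse (\<beta> x) *\<^sub>R (cmod (f x))\<^sup>2)"
      using K(2) inverse_\<beta>
    proof eventually_elim
      case (elim x)
      then have "1 \<le> K * inverse (\<beta> x)" by (simp add: field_simps)
      then show ?case using mult_right_mono[of 1 "K * inverse (\<beta> x)" "(cmod (f x))\<^sup>2"] by (simp add: mult.assoc)
    qed
    have L: "f \<in> L2 (surf \<Omega>)"
      by (rule L2_I_bound[OF fm Bochner_Integration.integrable_mult_right[OF i, of K]]) (use le in simp)
    have "(\<integral>x. (cmod (f x))\<^sup>2 \<partial>surf \<Omega>) \<le> (\<integral>x. K * (inverse (\<beta> x) *\<^sub>R (cmod (f x))\<^sup>2) \<partial>surf \<Omega>)"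
      using L2_integrable[OF L] i le by (intro integral_mono_AE Bochner_Integration.integrable_mult_right) auto
    also have "\<dots> = K * (\<integral>x. (cmod (f x))\<^sup>2 \<partial>wsurf)" by (subst integral_wsurf) auto
    finally show ?thesis using L by (simp add: L2_norm_def flip: real_sqrt_mult)
  qed
  then show thesis using K(1) by (intro that[of "sqrt K"]) auto
qed

lemma L2_wsurf_surf: "f \<in> L2 wsurf \<Longrightarrow> f \<in> L2 (surf \<Omega>)"
  using wsurf_norm_bound by blast

lemma smooth_L2:
  assumes "smooth \<phi>"
  shows "\<phi> \<in> L2 (vol \<Omega>)" "\<phi> \<in> L2 (surf \<Omega>)"
proof -
  have m: "\<phi> \<in> borel_measurable borel" using assms by (rule smooth_measurable)
  have c: "compact (\<phi> ` closure \<Omega>)"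
    using \<Omega>(2) by (intro compact_continuous_image continuous_on_subset[OF smooth_continuous[OF assms]]) auto
  then obtain M where M: "\<And>x. x \<in> closure \<Omega> \<Longrightarrow> cmod (\<phi> x) \<le> M"
    by (metis bounded_iff compact_imp_bounded imageI)
  show "\<phi> \<in> L2 (vol \<Omega>)"
    by (rule L2_bounded[OF \<Omega>_finite vol_measurable[OF m], where K = M], rule AE_I2, rule M)
      (use closure_subset in auto)
  have "x \<in> closure \<Omega>" if "x \<in> space (surf \<Omega>)" for x
    using that by (auto simp: surf_def space_restrict_space frontier_def)
  then show "\<phi> \<in> L2 (surf \<Omega>)"
    by (intro L2_bounded[OF finite_surf surf_measurable[OF m], where K = M] AE_I2 M)
qed

section \<open>Linearity and closedness of the trace relation\<close>

lemma has_trace_H1: "has_trace \<Omega> u g \<Longrightarrow> u \<in> H1 \<Omega>"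
  by (simp add: has_trace_def)

lemma has_trace_L2: "has_trace \<Omega> u g \<Longrightarrow> g \<in> L2 (surf \<Omega>)"
  by (simp add: has_trace_def)

lemma has_trace_add:
  assumes "has_trace \<Omega> u g" "has_trace \<Omega> v h"
  shows "has_trace \<Omega> (\<lambda>x. u x + v x) (\<lambda>x. g x + h x)"
proof -
  note H = has_trace_H1[OF assms(1)] has_trace_H1[OF assms(2)]
  note T = has_trace_L2[OF assms(1)] has_trace_L2[OF assms(2)]
  obtain \<phi> where \<phi>: "\<And>n. smooth (\<phi> n)" "(\<lambda>n. L2_norm (vol \<Omega>) (\<lambda>x. \<phi> n x - u x)) \<longlonglongrightarrow> 0"
      "\<And>i. i \<in> Basis \<Longrightarrow> (\<lambda>n. L2_norm (vol \<Omega>) (\<lambda>x. partial i (\<phi> n) x - weak_partial \<Omega> i u x)) \<longlonglongrightarrow> 0"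
      "(\<lambda>n. L2_norm (surf \<Omega>) (\<lambda>x. \<phi> n x - g x)) \<longlonglongrightarrow> 0"
    using assms(1) by (auto simp: has_trace_def)
  obtain \<psi> where \<psi>: "\<And>n. smooth (\<psi> n)" "(\<lambda>n. L2_norm (vol \<Omega>) (\<lambda>x. \<psi> n x - v x)) \<longlonglongrightarrow> 0"
      "\<And>i. i \<in> Basis \<Longrightarrow> (\<lambda>n. L2_norm (vol \<Omega>) (\<lambda>x. partial i (\<psi> n) x - weak_partial \<Omega> i v x)) \<longlonglongrightarrow> 0"
      "(\<lambda>n. L2_norm (surf \<Omega>) (\<lambda>x. \<psi> n x - h x)) \<longlonglongrightarrow> 0"
    using assms(2) by (auto simp: has_trace_def)
  show ?thesis
    unfolding has_trace_def
  proof (intro conjI exI[of _ "\<lambda>n x. \<phi> n x + \<psi> n x"] allI ballI)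
    show "(\<lambda>n. L2_norm (vol \<Omega>) (\<lambda>x. \<phi> n x + \<psi> n x - (u x + v x))) \<longlonglongrightarrow> 0"
      by (intro L2_tendsto_add \<Omega>_finite smooth_L2 \<phi> \<psi> H1_L2 H)
    show "(\<lambda>n. L2_norm (surf \<Omega>) (\<lambda>x. \<phi> n x + \<psi> n x - (g x + h x))) \<longlonglongrightarrow> 0"
      by (intro L2_tendsto_add finite_surf smooth_L2 \<phi> \<psi> T)
    fix i :: 'a assume i: "i \<in> Basis"
    have "(\<lambda>n. L2_norm (vol \<Omega>) (\<lambda>x. partial i (\<phi> n) x + partial i (\<psi> n) x -
        (weak_partial \<Omega> i u x + weak_partial \<Omega> i v x))) \<longlonglongrightarrow> 0"
      by (intro L2_tendsto_add \<Omega>_finite smooth_L2 smooth_partial \<phi> \<psi> weak_partial_spec H i)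
    then show "(\<lambda>n. L2_norm (vol \<Omega>) (\<lambda>x. partial i (\<lambda>x. \<phi> n x + \<psi> n x) x -
        weak_partial \<Omega> i (\<lambda>x. u x + v x) x)) \<longlonglongrightarrow> 0"
    proof (rule L2_tendsto_cong_AE)
      show "AE x in vol \<Omega>. partial i (\<phi> n) x + partial i (\<psi> n) x = partial i (\<lambda>x. \<phi> n x + \<psi> n x) x" for n
        by (simp add: partial_add smooth_differentiable \<phi> \<psi>)
      show "AE x in vol \<Omega>. weak_partial \<Omega> i u x + weak_partial \<Omega> i v x = weak_partial \<Omega> i (\<lambda>x. u x + v x) x"
        using H1_add(2)[OF H i] by eventually_elim simp
    qed (intro L2_add smooth_L2 smooth_partial smooth_add weak_partial_spec H1_add H i \<phi>(1) \<psi>(1))+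
  qed (intro H1_add L2_add H T smooth_add \<phi>(1) \<psi>(1))+
qed

lemma partial_cmult: "smooth \<phi> \<Longrightarrow> partial i (\<lambda>x. c * \<phi> x) x = c * partial i \<phi> x"
  using partial_mult[of "\<lambda>_. c" x \<phi> i] smooth_differentiable[of \<phi> x] by simp

lemma has_trace_cmult:
  assumes "has_trace \<Omega> u g"
  shows "has_trace \<Omega> (\<lambda>x. c * u x) (\<lambda>x. c * g x)"
proof -
  note H = has_trace_H1[OF assms] and T = has_trace_L2[OF assms]
  obtain \<phi> where \<phi>: "\<And>n. smooth (\<phi> n)" "(\<lambda>n. L2_norm (vol \<Omega>) (\<lambda>x. \<phi> n x - u x)) \<longlonglongrightarrow> 0"
      "\<And>i. i \<in> Basis \<Longrightarrow> (\<lambda>n. L2_norm (vol \<Omega>) (\<lambda>x. partial i (\<phi> n) x - weak_partial \<Omega> i u x)) \<longlonglongrightarrow> 0"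
      "(\<lambda>n. L2_norm (surf \<Omega>) (\<lambda>x. \<phi> n x - g x)) \<longlonglongrightarrow> 0"
    using assms by (auto simp: has_trace_def)
  show ?thesis
    unfolding has_trace_def
  proof (intro conjI exI[of _ "\<lambda>n x. c * \<phi> n x"] allI ballI)
    show "(\<lambda>n. L2_norm (vol \<Omega>) (\<lambda>x. c * \<phi> n x - c * u x)) \<longlonglongrightarrow> 0"
      "(\<lambda>n. L2_norm (surf \<Omega>) (\<lambda>x. c * \<phi> n x - c * g x)) \<longlonglongrightarrow> 0"
      by (intro L2_tendsto_cmult \<phi>)+
    fix i :: 'a assume i: "i \<in> Basis"
    have "(\<lambda>n. L2_norm (vol \<Omega>) (\<lambda>x. c * partial i (\<phi> n) x - c * weak_partial \<Omega> i u x)) \<longlonglongrightarrow> 0"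
      by (intro L2_tendsto_cmult \<phi> i)
    then show "(\<lambda>n. L2_norm (vol \<Omega>) (\<lambda>x. partial i (\<lambda>x. c * \<phi> n x) x - weak_partial \<Omega> i (\<lambda>x. c * u x) x)) \<longlonglongrightarrow> 0"
    proof (rule L2_tendsto_cong_AE)
      show "AE x in vol \<Omega>. c * partial i (\<phi> n) x = partial i (\<lambda>x. c * \<phi> n x) x" for n
        by (simp add: partial_cmult \<phi>)
      show "AE x in vol \<Omega>. c * weak_partial \<Omega> i u x = weak_partial \<Omega> i (\<lambda>x. c * u x) x"
        using H1_cmult(2)[OF H i, of c] by eventually_elim simp
    qed (intro L2_cmult smooth_L2 smooth_partial smooth_mult smooth_const weak_partial_spec H1_cmult H i \<phi>(1))+
  qed (intro H1_cmult L2_cmult H T smooth_mult smooth_const \<phi>(1))+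
qed

lemma has_trace_cnj:
  assumes "has_trace \<Omega> u g"
  shows "has_trace \<Omega> (\<lambda>x. cnj (u x)) (\<lambda>x. cnj (g x))"
proof -
  note H = has_trace_H1[OF assms] and T = has_trace_L2[OF assms]
  obtain \<phi> where \<phi>: "\<And>n. smooth (\<phi> n)" "(\<lambda>n. L2_norm (vol \<Omega>) (\<lambda>x. \<phi> n x - u x)) \<longlonglongrightarrow> 0"
      "\<And>i. i \<in> Basis \<Longrightarrow> (\<lambda>n. L2_norm (vol \<Omega>) (\<lambda>x. partial i (\<phi> n) x - weak_partial \<Omega> i u x)) \<longlonglongrightarrow> 0"
      "(\<lambda>n. L2_norm (surf \<Omega>) (\<lambda>x. \<phi> n x - g x)) \<longlonglongrightarrow> 0"
    using assms by (auto simp: has_trace_def)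
  show ?thesis
    unfolding has_trace_def
  proof (intro conjI exI[of _ "\<lambda>n x. cnj (\<phi> n x)"] allI ballI)
    show "(\<lambda>n. L2_norm (vol \<Omega>) (\<lambda>x. cnj (\<phi> n x) - cnj (u x))) \<longlonglongrightarrow> 0"
      "(\<lambda>n. L2_norm (surf \<Omega>) (\<lambda>x. cnj (\<phi> n x) - cnj (g x))) \<longlonglongrightarrow> 0"
      by (intro L2_tendsto_cnj \<phi>)+
    fix i :: 'a assume i: "i \<in> Basis"
    have "(\<lambda>n. L2_norm (vol \<Omega>) (\<lambda>x. cnj (partial i (\<phi> n) x) - cnj (weak_partial \<Omega> i u x))) \<longlonglongrightarrow> 0"
      by (intro L2_tendsto_cnj \<phi> i)
    then show "(\<lambda>n. L2_norm (vol \<Omega>) (\<lambda>x. partial i (\<lambda>x. cnj (\<phi> n x)) x - weak_partial \<Omega> i (\<lambda>x. cnj (u x)) x)) \<longlonglongrightarrow> 0"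
    proof (rule L2_tendsto_cong_AE)
      show "AE x in vol \<Omega>. cnj (partial i (\<phi> n) x) = partial i (\<lambda>x. cnj (\<phi> n x)) x" for n
        by (simp add: partial_cnj smooth_differentiable \<phi>)
      show "AE x in vol \<Omega>. cnj (weak_partial \<Omega> i u x) = weak_partial \<Omega> i (\<lambda>x. cnj (u x)) x"
        using H1_cnj(2)[OF H i] by eventually_elim simp
    qed (intro L2_cnj smooth_L2 smooth_partial smooth_cnj weak_partial_spec H1_cnj H i \<phi>(1))+
  qed (intro H1_cnj L2_cnj H T smooth_cnj \<phi>(1))+
qed

lemma has_trace_test:
  assumes \<phi>: "\<phi> \<in> test_functions \<Omega>"
  shows "has_trace \<Omega> \<phi> \<phi>"
  unfolding has_trace_def
proof (intro conjI exI[of _ "\<lambda>_. \<phi>"] allI ballI)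
  fix i :: 'a assume i: "i \<in> Basis"
  have "L2_norm (vol \<Omega>) (\<lambda>x. partial i \<phi> x - weak_partial \<Omega> i \<phi> x) = L2_norm (vol \<Omega>) (\<lambda>x. 0)"
  proof (rule L2_norm_cong_AE)
    show "AE x in vol \<Omega>. partial i \<phi> x - weak_partial \<Omega> i \<phi> x = 0"
      using test_function_H1_laplace(2)[OF \<phi> i] by eventually_elim simp
  qed (simp_all add: L2_diff test_L2 test_functions_partial \<phi> i weak_partial_spec H1_laplace_H1 test_function_H1_laplace)
  then show "(\<lambda>_::nat. L2_norm (vol \<Omega>) (\<lambda>x. partial i \<phi> x - weak_partial \<Omega> i \<phi> x)) \<longlonglongrightarrow> 0" by (simp add: L2_norm_def)
qed (use \<phi> in \<open>auto simp: L2_norm_def intro: smooth_L2 test_functions_smooth H1_laplace_H1 test_function_H1_laplace\<close>)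

text \<open>A diagonal sequence: for each \<open>n\<close> a smooth function is chosen within
  \<open>1 / real (Suc n)\<close> of \<open>u n\<close> and \<open>g n\<close> in all the finitely
  many norms of the trace relation at once. By the triangle inequality it also approximates the
  limits.\<close>

lemma has_trace_limit:
  assumes tr: "\<And>n. has_trace \<Omega> (u n) (g n)" and u': "u' \<in> H1 \<Omega>" and g': "g' \<in> L2 (surf \<Omega>)"
    and lim: "(\<lambda>n. L2_norm (vol \<Omega>) (\<lambda>x. u n x - u' x)) \<longlonglongrightarrow> 0"
      "\<And>i. i \<in> Basis \<Longrightarrow> (\<lambda>n. L2_norm (vol \<Omega>) (\<lambda>x. weak_partial \<Omega> i (u n) x - weak_partial \<Omega> i u' x)) \<longlonglongrightarrow> 0"
      "(\<lambda>n. L2_norm (surf \<Omega>) (\<lambda>x. g n x - g' x)) \<longlonglongrightarrow> 0"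
  shows "has_trace \<Omega> u' g'"
proof -
  note H = has_trace_H1[OF tr] and T = has_trace_L2[OF tr]
  have "\<exists>\<phi>. smooth \<phi> \<and> L2_norm (vol \<Omega>) (\<lambda>x. \<phi> x - u n x) < 1 / real (Suc n) \<and>
      (\<forall>i\<in>Basis. L2_norm (vol \<Omega>) (\<lambda>x. partial i \<phi> x - weak_partial \<Omega> i (u n) x) < 1 / real (Suc n)) \<and>
      L2_norm (surf \<Omega>) (\<lambda>x. \<phi> x - g n x) < 1 / real (Suc n)" for n
  proof -
    obtain \<phi> where \<phi>: "\<And>k. smooth (\<phi> k)" "(\<lambda>k. L2_norm (vol \<Omega>) (\<lambda>x. \<phi> k x - u n x)) \<longlonglongrightarrow> 0"
        "\<And>i. i \<in> Basis \<Longrightarrow> (\<lambda>k. L2_norm (vol \<Omega>) (\<lambda>x. partial i (\<phi> k) x - weak_partial \<Omega> i (u n) x)) \<longlonglongrightarrow> 0"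
        "(\<lambda>k. L2_norm (surf \<Omega>) (\<lambda>x. \<phi> k x - g n x)) \<longlonglongrightarrow> 0"
      using tr[of n] by (auto simp: has_trace_def)
    have p: "0 < 1 / real (Suc n)" by simp
    have "\<forall>\<^sub>F k in sequentially. \<forall>i\<in>Basis. L2_norm (vol \<Omega>) (\<lambda>x. partial i (\<phi> k) x - weak_partial \<Omega> i (u n) x) < 1 / real (Suc n)"
      by (intro eventually_ball_finite ballI finite_Basis order_tendstoD(2)[OF \<phi>(3) p])
    with order_tendstoD(2)[OF \<phi>(2) p] order_tendstoD(2)[OF \<phi>(4) p]
    have "\<forall>\<^sub>F k in sequentially. L2_norm (vol \<Omega>) (\<lambda>x. \<phi> k x - u n x) < 1 / real (Suc n) \<and>
      (\<forall>i\<in>Basis. L2_norm (vol \<Omega>) (\<lambda>x. partial i (\<phi> k) x - weak_partial \<Omega> i (u n) x) < 1 / real (Suc n)) \<and>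
      L2_norm (surf \<Omega>) (\<lambda>x. \<phi> k x - g n x) < 1 / real (Suc n)"
      by eventually_elim blast
    then obtain k where "L2_norm (vol \<Omega>) (\<lambda>x. \<phi> k x - u n x) < 1 / real (Suc n) \<and>
      (\<forall>i\<in>Basis. L2_norm (vol \<Omega>) (\<lambda>x. partial i (\<phi> k) x - weak_partial \<Omega> i (u n) x) < 1 / real (Suc n)) \<and>
      L2_norm (surf \<Omega>) (\<lambda>x. \<phi> k x - g n x) < 1 / real (Suc n)"
      unfolding eventually_sequentially by blast
    then show ?thesis using \<phi>(1) by blast
  qed
  then have "\<exists>\<phi>. \<forall>n. smooth (\<phi> n) \<and> L2_norm (vol \<Omega>) (\<lambda>x. \<phi> n x - u n x) < 1 / real (Suc n) \<and>
      (\<forall>i\<in>Basis. L2_norm (vol \<Omega>) (\<lambda>x. partial i (\<phi> n) x - weak_partial \<Omega> i (u n) x) < 1 / real (Suc n)) \<and>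
      L2_norm (surf \<Omega>) (\<lambda>x. \<phi> n x - g n x) < 1 / real (Suc n)"
    by (intro choice allI)
  then obtain \<phi> where "\<forall>n. smooth (\<phi> n) \<and> L2_norm (vol \<Omega>) (\<lambda>x. \<phi> n x - u n x) < 1 / real (Suc n) \<and>
      (\<forall>i\<in>Basis. L2_norm (vol \<Omega>) (\<lambda>x. partial i (\<phi> n) x - weak_partial \<Omega> i (u n) x) < 1 / real (Suc n)) \<and>
      L2_norm (surf \<Omega>) (\<lambda>x. \<phi> n x - g n x) < 1 / real (Suc n)" by blast
  then have \<phi>: "\<And>n. smooth (\<phi> n)" "\<And>n. L2_norm (vol \<Omega>) (\<lambda>x. \<phi> n x - u n x) < 1 / real (Suc n)"
      "\<And>n i. i \<in> Basis \<Longrightarrow> L2_norm (vol \<Omega>) (\<lambda>x. partial i (\<phi> n) x - weak_partial \<Omega> i (u n) x) < 1 / real (Suc n)"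
      "\<And>n. L2_norm (surf \<Omega>) (\<lambda>x. \<phi> n x - g n x) < 1 / real (Suc n)"
    by blast+
  have comb: "(\<lambda>n. L2_norm M (\<lambda>x. f n x - h' x)) \<longlonglongrightarrow> 0"
    if "finite_measure M" "\<And>n. f n \<in> L2 M" "\<And>n. h n \<in> L2 M" "h' \<in> L2 M"
      "\<And>n. L2_norm M (\<lambda>x. f n x - h n x) < 1 / real (Suc n)" "(\<lambda>n. L2_norm M (\<lambda>x. h n x - h' x)) \<longlonglongrightarrow> 0"
    for M :: "'a measure" and f h h'
  proof (rule tendsto_sandwich[where f = "\<lambda>_. 0" and h = "\<lambda>n. 1 / real (Suc n) + L2_norm M (\<lambda>x. h n x - h' x)"])
    show "(\<lambda>n. 1 / real (Suc n) + L2_norm M (\<lambda>x. h n x - h' x)) \<longlonglongrightarrow> 0"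
      using tendsto_add[OF lim_const_over_n[THEN LIMSEQ_Suc, of 1] that(6)] by simp
    have "L2_norm M (\<lambda>x. f n x - h' x) \<le> 1 / real (Suc n) + L2_norm M (\<lambda>x. h n x - h' x)" for n
      using L2_norm_triangle_diff[OF that(1) that(2)[of n] that(3)[of n] that(4)] that(5)[of n] by linarith
    then show "\<forall>\<^sub>F n in sequentially. L2_norm M (\<lambda>x. f n x - h' x) \<le> 1 / real (Suc n) + L2_norm M (\<lambda>x. h n x - h' x)" by simp
  qed (auto simp: L2_norm_nonneg)
  show ?thesis
    unfolding has_trace_def
  proof (intro conjI exI[of _ \<phi>] allI ballI)
    show "(\<lambda>n. L2_norm (vol \<Omega>) (\<lambda>x. \<phi> n x - u' x)) \<longlonglongrightarrow> 0"
      by (rule comb[OF \<Omega>_finite smooth_L2(1)[OF \<phi>(1)] H1_L2[OF H] H1_L2[OF u'] \<phi>(2) lim(1)])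
    show "(\<lambda>n. L2_norm (surf \<Omega>) (\<lambda>x. \<phi> n x - g' x)) \<longlonglongrightarrow> 0"
      by (rule comb[OF finite_surf smooth_L2(2)[OF \<phi>(1)] T g' \<phi>(4) lim(3)])
    fix i :: 'a assume i: "i \<in> Basis"
    show "(\<lambda>n. L2_norm (vol \<Omega>) (\<lambda>x. partial i (\<phi> n) x - weak_partial \<Omega> i u' x)) \<longlonglongrightarrow> 0"
      by (rule comb[OF \<Omega>_finite smooth_L2(1)[OF smooth_partial[OF \<phi>(1) i]] weak_partial_spec(1)[OF H i]
            weak_partial_spec(1)[OF u' i] \<phi>(3)[OF i] lim(2)[OF i]])
  qed (intro u' g' \<phi>(1))+
qed

subsection \<open>The Hilbert space and the form\<close>

definition hip :: "'a pair \<Rightarrow> 'a pair \<Rightarrow> real" where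
  "hip u v = real_ip (vol \<Omega>) (fst u) (fst v) + real_ip wsurf (snd u) (snd v)"

abbreviation sc :: "real \<Rightarrow> 'a pair \<Rightarrow> 'a pair" where
  "sc c \<equiv> scale (complex_of_real c)"

sublocale V: semi_hilbert "L2 (vol \<Omega>)" real_scale "real_ip (vol \<Omega>)"
  by (rule semi_hilbert_L2[OF \<Omega>_finite])

sublocale W: semi_hilbert "L2 wsurf" real_scale "real_ip wsurf"
  by (rule semi_hilbert_L2[OF finite_wsurf])

lemma Hsp_iff: "u \<in> Hsp \<Omega> \<beta> \<longleftrightarrow> fst u \<in> L2 (vol \<Omega>) \<and> snd u \<in> L2 wsurf"
  by (cases u) (simp add: Hsp_def)

lemma Hsp_D: "u \<in> Hsp \<Omega> \<beta> \<Longrightarrow> fst u \<in> L2 (vol \<Omega>)" "u \<in> Hsp \<Omega> \<beta> \<Longrightarrow> snd u \<in> L2 wsurf"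
  by (simp_all add: Hsp_iff)

sublocale H: semi_hilbert "Hsp \<Omega> \<beta>" sc hip
proof -
  have "semi_hilbert (L2 (vol \<Omega>) \<times> L2 wsurf) (\<lambda>c u. (real_scale c (fst u), real_scale c (snd u)))
      (\<lambda>u v. real_ip (vol \<Omega>) (fst u) (fst v) + real_ip wsurf (snd u) (snd v))"
    by (rule semi_hilbert_Times[OF V.semi_hilbert_axioms W.semi_hilbert_axioms])
  then show "semi_hilbert (Hsp \<Omega> \<beta>) sc hip"
    by (simp add: Hsp_def hip_def[abs_def] scale_def[abs_def])
qed

lemma inner_surf_eq:
  assumes "f \<in> L2 wsurf" "g \<in> L2 wsurf"
  shows "inner_surf \<Omega> \<beta> f g = (\<integral>x. f x * cnj (g x) \<partial>wsurf)"
proof -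
  have [measurable]: "f \<in> borel_measurable (surf \<Omega>)" "g \<in> borel_measurable (surf \<Omega>)"
    using assms[THEN L2_measurable] by simp_all
  show ?thesis
    unfolding inner_surf_def by (subst integral_wsurf) (simp_all add: scaleR_conv_of_real mult.commute)
qed

lemma H_inner_eq: "u \<in> Hsp \<Omega> \<beta> \<Longrightarrow> v \<in> Hsp \<Omega> \<beta> \<Longrightarrow> Re (H_inner \<Omega> \<beta> u v) = hip u v"
  by (simp add: H_inner_def hip_def inner_surf_eq Hsp_D real_ip_def inner_vol_def)

lemma H_norm_eq: "u \<in> Hsp \<Omega> \<beta> \<Longrightarrow> H_norm \<Omega> \<beta> u = H.nm u"
  by (simp add: H_norm_def H.nm_def H_inner_eq)

text \<open>The squared distance is a sum of two integrals of squares, and each of them vanishes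
  only if its integrand does so almost everywhere. The weighted and unweighted boundary measures
  have the same null sets.\<close>

lemma H_eq_iff:
  assumes u: "u \<in> Hsp \<Omega> \<beta>" and v: "v \<in> Hsp \<Omega> \<beta>"
  shows "H_eq \<Omega> u v \<longleftrightarrow> H.equiv u v"
proof -
  note d = Hsp_D[OF H.diff_mem[OF u v]]
  have "H.equiv u v \<longleftrightarrow> hip (u - v) (u - v) = 0" by (simp add: H.equiv_def H.nm_def)
  also have "\<dots> \<longleftrightarrow> real_ip (vol \<Omega>) (fst (u - v)) (fst (u - v)) = 0 \<and> real_ip wsurf (snd (u - v)) (snd (u - v)) = 0"
    unfolding hip_def by (rule add_nonneg_eq_0_iff) (use d in \<open>simp_all add: real_ip_self\<close>)
  also have "real_ip (vol \<Omega>) (fst (u - v)) (fst (u - v)) = 0 \<longleftrightarrow> (AE x in vol \<Omega>. fst u x = fst v x)"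
    unfolding real_ip_self[OF d(1)] by (subst integral_nonneg_eq_0_iff_AE[OF L2_integrable[OF d(1)]]) simp_all
  also have "real_ip wsurf (snd (u - v)) (snd (u - v)) = 0 \<longleftrightarrow> (AE x in surf \<Omega>. snd u x = snd v x)"
    unfolding real_ip_self[OF d(2)] AE_wsurf[symmetric]
    by (subst integral_nonneg_eq_0_iff_AE[OF L2_integrable[OF d(2)]]) simp_all
  finally show ?thesis by (simp add: H_eq_def)
qed

abbreviation "\<Delta> u \<equiv> weak_laplacian \<Omega> u"

definition rform :: "'a pair \<Rightarrow> 'a pair \<Rightarrow> real" where
  "rform u v = real_ip (vol \<Omega>) (\<lambda>x. complex_of_real (\<alpha> x) * \<Delta> (fst u) x) (\<Delta> (fst v)) +
    real_ip wsurf (\<lambda>x. complex_of_real (\<gamma> x) * snd u x) (snd v)"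

abbreviation "D \<equiv> form_domain \<Omega> \<beta>"

lemma D_mem:
  assumes "u \<in> D"
  shows "u \<in> Hsp \<Omega> \<beta>" "fst u \<in> neumann_domain \<Omega>" "has_trace \<Omega> (fst u) (snd u)" "fst u \<in> H1_laplace \<Omega>"
    "fst u \<in> H1 \<Omega>" "\<Delta> (fst u) \<in> L2 (vol \<Omega>)" "snd u \<in> L2 wsurf"
  using assms by (auto simp: form_domain_def neumann_domain_def Hsp_iff intro: weak_laplacian_spec H1_laplace_H1)

lemma \<alpha>_bound: obtains K where "K \<ge> 0" "AE x in vol \<Omega>. \<bar>\<alpha> x\<bar> \<le> K"
  using Linf_bound[OF \<alpha>] by auto

lemma \<gamma>_bound: obtains K where "K \<ge> 0" "AE x in wsurf. \<bar>\<gamma> x\<bar> \<le> K"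
  unfolding AE_wsurf using Linf_bound[OF \<gamma>] by auto

lemma \<alpha>_L2: "f \<in> L2 (vol \<Omega>) \<Longrightarrow> (\<lambda>x. complex_of_real (\<alpha> x) * f x) \<in> L2 (vol \<Omega>)"
proof -
  assume f: "f \<in> L2 (vol \<Omega>)"
  obtain K where K: "AE x in vol \<Omega>. \<bar>\<alpha> x\<bar> \<le> K" using \<alpha>_bound by blast
  show ?thesis by (rule L2_mult_bounded[OF f, where K = K]) (use K in auto)
qed

lemma \<gamma>_L2: "f \<in> L2 wsurf \<Longrightarrow> (\<lambda>x. complex_of_real (\<gamma> x) * f x) \<in> L2 wsurf"
proof -
  assume f: "f \<in> L2 wsurf"
  obtain K where K: "AE x in wsurf. \<bar>\<gamma> x\<bar> \<le> K" using \<gamma>_bound by blast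
  show ?thesis by (rule L2_mult_bounded[OF f, where K = K]) (use K in auto)
qed

lemma form_eq:
  assumes "u \<in> D" "v \<in> D"
  shows "form \<Omega> \<alpha> \<beta> \<gamma> u v = (\<integral>x. complex_of_real (\<alpha> x) * \<Delta> (fst u) x * cnj (\<Delta> (fst v) x) \<partial>vol \<Omega>) +
    (\<integral>x. complex_of_real (\<gamma> x) * snd u x * cnj (snd v x) \<partial>wsurf)"
  unfolding form_def inner_vol_def
  by (subst inner_surf_eq) (use assms in \<open>auto intro: \<gamma>_L2 D_mem\<close>)

lemma Re_form: "u \<in> D \<Longrightarrow> v \<in> D \<Longrightarrow> Re (form \<Omega> \<alpha> \<beta> \<gamma> u v) = rform u v"
  by (simp add: form_eq rform_def real_ip_def)

lemma scale_eq: "scale c u = ((\<lambda>x. c * fst u x), (\<lambda>x. c * snd u x))"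
  by (simp add: scale_def)

section \<open>Algebra, bounds and closedness of the form\<close>

lemma D_add: "u \<in> D \<Longrightarrow> v \<in> D \<Longrightarrow> u + v \<in> D"
  using H.add_mem[of u v] neumann_domain_add[of "fst u" "fst v"] has_trace_add[of "fst u" "snd u" "fst v" "snd v"]
  by (simp add: form_domain_def plus_fun_def)

lemma D_scale: "u \<in> D \<Longrightarrow> scale c u \<in> D"
  using neumann_domain_cmult[of "fst u" c] has_trace_cmult[of "fst u" "snd u" c]
  by (auto simp: form_domain_def scale_eq Hsp_iff intro: L2_cmult)

lemma \<Delta>_add: "u \<in> D \<Longrightarrow> v \<in> D \<Longrightarrow> AE x in vol \<Omega>. \<Delta> (fst (u + v)) x = \<Delta> (fst u) x + \<Delta> (fst v) x"
  using H1_laplace_add(2)[OF D_mem(4) D_mem(4), of u v] by (simp add: plus_fun_def)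

lemma \<Delta>_scale: "u \<in> D \<Longrightarrow> AE x in vol \<Omega>. \<Delta> (fst (scale c u)) x = c * \<Delta> (fst u) x"
  using H1_laplace_cmult(2)[OF D_mem(4), of u c] by (simp add: scale_eq)

lemma rform_add:
  assumes "u \<in> D" "v \<in> D" "w \<in> D"
  shows "rform (u + v) w = rform u w + rform v w"
proof -
  have "real_ip (vol \<Omega>) (\<lambda>x. complex_of_real (\<alpha> x) * \<Delta> (fst (u + v)) x) (\<Delta> (fst w)) =
      real_ip (vol \<Omega>) ((\<lambda>x. complex_of_real (\<alpha> x) * \<Delta> (fst u) x) + (\<lambda>x. complex_of_real (\<alpha> x) * \<Delta> (fst v) x)) (\<Delta> (fst w))"
    using \<Delta>_add[OF assms(1,2)]
    by (intro real_ip_cong_AE \<alpha>_L2 V.add_mem D_mem(6) D_add assms) (auto simp: distrib_left elim!: eventually_mono)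
  moreover have "(\<lambda>x. complex_of_real (\<gamma> x) * snd (u + v) x) =
      (\<lambda>x. complex_of_real (\<gamma> x) * snd u x) + (\<lambda>x. complex_of_real (\<gamma> x) * snd v x)"
    by (simp add: fun_eq_iff distrib_left)
  ultimately show ?thesis
    using assms by (simp add: rform_def V.ip_add_left W.ip_add_left \<alpha>_L2 \<gamma>_L2 D_mem)
qed

lemma rform_sc:
  assumes "u \<in> D" "w \<in> D"
  shows "rform (sc c u) w = c * rform u w"
proof -
  have "real_ip (vol \<Omega>) (\<lambda>x. complex_of_real (\<alpha> x) * \<Delta> (fst (sc c u)) x) (\<Delta> (fst w)) =
      real_ip (vol \<Omega>) (real_scale c (\<lambda>x. complex_of_real (\<alpha> x) * \<Delta> (fst u) x)) (\<Delta> (fst w))"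
    using \<Delta>_scale[OF assms(1), of "complex_of_real c"]
    by (intro real_ip_cong_AE \<alpha>_L2 V.sc_mem D_mem(6) D_scale assms) (auto elim!: eventually_mono)
  moreover have "(\<lambda>x. complex_of_real (\<gamma> x) * snd (sc c u) x) = real_scale c (\<lambda>x. complex_of_real (\<gamma> x) * snd u x)"
    by (simp add: fun_eq_iff scale_eq)
  ultimately show ?thesis
    using assms by (simp add: rform_def V.ip_sc_left W.ip_sc_left \<alpha>_L2 \<gamma>_L2 D_mem distrib_left)
qed

lemma rform_sym:
  assumes "u \<in> D" "v \<in> D"
  shows "rform u v = rform v u"
proof -
  have w: "real_ip M (\<lambda>x. complex_of_real (a x) * f x) g = real_ip M f (\<lambda>x. complex_of_real (a x) * g x)"
    for M :: "'a measure" and a f g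
    by (simp add: real_ip_def mult.assoc mult.left_commute)
  show ?thesis
    unfolding rform_def w[of _ _ "\<Delta> (fst u)"] w[of _ _ "snd u"]
    using assms by (intro arg_cong2[of _ _ _ _ "(+)"] V.ip_sym W.ip_sym \<alpha>_L2 \<gamma>_L2 D_mem)
qed

lemma rform_self:
  assumes "u \<in> D"
  shows "rform u u = (\<integral>x. \<alpha> x * (cmod (\<Delta> (fst u) x))\<^sup>2 \<partial>vol \<Omega>) + (\<integral>x. \<gamma> x * (cmod (snd u x))\<^sup>2 \<partial>wsurf)"
  unfolding rform_def using assms by (simp add: real_ip_weight \<alpha>_L2 \<gamma>_L2 D_mem)

lemma weighted_integrable:
  assumes a: "a \<in> borel_measurable M" "AE x in M. \<bar>a x\<bar> \<le> K" and f: "f \<in> L2 M"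
  shows "integrable M (\<lambda>x. a x * (cmod (f x))\<^sup>2)"
proof (rule Bochner_Integration.integrable_bound)
  show "integrable M (\<lambda>x. K * (cmod (f x))\<^sup>2)" by (intro Bochner_Integration.integrable_mult_right L2_integrable f)
  show "AE x in M. norm (a x * (cmod (f x))\<^sup>2) \<le> norm (K * (cmod (f x))\<^sup>2)"
    using a(2) by eventually_elim (auto simp: abs_mult intro!: mult_right_mono)
  show "(\<lambda>x. a x * (cmod (f x))\<^sup>2) \<in> borel_measurable M" using a(1) L2_measurable[OF f] by measurable
qed

lemma weighted_mono:
  assumes "AE x in M. a x \<le> a' x" "integrable M (\<lambda>x. a x * (cmod (f x))\<^sup>2)" "integrable M (\<lambda>x. a' x * (cmod (f x))\<^sup>2)"
  shows "(\<integral>x. a x * (cmod (f x))\<^sup>2 \<partial>M) \<le> (\<integral>x. a' x * (cmod (f x))\<^sup>2 \<partial>M)"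
  using assms by (intro integral_mono_AE) (auto elim!: eventually_mono intro!: mult_right_mono)

text \<open>The lower bound of \<open>\<alpha>\<close> controls the Laplacian, and \<gamma> \<ge> 0
  allows the boundary term to be discarded.\<close>

lemma rform_lower:
  assumes u: "u \<in> D"
  shows "\<eta> * (L2_norm (vol \<Omega>) (\<Delta> (fst u)))\<^sup>2 \<le> rform u u"
proof -
  obtain K where K: "AE x in vol \<Omega>. \<bar>\<alpha> x\<bar> \<le> K" using \<alpha>_bound by blast
  have "(\<integral>x. \<eta> * (cmod (\<Delta> (fst u) x))\<^sup>2 \<partial>vol \<Omega>) \<le> (\<integral>x. \<alpha> x * (cmod (\<Delta> (fst u) x))\<^sup>2 \<partial>vol \<Omega>)"
    using \<alpha>_ge D_mem(6)[OF u]
    by (intro weighted_mono weighted_integrable[OF _ K] Bochner_Integration.integrable_mult_right L2_integrable) auto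
  moreover have "0 \<le> (\<integral>x. \<gamma> x * (cmod (snd u x))\<^sup>2 \<partial>wsurf)"
    using \<gamma>_ge unfolding AE_wsurf[symmetric] by (intro integral_nonneg_AE) (auto elim!: eventually_mono)
  ultimately show ?thesis using D_mem(6)[OF u] by (simp add: rform_self[OF u] L2_norm_sq real_ip_self)
qed

lemma rform_nonneg: "u \<in> D \<Longrightarrow> 0 \<le> rform u u"
  by (rule order_trans[OF _ rform_lower]) (use \<eta> in simp_all)

text \<open>The coefficients are essentially bounded. This direction is needed at the end of
  \<open>form_complete\<close>, to turn L2 convergence of Laplacians and boundary values into
  convergence in the form.\<close>

lemma rform_upper:
  obtains K where "K \<ge> 0" "\<And>u. u \<in> D \<Longrightarrow>
    rform u u \<le> K * ((L2_norm (vol \<Omega>) (\<Delta> (fst u)))\<^sup>2 + (L2_norm wsurf (snd u))\<^sup>2)"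
proof -
  obtain K where K: "K \<ge> 0" "AE x in vol \<Omega>. \<bar>\<alpha> x\<bar> \<le> K" using \<alpha>_bound by blast
  obtain L where L: "L \<ge> 0" "AE x in wsurf. \<bar>\<gamma> x\<bar> \<le> L" using \<gamma>_bound by blast
  have "rform u u \<le> max K L * ((L2_norm (vol \<Omega>) (\<Delta> (fst u)))\<^sup>2 + (L2_norm wsurf (snd u))\<^sup>2)" if u: "u \<in> D" for u
  proof -
    have "(\<integral>x. \<alpha> x * (cmod (\<Delta> (fst u) x))\<^sup>2 \<partial>vol \<Omega>) \<le> (\<integral>x. max K L * (cmod (\<Delta> (fst u) x))\<^sup>2 \<partial>vol \<Omega>)"
      using K(2) D_mem(6)[OF u]
      by (intro weighted_mono weighted_integrable[OF _ K(2)] Bochner_Integration.integrable_mult_right L2_integrable)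
        (auto elim!: eventually_mono)
    moreover have "(\<integral>x. \<gamma> x * (cmod (snd u x))\<^sup>2 \<partial>wsurf) \<le> (\<integral>x. max K L * (cmod (snd u x))\<^sup>2 \<partial>wsurf)"
      using L(2) D_mem(7)[OF u]
      by (intro weighted_mono weighted_integrable[OF _ L(2)] Bochner_Integration.integrable_mult_right L2_integrable)
        (auto elim!: eventually_mono)
    ultimately show ?thesis
      using D_mem(6,7)[OF u] by (simp add: rform_self[OF u] L2_norm_sq real_ip_self distrib_left)
  qed
  then show thesis using K(1) by (intro that[of "max K L"]) auto
qed

text \<open>The Neumann condition tested with \<open>u\<close> itself says that the squared norms of
  all partial derivatives add up to minus the inner product of the Laplacian with \<open>u\<close>.
  Cauchy-Schwarz then bounds each of them by quantities that the form and the Hilbert norm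
  control.\<close>

lemma gradient_bound:
  assumes u: "u \<in> neumann_domain \<Omega>" and i: "i \<in> Basis"
  shows "(L2_norm (vol \<Omega>) (weak_partial \<Omega> i u))\<^sup>2 \<le> L2_norm (vol \<Omega>) (\<Delta> u) * L2_norm (vol \<Omega>) u"
proof -
  have L: "u \<in> H1_laplace \<Omega>" "u \<in> H1 \<Omega>" using u by (auto intro: neumann_domain_laplace H1_laplace_H1)
  have nm: "V.nm f = L2_norm (vol \<Omega>) f" if "f \<in> L2 (vol \<Omega>)" for f
    using that by (simp add: V.nm_def L2_norm_def real_ip_self)
  have "(L2_norm (vol \<Omega>) (weak_partial \<Omega> i u))\<^sup>2 \<le> (\<Sum>j\<in>Basis. (L2_norm (vol \<Omega>) (weak_partial \<Omega> j u))\<^sup>2)"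
    using i by (intro member_le_sum) auto
  also have "\<dots> = (\<Sum>j\<in>Basis. real_ip (vol \<Omega>) (weak_partial \<Omega> j u) (weak_partial \<Omega> j u))"
    by (intro sum.cong refl L2_norm_sq weak_partial_spec L)
  also have "\<dots> = Re (\<Sum>j\<in>Basis. \<integral>x. weak_partial \<Omega> j u x * cnj (weak_partial \<Omega> j u x) \<partial>vol \<Omega>)"
    by (simp add: real_ip_def)
  also have "\<dots> = - real_ip (vol \<Omega>) (\<Delta> u) u"
    using neumann_domain_eq[OF u] L(2) by (simp add: neumann_eq_def real_ip_def)
  also have "\<dots> \<le> V.nm (\<Delta> u) * V.nm u"
    using V.cauchy_schwarz[OF weak_laplacian_spec(1)[OF L(1)] H1_L2[OF L(2)]] by linarith
  finally show ?thesis using L by (simp add: nm weak_laplacian_spec H1_L2)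
qed

lemma D_diff: "u \<in> D \<Longrightarrow> v \<in> D \<Longrightarrow> u - v \<in> D"
  using D_add[OF _ D_scale[of v "- 1"], of u] H.sc_minus_one[OF D_mem(1), of v] by simp

lemma diff_eq_add_scale: "(u :: 'a pair) - v = u + scale (- 1) v"
  by (simp add: scale_eq prod_eq_iff fun_eq_iff)

lemma \<Delta>_diff:
  assumes "u \<in> D" "v \<in> D"
  shows "L2_norm (vol \<Omega>) (\<Delta> (fst (u - v))) = L2_norm (vol \<Omega>) (\<lambda>x. \<Delta> (fst u) x - \<Delta> (fst v) x)"
proof (rule L2_norm_cong_AE)
  show "AE x in vol \<Omega>. \<Delta> (fst (u - v)) x = \<Delta> (fst u) x - \<Delta> (fst v) x"
    unfolding diff_eq_add_scale
    using \<Delta>_add[OF assms(1) D_scale[OF assms(2)], of "- 1"] \<Delta>_scale[OF assms(2), of "- 1"]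
    by eventually_elim simp
qed (intro L2_diff D_mem(6) D_diff assms)+

lemma weak_partial_diff:
  assumes "u \<in> D" "v \<in> D" and i: "i \<in> Basis"
  shows "L2_norm (vol \<Omega>) (weak_partial \<Omega> i (fst (u - v))) =
    L2_norm (vol \<Omega>) (\<lambda>x. weak_partial \<Omega> i (fst u) x - weak_partial \<Omega> i (fst v) x)"
proof (rule L2_norm_cong_AE)
  have "AE x in vol \<Omega>. weak_partial \<Omega> i (fst (u + scale (- 1) v)) x =
      weak_partial \<Omega> i (fst u) x + weak_partial \<Omega> i (fst (scale (- 1) v)) x"
    using H1_add(2)[OF D_mem(5)[OF assms(1)] D_mem(5)[OF D_scale[OF assms(2), of "- 1"]] i] by (simp add: plus_fun_def)
  moreover have "AE x in vol \<Omega>. weak_partial \<Omega> i (fst (scale (- 1) v)) x = (- 1) * weak_partial \<Omega> i (fst v) x"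
    using H1_cmult(2)[OF D_mem(5)[OF assms(2)] i, of "- 1"] by (simp add: scale_eq)
  ultimately show "AE x in vol \<Omega>. weak_partial \<Omega> i (fst (u - v)) x = weak_partial \<Omega> i (fst u) x - weak_partial \<Omega> i (fst v) x"
    unfolding diff_eq_add_scale by eventually_elim simp
qed (intro L2_diff weak_partial_spec D_mem(5) D_diff assms)+

lemma hip_self: "u \<in> Hsp \<Omega> \<beta> \<Longrightarrow> hip u u = (L2_norm (vol \<Omega>) (fst u))\<^sup>2 + (L2_norm wsurf (snd u))\<^sup>2"
  by (simp add: hip_def L2_norm_sq Hsp_D)

text \<open>Completeness of L2 supplies limits of the functions, of their Laplacians by
  \<open>rform_lower\<close>, and of their gradients by \<open>gradient_bound\<close>. Weak
  derivatives and the Neumann identity pass to these limits because they are tested against fixed L2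
  functions; the trace relation passes because convergence of the gradients is at hand.\<close>

lemma form_complete:
  fixes X :: "nat \<Rightarrow> 'a pair"
  assumes X: "\<And>n. X n \<in> D"
    and C1: "\<And>e. e > 0 \<Longrightarrow> \<exists>N. \<forall>m\<ge>N. \<forall>n\<ge>N. hip (X m - X n) (X m - X n) < e"
    and C2: "\<And>e. e > 0 \<Longrightarrow> \<exists>N. \<forall>m\<ge>N. \<forall>n\<ge>N. rform (X m - X n) (X m - X n) < e"
  shows "\<exists>x\<in>D. (\<lambda>n. hip (X n - x) (X n - x)) \<longlonglongrightarrow> 0 \<and> (\<lambda>n. rform (X n - x) (X n - x)) \<longlonglongrightarrow> 0"
proof -
  let ?V = "L2_norm (vol \<Omega>)" and ?W = "L2_norm wsurf"
  note XS = D_mem(1)[OF X]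
  obtain x where x: "x \<in> Hsp \<Omega> \<beta>" and xlim: "(\<lambda>n. hip (X n - x) (X n - x)) \<longlonglongrightarrow> 0"
    using H.complete[OF XS C1] by blast
  have hip_ge: "(?V (fst u))\<^sup>2 \<le> hip u u" "(?W (snd u))\<^sup>2 \<le> hip u u" if "u \<in> Hsp \<Omega> \<beta>" for u
    using that by (simp_all add: hip_self)
  have sq_lim: "(\<lambda>n. a n) \<longlonglongrightarrow> 0" if "\<And>n. 0 \<le> a n" "\<And>n. (a n)\<^sup>2 \<le> b n" "b \<longlonglongrightarrow> 0" for a b :: "nat \<Rightarrow> real"
  proof -
    have "(\<lambda>n. (a n)\<^sup>2) \<longlonglongrightarrow> 0"
      by (rule tendsto_sandwich[OF _ _ tendsto_const that(3)]) (use that in auto)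
    from tendsto_real_sqrt[OF this] show ?thesis using that(1) by simp
  qed
  have lim1: "(\<lambda>n. ?V (\<lambda>y. fst (X n) y - fst x y)) \<longlonglongrightarrow> 0"
    using hip_ge(1)[OF H.diff_mem[OF XS x]] by (intro sq_lim[OF _ _ xlim]) (auto simp: L2_norm_nonneg fun_diff_def)
  have lim2: "(\<lambda>n. ?W (\<lambda>y. snd (X n) y - snd x y)) \<longlonglongrightarrow> 0"
    using hip_ge(2)[OF H.diff_mem[OF XS x]] by (intro sq_lim[OF _ _ xlim]) (auto simp: L2_norm_nonneg fun_diff_def)
  have lap_le: "(?V (\<Delta> (fst (X m - X n))))\<^sup>2 \<le> rform (X m - X n) (X m - X n) / \<eta>" for m n
    using rform_lower[OF D_diff[OF X X, of m n]] \<eta> by (simp add: field_simps)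
  obtain f where f: "f \<in> L2 (vol \<Omega>)" "(\<lambda>n. ?V (\<lambda>y. \<Delta> (fst (X n)) y - f y)) \<longlonglongrightarrow> 0"
  proof -
    have "\<exists>g\<in>L2 (vol \<Omega>). (\<lambda>n. ?V (\<lambda>y. \<Delta> (fst (X n)) y - g y)) \<longlonglongrightarrow> 0"
    proof (rule L2_norm_Cauchy_complete[OF \<Omega>_finite D_mem(6)[OF X]])
      fix e :: real assume e: "e > 0"
      then obtain N where N: "\<And>m n. m \<ge> N \<Longrightarrow> n \<ge> N \<Longrightarrow> rform (X m - X n) (X m - X n) < \<eta> * e"
        using C2[of "\<eta> * e"] \<eta> by auto
      have "(?V (\<lambda>y. \<Delta> (fst (X m)) y - \<Delta> (fst (X n)) y))\<^sup>2 < e" if "m \<ge> N" "n \<ge> N" for m n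
      proof -
        have "rform (X m - X n) (X m - X n) / \<eta> < e" using N[OF that] \<eta> by (simp add: field_simps)
        then show ?thesis using lap_le[of m n] unfolding \<Delta>_diff[OF X X] by linarith
      qed
      then show "\<exists>N. \<forall>m\<ge>N. \<forall>n\<ge>N. (?V (\<lambda>y. \<Delta> (fst (X m)) y - \<Delta> (fst (X n)) y))\<^sup>2 < e" by blast
    qed
    then show thesis using that by blast
  qed
  have "\<exists>g\<in>L2 (vol \<Omega>). (\<lambda>n. ?V (\<lambda>y. weak_partial \<Omega> i (fst (X n)) y - g y)) \<longlonglongrightarrow> 0" if i: "i \<in> Basis" for i
  proof (rule L2_norm_Cauchy_complete[OF \<Omega>_finite weak_partial_spec(1)[OF D_mem(5)[OF X] i]])
    fix e :: real assume e: "e > 0"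
    then obtain N1 where N1: "\<And>m n. m \<ge> N1 \<Longrightarrow> n \<ge> N1 \<Longrightarrow> rform (X m - X n) (X m - X n) < \<eta> * e"
      using C2[of "\<eta> * e"] \<eta> by auto
    obtain N2 where N2: "\<And>m n. m \<ge> N2 \<Longrightarrow> n \<ge> N2 \<Longrightarrow> hip (X m - X n) (X m - X n) < e"
      using C1[OF e] by auto
    have "(?V (\<lambda>y. weak_partial \<Omega> i (fst (X m)) y - weak_partial \<Omega> i (fst (X n)) y))\<^sup>2 < e"
      if "m \<ge> max N1 N2" "n \<ge> max N1 N2" for m n
    proof -
      let ?a = "?V (\<Delta> (fst (X m - X n)))" and ?b = "?V (fst (X m - X n))"
      have "rform (X m - X n) (X m - X n) / \<eta> < e" using N1[of m n] that \<eta> by (simp add: field_simps)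
      then have a: "?a\<^sup>2 < e" using lap_le[of m n] by linarith
      have b: "?b\<^sup>2 < e" using N2[of m n] that hip_ge(1)[OF H.diff_mem[OF XS XS], of m n] by simp
      have "(?V (weak_partial \<Omega> i (fst (X m - X n))))\<^sup>2 \<le> ?a * ?b"
        by (rule gradient_bound[OF D_mem(2)[OF D_diff[OF X X]] i])
      moreover have "2 * (?a * ?b) \<le> ?a\<^sup>2 + ?b\<^sup>2" using zero_le_power2[of "?a - ?b"] by (simp add: power2_diff)
      ultimately have "(?V (weak_partial \<Omega> i (fst (X m - X n))))\<^sup>2 < e" using a b by linarith
      then show ?thesis by (simp only: weak_partial_diff[OF X X i])
    qed
    then show "\<exists>N. \<forall>m\<ge>N. \<forall>n\<ge>N. (?V (\<lambda>y. weak_partial \<Omega> i (fst (X m)) y - weak_partial \<Omega> i (fst (X n)) y))\<^sup>2 < e"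
      by blast
  qed
  then have "\<forall>i\<in>Basis. \<exists>h. h \<in> L2 (vol \<Omega>) \<and> (\<lambda>n. ?V (\<lambda>y. weak_partial \<Omega> i (fst (X n)) y - h y)) \<longlonglongrightarrow> 0"
    by blast
  from bchoice[OF this] obtain g where g: "\<And>i. i \<in> Basis \<Longrightarrow> g i \<in> L2 (vol \<Omega>)"
      "\<And>i. i \<in> Basis \<Longrightarrow> (\<lambda>n. ?V (\<lambda>y. weak_partial \<Omega> i (fst (X n)) y - g i y)) \<longlonglongrightarrow> 0" by blast
  have wg: "has_weak \<Omega> (grad_op i) (fst x) (g i)" if i: "i \<in> Basis" for i
    by (rule has_weak_limit[OF test_operator_grad[OF i] H1_L2[OF D_mem(5)[OF X]] weak_partial_spec(1)[OF D_mem(5)[OF X] i]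
          Hsp_D(1)[OF x] g(1)[OF i] weak_partial_spec(2)[OF D_mem(5)[OF X] i] lim1 g(2)[OF i]])
  have wf: "has_weak \<Omega> lap_op (fst x) f"
    by (rule has_weak_limit[OF test_operator_lap H1_L2[OF D_mem(5)[OF X]] D_mem(6)[OF X]
          Hsp_D(1)[OF x] f(1) weak_laplacian_spec(2)[OF D_mem(4)[OF X]] lim1 f(2)])
  have H1: "fst x \<in> H1 \<Omega>" by (rule H1_I[OF Hsp_D(1)[OF x]]) (use g wg in blast)
  have HL: "fst x \<in> H1_laplace \<Omega>" by (rule H1_laplace_I[OF H1 f(1) wf])
  have ae_g: "AE y in vol \<Omega>. weak_partial \<Omega> i (fst x) y = g i y" if "i \<in> Basis" for i
    by (rule weak_partial_eq[OF g(1)[OF that] wg[OF that] H1 that])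
  have ae_f: "AE y in vol \<Omega>. \<Delta> (fst x) y = f y" by (rule weak_laplacian_eq[OF f(1) wf HL])
  have neu: "fst x \<in> neumann_domain \<Omega>"
  proof (subst neumann_domain_iff[OF HL g(1) ae_g f(1) ae_f])
    show "neumann_eq g f"
      unfolding neumann_eq_def
    proof
      fix v assume v: "v \<in> H1 \<Omega>"
      have "(\<lambda>n. \<Sum>i\<in>Basis. \<integral>y. weak_partial \<Omega> i (fst (X n)) y * cnj (weak_partial \<Omega> i v y) \<partial>vol \<Omega>)
          \<longlonglongrightarrow> (\<Sum>i\<in>Basis. \<integral>y. g i y * cnj (weak_partial \<Omega> i v y) \<partial>vol \<Omega>)"
      proof (rule tendsto_sum)
        fix i :: 'a assume i: "i \<in> Basis"
        show "(\<lambda>n. \<integral>y. weak_partial \<Omega> i (fst (X n)) y * cnj (weak_partial \<Omega> i v y) \<partial>vol \<Omega>)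
          \<longlonglongrightarrow> (\<integral>y. g i y * cnj (weak_partial \<Omega> i v y) \<partial>vol \<Omega>)"
          by (rule L2_tendsto_integral[OF \<Omega>_finite weak_partial_spec(1)[OF D_mem(5)[OF X] i] g(1)[OF i]
                L2_cnj[OF weak_partial_spec(1)[OF v i]] g(2)[OF i]])
      qed
      moreover have "(\<lambda>n. - (\<integral>y. \<Delta> (fst (X n)) y * cnj (v y) \<partial>vol \<Omega>)) \<longlonglongrightarrow> - (\<integral>y. f y * cnj (v y) \<partial>vol \<Omega>)"
        by (intro tendsto_minus L2_tendsto_integral[OF \<Omega>_finite D_mem(6)[OF X] f(1) L2_cnj[OF H1_L2[OF v]] f(2)])
      moreover have "(\<Sum>i\<in>Basis. \<integral>y. weak_partial \<Omega> i (fst (X n)) y * cnj (weak_partial \<Omega> i v y) \<partial>vol \<Omega>) =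
          - (\<integral>y. \<Delta> (fst (X n)) y * cnj (v y) \<partial>vol \<Omega>)" for n
        using neumann_domain_eq[OF D_mem(2)[OF X]] v by (simp add: neumann_eq_def)
      ultimately show "(\<Sum>i\<in>Basis. \<integral>y. g i y * cnj (weak_partial \<Omega> i v y) \<partial>vol \<Omega>) = - (\<integral>y. f y * cnj (v y) \<partial>vol \<Omega>)"
        by (simp add: LIMSEQ_unique)
    qed
  qed
  have tr: "has_trace \<Omega> (fst x) (snd x)"
  proof (rule has_trace_limit[OF D_mem(3)[OF X] H1 L2_wsurf_surf[OF Hsp_D(2)[OF x]] lim1])
    fix i :: 'a assume i: "i \<in> Basis"
    show "(\<lambda>n. ?V (\<lambda>y. weak_partial \<Omega> i (fst (X n)) y - weak_partial \<Omega> i (fst x) y)) \<longlonglongrightarrow> 0"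
    proof (rule L2_tendsto_cong_AE[OF g(2)[OF i]])
      show "AE y in vol \<Omega>. g i y = weak_partial \<Omega> i (fst x) y" using ae_g[OF i] by eventually_elim simp
    qed (auto intro!: weak_partial_spec g i H1 D_mem(5)[OF X])
  next
    obtain K where K: "K \<ge> 0" "\<And>f. f \<in> L2 wsurf \<Longrightarrow> f \<in> L2 (surf \<Omega>) \<and> L2_norm (surf \<Omega>) f \<le> K * ?W f"
      using wsurf_norm_bound by blast
    show "(\<lambda>n. L2_norm (surf \<Omega>) (\<lambda>y. snd (X n) y - snd x y)) \<longlonglongrightarrow> 0"
    proof (rule tendsto_sandwich[where f = "\<lambda>_. 0" and h = "\<lambda>n. K * ?W (\<lambda>y. snd (X n) y - snd x y)"])
      show "(\<lambda>n. K * ?W (\<lambda>y. snd (X n) y - snd x y)) \<longlonglongrightarrow> 0" using tendsto_mult_left[OF lim2, of K] by simp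
      show "\<forall>\<^sub>F n in sequentially. L2_norm (surf \<Omega>) (\<lambda>y. snd (X n) y - snd x y) \<le> K * ?W (\<lambda>y. snd (X n) y - snd x y)"
        using K(2)[OF L2_diff[OF D_mem(7)[OF X] Hsp_D(2)[OF x]]] by simp
    qed (auto simp: L2_norm_nonneg)
  qed
  have xD: "x \<in> D" using x neu tr by (simp add: form_domain_def)
  obtain K where K: "K \<ge> 0" "\<And>u. u \<in> D \<Longrightarrow> rform u u \<le> K * ((?V (\<Delta> (fst u)))\<^sup>2 + (?W (snd u))\<^sup>2)"
    using rform_upper by blast
  have limf: "(\<lambda>n. ?V (\<lambda>y. \<Delta> (fst (X n)) y - \<Delta> (fst x) y)) \<longlonglongrightarrow> 0"
  proof (rule L2_tendsto_cong_AE[OF f(2)])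
    show "AE y in vol \<Omega>. f y = \<Delta> (fst x) y" using ae_f by eventually_elim simp
  qed (auto intro!: f D_mem(6)[OF X] D_mem(6)[OF xD])
  have "(\<lambda>n. rform (X n - x) (X n - x)) \<longlonglongrightarrow> 0"
  proof (rule tendsto_sandwich[where f = "\<lambda>_. 0"])
    show "(\<lambda>n. K * ((?V (\<lambda>y. \<Delta> (fst (X n)) y - \<Delta> (fst x) y))\<^sup>2 + (?W (\<lambda>y. snd (X n) y - snd x y))\<^sup>2)) \<longlonglongrightarrow> 0"
      using tendsto_mult_left[OF tendsto_add[OF tendsto_power[OF limf, of 2] tendsto_power[OF lim2, of 2]], of K] by simp
    show "\<forall>\<^sub>F n in sequentially. 0 \<le> rform (X n - x) (X n - x)" by (simp add: rform_nonneg D_diff X xD)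
    show "\<forall>\<^sub>F n in sequentially. rform (X n - x) (X n - x) \<le>
        K * ((?V (\<lambda>y. \<Delta> (fst (X n)) y - \<Delta> (fst x) y))\<^sup>2 + (?W (\<lambda>y. snd (X n) y - snd x y))\<^sup>2)"
      using K(2)[OF D_diff[OF X xD], unfolded \<Delta>_diff[OF X xD]] by (simp add: fun_diff_def)
  qed simp
  with xD xlim show ?thesis by blast
qed

lemma form_scale_right:
  assumes "u \<in> D" "v \<in> D"
  shows "form \<Omega> \<alpha> \<beta> \<gamma> u (scale c v) = cnj c * form \<Omega> \<alpha> \<beta> \<gamma> u v"
proof -
  note [measurable] = L2_measurable[OF D_mem(6)[OF assms(1)]] L2_measurable[OF D_mem(6)[OF assms(2)]]
    L2_measurable[OF D_mem(6)[OF D_scale[OF assms(2)]]]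
  have "(\<integral>x. complex_of_real (\<alpha> x) * \<Delta> (fst u) x * cnj (\<Delta> (fst (scale c v)) x) \<partial>vol \<Omega>) =
      (\<integral>x. cnj c * (complex_of_real (\<alpha> x) * \<Delta> (fst u) x * cnj (\<Delta> (fst v) x)) \<partial>vol \<Omega>)"
  proof (rule integral_cong_AE)
    show "AE x in vol \<Omega>. complex_of_real (\<alpha> x) * \<Delta> (fst u) x * cnj (\<Delta> (fst (scale c v)) x) =
        cnj c * (complex_of_real (\<alpha> x) * \<Delta> (fst u) x * cnj (\<Delta> (fst v) x))"
      using \<Delta>_scale[OF assms(2), of c] by eventually_elim simp
  qed measurable
  moreover have "(\<lambda>x. complex_of_real (\<gamma> x) * snd u x * cnj (snd (scale c v) x)) =
      (\<lambda>x. cnj c * (complex_of_real (\<gamma> x) * snd u x * cnj (snd v x)))"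
    by (simp add: scale_eq fun_eq_iff)
  ultimately show ?thesis
    by (simp add: form_eq D_scale assms distrib_left)
qed

lemma H_inner_scale_right: "H_inner \<Omega> \<beta> u (scale c v) = cnj c * H_inner \<Omega> \<beta> u v"
proof -
  have "(\<lambda>x. fst u x * cnj (c * fst v x)) = (\<lambda>x. cnj c * (fst u x * cnj (fst v x)))"
    "(\<lambda>x. snd u x * cnj (c * snd v x) * complex_of_real (inverse (\<beta> x))) =
      (\<lambda>x. cnj c * (snd u x * cnj (snd v x) * complex_of_real (inverse (\<beta> x))))"
    by (simp_all add: fun_eq_iff)
  then show ?thesis
    unfolding H_inner_def inner_vol_def inner_surf_def scale_eq fst_conv snd_conv
    by (simp only: integral_mult_right_zero distrib_left)
qed

text \<open>Both sides are conjugate linear in \<open>v\<close>, so replacing \<open>v\<close> by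
  its multiple with the imaginary unit recovers the imaginary parts. Nothing is lost by working over
  the reals.\<close>

lemma complex_form_iff:
  assumes u: "u \<in> D" and f: "f \<in> Hsp \<Omega> \<beta>"
  shows "(\<forall>v\<in>D. form \<Omega> \<alpha> \<beta> \<gamma> u v = H_inner \<Omega> \<beta> f v) \<longleftrightarrow> (\<forall>v\<in>D. rform u v = hip f v)"
proof
  assume "\<forall>v\<in>D. form \<Omega> \<alpha> \<beta> \<gamma> u v = H_inner \<Omega> \<beta> f v"
  then show "\<forall>v\<in>D. rform u v = hip f v"
    using u f by (simp add: Re_form[symmetric] H_inner_eq[symmetric] D_mem)
next
  assume *: "\<forall>v\<in>D. rform u v = hip f v"
  then have re: "Re (form \<Omega> \<alpha> \<beta> \<gamma> u v) = Re (H_inner \<Omega> \<beta> f v)" if "v \<in> D" for v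
    using that u f by (simp add: Re_form H_inner_eq D_mem)
  have "Im (form \<Omega> \<alpha> \<beta> \<gamma> u v) = Im (H_inner \<Omega> \<beta> f v)" if v: "v \<in> D" for v
    using re[OF D_scale[OF v, of \<i>]] by (simp add: form_scale_right[OF u v] H_inner_scale_right)
  with re show "\<forall>v\<in>D. form \<Omega> \<alpha> \<beta> \<gamma> u v = H_inner \<Omega> \<beta> f v" by (simp add: complex_eq_iff)
qed

lemma form_semigroup:
  assumes T: "semigroup_generated_by \<Omega> \<beta> (\<lambda>u f. assoc_op \<Omega> \<alpha> \<beta> \<gamma> u (- f)) T"
  shows "form_semigroup (Hsp \<Omega> \<beta>) sc hip D rform T"
proof -
  have C: "C0_semigroup \<Omega> \<beta> T" and G: "\<And>u f. generator \<Omega> \<beta> T u f \<longleftrightarrow> assoc_op \<Omega> \<alpha> \<beta> \<gamma> u (- f)"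
    using T by (auto simp: semigroup_generated_by_def)
  have T_mem: "\<And>t u. t \<ge> 0 \<Longrightarrow> u \<in> Hsp \<Omega> \<beta> \<Longrightarrow> T t u \<in> Hsp \<Omega> \<beta>" using C by (simp add: C0_semigroup_def)
  show ?thesis
  proof
    show "D \<subseteq> Hsp \<Omega> \<beta>" by (auto intro: D_mem)
    show "0 \<in> D"
      using test_function_neumann[OF test_functions_zero] has_trace_test[OF test_functions_zero] H.zero_mem
      by (simp add: form_domain_def zero_prod_def zero_fun_def)
  next
    fix t x y assume a: "0 \<le> (t::real)" "x \<in> Hsp \<Omega> \<beta>" "y \<in> Hsp \<Omega> \<beta>"
    then show "H.equiv (T t (x + y)) (T t x + T t y)"
      using C by (subst H_eq_iff[symmetric]) (auto simp: C0_semigroup_def)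
  next
    fix t x c assume a: "0 \<le> (t::real)" "x \<in> Hsp \<Omega> \<beta>"
    then show "H.equiv (T t (sc c x)) (sc c (T t x))"
      using C by (subst H_eq_iff[symmetric]) (auto simp: C0_semigroup_def)
  next
    fix t :: real assume t: "0 \<le> t"
    then obtain K where "\<forall>u\<in>Hsp \<Omega> \<beta>. H_norm \<Omega> \<beta> (T t u) \<le> K * H_norm \<Omega> \<beta> u"
      using C by (auto simp: C0_semigroup_def)
    then show "\<exists>K. \<forall>x\<in>Hsp \<Omega> \<beta>. H.nm (T t x) \<le> K * H.nm x"
      using t by (intro exI[of _ K]) (simp add: H_norm_eq[symmetric] T_mem)
  next
    fix x assume "x \<in> Hsp \<Omega> \<beta>"
    then show "H.equiv (T 0 x) x"
      using C by (subst H_eq_iff[symmetric]) (auto simp: C0_semigroup_def)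
  next
    fix s t x assume "0 \<le> (s::real)" "0 \<le> (t::real)" "x \<in> Hsp \<Omega> \<beta>"
    then show "H.equiv (T (s + t) x) (T s (T t x))"
      using C by (subst H_eq_iff[symmetric]) (auto simp: C0_semigroup_def)
  next
    fix x assume x: "x \<in> Hsp \<Omega> \<beta>"
    then have "((\<lambda>t. H_norm \<Omega> \<beta> (T t x - x)) \<longlongrightarrow> 0) (at_right 0)" using C by (simp add: C0_semigroup_def)
    then show "((\<lambda>h. H.nm (T h x - x)) \<longlongrightarrow> 0) (at_right 0)"
      by (rule Lim_transform_eventually) (use x in \<open>auto simp: eventually_at_filter H_norm_eq T_mem\<close>)
  next
    fix u f assume u: "u \<in> Hsp \<Omega> \<beta>" and f: "f \<in> Hsp \<Omega> \<beta>"
    \<comment> \<open>The generator is minus the operator and takes the value \<open>- f\<close> at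
      \<open>u\<close>; the double sign brings the condition into the shape of the hypothesis on
      \<open>T\<close>.\<close>
    have "u \<in> D \<and> (\<forall>v\<in>D. rform u v = hip f v) \<longleftrightarrow> assoc_op \<Omega> \<alpha> \<beta> \<gamma> u (- (- f))"
      using complex_form_iff[of u f] f by (auto simp: assoc_op_def)
    also have "\<dots> \<longleftrightarrow> generator \<Omega> \<beta> T u (- f)" by (rule G[symmetric])
    also have "\<dots> \<longleftrightarrow> ((\<lambda>h. H_norm \<Omega> \<beta> (sc (inverse h) (T h u - u) + f)) \<longlongrightarrow> 0) (at_right 0)"
      using u f by (simp add: generator_def)
    also have "\<dots> \<longleftrightarrow> ((\<lambda>h. H.nm (sc (inverse h) (T h u - u) + f)) \<longlongrightarrow> 0) (at_right 0)"
    proof (rule tendsto_cong)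
      have "H_norm \<Omega> \<beta> (sc (inverse h) (T h u - u) + f) = H.nm (sc (inverse h) (T h u - u) + f)" if "h > 0" for h
        using that u f by (intro H_norm_eq H.add_mem H.sc_mem H.diff_mem T_mem) auto
      then show "\<forall>\<^sub>F h in at_right 0. H_norm \<Omega> \<beta> (sc (inverse h) (T h u - u) + f) = H.nm (sc (inverse h) (T h u - u) + f)"
        by (auto simp: eventually_at_filter simp del: of_real_inverse)
    qed
    finally show "u \<in> D \<and> (\<forall>v\<in>D. rform u v = hip f v) \<longleftrightarrow>
      ((\<lambda>h. H.nm (sc (inverse h) (T h u - u) + f)) \<longlongrightarrow> 0) (at_right 0)" .
  qed (use form_complete T_mem in \<open>auto intro: D_add D_scale rform_add rform_sc rform_sym rform_nonneg\<close>)
qed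

subsection \<open>Complex conjugation\<close>

definition conj_pair :: "'a pair \<Rightarrow> 'a pair" where
  "conj_pair u = ((\<lambda>x. cnj (fst u x)), (\<lambda>x. cnj (snd u x)))"

lemma conj_pair_simps [simp]:
  "fst (conj_pair u) = (\<lambda>x. cnj (fst u x))" "snd (conj_pair u) = (\<lambda>x. cnj (snd u x))"
  by (simp_all add: conj_pair_def)

lemma real_ip_cnj: "real_ip M (\<lambda>x. cnj (f x)) g = real_ip M f (\<lambda>x. cnj (g x))"
proof -
  have "real_ip M (\<lambda>x. cnj (f x)) g = Re (\<integral>x. cnj (f x * g x) \<partial>M)" by (simp add: real_ip_def)
  also have "\<dots> = Re (cnj (\<integral>x. f x * g x \<partial>M))" by (simp only: Bochner_Integration.integral_cnj)
  finally show ?thesis by (simp add: real_ip_def)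
qed

lemma D_conj:
  assumes "u \<in> D"
  shows "conj_pair u \<in> D"
  using assms neumann_domain_cnj[of "fst u"] has_trace_cnj[of "fst u" "snd u"]
  by (auto simp: form_domain_def Hsp_iff intro: L2_cnj)

text \<open>The coefficients are real, and the weak Laplacian commutes with conjugation almost
  everywhere, so conjugation can be moved to the other argument.\<close>

lemma rform_conj:
  assumes "u \<in> D" "v \<in> D"
  shows "rform (conj_pair u) v = rform u (conj_pair v)"
proof -
  have ae: "AE x in vol \<Omega>. \<Delta> (fst (conj_pair w)) x = cnj (\<Delta> (fst w) x)" if "w \<in> D" for w
    using H1_laplace_cnj(2)[OF D_mem(4)[OF that]] by simp
  have "real_ip (vol \<Omega>) (\<lambda>x. complex_of_real (\<alpha> x) * \<Delta> (fst (conj_pair u)) x) (\<Delta> (fst v)) =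
      real_ip (vol \<Omega>) (\<lambda>x. cnj (complex_of_real (\<alpha> x) * \<Delta> (fst u) x)) (\<Delta> (fst v))"
    using ae[OF assms(1)]
    by (intro real_ip_cong_AE L2_cnj \<alpha>_L2 D_mem(6) D_conj assms) (auto elim!: eventually_mono)
  also have "\<dots> = real_ip (vol \<Omega>) (\<lambda>x. complex_of_real (\<alpha> x) * \<Delta> (fst u) x) (\<lambda>x. cnj (\<Delta> (fst v) x))"
    by (rule real_ip_cnj)
  also have "\<dots> = real_ip (vol \<Omega>) (\<lambda>x. complex_of_real (\<alpha> x) * \<Delta> (fst u) x) (\<Delta> (fst (conj_pair v)))"
    using ae[OF assms(2)]
    by (intro real_ip_cong_AE L2_cnj \<alpha>_L2 D_mem(6) D_conj assms) (auto elim!: eventually_mono)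
  finally show ?thesis
    using real_ip_cnj[of wsurf "\<lambda>x. complex_of_real (\<gamma> x) * snd u x" "snd v"] by (simp add: rform_def)
qed

lemma hip_conj: "hip (conj_pair u) v = hip u (conj_pair v)"
  by (simp add: hip_def real_ip_cnj)

subsection \<open>The measure space \<open>X\<close>\<close>

abbreviation "X \<equiv> X_measure \<Omega> \<beta>"

lemma frontier_disjoint: "x \<in> frontier \<Omega> \<Longrightarrow> x \<notin> \<Omega>"
  using \<Omega>_open by (auto simp: frontier_def interior_open)

lemma sets_X: "sets X = {A \<in> sets borel. A \<subseteq> \<Omega> \<union> frontier \<Omega>}"
proof -
  have "\<Omega> \<union> frontier \<Omega> \<in> sets borel" using \<Omega>_open by simp
  then show ?thesis
    unfolding sets_X_measure by (auto simp: sets_restrict_space image_iff intro: bexI[of _ "_"])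
qed

lemma trace_sets_X:
  assumes "S \<in> sets borel" "S \<subseteq> \<Omega> \<union> frontier \<Omega>"
  shows "sets (restrict_space X S) = (\<inter>) S ` sets borel"
  unfolding sets_restrict_space sets_X
proof (intro equalityI image_subsetI)
  fix B :: "'a set" assume "B \<in> sets borel"
  then show "S \<inter> B \<in> (\<inter>) S ` {A \<in> sets borel. A \<subseteq> \<Omega> \<union> frontier \<Omega>}"
    using assms by (intro image_eqI[of _ _ "S \<inter> B"]) auto
qed auto

lemma emeasure_X:
  "A \<in> sets borel \<Longrightarrow> A \<subseteq> \<Omega> \<union> frontier \<Omega> \<Longrightarrow>
    emeasure X A = emeasure lborel (A \<inter> \<Omega>) + emeasure wsurf (A \<inter> frontier \<Omega>)"
proof -
  assume A: "A \<in> sets borel" "A \<subseteq> \<Omega> \<union> frontier \<Omega>"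
  have "A \<inter> frontier \<Omega> \<in> sets (surf \<Omega>)" using A(1) by (auto simp: surf_def sets_restrict_space)
  then show ?thesis
    by (subst emeasure_X_measure[OF \<Omega>_open measurable_coeffs(2) A]) (simp add: emeasure_density)
qed

lemma restrict_X_vol: "restrict_space X \<Omega> = vol \<Omega>"
proof (rule measure_eqI)
  have "\<Omega> \<inter> space X \<in> sets X" using \<Omega>_open by (simp add: sets_X space_X_measure)
  note r = emeasure_restrict_space[OF this]
  show s: "sets (restrict_space X \<Omega>) = sets (vol \<Omega>)"
    using \<Omega>_open by (subst trace_sets_X) (auto simp: vol_def sets_restrict_space)
  fix A assume "A \<in> sets (restrict_space X \<Omega>)"
  then have "A \<in> sets (restrict_space lborel \<Omega>)" unfolding s vol_def .
  then have A: "A \<in> sets borel" "A \<subseteq> \<Omega>" using \<Omega>_open by (auto simp: sets_restrict_space)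
  then have "A \<inter> frontier \<Omega> = {}" using frontier_disjoint by auto
  then show "emeasure (restrict_space X \<Omega>) A = emeasure (vol \<Omega>) A"
    using A \<Omega>_open by (simp add: r emeasure_X vol_def emeasure_restrict_space Int_absorb2 le_supI1)
qed

lemma restrict_X_surf: "restrict_space X (frontier \<Omega>) = wsurf"
proof (rule measure_eqI)
  have "frontier \<Omega> \<inter> space X \<in> sets X" by (simp add: sets_X space_X_measure)
  note r = emeasure_restrict_space[OF this]
  show s: "sets (restrict_space X (frontier \<Omega>)) = sets wsurf"
    by (subst trace_sets_X) (auto simp: surf_def sets_restrict_space)
  fix A assume "A \<in> sets (restrict_space X (frontier \<Omega>))"
  then have "A \<in> sets (restrict_space (hausdorff_measure (DIM('a) - 1) :: 'a measure) (frontier \<Omega>))"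
    unfolding s surf_def by simp
  then have A: "A \<in> sets borel" "A \<subseteq> frontier \<Omega>" by (auto simp: sets_restrict_space)
  then have "A \<inter> \<Omega> = {}" using frontier_disjoint by auto
  then show "emeasure (restrict_space X (frontier \<Omega>)) A = emeasure wsurf A"
    using A by (simp add: r emeasure_X Int_absorb2 le_supI2)
qed

text \<open>\<Omega> and its frontier cover the space, and the restrictions of \<open>X\<close> to
  them are the volume measure and the weighted surface measure.\<close>

lemma AE_X: "(AE x in X. P x) \<longleftrightarrow> (AE x in vol \<Omega>. P x) \<and> (AE x in wsurf. P x)"
proof -
  have m: "\<Omega> \<inter> space X \<in> sets X" "frontier \<Omega> \<inter> space X \<in> sets X"
    using \<Omega>_open by (simp_all add: sets_X space_X_measure)
  have "(AE x in X. P x) \<longleftrightarrow> (AE x in X. (x \<in> \<Omega> \<longrightarrow> P x) \<and> (x \<in> frontier \<Omega> \<longrightarrow> P x))"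
  proof
    assume "AE x in X. (x \<in> \<Omega> \<longrightarrow> P x) \<and> (x \<in> frontier \<Omega> \<longrightarrow> P x)"
    with AE_space show "AE x in X. P x" by eventually_elim (auto simp: space_X_measure)
  qed (auto elim!: eventually_mono)
  then show ?thesis
    unfolding restrict_X_vol[symmetric] restrict_X_surf[symmetric]
    by (simp add: AE_restrict_space_iff[OF m(1)] AE_restrict_space_iff[OF m(2)])
qed

lemma finite_X: "finite_measure X"
proof (rule finite_measureI)
  have "emeasure X (space X) = emeasure lborel ((\<Omega> \<union> frontier \<Omega>) \<inter> \<Omega>) + emeasure wsurf ((\<Omega> \<union> frontier \<Omega>) \<inter> frontier \<Omega>)"
    using \<Omega>_open by (simp add: space_X_measure emeasure_X)
  moreover have "emeasure lborel ((\<Omega> \<union> frontier \<Omega>) \<inter> \<Omega>) < \<infinity>"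
    using \<Omega>(2) by (intro emeasure_bounded_finite) (auto intro: bounded_subset)
  moreover have "emeasure wsurf ((\<Omega> \<union> frontier \<Omega>) \<inter> frontier \<Omega>) < \<infinity>"
    using finite_measure.emeasure_finite[OF finite_wsurf] by (simp add: less_top[symmetric])
  ultimately show "emeasure X (space X) \<noteq> \<infinity>" by (simp add: less_top)
qed

lemma L2_X:
  assumes f: "f \<in> L2 X"
  shows "(f, f) \<in> Hsp \<Omega> \<beta>"
proof -
  have m: "\<Omega> \<inter> space X \<in> sets X" "frontier \<Omega> \<inter> space X \<in> sets X"
    using \<Omega>_open by (simp_all add: sets_X space_X_measure)
  have s: "\<Omega> \<in> sets X" "frontier \<Omega> \<in> sets X" using \<Omega>_open by (simp_all add: sets_X)
  have "f \<in> L2 (restrict_space X \<Omega>)" "f \<in> L2 (restrict_space X (frontier \<Omega>))"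
    using f s unfolding L2_def
    by (auto simp: integrable_restrict_space[OF m(1)] integrable_restrict_space[OF m(2)]
        intro: measurable_restrict_space1 intro!: integrable_mult_indicator simp del: real_scaleR_def)
  then show ?thesis by (simp add: Hsp_iff restrict_X_vol restrict_X_surf)
qed

lemma borel_L2_X:
  assumes "f \<in> borel_measurable borel" "\<And>x. cmod (f x) \<le> K"
  shows "f \<in> L2 X"
proof (rule L2_bounded[OF finite_X, where K = K])
  have "sets X = sets (restrict_space borel (\<Omega> \<union> frontier \<Omega>))" by (rule sets_X_measure)
  then show "f \<in> borel_measurable X"
    using measurable_restrict_space1[OF assms(1)] by (simp cong: measurable_cong_sets)
qed (use assms(2) in simp)

lemma AE_on_X:
  "(AE x in X. P (on_X \<Omega> T t f x)) \<longleftrightarrow>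
    (AE x in vol \<Omega>. P (fst (T t (f, f)) x)) \<and> (AE x in wsurf. P (snd (T t (f, f)) x))"
proof -
  have "(AE x in vol \<Omega>. P (on_X \<Omega> T t f x)) \<longleftrightarrow> (AE x in vol \<Omega>. P (fst (T t (f, f)) x))"
    by (rule AE_cong) (simp add: on_X_def glue_def)
  moreover have "(AE x in wsurf. P (on_X \<Omega> T t f x)) \<longleftrightarrow> (AE x in wsurf. P (snd (T t (f, f)) x))"
    by (rule AE_cong) (use frontier_disjoint in \<open>auto simp: on_X_def glue_def surf_def space_restrict_space\<close>)
  ultimately show ?thesis by (simp add: AE_X)
qed

section \<open>Test functions whose truncations have a kink\<close>

lemma test_pair_D:
  assumes \<phi>: "\<phi> \<in> test_functions \<Omega>"
  shows "(\<phi>, \<phi>) \<in> D"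
proof -
  obtain M where "\<And>x. cmod (\<phi> x) \<le> M" using test_functions_bounded[OF \<phi>] by blast
  then have "\<phi> \<in> L2 X" using test_functions_measurable[OF \<phi>] by (intro borel_L2_X)
  then show ?thesis
    using L2_X has_trace_test[OF \<phi>] test_function_neumann[OF \<phi>] by (simp add: form_domain_def)
qed

text \<open>A cutoff times an affine function. The value \<open>c\<close> at \<open>x0\<close>
  places the kink of the truncation there: 0 for the positive part, 1 for the truncation to the unit
  ball. The bound \<open>r \<le> 1\<close> keeps the function above -1 near \<open>x0\<close> when
  \<open>c = 1\<close>, so that only the upper truncation acts there.\<close>

lemma locally_affine_test_function:
  obtains x0 i r and \<phi> :: "'a \<Rightarrow> real" where "i \<in> Basis" "0 < r" "r \<le> 1" "ball x0 r \<subseteq> \<Omega>"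
    "(\<lambda>x. complex_of_real (\<phi> x)) \<in> test_functions \<Omega>" "\<And>x. x \<in> ball x0 r \<Longrightarrow> \<phi> x = c + (x - x0) \<bullet> i"
proof -
  obtain x0 where "x0 \<in> \<Omega>" using \<Omega>(1) by (auto simp: lipschitz_domain_def)
  then obtain \<rho> where \<rho>: "\<rho> > 0" "cball x0 \<rho> \<subseteq> \<Omega>" using \<Omega>_open open_contains_cball by blast
  define s where "s = min \<rho> 1"
  have s: "s > 0" "s \<le> 1" "cball x0 s \<subseteq> \<Omega>" using \<rho> by (auto simp: s_def)
  obtain i :: 'a where i: "i \<in> Basis" using nonempty_Basis by blast
  define \<phi> where "\<phi> x = cutoff x0 (s / 2) s x * (c + (x - x0) \<bullet> i)" for x
  have "smooth (\<lambda>x. complex_of_real (cutoff x0 (s / 2) s x) *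
      (complex_of_real c + (complex_of_real (x \<bullet> i) - complex_of_real (x0 \<bullet> i))))"
    using s by (intro smooth_mult smooth_cutoff smooth_add smooth_diff smooth_const smooth_inner) auto
  then have sm: "smooth (\<lambda>x. complex_of_real (\<phi> x))" by (simp add: \<phi>_def inner_diff_left)
  show thesis
  proof (rule that[OF i, of "s / 2"])
    show "(\<lambda>x. complex_of_real (\<phi> x)) \<in> test_functions \<Omega>"
      by (rule test_functions_I[OF sm compact_cball s(3)]) (use s in \<open>simp add: \<phi>_def cutoff_outside\<close>)
    show "\<phi> x = c + (x - x0) \<bullet> i" if "x \<in> ball x0 (s / 2)" for x
      using that s by (simp add: \<phi>_def cutoff_inside)
    show "ball x0 (s / 2) \<subseteq> \<Omega>" using s by (auto intro!: subsetD[OF s(3)])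
  qed (use s in auto)
qed

lemma real_ip_nonneg_AE:
  assumes "f \<in> L2 M" "g \<in> L2 M" "AE x in M. 0 \<le> Re (f x * cnj (g x))"
  shows "0 \<le> real_ip M f g"
  unfolding real_ip_def
  by (subst integral_Re[OF L2_mult_integrable[OF assms(1) L2_cnj[OF assms(2)]]]) (rule integral_nonneg_AE[OF assms(3)])

end

locale wentzell_semigroup = wentzell +
  fixes T :: "real \<Rightarrow> 'a pair \<Rightarrow> 'a pair"
  assumes T: "semigroup_generated_by \<Omega> \<beta> (\<lambda>u f. assoc_op \<Omega> \<alpha> \<beta> \<gamma> u (- f)) T"
begin

sublocale F: form_semigroup "Hsp \<Omega> \<beta>" sc hip D rform T
  using T by (rule form_semigroup)

lemma conj_pair_op: "F.op u f \<Longrightarrow> F.op (conj_pair u) (conj_pair f)"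
  using D_conj by (auto simp: F.op_def rform_conj hip_conj Hsp_iff L2_cnj)

lemma semigroup_real: "real_semigroup X (on_X \<Omega> T)"
  unfolding real_semigroup_def
proof (intro allI impI ballI)
  fix t :: real and f assume t: "t \<ge> 0" and f: "f \<in> L2 X" and re: "AE x in X. f x \<in> \<real>"
  let ?y = "(f, f)"
  have y: "?y \<in> Hsp \<Omega> \<beta>" using f by (rule L2_X)
  have conj_mem: "conj_pair u \<in> Hsp \<Omega> \<beta>" if "u \<in> Hsp \<Omega> \<beta>" for u
    using that by (simp add: Hsp_iff L2_cnj)
  \<comment> \<open>Real-valued almost everywhere means fixed by conjugation up to
    \<open>H_eq\<close>, and this fixed point property is carried over to \<open>T t ?y\<close> by
    intertwining.\<close>
  have "H_eq \<Omega> (conj_pair ?y) ?y"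
    using re unfolding AE_X AE_wsurf H_eq_def by (auto elim!: eventually_mono simp: Reals_cnj_iff)
  then have "H.equiv (conj_pair ?y) ?y" using y conj_mem by (simp add: H_eq_iff)
  then have "H.equiv (T t (conj_pair ?y)) (T t ?y)" using t y conj_mem by (intro F.T_equiv)
  moreover have "H.equiv (T t (conj_pair ?y)) (conj_pair (T t ?y))"
  proof (rule F.T_intertwining[OF conj_mem _ _ _ conj_pair_op t y])
    fix x z :: "'a pair" and c
    show "conj_pair (x - z) = conj_pair x - conj_pair z" by (simp add: conj_pair_def prod_eq_iff fun_eq_iff)
    show "conj_pair (sc c x) = sc c (conj_pair x)" by (simp add: conj_pair_def scale_eq)
    show "hip (conj_pair x) (conj_pair z) = hip x z" by (simp add: hip_conj) (simp add: conj_pair_def)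
  qed
  ultimately have "H.equiv (conj_pair (T t ?y)) (T t ?y)"
    using t y conj_mem by (meson H.equiv_sym H.equiv_trans F.T_mem)
  then have "H_eq \<Omega> (conj_pair (T t ?y)) (T t ?y)" using t y conj_mem by (simp add: H_eq_iff)
  then show "AE x in X. on_X \<Omega> T t f x \<in> \<real>"
    unfolding AE_on_X[where P = "\<lambda>z. z \<in> \<real>"] AE_wsurf H_eq_def by (auto elim!: eventually_mono simp: Reals_cnj_iff)
qed

text \<open>Integrating the pointwise inequality over both components of \<open>X\<close> gives the
  variational inequality of the projection for the pairs \<open>(\<phi>, \<phi>)\<close> and
  \<open>(f, f)\<close>. The element of the form domain obtained from it agrees with
  \<open>f\<close> almost everywhere, and a weak Laplacian depends on no more than that.\<close>

lemma projection_weak_laplacian: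
  fixes f \<phi> :: "'a \<Rightarrow> complex"
  assumes \<phi>: "\<phi> \<in> test_functions \<Omega>" and f: "f \<in> L2 X"
    and proj: "\<And>t. t > 0 \<Longrightarrow> AE x in X. 0 \<le> Re ((f x - on_X \<Omega> T t f x) * cnj (\<phi> x - f x))"
  shows "\<exists>g\<in>L2 (vol \<Omega>). has_weak_laplacian \<Omega> f g"
proof -
  have w: "(f, f) \<in> Hsp \<Omega> \<beta>" using f by (rule L2_X)
  have u: "(\<phi>, \<phi>) \<in> D" using \<phi> by (rule test_pair_D)
  have "\<exists>w'\<in>D. H.equiv (f, f) w'"
  proof (rule F.projection_in_form_domain[OF u w])
    fix t :: real assume t: "t > 0"
    let ?a = "(f, f) - T t (f, f)" and ?b = "(\<phi>, \<phi>) - (f, f)"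
    have ab: "?a \<in> Hsp \<Omega> \<beta>" "?b \<in> Hsp \<Omega> \<beta>" using t w D_mem(1)[OF u] by (intro H.diff_mem F.T_mem; simp)+
    have v: "AE x in vol \<Omega>. 0 \<le> Re (fst ?a x * cnj (fst ?b x))" "AE x in wsurf. 0 \<le> Re (snd ?a x * cnj (snd ?b x))"
    proof -
      have "AE x in vol \<Omega>. 0 \<le> Re ((f x - on_X \<Omega> T t f x) * cnj (\<phi> x - f x))"
        "AE x in wsurf. 0 \<le> Re ((f x - on_X \<Omega> T t f x) * cnj (\<phi> x - f x))"
        using proj[OF t] by (simp_all add: AE_X)
      moreover have "on_X \<Omega> T t f x = fst (T t (f, f)) x" if "x \<in> space (vol \<Omega>)" for x
        using that by (simp add: on_X_def glue_def)
      moreover have "on_X \<Omega> T t f x = snd (T t (f, f)) x" if "x \<in> space wsurf" for x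
        using that frontier_disjoint by (auto simp: on_X_def glue_def surf_def space_restrict_space)
      ultimately show "AE x in vol \<Omega>. 0 \<le> Re (fst ?a x * cnj (fst ?b x))" "AE x in wsurf. 0 \<le> Re (snd ?a x * cnj (snd ?b x))"
        by (simp_all cong: AE_cong_simp)
    qed
    show "0 \<le> hip ?a ?b"
      unfolding hip_def by (intro add_nonneg_nonneg real_ip_nonneg_AE Hsp_D ab v)
  qed
  then obtain w' where w': "w' \<in> D" "H.equiv (f, f) w'" by blast
  then have "H_eq \<Omega> (f, f) w'" using w by (simp add: H_eq_iff D_mem)
  then have ae: "AE x in vol \<Omega>. f x = fst w' x" by (simp add: H_eq_def)
  have "has_weak \<Omega> lap_op f (\<Delta> (fst w'))"
    unfolding has_weak_def
  proof
    fix \<psi> assume \<psi>: "\<psi> \<in> test_functions \<Omega>"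
    have lap: "lap_op \<psi> \<in> L2 (vol \<Omega>)" using test_operator_lap[of \<Omega>] \<psi> by (auto simp: test_operator_def intro: test_L2)
    have "(\<integral>x. f x * lap_op \<psi> x \<partial>vol \<Omega>) = (\<integral>x. fst w' x * lap_op \<psi> x \<partial>vol \<Omega>)"
    proof (rule integral_cong_AE)
      show "AE x in vol \<Omega>. f x * lap_op \<psi> x = fst w' x * lap_op \<psi> x" using ae by eventually_elim simp
    qed (use Hsp_D(1)[OF w] Hsp_D(1)[OF D_mem(1)[OF w'(1)]] lap in \<open>auto intro!: borel_measurable_times L2_measurable\<close>)
    also have "\<dots> = (\<integral>x. \<Delta> (fst w') x * \<psi> x \<partial>vol \<Omega>)"
      using weak_laplacian_spec(2)[OF D_mem(4)[OF w'(1)]] \<psi> by (simp add: has_weak_def)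
    finally show "(\<integral>x. f x * lap_op \<psi> x \<partial>vol \<Omega>) = (\<integral>x. \<Delta> (fst w') x * \<psi> x \<partial>vol \<Omega>)" .
  qed
  then show ?thesis using D_mem(6)[OF w'(1)] by (auto simp: has_weak_laplacian_iff)
qed

text \<open>Under positivity the cone of nonnegative functions is invariant, and the projection of
  \<open>\<phi>\<close> to it is the positive part. Since \<open>\<phi>\<close> is affine near
  \<open>x0\<close> and vanishes there, this positive part has a kink of height 1.\<close>

lemma semigroup_not_positive: "\<not> positive_semigroup X (on_X \<Omega> T)"
proof
  assume pos: "positive_semigroup X (on_X \<Omega> T)"
  obtain x0 i r and \<phi> :: "'a \<Rightarrow> real" where \<phi>: "i \<in> Basis" "0 < r" "r \<le> 1" "ball x0 r \<subseteq> \<Omega>"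
    "(\<lambda>x. complex_of_real (\<phi> x)) \<in> test_functions \<Omega>" "\<And>x. x \<in> ball x0 r \<Longrightarrow> \<phi> x = 0 + (x - x0) \<bullet> i"
    by (rule locally_affine_test_function[of 0]) (rule that; assumption)
  define f where "f x = complex_of_real (max 0 (\<phi> x))" for x
  obtain M where M: "\<And>x. cmod (complex_of_real (\<phi> x)) \<le> M" using test_functions_bounded[OF \<phi>(5)] by blast
  have [measurable]: "\<phi> \<in> borel_measurable borel"
    using measurable_compose[OF test_functions_measurable[OF \<phi>(5)] borel_measurable_Re] by simp
  have fL2: "f \<in> L2 X"
  proof (rule borel_L2_X)
    show "f \<in> borel_measurable borel" unfolding f_def by measurable
    show "cmod (f x) \<le> M" for x using M[of x] by (auto simp: f_def max_def)
  qed
  have "\<exists>g\<in>L2 (vol \<Omega>). has_weak_laplacian \<Omega> f g"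
  proof (rule projection_weak_laplacian[OF \<phi>(5) fL2])
    fix t :: real assume "t > 0"
    then have "AE x in X. on_X \<Omega> T t f x \<in> \<real> \<and> 0 \<le> Re (on_X \<Omega> T t f x)"
      using pos fL2 unfolding positive_semigroup_def by (auto simp: f_def)
    \<comment> \<open>Where \<open>\<phi> x \<ge> 0\<close> the second factor is 0. Elsewhere
      \<open>f x = 0\<close>, and the product is that of two nonpositive numbers,
      \<open>\<phi> x\<close> and minus the value of the semigroup.\<close>
    then show "AE x in X. 0 \<le> Re ((f x - on_X \<Omega> T t f x) * cnj (complex_of_real (\<phi> x) - f x))"
    proof eventually_elim
      case (elim x)
      then show ?case
        by (cases "\<phi> x \<ge> 0") (auto simp: f_def max_def mult_nonneg_nonpos)
    qed
  qed
  then obtain g where g: "g \<in> L2 (vol \<Omega>)" "has_weak_laplacian \<Omega> f g" by blast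
  show False
  proof (rule kink_no_weak_laplacian[OF \<Omega>_open \<Omega>_finite \<phi>(1,2,4) _ _ g])
    show "f x = 0 + 0 * complex_of_real ((x - x0) \<bullet> i) + 1 * complex_of_real (max 0 ((x - x0) \<bullet> i))"
      if "x \<in> ball x0 r" for x
      using \<phi>(6)[OF that] by (simp add: f_def)
  qed simp
qed

text \<open>The projection of the real function \<open>\<phi>\<close> to the unit ball is its
  truncation to values between -1 and 1. With \<open>\<phi> x0 = 1\<close> and slope 1 the upper
  truncation starts exactly on the hyperplane through \<open>x0\<close>.\<close>

lemma semigroup_not_contractive: "\<not> Linf_contractive_semigroup X (on_X \<Omega> T)"
proof
  assume con: "Linf_contractive_semigroup X (on_X \<Omega> T)"
  obtain x0 i r and \<phi> :: "'a \<Rightarrow> real" where \<phi>: "i \<in> Basis" "0 < r" "r \<le> 1" "ball x0 r \<subseteq> \<Omega>"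
    "(\<lambda>x. complex_of_real (\<phi> x)) \<in> test_functions \<Omega>" "\<And>x. x \<in> ball x0 r \<Longrightarrow> \<phi> x = 1 + (x - x0) \<bullet> i"
    by (rule locally_affine_test_function[of 1]) (rule that; assumption)
  define f where "f x = complex_of_real (max (- 1) (min 1 (\<phi> x)))" for x
  have [measurable]: "\<phi> \<in> borel_measurable borel"
    using measurable_compose[OF test_functions_measurable[OF \<phi>(5)] borel_measurable_Re] by simp
  have f1: "cmod (f x) \<le> 1" for x by (auto simp: f_def)
  have fm: "f \<in> borel_measurable borel" unfolding f_def by measurable
  have fL2: "f \<in> L2 X" by (rule borel_L2_X[OF fm f1])
  have "(\<lambda>x. ereal (norm (f x))) \<in> borel_measurable X" using L2_measurable[OF fL2] by measurable
  then have le1: "Linf_norm X f \<le> 1"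
    unfolding Linf_norm_def by (rule esssup_I) (use f1 in auto)
  then have fLinf: "f \<in> Linf X" using L2_measurable[OF fL2] by (auto simp: Linf_def)
  have "\<exists>g\<in>L2 (vol \<Omega>). has_weak_laplacian \<Omega> f g"
  proof (rule projection_weak_laplacian[OF \<phi>(5) fL2])
    fix t :: real assume "t > 0"
    then have "Linf_norm X (on_X \<Omega> T t f) \<le> Linf_norm X f"
      using con fL2 fLinf unfolding Linf_contractive_semigroup_def by simp
    then have "Linf_norm X (on_X \<Omega> T t f) \<le> 1" using le1 by (rule order_trans)
    moreover have "AE x in X. ereal (norm (on_X \<Omega> T t f x)) \<le> Linf_norm X (on_X \<Omega> T t f)"
      unfolding Linf_norm_def by (rule esssup_AE)
    ultimately have "AE x in X. cmod (on_X \<Omega> T t f x) \<le> 1"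
      by (auto elim!: eventually_mono dest: order_trans)
    then show "AE x in X. 0 \<le> Re ((f x - on_X \<Omega> T t f x) * cnj (complex_of_real (\<phi> x) - f x))"
    proof eventually_elim
      case (elim x)
      then have "\<bar>Re (on_X \<Omega> T t f x)\<bar> \<le> 1" using abs_Re_le_cmod[of "on_X \<Omega> T t f x"] by linarith
      \<comment> \<open>The second factor is real, so only the real part of the semigroup value
        enters, and that lies between -1 and 1. If \<open>\<phi> x\<close> exceeds 1, then
        \<open>f x = 1\<close> and both factors are nonnegative; below -1 both are
        nonpositive.\<close>
      moreover have "Re ((f x - on_X \<Omega> T t f x) * cnj (complex_of_real (\<phi> x) - f x)) =
          (max (- 1) (min 1 (\<phi> x)) - Re (on_X \<Omega> T t f x)) * (\<phi> x - max (- 1) (min 1 (\<phi> x)))"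
        by (simp add: f_def)
      ultimately show ?case
        by (auto simp: max_def min_def zero_le_mult_iff)
    qed
  qed
  then obtain g where g: "g \<in> L2 (vol \<Omega>)" "has_weak_laplacian \<Omega> f g" by blast
  show False
  proof (rule kink_no_weak_laplacian[OF \<Omega>_open \<Omega>_finite \<phi>(1,2,4) _ _ g])
    \<comment> \<open>The minimum of 1 and 1 + y is 1 + y minus the positive part of y: a kink with
      coefficient -1.\<close>
    show "f x = 1 + 1 * complex_of_real ((x - x0) \<bullet> i) + (- 1) * complex_of_real (max 0 ((x - x0) \<bullet> i))"
      if x: "x \<in> ball x0 r" for x
    proof -
      have "\<bar>(x - x0) \<bullet> i\<bar> \<le> norm (x - x0)" using \<phi>(1) by (rule Basis_le_norm)
      then have "\<bar>(x - x0) \<bullet> i\<bar> < 1" using x \<phi>(3) by (simp add: dist_norm norm_minus_commute)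
      then have "max (- 1) (min 1 (\<phi> x)) = 1 + (x - x0) \<bullet> i - max 0 ((x - x0) \<bullet> i)"
        using \<phi>(6)[OF x] by (auto simp: max_def min_def)
      then show ?thesis by (simp only: f_def) simp
    qed
  qed simp
qed

end

text \<open>A pair \<open>u\<close>, \<open>f\<close> of the generator satisfies A u = -f for the
  associated operator A, which is why \<open>assoc_op\<close> is applied to
  \<open>- f\<close>.\<close>

theorem proposition3p5:
  fixes \<Omega> :: "'a::euclidean_space set"
    and \<alpha> \<beta> \<gamma> :: "'a \<Rightarrow> real"
    and \<eta> :: real
    and T :: "real \<Rightarrow> 'a pair \<Rightarrow> 'a pair"
  assumes "lipschitz_domain \<Omega>" and "bounded \<Omega>"
    and "\<alpha> \<in> Linf (vol \<Omega>)" and "\<beta> \<in> Linf (surf \<Omega>)" and "\<gamma> \<in> Linf (surf \<Omega>)"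
    and "\<eta> > 0"
    and "AE x in vol \<Omega>. \<alpha> x \<ge> \<eta>"
    and "AE x in surf \<Omega>. \<beta> x \<ge> \<eta>"
    and "AE x in surf \<Omega>. \<gamma> x \<ge> 0"
    and "semigroup_generated_by \<Omega> \<beta> (\<lambda>u f. assoc_op \<Omega> \<alpha> \<beta> \<gamma> u (- f)) T"
  shows "real_semigroup (X_measure \<Omega> \<beta>) (on_X \<Omega> T)
    \<and> \<not> positive_semigroup (X_measure \<Omega> \<beta>) (on_X \<Omega> T)
    \<and> \<not> Linf_contractive_semigroup (X_measure \<Omega> \<beta>) (on_X \<Omega> T)"
proof -
  interpret wentzell_semigroup \<Omega> \<alpha> \<beta> \<gamma> \<eta> T
    by (intro wentzell_semigroup.intro wentzell.intro wentzell_semigroup_axioms.intro) fact+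
  show ?thesis
    using semigroup_real semigroup_not_positive semigroup_not_contractive by blast
qed

end
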